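(* Let $w$ be a doubling weight, $1\le p\le\infty$, $f\in L_p[-1,1]$, let $A,B>0$ be constants, and let $n,r\in\mathbb{N}$ be such that $n\ge r$, and $A/n\le t\le B/n$. Then $$\omega_\varphi^r(f,t)_{p,w_n}\sim\tilde\omega_\varphi^r(f,t)_{p,w_n}\sim K_{r,\varphi}(f,t)_{p,w_n}\sim K_{r,\varphi_n}(f,t)_{p,w_n}\sim R_{r,\varphi}(f,t)_{p,w_n}\sim R_{r,\varphi_n}(f,t)_{p,w_n},$$ where all equivalence constants depend only on $r$, $p$, $A$, $B$, and the doubling constant of $w$.
   Context: A doubling weight is a nonnegative $w\in L_1[-1,1]$, extended by $0$ outside $[-1,1]$, for which there is a constant $L$ (the doubling constant of $w$) with $\int_{2I}w\le L\int_I w$ for all intervals $I\subset[-1,1]$, where $2I$ is the interval with the same center as $I$ and twice its length. Let $\varphi(x)=\sqrt{1-x^2}$, $\rho_n(x)=n^{-1}\sqrt{1-x^2}+n^{-2}$, $\varphi_n(x)=\varphi(x)+1/n=n\rho_n(x)$, and $w_n(x)=\frac{1}{\rho_n(x)}\int_{x-\rho_n(x)}^{x+\rho_n(x)}w(u)\,du$. For a weight $v$ on $[-1,1]$: $\|g\|_{p,v}=\left(\int_{-1}^1|g|^p v\right)^{1/p}$ if $p<\infty$, $\|g\|_{\infty,v}=\operatorname{ess\,sup}_{[-1,1]}|g|v$. $\Pi_n$ is the set of algebraic polynomials of degree $\le n-1$; $\mathrm{AC}_{\mathrm{loc}}$ is the set of locally absolutely continuous functions on $(-1,1)$. Symmetric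 difference: $\Delta_h^r(f,x)=\sum_{i=0}^r\binom ri(-1)^{r-i}f(x-rh/2+ih)$ if $x\pm rh/2\in[-1,1]$, and $0$ otherwise. Moduli: $\omega_\varphi^r(f,t)_{p,v}=\sup_{0<h\le t}\|\Delta_{h\varphi(\cdot)}^r(f,\cdot)\|_{p,v}$; for $p<\infty$, $\tilde\omega_\varphi^r(f,t)_{p,v}=\left(\frac1t\int_0^t\|\Delta^r_{h\varphi(\cdot)}(f,\cdot)\|_{p,v}^p\,dh\right)^{1/p}$, and $\tilde\omega_\varphi^r(f,t)_{\infty,v}=\omega_\varphi^r(f,t)_{\infty,v}$. For $\psi\in\{\varphi,\varphi_n\}$: $$K_{r,\psi}(f,t)_{p,w_n}=\inf_{g^{(r-1)}\in\mathrm{AC}_{\mathrm{loc}}}\left(\|f-g\|_{p,w_n}+t^r\|\psi^r g^{(r)}\|_{p,w_n}\right),$$ $$R_{r,\psi}(f,t)_{p,w_n}=\inf_{P_n\in\Pi_n}\left(\|f-P_n\|_{p,w_n}+t^r\|\psi^r P_n^{(r)}\|_{p,w_n}\right).$$ $X\sim Y$ means $c^{-1}X\le Y\le cX$ for some constant $c>0$ (the equivalence constant). *)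

theory Defs
  imports
    "HOL-Probability.Essential_Supremum"
    "HOL-Computational_Algebra.Polynomial"
begin

text \<open>
  Functions on \<open>[-1, 1]\<close> are total functions \<open>real \<Rightarrow> real\<close>; except for doubling weights, which
  are extended by \<open>0\<close>, their values outside \<open>[-1, 1]\<close> are never used.  All norms, moduli and
  functionals take values in \<^typ>\<open>ennreal\<close>, so that no suprema, infima or integrals degenerate.
\<close>

text \<open>Only used for exponents \<open>q > 0\<close>.\<close>

definition ennreal_powr :: "ennreal \<Rightarrow> real \<Rightarrow> ennreal" where
  "ennreal_powr x q = (if x = top then top else ennreal (enn2real x powr q))"


section \<open>Doubling weights\<close>

text \<open>For \<open>I = [a, b]\<close> the interval \<open>2I\<close> is \<open>[a - (b - a)/2, b + (b - a)/2]\<close>; it may stick out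
  of \<open>[-1, 1]\<close>, where \<open>w\<close> vanishes.\<close>

definition doubling_weight :: "(real \<Rightarrow> real) \<Rightarrow> real \<Rightarrow> bool" where
  "doubling_weight w L \<longleftrightarrow>
     (\<forall>x\<in>{-1..1}. 0 \<le> w x) \<and> (\<forall>x. x \<notin> {-1..1} \<longrightarrow> w x = 0) \<and>
     set_integrable lebesgue {-1..1} w \<and>
     (\<forall>a b. -1 \<le> a \<and> a < b \<and> b \<le> 1 \<longrightarrow>
        (LINT x:{a - (b - a) / 2 .. b + (b - a) / 2}|lebesgue. w x)
          \<le> L * (LINT x:{a..b}|lebesgue. w x))"

definition phi :: "real \<Rightarrow> real" where
  "phi x = sqrt (1 - x\<^sup>2)"

definition rho :: "nat \<Rightarrow> real \<Rightarrow> real" where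
  "rho n x = sqrt (1 - x\<^sup>2) / real n + 1 / (real n)\<^sup>2"

definition phi_n :: "nat \<Rightarrow> real \<Rightarrow> real" where
  "phi_n n x = phi x + 1 / real n"

definition weight_n :: "(real \<Rightarrow> real) \<Rightarrow> nat \<Rightarrow> real \<Rightarrow> real" where
  "weight_n w n x = 1 / rho n x * (LINT u:{x - rho n x .. x + rho n x}|lebesgue. w u)"


section \<open>Weighted norms and function spaces\<close>

text \<open>The exponent \<open>p \<in> [1, \<infinity>]\<close> is an \<^typ>\<open>ennreal\<close>.  For \<open>p = \<infinity>\<close> the weight enters as a factor.\<close>

definition wnorm :: "ennreal \<Rightarrow> (real \<Rightarrow> real) \<Rightarrow> (real \<Rightarrow> real) \<Rightarrow> ennreal" where
  "wnorm p v g =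
     (if p = top then esssup (lebesgue_on {-1..1}) (\<lambda>x. ennreal (\<bar>g x\<bar> * v x))
      else ennreal_powr
             (\<integral>\<^sup>+x. ennreal (\<bar>g x\<bar> powr enn2real p * v x) \<partial>lebesgue_on {-1..1})
             (1 / enn2real p))"

definition Lp :: "ennreal \<Rightarrow> (real \<Rightarrow> real) set" where
  "Lp p = {f. f \<in> borel_measurable (lebesgue_on {-1..1}) \<and> wnorm p (\<lambda>_. 1) f < top}"

definition absolutely_continuous_interval :: "real \<Rightarrow> real \<Rightarrow> (real \<Rightarrow> real) \<Rightarrow> bool" where
  "absolutely_continuous_interval a b g \<longleftrightarrow>
     (\<forall>\<epsilon>>0. \<exists>\<delta>>0. \<forall>\<D>. \<D> division_of \<Union>\<D> \<and> \<Union>\<D> \<subseteq> {a..b} \<and> (\<Sum>I\<in>\<D>. Sup I - Inf I) < \<delta>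
        \<longrightarrow> (\<Sum>I\<in>\<D>. \<bar>g (Sup I) - g (Inf I)\<bar>) < \<epsilon>)"

definition AC_loc :: "(real \<Rightarrow> real) set" where
  "AC_loc = {g. \<forall>a b. -1 < a \<and> a \<le> b \<and> b < 1 \<longrightarrow> absolutely_continuous_interval a b g}"

text \<open>The functions \<open>g\<close> whose derivative of order \<open>r - 1\<close> exists on \<open>(-1, 1)\<close> and is locally
  absolutely continuous (\<open>r \<ge> 1\<close>).  Their derivative of order \<open>r\<close> exists almost everywhere;
  the arbitrary values of \<^const>\<open>deriv\<close> elsewhere do not affect the norms.\<close>

definition AC_loc_deriv :: "nat \<Rightarrow> (real \<Rightarrow> real) set" where
  "AC_loc_deriv r =
     {g. (\<forall>k<r - 1. \<forall>x\<in>{-1<..<1}. (deriv ^^ k) g differentiable (at x)) \<and>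
         (deriv ^^ (r - 1)) g \<in> AC_loc}"


section \<open>Moduli of smoothness\<close>

definition sym_diff :: "nat \<Rightarrow> real \<Rightarrow> (real \<Rightarrow> real) \<Rightarrow> real \<Rightarrow> real" where
  "sym_diff r h f x =
     (if x - real r * h / 2 \<in> {-1..1} \<and> x + real r * h / 2 \<in> {-1..1}
      then \<Sum>i=0..r. real (r choose i) * (-1) ^ (r - i) * f (x - real r * h / 2 + real i * h)
      else 0)"

definition omega_phi ::
  "nat \<Rightarrow> (real \<Rightarrow> real) \<Rightarrow> real \<Rightarrow> ennreal \<Rightarrow> (real \<Rightarrow> real) \<Rightarrow> ennreal" where
  "omega_phi r f t p v = (SUP h\<in>{0<..t}. wnorm p v (\<lambda>x. sym_diff r (h * phi x) f x))"

definition omega_phi_avg ::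
  "nat \<Rightarrow> (real \<Rightarrow> real) \<Rightarrow> real \<Rightarrow> ennreal \<Rightarrow> (real \<Rightarrow> real) \<Rightarrow> ennreal" where
  "omega_phi_avg r f t p v =
     (if p = top then omega_phi r f t p v
      else ennreal_powr
             (ennreal (1 / t) *
                (\<integral>\<^sup>+h\<in>{0..t}. ennreal_powr (wnorm p v (\<lambda>x. sym_diff r (h * phi x) f x)) (enn2real p)
                  \<partial>lebesgue))
             (1 / enn2real p))"


section \<open>K-functionals and realization functionals\<close>

definition K_functional ::
  "nat \<Rightarrow> (real \<Rightarrow> real) \<Rightarrow> (real \<Rightarrow> real) \<Rightarrow> real \<Rightarrow> ennreal \<Rightarrow> (real \<Rightarrow> real) \<Rightarrow> ennreal" where
  "K_functional r \<psi> f t p v =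
     (INF g\<in>AC_loc_deriv r.
        wnorm p v (\<lambda>x. f x - g x) +
        ennreal (t ^ r) * wnorm p v (\<lambda>x. \<psi> x ^ r * (deriv ^^ r) g x))"

text \<open>The polynomials range over those of degree at most \<open>n - 1\<close>, where \<open>n \<ge> 1\<close>.\<close>

definition R_functional ::
  "nat \<Rightarrow> nat \<Rightarrow> (real \<Rightarrow> real) \<Rightarrow> (real \<Rightarrow> real) \<Rightarrow> real \<Rightarrow> ennreal \<Rightarrow> (real \<Rightarrow> real) \<Rightarrow> ennreal"
where
  "R_functional n r \<psi> f t p v =
     (INF P\<in>{P :: real poly. degree P \<le> n - 1}.
        wnorm p v (\<lambda>x. f x - poly P x) +
        ennreal (t ^ r) * wnorm p v (\<lambda>x. \<psi> x ^ r * poly ((pderiv ^^ r) P) x))"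

definition equiv_with :: "real \<Rightarrow> ennreal \<Rightarrow> ennreal \<Rightarrow> bool" where
  "equiv_with c X Y \<longleftrightarrow> ennreal (inverse c) * X \<le> Y \<and> Y \<le> ennreal c * X"

end

theory Submission
  imports Defs "HOL-Complex_Analysis.Complex_Analysis"
begin

text \<open>
  Trivially the averaged modulus is at most the modulus, and each of the functionals is at most
  the realization functional for \<open>phi_n\<close>.  Two inequalities close the circle.

  Averaged modulus bounds realization: on each cell of the grid \<open>x = cos (j \<pi> / N)\<close>, \<open>N\<close> a multiple
  of \<open>n\<close>, a local polynomial approximates \<open>f\<close> up to averages of \<open>r\<close>-th differences inside the cell,
  whose steps are automatically of the form \<open>h phi x\<close> with \<open>h <= A / n\<close>.  The local polynomials are glued
  with polynomial kernels that sum to \<open>1\<close> and decay fast, uniformly on complex discs of radius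
  comparable to \<open>rho n x\<close>, so that Cauchy's estimate controls the derivatives as well.  Since \<open>w_n (cos \<alpha>)\<close>
  and \<open>w_n (cos \<beta>)\<close> differ at most by a power of \<open>1 + n \<bar>\<alpha> - \<beta>\<bar>\<close>, the decay of the kernels absorbs the weight.

  K-functional bounds modulus: for smooth \<open>g\<close>, the Taylor remainder bounds the difference of step \<open>h phi x\<close>
  by \<open>h ^ r\<close> times an average of \<open>phi ^ r * g^(r)\<close> against the kernel \<open>1 / (h phi y)\<close> on
  \<open>\<bar>y - x\<bar> <= r h phi x / 2\<close>, which has bounded marginals in both variables.
\<close>

text \<open>Two scales are kept apart. The polynomial has degree below \<open>n\<close>, so the
  kernels live on the angular scale \<open>1 / n\<close>; but steps of differences inside a cell
  must not exceed \<open>t\<close>, which may be as small as \<open>A / n\<close>, so the cells have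
  the finer scale \<open>1 / N\<close>. With \<open>N = M * n\<close> and \<open>M >= 16 / A\<close>
  the ratio \<open>M\<close> enters constants only. Differences are integrated with the first node,
  the last node or the centre as variable. For a fixed step these differ by a translation, so all
  become integrals over pairs of a centre \<open>y\<close> and a step \<open>s\<close>; then
  \<open>s = h * phi y\<close> yields the averaged modulus. Elements of \<open>Lp p\<close> are
  Lebesgue measurable and matter up to null sets, while Fubini's theorem is applied to Borel
  functions. So the modulus must be shown insensitive to null sets, which rests on
  \<open>x + \<kappa> * phi x\<close> having derivative at least \<open>1/2\<close> wherever the
  difference is formed, endpoints aside. Absolute continuity is given in epsilon-delta form, so a
  derivative that controls increments is constructed first, from variations and the Radon-Nikodym
  theorem.\<close>

text \<open>An integral sign without measure stands for the nonnegative integral with respect to Lebesgue measure.\<close>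

abbreviation lborel_nn_integral :: "(real => ennreal) => ennreal" (binder "\<integral>" 10) where
  "lborel_nn_integral \<equiv> nn_integral lborel"

syntax "_lborel_set_nn_integral" :: "pttrn => real set => ennreal => ennreal" ("(\<integral>_\<in>_./ _)" [0, 0, 10] 10)
translations "\<integral>x\<in>A. f" \<rightharpoonup> "CONST set_nn_integral CONST lborel A (\<lambda>x. f)"

abbreviation leb :: "real measure" where
  "leb \<equiv> lebesgue_on {-1..1}"

abbreviation apx_err :: "nat => nat => (real => real) => real poly => real => real" where
  "apx_err r n f P x \<equiv> \<bar>f x - poly P x\<bar> + rho n x ^ r * \<bar>poly ((pderiv ^^ r) P) x\<bar>"

section \<open>Doubling weights\<close>

lemma phi_cos: "0 <= \<alpha> ==> \<alpha> <= pi ==> phi (cos \<alpha>) = sin \<alpha>"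
 unfolding phi_def using sin_ge_zero[of \<alpha>]
 by (metis cos_squared_eq add_diff_cancel_left' diff_diff_eq2 real_sqrt_abs abs_of_nonneg diff_add_cancel)

lemma rho_cos: "0 <= \<alpha> ==> \<alpha> <= pi ==> rho n (cos \<alpha>) = sin \<alpha> / real n + 1 / (real n)^2"
 using phi_cos[of \<alpha>] by (simp add: rho_def phi_def)

text \<open>In the product formula the sine of the midpoint is expanded about
  \<open>\<beta>\<close>, so that only \<open>sin \<beta>\<close> and the angular distance remain.
  Near the endpoints of \<open>[-1, 1]\<close> the second term takes over, just as
  \<open>1 / n^2\<close> does in \<open>rho\<close>.\<close>

lemma abs_cos_diff_le: "\<bar>cos \<alpha> - cos \<beta>\<bar> <= \<bar>\<alpha> - \<beta>\<bar> * (\<bar>sin \<beta>\<bar> + \<bar>\<alpha> - \<beta>\<bar>)" for \<alpha> \<beta> :: real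
proof -
 let ?a = "sin (\<beta> + (\<alpha> - \<beta>) / 2)"
 let ?b = "sin ((\<beta> - \<alpha>) / 2)"
 have "cos \<alpha> - cos \<beta> = 2 * ?a * ?b"
  using cos_diff_cos[of \<alpha> \<beta>] by (simp add: field_simps)
 then have "\<bar>cos \<alpha> - cos \<beta>\<bar> = \<bar>?a\<bar> * (2 * \<bar>?b\<bar>)"
  by (simp add: abs_mult)
 also have "... <= (\<bar>sin \<beta>\<bar> + \<bar>\<alpha> - \<beta>\<bar>) * \<bar>\<alpha> - \<beta>\<bar>"
 proof (rule mult_mono)
  have "\<bar>?a\<bar> <= \<bar>sin \<beta>\<bar> * \<bar>cos ((\<alpha> - \<beta>) / 2)\<bar> + \<bar>cos \<beta>\<bar> * \<bar>sin ((\<alpha> - \<beta>) / 2)\<bar>"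
   unfolding sin_add by (metis abs_mult abs_triangle_ineq)
  also have "... <= \<bar>sin \<beta>\<bar> * 1 + 1 * \<bar>(\<alpha> - \<beta>) / 2\<bar>"
   by (intro add_mono mult_mono abs_sin_x_le_abs_x) auto
  also have "... <= \<bar>sin \<beta>\<bar> + \<bar>\<alpha> - \<beta>\<bar>" by (simp add: field_simps)
  finally show "\<bar>?a\<bar> <= \<bar>sin \<beta>\<bar> + \<bar>\<alpha> - \<beta>\<bar>" .
  show "2 * \<bar>?b\<bar> <= \<bar>\<alpha> - \<beta>\<bar>"
   using abs_sin_x_le_abs_x[of "(\<beta> - \<alpha>) / 2"] by simp
 qed auto
 finally show ?thesis by (simp add: mult.commute)
qed

lemma abs_sin_diff_le: "\<bar>sin \<alpha> - sin \<beta>\<bar> <= \<bar>\<alpha> - \<beta>\<bar>" for \<alpha> \<beta> :: real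
proof -
 have "\<bar>sin \<alpha> - sin \<beta>\<bar> = 2 * \<bar>sin ((\<alpha> - \<beta>) / 2)\<bar> * \<bar>cos ((\<alpha> + \<beta>) / 2)\<bar>"
  using sin_diff_sin[of \<alpha> \<beta>] by (simp add: abs_mult)
 also have "... <= 2 * \<bar>(\<alpha> - \<beta>) / 2\<bar> * 1"
  by (intro mult_mono abs_sin_x_le_abs_x) auto
 finally show ?thesis by simp
qed

lemma rho_pos: "x \<in> {-1..1} ==> 0 < n ==> 0 < rho n x"
 unfolding rho_def by (intro add_nonneg_pos) (auto simp: abs_square_le_1)

lemma rho_le_2: "x \<in> {-1..1} ==> 0 < n ==> rho n x <= 2"
proof -
 assume x: "x \<in> {-1..1}" "0 < n"
 have "sqrt (1 - x^2) <= 1" by simp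
 moreover have n: "real n \<ge> 1" using x by simp
 ultimately have "sqrt (1 - x^2) <= real n" by linarith
 then have "sqrt (1 - x^2) / real n <= 1" "1 / (real n)^2 <= 1"
  using n by (simp_all add: divide_le_eq)
 then show ?thesis unfolding rho_def by simp
qed

definition mass :: "(real => real) => real => real => real" where
 "mass w a b = (LINT u:{a..b}|lebesgue. w u)"

lemma weight_n_mass: "weight_n w n x = mass w (x - rho n x) (x + rho n x) / rho n x"
 by (simp add: weight_n_def mass_def)

text \<open>Reduces everything to doubling constants \<open>L >= 1\<close>, which the estimates
  below assume while the theorem allows any \<open>L\<close>.\<close>

lemma doubling_weight_mono: "doubling_weight w L ==> L <= L' ==> doubling_weight w L'"
proof -
 assume d: "doubling_weight w L" and L: "L <= L'"
 have nn: "0 <= w x" for x using d unfolding doubling_weight_def by (cases "x \<in> {-1..1}") auto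
 have "L * (LINT x:{a..b}|lebesgue. w x) <= L' * (LINT x:{a..b}|lebesgue. w x)" for a b
  by (intro mult_right_mono L) (auto simp: set_lebesgue_integral_def nn intro!: Bochner_Integration.integral_nonneg)
 then show ?thesis using d unfolding doubling_weight_def by (meson order_trans)
qed

context
 fixes w :: "real => real" and L :: real
 assumes dw: "doubling_weight w L"
begin

lemma dw_nonneg: "0 <= w x"
 using dw unfolding doubling_weight_def by (cases "x \<in> {-1..1}") auto

lemma dw_zero: "x \<notin> {-1..1} ==> w x = 0"
 using dw unfolding doubling_weight_def by auto

lemma dw_integrable: "integrable lebesgue w"
proof -
 have "(\<lambda>x. indicator {-1..1} x *\<^sub>R w x) = w"
  using dw_zero by (auto simp: fun_eq_iff indicator_def)
 then show ?thesis using dw unfolding doubling_weight_def set_integrable_def by simp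
qed

lemma mass_nonneg: "0 <= mass w a b"
 by (auto simp: mass_def set_lebesgue_integral_def dw_nonneg intro!: Bochner_Integration.integral_nonneg)

text \<open>Inclusion is asked for inside \<open>[-1, 1]\<close> only, because \<open>w\<close>
  vanishes elsewhere. Thus clipping an interval to \<open>[-1, 1]\<close> costs nothing.\<close>

lemma mass_mono:
 assumes "\<And>x. x \<in> {a..b} ==> -1 <= x ==> x <= 1 ==> x \<in> {c..d}"
 shows "mass w a b <= mass w c d"
 unfolding mass_def set_lebesgue_integral_def
proof (rule integral_mono)
 show "integrable lebesgue (\<lambda>x. indicat_real {a..b} x *\<^sub>R w x)"
  by (intro integrable_mult_indicator dw_integrable) auto
 show "integrable lebesgue (\<lambda>x. indicat_real {c..d} x *\<^sub>R w x)"
  by (intro integrable_mult_indicator dw_integrable) auto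
 show "indicat_real {a..b} x *\<^sub>R w x <= indicat_real {c..d} x *\<^sub>R w x" for x
  using assms[of x] dw_zero[of x] dw_nonneg[of x] by (auto simp: indicator_def)
qed

lemma mass_double:
 assumes "-1 <= a" "a < b" "b <= 1"
 shows "mass w (a - (b - a) / 2) (b + (b - a) / 2) <= L * mass w a b"
 using dw assms unfolding doubling_weight_def mass_def by auto

text \<open>The interval reached so far is clipped to \<open>[-1, 1]\<close> before it is doubled.
  If one side has been clipped, the other side is only guaranteed to move out by half of
  \<open>b - a + g\<close>; hence the growth factor \<open>3/2\<close> per step instead of
  \<open>2\<close>.\<close>

lemma mass_expand:
 assumes ab: "-1 <= a" "a < b" "b <= 1" and L: "1 <= L"
 shows "mass w (a - ((3/2)^k - 1) * (b - a)) (b + ((3/2)^k - 1) * (b - a)) <= L ^ k * mass w a b"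
proof (induction k)
 case 0
 then show ?case by simp
next
 case (Suc k)
 define g where "g = ((3/2)^k - 1) * (b - a)"
 define g' where "g' = ((3/2)^Suc k - 1) * (b - a)"
 have g': "g' = 3/2 * g + (b - a) / 2" unfolding g_def g'_def by (simp add: field_simps)
 have "(1::real) <= (3/2)^k" by (rule one_le_power) simp
 then have g0: "0 <= g" unfolding g_def using ab by simp
 define c where "c = max (-1) (a - g)"
 define d where "d = min 1 (b + g)"
 have cd: "-1 <= c" "c < d" "d <= 1" using ab g0 unfolding c_def d_def by auto
 have "mass w (a - g') (b + g') <= mass w (c - (d - c) / 2) (d + (d - c) / 2)"
 proof (rule mass_mono)
  fix x assume x: "x \<in> {a - g'..b + g'}" "-1 <= x" "x <= 1"
  show "x \<in> {c - (d - c) / 2..d + (d - c) / 2}"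
  proof (cases "c = -1"; cases "d = 1")
   assume "c = -1" "d = 1" then show ?thesis using x by auto
  next
   assume 1: "c = -1" "d \<noteq> 1"
   then have "d = b + g" unfolding d_def by auto
   then show ?thesis using 1 x g' ab g0 cd unfolding atLeastAtMost_iff by argo
  next
   assume 1: "c \<noteq> -1" "d = 1"
   then have "c = a - g" unfolding c_def by auto
   then show ?thesis using 1 x g' ab g0 cd unfolding atLeastAtMost_iff by argo
  next
   assume 1: "c \<noteq> -1" "d \<noteq> 1"
   then have "c = a - g" "d = b + g" unfolding c_def d_def by auto
   then show ?thesis using 1 x g' ab g0 cd unfolding atLeastAtMost_iff by argo
  qed
 qed
 also have "... <= L * mass w c d" by (rule mass_double[OF cd])
 also have "... <= L * mass w (a - g) (b + g)"
  using L by (intro mult_left_mono mass_mono) (auto simp: c_def d_def)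
 also have "... <= L * (L ^ k * mass w a b)"
  using Suc L unfolding g_def by (intro mult_left_mono) auto
 finally show ?case unfolding g'_def by simp
qed

text \<open>The least \<open>k\<close> with \<open>1 + D / \<rho> <= (3/2) ^ k\<close> overshoots by
  a factor \<open>3/2\<close> at most. As \<open>L <= (3/2) ^ s\<close>, the loss
  \<open>L ^ k\<close> of \<open>k\<close> enlargements is at most the \<open>s\<close>-th power of
  \<open>(3/2) ^ k\<close>: exponential in the number of doublings, hence polynomial in the
  distance.\<close>

lemma mass_compare:
 assumes L: "1 <= L" and s: "L <= (3/2) ^ s" and y: "y \<in> {-1..1}" and \<rho>: "0 < \<rho>" "\<rho> <= 2"
  and D: "\<bar>x - y\<bar> + \<rho>' <= D" "0 <= D"
 shows "mass w (x - \<rho>') (x + \<rho>') <= (3/2 * (1 + D / \<rho>)) ^ s * mass w (y - \<rho>) (y + \<rho>)"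
proof -
 define c where "c = max (-1) (y - \<rho>)"
 define d where "d = min 1 (y + \<rho>)"
 \<comment> \<open>This is where \<open>\<rho> <= 2\<close> enters: an interval of radius
   \<open>\<rho>\<close> about a point of \<open>[-1, 1]\<close> keeps at least the length
   \<open>\<rho>\<close> after clipping.\<close>
 have cd: "-1 <= c" "c < d" "d <= 1" "\<rho> <= d - c" using y \<rho> unfolding c_def d_def by auto
 define q where "q = 1 + D / \<rho>"
 have q: "1 <= q" unfolding q_def using D \<rho> by simp
 have "\<exists>k. q <= (3/2) ^ k" using real_arch_pow[of "3/2" q] by (auto intro: less_imp_le)
 define k where "k = (LEAST k. q <= (3/2) ^ k)"
 have k1: "q <= (3/2) ^ k" unfolding k_def by (rule LeastI_ex) fact
 have k2: "(3/2) ^ k <= 3/2 * q"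
 proof (cases k)
  case 0 then show ?thesis using q by simp
 next
  case (Suc j)
  have "\<not> q <= (3/2) ^ j" using not_less_Least[of j "\<lambda>k. q <= (3/2) ^ k"] Suc k_def by simp
  then show ?thesis using Suc by simp
 qed
 define g where "g = ((3/2)^k - 1) * (d - c)"
 have "D = (q - 1) * \<rho>" unfolding q_def using \<rho> by simp
 also have "... <= g" unfolding g_def using k1 cd \<rho> q by (intro mult_mono) auto
 finally have Dg: "D <= g" .
 have "mass w (x - \<rho>') (x + \<rho>') <= mass w (c - g) (d + g)"
 proof (rule mass_mono)
  fix u assume u: "u \<in> {x - \<rho>'..x + \<rho>'}" "-1 <= u" "u <= 1"
  then have "\<bar>u - y\<bar> <= g" using D Dg by auto
  moreover have "c <= y" "y <= d" using y \<rho> unfolding c_def d_def by auto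
  ultimately show "u \<in> {c - g..d + g}" by auto
 qed
 also have "... <= L ^ k * mass w c d" unfolding g_def by (rule mass_expand[OF cd(1-3) L])
 also have "... <= (3/2 * q) ^ s * mass w (y - \<rho>) (y + \<rho>)"
 proof (rule mult_mono)
  have "L ^ k <= ((3/2) ^ s) ^ k" using s L by (intro power_mono) auto
  also have "... = ((3/2) ^ k) ^ s" by (simp only: mult.commute flip: power_mult)
  also have "... <= (3/2 * q) ^ s" by (intro power_mono k2) auto
  finally show "L ^ k <= (3/2 * q) ^ s" .
  show "mass w c d <= mass w (y - \<rho>) (y + \<rho>)" by (rule mass_mono) (auto simp: c_def d_def)
 qed (use q mass_nonneg in auto)
 finally show ?thesis unfolding q_def .
qed

lemma weight_n_nonneg: "x \<in> {-1..1} ==> 0 < n ==> 0 <= weight_n w n x"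
 using rho_pos[of x n] mass_nonneg by (simp add: weight_n_mass)

text \<open>With \<open>l = n * \<bar>\<alpha> - \<beta>\<bar>\<close>, the two values of
  \<open>rho\<close> differ by a factor at most \<open>1 + l\<close> and the two points by at most
  \<open>(l + l^2) * rho n y\<close>, so \<open>mass_compare\<close> applies with a quotient
  quadratic in \<open>l\<close>. The exponent is \<open>2 * s\<close> from the masses plus
  \<open>1\<close> from the ratio of the two \<open>rho\<close>.\<close>

lemma weight_n_cos_compare:
 assumes L: "1 <= L" and s: "L <= (3/2) ^ s" and n: "0 < n"
  and \<alpha>: "0 <= \<alpha>" "\<alpha> <= pi" and \<beta>: "0 <= \<beta>" "\<beta> <= pi"
 shows "weight_n w n (cos \<alpha>) <= 3 ^ s * (1 + real n * \<bar>\<alpha> - \<beta>\<bar>) ^ (2 * s + 1) * weight_n w n (cos \<beta>)"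
proof -
 let ?a = "\<lambda>x. mass w (x - rho n x) (x + rho n x)"
 define l where "l = real n * \<bar>\<alpha> - \<beta>\<bar>"
 have l0: "0 <= l" unfolding l_def by simp
 have nl: "\<bar>\<alpha> - \<beta>\<bar> = l / real n" using n unfolding l_def by simp
 define x where "x = cos \<alpha>"
 define y where "y = cos \<beta>"
 have xy: "x \<in> {-1..1}" "y \<in> {-1..1}" unfolding x_def y_def by auto
 note rx = rho_pos[OF xy(1) n] and ry = rho_pos[OF xy(2) n]
 have rc: "rho n (cos \<beta>') <= (1 + l) * rho n (cos \<alpha>')"
  if "0 <= \<alpha>'" "\<alpha>' <= pi" "0 <= \<beta>'" "\<beta>' <= pi" "\<bar>\<beta>' - \<alpha>'\<bar> = l / real n" for \<alpha>' \<beta>'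
 proof -
  have s0: "0 <= sin \<alpha>'" using that by (simp add: sin_ge_zero)
  have "sin \<beta>' <= sin \<alpha>' + l / real n" using abs_sin_diff_le[of \<beta>' \<alpha>'] that by auto
  then have "sin \<beta>' / real n <= (sin \<alpha>' + l / real n) / real n" by (intro divide_right_mono) auto
  also have "... = sin \<alpha>' / real n + l / (real n)^2" by (simp add: add_divide_distrib power2_eq_square)
  also have "... <= (1 + l) * (sin \<alpha>' / real n) + l / (real n)^2"
   using s0 l0 mult_right_mono[of 1 "1 + l" "sin \<alpha>' / n"] by simp
  finally show ?thesis using that by (simp add: rho_cos algebra_simps add_divide_distrib)
 qed
 have rxy: "rho n x <= (1 + l) * rho n y" "rho n y <= (1 + l) * rho n x"
  unfolding x_def y_def using \<alpha> \<beta> nl by (auto intro!: rc simp: abs_minus_commute)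
 have "\<bar>x - y\<bar> <= l / n * (sin \<beta> + l / n)"
  unfolding x_def y_def using abs_cos_diff_le[of \<alpha> \<beta>] sin_ge_zero[of \<beta>] \<beta> unfolding nl by simp
 also have "... = l * (sin \<beta> / n) + l * l * (1 / (real n)^2)"
  by (simp add: distrib_left power2_eq_square)
 also have "... <= l * rho n y + l * l * rho n y"
  unfolding y_def rho_cos[OF \<beta>] using l0 sin_ge_zero[of \<beta>] \<beta> by (intro add_mono mult_left_mono) auto
 finally have xmy: "\<bar>x - y\<bar> <= (l + l * l) * rho n y" by (simp add: distrib_right)
 define D where "D = \<bar>x - y\<bar> + rho n x"
 have D: "D <= (1 + 2 * l + l * l) * rho n y" unfolding D_def using xmy rxy by (simp add: algebra_simps)
 have D0: "0 <= D" unfolding D_def using rx by simp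
 have "D / rho n y <= 1 + 2 * l + l * l" using D ry by (simp add: divide_le_eq)
 then have q: "3/2 * (1 + D / rho n y) <= 3 * (1 + l)^2"
 proof -
  assume e: "D / rho n y <= 1 + 2 * l + l * l"
  have "0 <= l * l" using l0 by simp
  then have "3/2 * (2 + 2 * l + l * l) <= 3 * (1 + l)^2" using l0 by (simp add: power2_eq_square algebra_simps)
  then show ?thesis using e by argo
 qed
 have "?a x <= (3/2 * (1 + D / rho n y)) ^ s * ?a y"
  by (rule mass_compare[OF L s xy(2) ry rho_le_2[OF xy(2) n]]) (use D0 in \<open>auto simp: D_def\<close>)
 also have "... <= (3 * (1 + l)^2) ^ s * ?a y"
  using q D0 ry mass_nonneg by (intro mult_right_mono power_mono) auto
 finally have m: "?a x <= (3 * (1 + l)^2) ^ s * ?a y" .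
 have "weight_n w n x <= (3 * (1 + l)^2) ^ s * ?a y / rho n x"
  unfolding weight_n_mass using m rx by (simp add: divide_right_mono)
 also have "... <= (3 * (1 + l)^2) ^ s * ?a y * ((1 + l) / rho n y)"
 proof -
  have "1 / rho n x <= (1 + l) / rho n y" using rxy(2) rx ry by (simp add: field_simps)
  then have "(3 * (1 + l)^2) ^ s * ?a y * (1 / rho n x) <= (3 * (1 + l)^2) ^ s * ?a y * ((1 + l) / rho n y)"
   using mass_nonneg l0 by (intro mult_left_mono) auto
  then show ?thesis by simp
 qed
 also have "... = 3 ^ s * (1 + l) ^ (2 * s + 1) * weight_n w n y"
  unfolding weight_n_mass by (simp add: power_mult_distrib power_mult power_add)
 finally show ?thesis unfolding x_def y_def l_def .
qed

text \<open>\<open>w\<close> itself is only Lebesgue measurable. Its distribution function is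
  monotone and hence Borel, and \<open>weight_n\<close> is a difference of two of its values divided
  by \<open>rho\<close>. The base point \<open>-2\<close> lies left of the support of
  \<open>w\<close>.\<close>

lemma weight_n_measurable: "weight_n w n \<in> borel_measurable borel"
proof -
 define F where "F = (\<lambda>x. mass w (-2) x)"
 have Fm: "F \<in> borel_measurable borel"
  by (rule borel_measurable_mono) (auto simp: mono_def F_def intro!: mass_mono)
 have F2: "mass w a b = (if a <= b then F b - F a else 0)" for a b
 proof (cases "a <= b")
  case True
  have ind: "integrable lebesgue (\<lambda>x. indicat_real {a..b} x *\<^sub>R w x)" for a b
   by (intro integrable_mult_indicator dw_integrable) auto
  have "F b = F a + mass w a b"
  proof (cases "a < -2")
   case True
   have "F b = mass w a b" unfolding F_def by (rule antisym; rule mass_mono) (use True in auto)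
   moreover have "F a = 0"
    unfolding F_def mass_def set_lebesgue_integral_def using True by (simp add: indicator_def)
   ultimately show ?thesis by simp
  next
   case False
   have "AE x in lebesgue. x \<noteq> a"
    by (rule AE_I'[of "{a}"]) (auto simp: negligible_iff_null_sets[symmetric])
   then have "AE x in lebesgue. indicat_real {-2..b} x *\<^sub>R w x = indicat_real {-2..a} x *\<^sub>R w x + indicat_real {a..b} x *\<^sub>R w x"
    by eventually_elim (use True False in \<open>auto simp: indicator_def\<close>)
   then have "F b = (\<integral>x. indicat_real {-2..a} x *\<^sub>R w x + indicat_real {a..b} x *\<^sub>R w x \<partial>lebesgue)"
    unfolding F_def mass_def set_lebesgue_integral_def
    by (intro integral_cong_AE borel_measurable_integrable Bochner_Integration.integrable_add ind)
   also have "... = F a + mass w a b"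
    unfolding F_def mass_def set_lebesgue_integral_def by (intro Bochner_Integration.integral_add ind)
   finally show ?thesis .
  qed
  then show ?thesis using True by simp
 next
  case False
  then show ?thesis unfolding mass_def set_lebesgue_integral_def by (simp add: indicator_def)
 qed
 have [measurable]: "rho n \<in> borel_measurable borel" unfolding rho_def[abs_def] by measurable
 note Fm[measurable]
 show ?thesis unfolding weight_n_mass[abs_def] F2 by measurable
qed

end

section \<open>Polynomials in the complex plane\<close>

text \<open>Lagrange interpolation: each of the \<open>r - 1\<close> factors of a basis polynomial
  is at most \<open>R\<close> because the nodes are \<open>\<delta>\<close>-separated.\<close>

lemma norm_poly_le_nodes:
 fixes q :: "'a::real_normed_field poly" and y :: "nat => 'a"
 assumes deg: "degree q < r" and \<delta>: "0 < \<delta>"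
  and sep: "\<And>i j. i < r ==> j < r ==> i \<noteq> j ==> \<delta> <= norm (y i - y j)"
  and R: "\<And>i. i < r ==> norm (z - y i) <= R * \<delta>"
  and M: "\<And>i. i < r ==> norm (poly q (y i)) <= M"
 shows "norm (poly q z) <= real r * R ^ (r - 1) * M"
proof -
 let ?a = "\<lambda>k i. smult (inverse (y k - y i)) [:- y i, 1:]"
 define ell where "ell k = (\<Prod>i\<in>{..<r} - {k}. ?a k i)" for k
 define p where "p = (\<Sum>k<r. smult (poly q (y k)) (ell k))"
 have inj: "inj_on y {..<r}"
 proof (rule inj_onI, rule ccontr)
  fix i j assume "i \<in> {..<r}" "j \<in> {..<r}" "y i = y j" "i \<noteq> j"
  then show False using sep[of i j] \<delta> by simp
 qed
 have ell_poly: "poly (ell k) x = (\<Prod>i\<in>{..<r} - {k}. (x - y i) / (y k - y i))" for k x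
  unfolding ell_def poly_prod by (intro prod.cong) (simp_all add: divide_inverse algebra_simps)
 have ell_node: "poly (ell k) (y j) = (if j = k then 1 else 0)" if "j < r" "k < r" for j k
 proof (cases "j = k")
  case True
  have "(\<Prod>i\<in>{..<r} - {k}. (y j - y i) / (y k - y i)) = (\<Prod>i\<in>{..<r} - {k}. 1)"
   using inj that True by (intro prod.cong) (auto simp: inj_on_def)
  then show ?thesis using True by (simp add: ell_poly)
 next
  case False
  then show ?thesis using that by (simp add: ell_poly) (auto intro!: prod_zero)
 qed
 have "degree (ell k) <= r - 1" if "k < r" for k
 proof -
  have "degree (ell k) <= (\<Sum>i\<in>{..<r} - {k}. degree (?a k i))"
   unfolding ell_def by (rule order_trans[OF degree_prod_sum_le]) (auto simp: o_def)
  also have "... <= (\<Sum>i\<in>{..<r} - {k}. 1)" by (intro sum_mono) (simp add: degree_smult_le)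
  also have "... = r - 1" using that by simp
  finally show ?thesis .
 qed
 then have "degree p <= r - 1" unfolding p_def
  by (intro degree_sum_le) (auto intro: order_trans[OF degree_smult_le])
 then have dp: "degree p < r" using deg by simp
 have "q = p"
 proof (rule poly_eqI_degree[of "y ` {..<r}"])
  show "degree q < card (y ` {..<r})" "degree p < card (y ` {..<r})"
   using deg dp inj by (auto simp: card_image)
  fix x assume "x \<in> y ` {..<r}"
  then obtain j where j: "j < r" "x = y j" by auto
  have "poly p x = (\<Sum>k<r. poly q (y k) * (if j = k then 1 else 0))"
   unfolding p_def poly_sum using j by (intro sum.cong) (auto simp: ell_node)
  also have "... = poly q x" using j by (simp add: if_distrib[of "(*) _"] cong: if_cong)
  finally show "poly q x = poly p x" by simp
 qed
 then have "norm (poly q z) = norm (\<Sum>k<r. poly q (y k) * poly (ell k) z)"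
  by (metis (no_types, lifting) p_def poly_smult poly_sum sum.cong)
 also have "... <= (\<Sum>k<r. norm (poly q (y k) * poly (ell k) z))" by (rule norm_sum)
 also have "... <= (\<Sum>k<r. M * R ^ (r - 1))"
 proof (rule sum_mono)
  fix k assume k: "k \<in> {..<r}"
  have "norm (poly (ell k) z) = (\<Prod>i\<in>{..<r} - {k}. norm (z - y i) / norm (y k - y i))"
   unfolding ell_poly by (simp add: prod_norm[symmetric] norm_divide)
  also have "... <= (\<Prod>i\<in>{..<r} - {k}. R)"
  proof (rule prod_mono, intro conjI)
   fix i assume i: "i \<in> {..<r} - {k}"
   have s: "\<delta> <= norm (y k - y i)" using i k by (intro sep) auto
   have "0 <= R * \<delta>" using R[of i] i by (auto intro: order_trans[OF norm_ge_zero])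
   then have R0: "0 <= R" using \<delta> by (simp add: zero_le_mult_iff)
   have "norm (z - y i) <= R * norm (y k - y i)"
    using R[of i] i mult_left_mono[OF s R0] by auto
   then show "norm (z - y i) / norm (y k - y i) <= R" using s \<delta> R0 by (simp add: divide_le_eq)
  qed auto
  also have "... = R ^ (r - 1)" using k by simp
  finally have e: "norm (poly (ell k) z) <= R ^ (r - 1)" .
  have "0 <= M" using M[of k] k by (auto intro: order_trans[OF norm_ge_zero])
  then show "norm (poly q (y k) * poly (ell k) z) <= M * R ^ (r - 1)"
   unfolding norm_mult using M[of k] k e by (intro mult_mono) auto
 qed
 also have "... = real r * R ^ (r - 1) * M" by simp
 finally show ?thesis .
qed

abbreviation cpoly :: "real poly => complex poly" where "cpoly \<equiv> map_poly complex_of_real"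

lemma poly_cpoly_of_real: "poly (cpoly q) (of_real x) = of_real (poly q x)"
 by (induction q) (auto simp: map_poly_pCons)

text \<open>Growth of a polynomial off an interval, measured by its \<open>L_1\<close> norm there.
  Interpolation is done at points where the modulus is at most its mean over a short subinterval, so
  that the integral controls the values at the nodes.\<close>

lemma poly_growth:
 fixes q :: "real poly"
 assumes deg: "degree q < r" and ab: "a < b"
 shows "ennreal (cmod (poly (cpoly q) z)) <=
  ennreal (real r * (2 * real r * (1 + cmod (z - of_real a) / (b - a))) ^ (r - 1) * (2 * real r / (b - a)))
   * (\<integral>x\<in>{a..b}. ennreal \<bar>poly q x\<bar>)"
proof -
 let ?a = "poly (cpoly q) z"
 define l where "l = b - a"
 define \<delta> where "\<delta> = l / (2 * real r)"
 have r: "0 < r" and l: "0 < l" using deg ab unfolding l_def by auto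
 have \<delta>: "0 < \<delta>" unfolding \<delta>_def using r l by simp
 define X where "X = (\<integral>x\<in>{a..b}. ennreal \<bar>poly q x\<bar>)"
 \<comment> \<open>Only every second subinterval of length \<open>\<delta>\<close> is used, which
   keeps the nodes \<open>\<delta>\<close> apart wherever they fall. A minimum point of
   \<open>\<bar>q\<bar>\<close> satisfies \<open>\<delta> * \<bar>q y\<bar> <= X\<close>.\<close>
 have "\<exists>y\<in>{a + 2 * real k * \<delta>..a + (2 * real k + 1) * \<delta>}. ennreal (\<delta> * \<bar>poly q y\<bar>) <= X" if k: "k < r" for k
 proof -
  let ?I = "{a + 2 * real k * \<delta>..a + (2 * real k + 1) * \<delta>}"
  have "\<exists>y\<in>?I. \<forall>x\<in>?I. \<bar>poly q y\<bar> <= \<bar>poly q x\<bar>"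
   by (rule continuous_attains_inf) (use \<delta> in \<open>auto intro!: continuous_intros simp: algebra_simps\<close>)
  then obtain y where y: "y \<in> ?I" "\<And>x. x \<in> ?I ==> \<bar>poly q y\<bar> <= \<bar>poly q x\<bar>" by auto
  have "(2 * real k + 1) * \<delta> <= 2 * real r * \<delta>" using k \<delta> by (intro mult_right_mono) auto
  moreover have "2 * real r * \<delta> = b - a" "0 <= 2 * real k * \<delta>"
   using \<delta> r by (simp add: \<delta>_def l_def) (use \<delta> in simp)
  ultimately have sub: "?I \<subseteq> {a..b}" by auto
  have "ennreal (\<delta> * \<bar>poly q y\<bar>) = (\<integral>x\<in>?I. ennreal \<bar>poly q y\<bar>)"
   using \<delta> by (simp add: nn_integral_cmult_indicator ennreal_mult algebra_simps)
  also have "... <= X" unfolding X_def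
  proof (intro nn_integral_mono)
   fix x
   show "ennreal \<bar>poly q y\<bar> * indicator ?I x <= ennreal \<bar>poly q x\<bar> * indicator {a..b} x"
   proof (cases "x \<in> ?I")
    case True
    then show ?thesis using y(2)[OF True] subsetD[OF sub True] by (simp add: indicator_def)
   qed (auto simp: indicator_def)
  qed
  finally show ?thesis using y(1) by blast
 qed
 then obtain y where y: "\<And>k. k < r ==> y k \<in> {a + 2 * real k * \<delta>..a + (2 * real k + 1) * \<delta>}"
  "\<And>k. k < r ==> ennreal (\<delta> * \<bar>poly q (y k)\<bar>) <= X" by metis
 define R where "R = 2 * real r * (1 + cmod (z - of_real a) / l)"
 show ?thesis
 \<comment> \<open>An infinite integral makes the bound trivial, which spares a proof that it is
   finite.\<close>
 proof (cases "X = top")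
  case True
  have "0 < real r * R ^ (r - 1) * (2 * real r / l)"
   unfolding R_def using r l by (auto intro!: mult_pos_pos zero_less_power divide_pos_pos add_pos_nonneg)
  then have "ennreal (real r * R ^ (r - 1) * (2 * real r / l)) * top = top"
   by (metis ennreal_mult_top ennreal_eq_0_iff not_le)
  then show ?thesis unfolding X_def[symmetric] True R_def l_def[symmetric] by simp
 next
  case False
  define X' where "X' = enn2real X"
  have X': "X = ennreal X'" "0 <= X'" unfolding X'_def using False by (auto simp: less_top)
  have M: "\<bar>poly q (y k)\<bar> <= X' / \<delta>" if "k < r" for k
   using y(2)[OF that] \<delta> X' by (simp add: field_simps)
  have "cmod (?a) <= real r * R ^ (r - 1) * (X' / \<delta>)"
  proof (rule norm_poly_le_nodes[where y = "\<lambda>k. of_real (y k)"])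
   show "degree (cpoly q) < r" using deg by (simp add: degree_map_poly)
   show "0 < \<delta>" by fact
   show "cmod (poly (cpoly q) (of_real (y i))) <= X' / \<delta>" if "i < r" for i
    using M[OF that] by (simp add: poly_cpoly_of_real)
   show "\<delta> <= cmod (of_real (y i) - of_real (y j))" if "i < r" "j < r" "i \<noteq> j" for i j
   proof -
    have *: "\<delta> <= y j - y i" if "i < j" "i < r" "j < r" for i j
    proof -
     have "2 * (real i + 1) * \<delta> <= 2 * real j * \<delta>" using that \<delta> by (intro mult_right_mono) auto
     then show ?thesis using y(1)[OF that(2)] y(1)[OF that(3)] by (simp add: algebra_simps)
    qed
    have "\<delta> <= \<bar>y i - y j\<bar>" using *[of i j] *[of j i] that by (cases "i < j") auto
    then show ?thesis by (metis norm_of_real of_real_diff)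
   qed
   show "cmod (z - of_real (y i)) <= R * \<delta>" if i: "i < r" for i
   proof -
    have "(2 * real i + 1) * \<delta> <= 2 * real r * \<delta>" using i \<delta> by (intro mult_right_mono) auto
    moreover have "2 * real r * \<delta> = l" using r by (simp add: \<delta>_def)
    moreover have "0 <= 2 * real i * \<delta>" using \<delta> by simp
    ultimately have yi: "\<bar>a - y i\<bar> <= l" using y(1)[OF i] l unfolding abs_le_iff atLeastAtMost_iff by linarith
    have "cmod (z - of_real (y i)) <= cmod (z - of_real a) + cmod (of_real a - of_real (y i))"
     by (metis diff_add_cancel add_diff_eq norm_triangle_ineq)
    also have "... <= cmod (z - of_real a) + l" using yi by (metis add_left_mono norm_of_real of_real_diff)
    also have "... = R * \<delta>" unfolding R_def \<delta>_def using r l by (simp add: field_simps)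
    finally show ?thesis .
   qed
  qed
  also have "... = real r * R ^ (r - 1) * (2 * real r / l) * X'" unfolding \<delta>_def by simp
  finally have "ennreal (cmod (?a)) <= ennreal (real r * R ^ (r - 1) * (2 * real r / l) * X')"
   by (rule ennreal_leI)
  also have "... = ennreal (real r * R ^ (r - 1) * (2 * real r / l)) * X"
   unfolding X' using X'(2) l by (intro ennreal_mult) (auto simp: R_def)
  finally show ?thesis unfolding X_def R_def l_def .
 qed
qed

section \<open>Polynomial kernels\<close>

lemma cev_pCons: "poly (cpoly (pCons a p)) z = of_real a + z * poly (cpoly p) z"
 by (simp add: map_poly_pCons)

lemma cev_add: "poly (cpoly (p + q)) z = poly (cpoly p) z + poly (cpoly q) z"
 by (induction p q rule: poly_induct2) (simp_all add: map_poly_pCons algebra_simps)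

lemma cev_smult: "poly (cpoly (smult a p)) z = of_real a * poly (cpoly p) z"
 by (induction p) (simp_all add: map_poly_pCons algebra_simps)

lemma cev_uminus: "poly (cpoly (- p)) z = - poly (cpoly p) z"
 using cev_smult[of "-1" p z] by simp

lemma cev_diff: "poly (cpoly (p - q)) z = poly (cpoly p) z - poly (cpoly q) z"
 using cev_add[of p "- q" z] by (simp add: cev_uminus)

lemma cev_mult: "poly (cpoly (p * q)) z = poly (cpoly p) z * poly (cpoly q) z"
 by (induction p) (simp_all add: cev_pCons cev_add cev_smult algebra_simps del: map_poly_pCons)

lemma cev_sum: "poly (cpoly (\<Sum>i\<in>A. p i)) z = (\<Sum>i\<in>A. poly (cpoly (p i)) z)"
 by (induction A rule: infinite_finite_induct) (simp_all add: cev_add)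

section \<open>Chebyshev polynomials and even trigonometric polynomials of a complex
  argument\<close>

fun cheb :: "nat => real poly" where
 "cheb 0 = 1"
| "cheb (Suc 0) = [:0, 1:]"
| "cheb (Suc (Suc n)) = [:0, 2:] * cheb (Suc n) - cheb n"

lemma degree_cheb: "degree (cheb n) <= n"
proof (induction n rule: cheb.induct)
 case (3 n)
 have "degree ([:0, 2:] * cheb (Suc n)) <= Suc (Suc n)"
  using 3(1) degree_mult_le[of "[:0, 2::real:]" "cheb (Suc n)"] by simp
 then show ?case using 3(2) by (simp only: cheb.simps) (intro degree_diff_le, auto)
qed auto

lemma cheb_cos: "poly (cpoly (cheb n)) (cos \<zeta>) = cos (of_nat n * \<zeta>)"
proof (induction n rule: cheb.induct)
 case (3 n)
 have "2 * (cos \<zeta> * cos (of_nat (Suc n) * \<zeta>)) = cos (of_nat (Suc (Suc n)) * \<zeta>) + cos (of_nat n * \<zeta>)"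
  using cos_times_cos[of \<zeta> "of_nat (Suc n) * \<zeta>"]
  by (simp add: algebra_simps)
 then show ?case using 3 by (simp add: cev_diff cev_mult cev_pCons cev_smult algebra_simps del: map_poly_pCons)
qed (auto simp: cev_pCons)

text \<open>The coefficients are real so that replacing \<open>cos (l * t)\<close> by
  \<open>cheb l\<close> yields real algebraic polynomials, although the kernels are estimated at
  complex arguments.\<close>

definition cos_poly :: "nat => (complex => complex) set" where
 "cos_poly d = {g. \<exists>a :: nat => real. \<forall>t. g t = (\<Sum>l\<le>d. of_real (a l) * cos (of_nat l * t))}"

lemma cos_poly_cos: "l <= d ==> (\<lambda>t. cos (of_nat l * t)) \<in> cos_poly d"
 unfolding cos_poly_def
 by (intro CollectI exI[of _ "\<lambda>i. if i = l then 1 else 0"] allI)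
   (simp add: if_distrib[of of_real] if_distrib[of "\<lambda>x. x * _"] cong: if_cong)

lemma cos_poly_scale: "g \<in> cos_poly d ==> (\<lambda>t. of_real c * g t) \<in> cos_poly d"
 unfolding cos_poly_def
proof (elim CollectE exE, intro CollectI)
 fix a :: "nat => real" assume "\<forall>t. g t = (\<Sum>l\<le>d. of_real (a l) * cos (of_nat l * t))"
 then show "\<exists>a :: nat => real. \<forall>t. of_real c * g t = (\<Sum>l\<le>d. of_real (a l) * cos (of_nat l * t))"
  by (intro exI[of _ "\<lambda>l. c * a l"]) (simp add: sum_distrib_left mult.assoc)
qed

lemma cos_poly_add: "g \<in> cos_poly d ==> h \<in> cos_poly d ==> (\<lambda>t. g t + h t) \<in> cos_poly d"
 unfolding cos_poly_def
proof (elim CollectE exE, intro CollectI)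
 fix a b :: "nat => real"
 assume "\<forall>t. g t = (\<Sum>l\<le>d. of_real (a l) * cos (of_nat l * t))" "\<forall>t. h t = (\<Sum>l\<le>d. of_real (b l) * cos (of_nat l * t))"
 then show "\<exists>a :: nat => real. \<forall>t. g t + h t = (\<Sum>l\<le>d. of_real (a l) * cos (of_nat l * t))"
  by (intro exI[of _ "\<lambda>l. a l + b l"]) (simp add: sum.distrib algebra_simps)
qed

lemma cos_poly_sum: "finite A ==> (\<And>i. i \<in> A ==> g i \<in> cos_poly d) ==> (\<lambda>t. \<Sum>i\<in>A. g i t) \<in> cos_poly d"
proof (induction A rule: finite_induct)
 case empty
 show ?case unfolding cos_poly_def by (intro CollectI exI[of _ "\<lambda>_. 0"]) simp
next
 case (insert x F)
 then show ?case using cos_poly_add[of "g x" d "\<lambda>t. \<Sum>i\<in>F. g i t"] by simp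
qed

lemma cos_poly_mult:
 assumes "g \<in> cos_poly d" "h \<in> cos_poly e"
 shows "(\<lambda>t. g t * h t) \<in> cos_poly (d + e)"
proof -
 let ?a = "\<lambda>l t. cos (of_nat l * t)"
 let ?b = "\<lambda>a b. \<lambda>t. \<Sum>l\<le>d. \<Sum>j\<le>e. of_real (a l * b j) * (?a l t * ?a j t)"
 obtain a b :: "nat => real" where
  g: "\<And>t. g t = (\<Sum>l\<le>d. of_real (a l) * ?a l t)" and
  h: "\<And>t. h t = (\<Sum>l\<le>e. of_real (b l) * ?a l t)"
  using assms unfolding cos_poly_def by auto
 have cc: "(\<lambda>t. ?a l t * ?a j t) \<in> cos_poly (d + e)" if "l <= d" "j <= e" for l j
 proof -
  have "?a l t * ?a j t =
    of_real (1/2) * (?a (l + j) t + ?a (if j <= l then l - j else j - l) t)" for t :: complex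
  proof (cases "j <= l")
   case True
   then show ?thesis using cos_times_cos[of "of_nat l * t" "of_nat j * t"]
    by (simp add: algebra_simps of_nat_diff add_divide_distrib[symmetric])
  next
   case False
   then show ?thesis using cos_times_cos[of "of_nat j * t" "of_nat l * t"]
    by (simp add: algebra_simps of_nat_diff add_divide_distrib[symmetric])
  qed
  moreover have "(\<lambda>t. of_real (1/2) * (?a (l + j) t + ?a (if j <= l then l - j else j - l) t)) \<in> cos_poly (d + e)"
   using that by (intro cos_poly_scale cos_poly_add cos_poly_cos) auto
  ultimately show ?thesis by presburger
 qed
 have "(?b a b) \<in> cos_poly (d + e)"
  by (intro cos_poly_sum cos_poly_scale cc) auto
 moreover have "(?b a b) = (\<lambda>t. g t * h t)"
  unfolding g h by (simp add: sum_product mult_ac)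
 ultimately show ?thesis by simp
qed

section \<open>The Dirichlet kernel near the real axis\<close>

definition dirichlet :: "nat => complex => complex" where
 "dirichlet k t = 1 + 2 * (\<Sum>l=1..k. cos (of_nat l * t))"

lemma dirichlet_cos_poly: "dirichlet k \<in> cos_poly k"
proof -
 have "(\<lambda>t. cos (of_nat 0 * t) + of_real 2 * (\<Sum>l=1..k. cos (of_nat l * t))) \<in> cos_poly k"
  by (intro cos_poly_add cos_poly_scale cos_poly_sum cos_poly_cos) auto
 moreover have "(\<lambda>t. cos (of_nat 0 * t) + of_real 2 * (\<Sum>l=1..k. cos (of_nat l * t))) = dirichlet k"
  by (simp add: dirichlet_def fun_eq_iff)
 ultimately show ?thesis by simp
qed

lemma dirichlet_power_cos_poly: "(\<lambda>t. dirichlet k t ^ j) \<in> cos_poly (k * j)"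
proof (induction j)
 case 0
 show ?case using cos_poly_cos[of 0 0] by simp
next
 case (Suc j)
 show ?case using cos_poly_mult[OF dirichlet_cos_poly[of k] Suc] by simp
qed

lemma dirichlet_sin: "sin (t / 2) * dirichlet k t = sin ((2 * of_nat k + 1) * t / 2)"
proof (induction k)
 case 0
 show ?case by (simp add: dirichlet_def)
next
 case (Suc k)
 have "sin ((2 * of_nat (Suc k) + 1) * t / 2) - sin ((2 * of_nat k + 1) * t / 2) = 2 * sin (t / 2) * cos (of_nat (Suc k) * t)"
 proof -
  have "((2 * of_nat (Suc k) + 1) * t / 2 - (2 * of_nat k + 1) * t / 2) / 2 = t / 2"
   "((2 * of_nat (Suc k) + 1) * t / 2 + (2 * of_nat k + 1) * t / 2) / 2 = of_nat (Suc k) * t"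
   by (simp_all add: add_divide_distrib[symmetric] diff_divide_distrib[symmetric] ring_distribs)
  then show ?thesis by (simp only: sin_diff_sin)
 qed
 moreover have "dirichlet (Suc k) t = dirichlet k t + 2 * cos (of_nat (Suc k) * t)"
  by (simp add: dirichlet_def algebra_simps)
 ultimately show ?case using Suc by (simp add: algebra_simps)
qed

lemma norm_cos_sin_le_exp:
 "cmod (cos z) <= exp \<bar>Im z\<bar>" "cmod (sin z) <= exp \<bar>Im z\<bar>"
proof -
 have e: "cmod (exp (\<i> * z)) <= exp \<bar>Im z\<bar>" "cmod (exp (- (\<i> * z))) <= exp \<bar>Im z\<bar>"
  by (auto simp: norm_exp_eq_Re)
 have "cmod (exp (\<i> * z) + exp (- (\<i> * z))) <= 2 * exp \<bar>Im z\<bar>"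
  using norm_triangle_ineq[of "exp (\<i> * z)" "exp (- (\<i> * z))"] e by linarith
 then show "cmod (cos z) <= exp \<bar>Im z\<bar>" by (simp add: cos_exp_eq norm_divide)
 have "cmod (exp (\<i> * z) - exp (- (\<i> * z))) <= 2 * exp \<bar>Im z\<bar>"
  using norm_triangle_ineq4[of "exp (\<i> * z)" "exp (- (\<i> * z))"] e by linarith
 then show "cmod (sin z) <= exp \<bar>Im z\<bar>" by (simp add: sin_exp_eq norm_divide norm_mult)
qed

text \<open>Adds the two classical bounds, of order \<open>k + 1\<close> from the sum and of order
  \<open>1 / sin (t / 2)\<close> from the closed form. Both survive for complex \<open>t\<close>,
  because the hypothesis keeps every argument of sine and cosine in the strip where the imaginary
  part is at most \<open>1\<close> and the functions are at most \<open>exp 1\<close>.\<close>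

lemma dirichlet_bound:
 assumes "(2 * real k + 1) * \<bar>Im t\<bar> <= 2"
 shows "cmod (dirichlet k t) * (1 + (real k + 1) * cmod (sin (t / 2))) <= 3 * exp 1 * (real k + 1)"
proof -
 let ?a = "cmod (dirichlet k t)"
 have "cmod (cos (of_nat l * t)) <= exp 1" if "l \<in> {1..k}" for l
 proof -
  have "2 * real l * \<bar>Im t\<bar> <= (2 * real k + 1) * \<bar>Im t\<bar>" using that by (intro mult_right_mono) auto
  then have "\<bar>Im (of_nat l * t)\<bar> <= 1" using assms by (simp add: abs_mult)
  then show ?thesis using norm_cos_sin_le_exp(1)[of "of_nat l * t"] by (meson exp_le_cancel_iff order_trans)
 qed
 then have "cmod (\<Sum>l=1..k. cos (of_nat l * t)) <= (\<Sum>l=1..k. exp 1)"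
  by (intro sum_norm_le) auto
 then have "?a <= 1 + 2 * (real k * exp 1)"
  unfolding dirichlet_def
  using norm_triangle_ineq[of 1 "2 * (\<Sum>l=1..k. cos (of_nat l * t))"] by (simp add: norm_mult)
 also have "... <= 2 * exp 1 * (real k + 1)" 
 proof -
  have "1 <= exp (1::real)" by simp
  then have "1 <= 2 * exp (1::real)" by linarith
  then show ?thesis by (simp add: algebra_simps)
 qed
 finally have 1: "?a <= 2 * exp 1 * (real k + 1)" .
 have "\<bar>Im ((2 * of_nat k + 1) * t / 2)\<bar> <= 1"
 proof -
  have "Im ((2 * of_nat k + 1) * t / 2) = (2 * real k + 1) * Im t / 2"
   by (simp add: Im_divide_numeral)
  then show ?thesis using assms by (simp add: abs_mult)
 qed
 then have "cmod (sin (t / 2)) * ?a <= exp 1"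
  unfolding norm_mult[symmetric] dirichlet_sin
  using norm_cos_sin_le_exp(2)[of "(2 * of_nat k + 1) * t / 2"] by (meson exp_le_cancel_iff order_trans)
 then have "(real k + 1) * (cmod (sin (t / 2)) * ?a) <= (real k + 1) * exp 1"
  by (intro mult_left_mono) auto
 with 1 show ?thesis by (simp add: algebra_simps)
qed

text \<open>Stands in for \<open>\<bar>cos z\<bar> <= 1\<close>, which fails off the real
  axis.\<close>

lemma norm_cos_le_norm_sin: "cmod (cos z) <= 1 + cmod (sin z)"
proof -
 have "(cos z)^2 = 1 - (sin z)^2" by (simp add: cos_squared_eq)
 then have "(cmod (cos z))^2 <= 1 + (cmod (sin z))^2"
  by (metis norm_one norm_power norm_triangle_ineq4)
 also have "... <= (1 + cmod (sin z))^2" by (simp add: power2_sum)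
 finally show ?thesis by (rule power2_le_imp_le) simp
qed

lemma norm_cos_ge_half: "cmod (sin z) <= 1/2 ==> 1/2 <= cmod (cos z)"
proof -
 assume s: "cmod (sin z) <= 1/2"
 have "1 = (cos z)^2 + (sin z)^2" by (simp add: cos_squared_eq)
 then have "1 <= (cmod (cos z))^2 + (cmod (sin z))^2"
  by (metis norm_one norm_power norm_triangle_ineq)
 moreover have "(cmod (sin z))^2 <= (1/2)^2" using s by (intro power_mono) auto
 ultimately have "(1/2)^2 <= (cmod (cos z))^2" by (simp add: power2_eq_square)
 then show ?thesis by (rule power2_le_imp_le) simp
qed

text \<open>Lifts the disc about \<open>cos \<theta>\<close> to the angle plane. The distance of
  \<open>z\<close> from \<open>cos \<theta>\<close> is twice the product of the sines of
  \<open>(\<zeta> - \<theta>) / 2\<close> and \<open>(\<zeta> + \<theta>) / 2\<close>. Nearness is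
  expressed by the sine of the half difference, so that no multiple of the period has to be
  tracked.\<close>

lemma cos_preimage_near:
 fixes \<theta> :: real
 assumes \<theta>: "0 <= \<theta>" "\<theta> <= pi" and n: "0 < n" and z: "cmod (z - of_real (cos \<theta>)) <= rho n (cos \<theta>) / 10"
 obtains \<zeta> where "cos \<zeta> = z" "cmod (sin ((\<zeta> - of_real \<theta>) / 2)) <= 1 / (2 * real n)"
proof -
 let ?a = "of_real \<theta>"
 let ?b = "\<lambda>\<zeta>. sin ((\<zeta> - ?a) / 2)"
 let ?c = "\<lambda>\<zeta>. sin ((\<zeta> + ?a) / 2)"
 have cd: "cmod (cos \<zeta> - of_real (cos \<theta>)) = 2 * cmod (?c \<zeta>) * cmod (?b \<zeta>)" for \<zeta> :: complex
 proof -
  have "sin ((?a - \<zeta>) / 2) = - ?b \<zeta>"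
   by (metis minus_diff_eq minus_divide_left sin_minus)
  then show ?thesis unfolding cos_of_real[symmetric] cos_diff_cos by (simp add: norm_mult)
 qed
 \<comment> \<open>Of the preimages \<open>Arccos z\<close> and its negative, the one for which the
   factor with the difference is the smaller.\<close>
 obtain \<zeta> where \<zeta>: "cos \<zeta> = z" "cmod (?b \<zeta>) <= cmod (?c \<zeta>)"
 proof (cases "cmod (sin ((Arccos z - ?a) / 2)) <= cmod (sin ((Arccos z + ?a) / 2))")
  case True
  then show ?thesis using that[of "Arccos z"] by simp
 next
  case False
  have *: "(- Arccos z - ?a) / 2 = - ((Arccos z + ?a) / 2)"
   "(- Arccos z + ?a) / 2 = - ((Arccos z - ?a) / 2)" by (simp_all add: minus_divide_left)
  have "cmod (sin ((- Arccos z - ?a) / 2)) <= cmod (sin ((- Arccos z + ?a) / 2))"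
   unfolding * sin_minus norm_minus_cancel using False by simp
  then show ?thesis by (intro that[of "- Arccos z"]) simp_all
 qed
 define a where "a = cmod (?b \<zeta>)"
 define b where "b = cmod (?c \<zeta>)"
 have ab: "0 <= a" "a <= b" using \<zeta>(2) unfolding a_def b_def by auto
 have "a <= 1 / (2 * real n)"
 proof (rule ccontr)
  \<comment> \<open>For larger \<open>a\<close> the two terms of \<open>rho\<close> would be at most
    \<open>6 * (a * b)\<close> and \<open>4 * (a * b)\<close>, while the radius
    \<open>rho / 10\<close> forces them to add up to at least \<open>20 * (a * b)\<close>.\<close>
  assume "\<not> a <= 1 / (2 * real n)"
  then have na: "1 / real n < 2 * a" by (simp add: field_simps)
  define i where "i = 1 / real n"
  have i: "0 < i" "i <= 1" "i < 2 * a" using n na unfolding i_def by auto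
  have "2 * (a * b) = cmod (z - of_real (cos \<theta>))" using cd[of \<zeta>] \<zeta>(1) unfolding a_def b_def by simp
  also have "... <= (sin \<theta> * i + i^2) / 10"
   using z \<theta> by (simp add: rho_cos i_def power_one_over)
  finally have 1: "20 * (a * b) <= sin \<theta> * i + i^2" by simp
  define U where "U = (\<zeta> + ?a) / 2"
  define V where "V = (\<zeta> - ?a) / 2"
  have UV: "U - V = ?a" unfolding U_def V_def by (simp add: field_simps)
  have "cmod (sin U * cos V - cos U * sin V) <= b * (1 + a) + (1 + b) * a"
  proof -
   have "cmod (sin U * cos V - cos U * sin V) <= cmod (sin U) * cmod (cos V) + cmod (cos U) * cmod (sin V)"
    by (metis norm_mult norm_triangle_ineq4)
   also have "... <= b * (1 + a) + (1 + b) * a"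
    using norm_cos_le_norm_sin[of U] norm_cos_le_norm_sin[of V]
    unfolding a_def b_def U_def V_def by (intro add_mono mult_mono) auto
   finally show ?thesis .
  qed
  moreover have "sin U * cos V - cos U * sin V = of_real (sin \<theta>)"
   using UV by (metis sin_diff sin_of_real)
  ultimately have "sin \<theta> <= b * (1 + a) + (1 + b) * a"
   by (metis abs_le_D1 norm_of_real)
  also have "... <= 2 * b + 2 * (a * b)" using ab by (simp add: algebra_simps)
  finally have "sin \<theta> * i <= (2 * b + 2 * (a * b)) * i" using i by (intro mult_right_mono) auto
  also have "... = 2 * (b * i) + 2 * (a * b) * i" by (simp add: algebra_simps)
  also have "... <= 2 * (b * (2 * a)) + 2 * (a * b) * 1"
   using i ab by (intro add_mono mult_left_mono) auto
  finally have 2: "sin \<theta> * i <= 6 * (a * b)" by simp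
  have "i^2 <= (2 * a) * (2 * b)" unfolding power2_eq_square using i ab by (intro mult_mono) auto
  with 1 2 have "20 * (a * b) <= 10 * (a * b)" by simp
  moreover have "0 < a * b" using i ab by (intro mult_pos_pos) auto
  ultimately show False by simp
 qed
 then show ?thesis using that[OF \<zeta>(1)] unfolding a_def by simp
qed

lemma Im_le_norm_sin: "\<bar>Im z\<bar> <= cmod (sin z)"
proof -
 have p: "x^2 <= (sinh x)^2" for x :: real
 proof -
  have "\<bar>x\<bar> <= \<bar>sinh x\<bar>"
  proof -
   have "x <= sinh x" if "0 <= x" for x :: real
   proof -
    have "sinh 0 - 0 <= sinh x - x"
    proof (rule DERIV_nonneg_imp_nondecreasing[OF that])
     fix u :: real
     show "\<exists>y. ((\<lambda>x. sinh x - x) has_real_derivative y) (at u) \<and> 0 <= y"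
      by (rule exI[of _ "cosh u - 1"]) (auto intro!: derivative_eq_intros simp: cosh_real_ge_1)
    qed
    then show ?thesis by simp
   qed
   from this[of "\<bar>x\<bar>"] show ?thesis by (simp add: sinh_real_abs)
  qed
  then show ?thesis by (simp add: abs_le_square_iff)
 qed
 have "(cmod (sin z))^2 = (sin (Re z))^2 + (sinh (Im z))^2"
 proof -
  have "Re (sin z) = sin (Re z) * cosh (Im z)" "Im (sin z) = cos (Re z) * sinh (Im z)"
   by (simp_all add: Re_sin Im_sin cosh_def sinh_def)
  then show ?thesis
   by (simp add: cmod_power2 power_mult_distrib cosh_square_eq cos_squared_eq algebra_simps)
 qed
 then have "\<bar>Im z\<bar>^2 <= (cmod (sin z))^2" using p[of "Im z"] by (simp add: add_increasing)
 then show ?thesis by (rule power2_le_imp_le) simp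
qed


section \<open>Chebyshev nodes and the decaying polynomial kernels\<close>

definition cheb_node :: "nat => nat => real" where
 "cheb_node N j = (2 * real j + 1) * pi / (2 * real N)"

text \<open>Multiplied by \<open>2 * sin h\<close> the sum telescopes to
  \<open>sin (l * pi) = 0\<close>. The range of \<open>l\<close> puts \<open>h\<close> strictly
  between \<open>0\<close> and \<open>pi\<close>, so \<open>sin h\<close> can be cancelled.\<close>

lemma sum_cos_cheb_node:
 assumes "0 < l" "l < 2 * N"
 shows "(\<Sum>j<N. cos (real l * cheb_node N j)) = 0"
proof -
 define h where "h = real l * pi / (2 * real N)"
 have N: "0 < N" using assms by auto
 have h: "0 < h" "h < pi"
 proof -
  have "real l * pi < 2 * real N * pi" using assms by (intro mult_strict_right_mono) auto
  then show "h < pi" unfolding h_def using N by (simp add: divide_less_eq mult.commute)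
  show "0 < h" unfolding h_def using assms N by simp
 qed
 have "2 * sin h * (\<Sum>j<M. cos (real l * cheb_node N j)) = sin (2 * real M * h)" for M
 proof (induction M)
  case (Suc M)
  have "sin (2 * real (Suc M) * h) - sin (2 * real M * h) = 2 * sin h * cos (real l * cheb_node N M)"
  proof -
   have "(2 * real (Suc M) * h - 2 * real M * h) / 2 = h" by (simp add: algebra_simps)
   moreover have "(2 * real (Suc M) * h + 2 * real M * h) / 2 = real l * cheb_node N M"
    by (simp add: algebra_simps cheb_node_def h_def add_divide_distrib)
   ultimately show ?thesis by (simp only: sin_diff_sin)
  qed
  then show ?case using Suc by (simp add: algebra_simps)
 qed simp
 from this[of N] have "2 * sin h * (\<Sum>j<N. cos (real l * cheb_node N j)) = sin (real l * pi)"
  unfolding h_def using N by (simp add: field_simps)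
 then show ?thesis using sin_gt_zero[OF h] by (simp add: sin_npi)
qed

lemma cheb_node_range: "j < N ==> 0 <= cheb_node N j \<and> cheb_node N j <= pi"
proof -
 assume j: "j < N"
 then have "(2 * real j + 1) * pi <= 2 * real N * pi" by (intro mult_right_mono) auto
 then show ?thesis unfolding cheb_node_def using j by (simp add: divide_le_eq mult.commute)
qed

text \<open>The constant \<open>1/2\<close> in place of \<open>2 / pi\<close> permits an easy proof:
  up to \<open>pi / 3\<close> the derivative \<open>cos u - 1/2\<close> is nonnegative, beyond that
  \<open>sin x >= sqrt 3 / 2 >= 4 / 5 >= x / 2\<close>.\<close>

lemma jordan: "x / 2 <= sin x" if "0 <= x" "x <= pi / 2" for x :: real
proof (cases "x <= pi / 3")
 case True
 have "sin 0 - 0 / 2 <= sin x - x / 2"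
 proof (rule DERIV_nonneg_imp_nondecreasing[OF that(1)])
  fix u assume u: "0 <= u" "u <= x"
  have "cos (pi / 3) <= cos u" using u True by (intro cos_monotone_0_pi_le) auto
  then show "\<exists>y. ((\<lambda>x. sin x - x / 2) has_real_derivative y) (at u) \<and> 0 <= y"
   by (intro exI[of _ "cos u - 1/2"]) (auto intro!: derivative_eq_intros simp: cos_60)
 qed
 then show ?thesis by simp
next
 case False
 have "sin (pi / 3) <= sin x" using that False by (intro sin_monotone_2pi_le) auto
 moreover have "x / 2 <= 4 / 5" using that pi_approx(2) by simp
 moreover have "4 / 5 <= sqrt 3 / 2" using real_le_rsqrt[of "8/5" 3] by (simp add: power2_eq_square)
 ultimately show ?thesis by (simp add: sin_60)
qed

lemma sin_half_lower:
 fixes \<theta> s :: real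
 assumes "0 <= \<theta>" "\<theta> <= pi" "0 <= s" "s <= pi"
 shows "\<bar>\<theta> - s\<bar> / 4 <= \<bar>sin ((\<theta> - s) / 2)\<bar>" "\<bar>\<theta> - s\<bar> / 4 <= \<bar>sin ((\<theta> + s) / 2)\<bar>"
proof -
 have 1: "\<bar>\<theta> - s\<bar> / 4 <= sin (\<bar>\<theta> - s\<bar> / 2)"
  using jordan[of "\<bar>\<theta> - s\<bar> / 2"] assms by auto
 have "sin (\<bar>\<theta> - s\<bar> / 2) <= \<bar>sin ((\<theta> - s) / 2)\<bar>"
 proof (cases "s <= \<theta>")
  case False
  then have "\<bar>\<theta> - s\<bar> / 2 = - ((\<theta> - s) / 2)" by (simp add: field_simps)
  then show ?thesis by (metis abs_ge_minus_self sin_minus)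
 qed simp
 then show "\<bar>\<theta> - s\<bar> / 4 <= \<bar>sin ((\<theta> - s) / 2)\<bar>" using 1 by simp
 have nn: "0 <= sin (\<theta> / 2)" "0 <= cos (\<theta> / 2)" "0 <= sin (s / 2)" "0 <= cos (s / 2)"
  using assms by (auto intro!: sin_ge_zero cos_ge_zero)
 have "\<bar>sin ((\<theta> - s) / 2)\<bar> <= \<bar>sin ((\<theta> + s) / 2)\<bar>"
  unfolding diff_divide_distrib add_divide_distrib sin_add sin_diff
  using mult_nonneg_nonneg[OF nn(1) nn(4)] mult_nonneg_nonneg[OF nn(2) nn(3)] by (simp add: abs_le_iff)
 then show "\<bar>\<theta> - s\<bar> / 4 <= \<bar>sin ((\<theta> + s) / 2)\<bar>"
  using \<open>\<bar>\<theta> - s\<bar> / 4 <= \<bar>sin ((\<theta> - s) / 2)\<bar>\<close> by simp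
qed

text \<open>Carries the real lower bound over to \<open>\<zeta>\<close>, by the addition theorem
  about the real angle; the \<open>1\<close> on the right absorbs the displacement. Both signs of
  \<open>s\<close> occur because the kernels are symmetrised to become functions of the
  cosine.\<close>

lemma norm_sin_shift_lower:
 fixes \<theta> s :: real
 assumes n: "0 < n" and v: "cmod (sin ((\<zeta> - of_real \<theta>) / 2)) <= 1 / (2 * real n)"
  and \<theta>: "0 <= \<theta>" "\<theta> <= pi" and s: "0 <= s" "s <= pi" and e: "e = s \<or> e = - s"
 shows "(1 + real n * \<bar>\<theta> - s\<bar>) / 8 <= 1 + real n * cmod (sin ((\<zeta> - of_real e) / 2))"
proof -
 let ?a = "\<lambda>u V. sin (of_real u + V)"
 define u where "u = (\<theta> - e) / 2"
 define V where "V = (\<zeta> - of_real \<theta>) / 2"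
 have n1: "1 / (2 * real n) <= 1 / 2" using n by (simp add: field_simps)
 have u: "\<bar>\<theta> - s\<bar> / 4 <= \<bar>sin u\<bar>" using e sin_half_lower[OF \<theta> s] unfolding u_def by auto
 have cV: "1/2 <= cmod (cos V)" using norm_cos_ge_half[of V] v n1 unfolding V_def by simp
 have eq: "(\<zeta> - of_real e) / 2 = of_real u + V" unfolding u_def V_def by (simp add: field_simps)
 have "\<bar>sin u\<bar> * (1/2) <= \<bar>sin u\<bar> * cmod (cos V)" using cV by (intro mult_left_mono) auto
 also have "... = cmod (?a u V - cos (of_real u) * sin V)"
  by (simp add: sin_add norm_mult sin_of_real)
 also have "... <= cmod (?a u V) + \<bar>cos u\<bar> * cmod (sin V)"
  by (metis norm_triangle_ineq4 norm_mult cos_of_real norm_of_real)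
 also have "... <= cmod (?a u V) + 1 * (1 / (2 * real n))"
  using v unfolding V_def by (intro add_mono mult_mono) auto
 finally have "\<bar>\<theta> - s\<bar> / 8 <= cmod (?a u V) + 1 / (2 * real n)" using u by simp
 then have "real n * (\<bar>\<theta> - s\<bar> / 8) <= real n * (cmod (?a u V) + 1 / (2 * real n))"
  by (intro mult_left_mono) auto
 also have "... = real n * cmod (?a u V) + 1 / 2" using n by (simp add: algebra_simps)
 finally show ?thesis unfolding eq by (simp add: add_divide_distrib)
qed

text \<open>\<open>K j\<close> is, in the variable \<open>cos \<zeta>\<close>, the sum of the powers
  \<open>2 * m\<close> of the Dirichlet kernel at \<open>\<zeta> - s\<close> and
  \<open>\<zeta> + s\<close>, where \<open>s\<close> is the \<open>j\<close>-th Chebyshev node,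
  divided by a constant \<open>c\<close>. All nonconstant frequencies are below
  \<open>2 * N\<close>, so discrete orthogonality makes the sum over \<open>j\<close> constant. The
  degree \<open>n - r\<close> leaves room for factors of degree below \<open>r\<close>.\<close>

lemma kernel_polynomials:
 assumes r: "1 <= r" and m: "1 <= (m::nat)"
 shows "\<exists>C>0. \<forall>n N. r <= n --> n <= N --> (\<exists>K :: nat => real poly.
  (\<forall>j. degree (K j) <= n - r) \<and> (\<Sum>j<N. K j) = 1 \<and>
  (\<forall>\<theta> z j. 0 <= \<theta> --> \<theta> <= pi --> j < N --> cmod (z - of_real (cos \<theta>)) <= rho n (cos \<theta>) / 10 -->
    cmod (poly (cpoly (K j)) z) * (1 + real n * \<bar>\<theta> - cheb_node N j\<bar>) ^ (2 * m) <= C))"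
proof -
 let ?a = "\<lambda>k \<zeta> e. dirichlet k (\<zeta> - of_real e)"
 let ?b = "\<lambda>K j z. poly (cpoly (K j)) z"
 let ?c = "2 * real m * real r"
 let ?d = "\<lambda>k q. 2 * real m * real r * (1 + (real k + 1) * q)"
 define C where "C = 2 * (3 * exp 1 * (8 * ?c)) ^ (2 * m)"
 have C: "0 < C" unfolding C_def using r m by simp
 show ?thesis
 proof (intro exI[of _ C] conjI C allI impI)
  fix n N :: nat assume n: "r <= n" "n <= N"
  have n0: "0 < n" using n r by simp
  define k where "k = (n - r) div (2 * m)"
  have k1: "2 * m * k <= n - r" unfolding k_def by simp
  have "2 * k <= n"
  proof -
   have "1 * (2 * k) <= m * (2 * k)" using m by (rule mult_le_mono1)
   then have "2 * k <= 2 * m * k" by (simp add: mult_ac)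
   then show ?thesis using k1 by linarith
  qed
  \<comment> \<open>Division rounds \<open>k\<close> down and \<open>n - r\<close> may be much
    smaller than \<open>n\<close>, so \<open>k\<close> may even be \<open>0\<close>. Since
    \<open>n <= r * (n - r + 1)\<close>, the order \<open>k + 1\<close> is still comparable with
    \<open>n\<close>.\<close>
  have k2: "real n <= 2 * real m * real r * (real k + 1)"
  proof -
   have "n - r < 2 * m * (k + 1)" unfolding k_def using m
    by (metis dividend_less_times_div mult_pos_pos zero_less_numeral less_le_trans zero_less_one add.commute distrib_left mult.right_neutral mult_1_right)
   then have "n - r + 1 <= 2 * m * (k + 1)" by simp
   then have "r * (n - r + 1) <= r * (2 * m * (k + 1))" by (rule mult_le_mono2)
   moreover have "n <= r * (n - r + 1)"
   proof -
    have "1 * (n - r) <= r * (n - r)" using r by (rule mult_le_mono1)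
    moreover have "r * (n - r + 1) = r * (n - r) + r" by simp
    ultimately show ?thesis using n by linarith
   qed
   ultimately have "n <= r * (2 * m * (k + 1))" by simp
   then have "real n <= real (r * (2 * m * (k + 1)))" by (simp only: of_nat_le_iff)
   then show ?thesis by (simp add: algebra_simps)
  qed
  define d where "d = k * (2 * m)"
  obtain a :: "nat => real" where a: "\<And>t. dirichlet k t ^ (2 * m) = (\<Sum>l\<le>d. of_real (a l) * cos (of_nat l * t))"
   using dirichlet_power_cos_poly[of k "2 * m"] unfolding cos_poly_def d_def by auto
  have dN: "d < N" using k1 n r unfolding d_def by (simp add: mult_ac)
  have dr: "d <= n - r" using k1 unfolding d_def by (simp add: mult_ac)
  let ?s = "cheb_node N"
  define H where "H j = (\<Sum>l\<le>d. smult (2 * a l * cos (real l * ?s j)) (cheb l))" for j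
  have Hcos: "?b H j (cos \<zeta>) = dirichlet k (\<zeta> - of_real (?s j)) ^ (2 * m) + dirichlet k (\<zeta> + of_real (?s j)) ^ (2 * m)" for j \<zeta>
  proof -
   have "?b H j (cos \<zeta>) = (\<Sum>l\<le>d. of_real (a l) * (2 * of_real (cos (real l * ?s j)) * cos (of_nat l * \<zeta>)))"
    unfolding H_def cev_sum cev_smult cheb_cos by (intro sum.cong) (auto simp: mult_ac)
   also have "... = (\<Sum>l\<le>d. of_real (a l) * (cos (of_nat l * (\<zeta> - of_real (?s j))) + cos (of_nat l * (\<zeta> + of_real (?s j)))))"
   proof (intro sum.cong refl arg_cong2[where f = "(*)"])
    fix l
    show "2 * of_real (cos (real l * ?s j)) * cos (of_nat l * \<zeta>) = cos (of_nat l * (\<zeta> - of_real (?s j))) + cos (of_nat l * (\<zeta> + of_real (?s j)))"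
     using cos_times_cos[of "of_nat l * \<zeta>" "of_real (real l * ?s j)"]
     by (simp add: algebra_simps cos_of_real[symmetric])
   qed
   also have "... = (\<Sum>l\<le>d. of_real (a l) * cos (of_nat l * (\<zeta> - of_real (?s j)))) + (\<Sum>l\<le>d. of_real (a l) * cos (of_nat l * (\<zeta> + of_real (?s j))))"
    by (simp add: distrib_left sum.distrib)
   finally show ?thesis unfolding a .
  qed
  \<comment> \<open>Only the frequency \<open>0\<close> survives the summation over the nodes, since
    \<open>d < N\<close>.\<close>
  have Hsum: "(\<Sum>j<N. H j) = [:2 * real N * a 0:]"
  proof -
   have "(\<Sum>j<N. H j) = (\<Sum>l\<le>d. \<Sum>j<N. smult (2 * a l * cos (real l * ?s j)) (cheb l))"
    unfolding H_def by (rule sum.swap)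
   also have "... = (\<Sum>l\<le>d. smult (2 * a l * (\<Sum>j<N. cos (real l * ?s j))) (cheb l))"
    by (simp add: smult_sum sum_distrib_left)
   also have "... = (\<Sum>l\<le>d. if l = 0 then [:2 * real N * a 0:] else 0)"
    using dN by (intro sum.cong) (auto simp: sum_cos_cheb_node)
   finally show ?thesis by simp
  qed
  define c where "c = 2 * real N * a 0"
  have dreal: "\<exists>y. dirichlet k (of_real x) = of_real y" for x
   unfolding dirichlet_def
   by (intro exI[of _ "1 + 2 * (\<Sum>l=1..k. cos (real l * x))"]) (simp flip: cos_of_real)
  have N0: "0 < N" using n n0 by simp
  \<comment> \<open>The constant sum is evaluated at the node \<open>0\<close>. On the real axis all
    summands are even powers of real numbers, so the single one with argument \<open>0\<close>,
    equal to \<open>(1 + 2 * k) ^ (2 * m)\<close>, is a lower bound.\<close>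
  have c: "(real k + 1) ^ (2 * m) <= c"
  proof -
   have "\<exists>g. (\<forall>x. g x \<ge> 0) \<and> (\<forall>x. dirichlet k (of_real x) ^ (2 * m) = of_real (g x))"
   proof -
    obtain y where y: "\<And>x. dirichlet k (of_real x) = of_real (y x)" using dreal by metis
    show ?thesis by (intro exI[of _ "\<lambda>x. y x ^ (2 * m)"]) (simp add: y zero_le_even_power)
   qed
   then obtain g :: "real => real" where g: "\<And>x. g x \<ge> 0" "\<And>x. dirichlet k (of_real x) ^ (2 * m) = of_real (g x)" by auto
   have "of_real c = poly (cpoly (\<Sum>j<N. H j)) (cos (of_real (?s 0)))"
    unfolding Hsum c_def by (simp add: cev_pCons)
   also have "... = (\<Sum>j<N. dirichlet k (of_real (?s 0 - ?s j)) ^ (2 * m) + dirichlet k (of_real (?s 0 + ?s j)) ^ (2 * m))"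
    unfolding cev_sum Hcos by simp
   also have "... = of_real (\<Sum>j<N. g (?s 0 - ?s j) + g (?s 0 + ?s j))" unfolding g by simp
   finally have "c = (\<Sum>j<N. g (?s 0 - ?s j) + g (?s 0 + ?s j))" by (simp only: of_real_eq_iff)
   also have "... \<ge> g (?s 0 - ?s 0) + g (?s 0 + ?s 0)"
    by (rule member_le_sum) (use g N0 in auto)
   finally have "g 0 <= c" using g(1)[of "?s 0 + ?s 0"] by simp
   moreover have "g 0 = (1 + 2 * real k) ^ (2 * m)"
   proof -
    have "of_real (g 0) = complex_of_real ((1 + 2 * real k) ^ (2 * m))"
     using g(2)[of 0] by (simp add: dirichlet_def)
    then show ?thesis by (simp only: of_real_eq_iff)
   qed
   moreover have "(real k + 1) ^ (2 * m) <= (1 + 2 * real k) ^ (2 * m)" by (intro power_mono) auto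
   ultimately show ?thesis by simp
  qed
  have c0: "0 < c" using c zero_less_power[of "real k + 1" "2 * m"] by linarith
  define K where "K j = smult (1 / c) (H j)" for j
  show "\<exists>K :: nat => real poly. (\<forall>j. degree (K j) <= n - r) \<and> (\<Sum>j<N. K j) = 1 \<and>
   (\<forall>\<theta> z j. 0 <= \<theta> --> \<theta> <= pi --> j < N --> cmod (z - of_real (cos \<theta>)) <= rho n (cos \<theta>) / 10 -->
    cmod (?b K j z) * (1 + real n * \<bar>\<theta> - ?s j\<bar>) ^ (2 * m) <= C)"
  proof (intro exI[of _ K] conjI allI impI)
   fix j show "degree (K j) <= n - r"
    unfolding K_def H_def
    by (intro order_trans[OF degree_smult_le] degree_sum_le)
      (use degree_cheb dr in \<open>auto intro: order_trans\<close>)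
  next
   have "(\<Sum>j<N. K j) = smult (1 / c) (\<Sum>j<N. H j)" unfolding K_def by (induction N) (simp_all add: smult_add_right)
   then show "(\<Sum>j<N. K j) = 1" unfolding Hsum c_def[symmetric] using c0 by (simp add: one_pCons)
  next
   fix \<theta> z j assume \<theta>: "0 <= \<theta>" "\<theta> <= pi" and j: "j < N" and z: "cmod (z - of_real (cos \<theta>)) <= rho n (cos \<theta>) / 10"
   obtain \<zeta> where \<zeta>: "cos \<zeta> = z" "cmod (sin ((\<zeta> - of_real \<theta>) / 2)) <= 1 / (2 * real n)"
    using cos_preimage_near[OF \<theta> n0 z] by auto
   note sj = cheb_node_range[OF j]
   define l where "l = 1 + real n * \<bar>\<theta> - ?s j\<bar>"
   have l1: "1 <= l" unfolding l_def by simp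
   have "\<bar>Im ((\<zeta> - of_real \<theta>) / 2)\<bar> <= 1 / (2 * real n)" using Im_le_norm_sin \<zeta>(2) by (rule order_trans)
   then have Im: "\<bar>Im \<zeta>\<bar> <= 1 / real n" by (simp add: Im_divide_numeral)
   have kn: "(2 * real k + 1) * \<bar>Im \<zeta>\<bar> <= 2"
   proof -
    have "2 * real k + 1 <= 2 * real n" using \<open>2 * k <= n\<close> n0 by linarith
    then have "(2 * real k + 1) * \<bar>Im \<zeta>\<bar> <= (2 * real n) * (1 / real n)" using Im by (intro mult_mono) auto
    then show ?thesis using n0 by simp
   qed
   have D: "cmod (?a k \<zeta> e) * l <= 3 * exp 1 * (8 * ?c) * (real k + 1)"
    if e: "e = ?s j \<or> e = - ?s j" for e
   proof -
    define q where "q = cmod (sin ((\<zeta> - of_real e) / 2))"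
    have "l <= 8 * (1 + real n * q)"
     using norm_sin_shift_lower[OF n0 \<zeta>(2) \<theta> conjunct1[OF sj] conjunct2[OF sj] e] unfolding l_def q_def by simp
    also have "... <= 8 * (?d k q)"
    proof -
     have "1 <= real m * real r" using m r by (metis mult_le_mono nat_mult_1 of_nat_1 of_nat_le_iff of_nat_mult)
     moreover have "real n * q <= 2 * real m * real r * (real k + 1) * q"
      unfolding q_def by (intro mult_right_mono k2) simp
     ultimately show ?thesis by (simp add: algebra_simps)
    qed
    finally have lq: "l <= 8 * (?d k q)" .
    have b: "cmod (?a k \<zeta> e) * (1 + (real k + 1) * q) <= 3 * exp 1 * (real k + 1)"
     unfolding q_def by (rule dirichlet_bound) (use kn in simp)
    have "cmod (?a k \<zeta> e) * l <= cmod (?a k \<zeta> e) * (8 * (?d k q))"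
     using lq by (intro mult_left_mono) auto
    also have "... = 8 * ?c * (cmod (?a k \<zeta> e) * (1 + (real k + 1) * q))" by simp
    also have "... <= 8 * ?c * (3 * exp 1 * (real k + 1))" using b by (intro mult_left_mono) auto
    finally show ?thesis by (simp add: mult_ac)
   qed
   have D2: "cmod (?a k \<zeta> e ^ (2 * m)) * l ^ (2 * m) <= C / 2 * c"
    if e: "e = ?s j \<or> e = - ?s j" for e
   proof -
    have "cmod (?a k \<zeta> e ^ (2 * m)) * l ^ (2 * m) = (cmod (?a k \<zeta> e) * l) ^ (2 * m)"
     by (simp add: norm_power power_mult_distrib)
    also have "... <= (3 * exp 1 * (8 * ?c) * (real k + 1)) ^ (2 * m)"
     using D[OF e] l1 by (intro power_mono) auto
    also have "... = C / 2 * (real k + 1) ^ (2 * m)" unfolding C_def by (simp only: power_mult_distrib) simp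
    also have "... <= C / 2 * c" using c C by (intro mult_left_mono) auto
    finally show ?thesis .
   qed
   have "cmod (?b H j z) * l ^ (2 * m) <= C * c"
   proof -
    have "cmod (?b H j z) <= cmod (dirichlet k (\<zeta> - of_real (?s j)) ^ (2 * m)) + cmod (dirichlet k (\<zeta> - of_real (- ?s j)) ^ (2 * m))"
     unfolding \<zeta>(1)[symmetric] Hcos by (metis diff_minus_eq_add norm_triangle_ineq of_real_minus)
    then have "cmod (?b H j z) * l ^ (2 * m) <= (cmod (dirichlet k (\<zeta> - of_real (?s j)) ^ (2 * m)) + cmod (dirichlet k (\<zeta> - of_real (- ?s j)) ^ (2 * m))) * l ^ (2 * m)"
     using l1 by (intro mult_right_mono) auto
    then show ?thesis using D2[of "?s j"] D2[of "- ?s j"] by (simp add: distrib_right)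
   qed
   then show "cmod (?b K j z) * (1 + real n * \<bar>\<theta> - ?s j\<bar>) ^ (2 * m) <= C"
    unfolding l_def[symmetric] K_def cev_smult using c0 by (simp add: norm_mult norm_divide field_simps)
  qed
 qed
qed

section \<open>Whitney's inequality\<close>

definition loc_int :: "(real => real) => bool" where
 "loc_int g \<longleftrightarrow> g \<in> borel_measurable borel \<and> (\<forall>a b. integrable lborel (\<lambda>x. indicator {a<..b} x * g x))"

text \<open>Half-open intervals make splitting an exact identity. With limits in the wrong order the
  value is \<open>0\<close> rather than the negative integral, which is why identities below are
  restricted to ordered limits or to \<open>x >= 0\<close>.\<close>

definition int_over :: "(real => real) => real => real => real" where
 "int_over g a b = (\<integral>x. indicator {a<..b} x * g x \<partial>lborel)"

lemma loc_int_measurable[measurable_dest]: "loc_int g ==> g \<in> borel_measurable borel"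
 by (simp add: loc_int_def)

lemma loc_int_integrable: "loc_int g ==> integrable lborel (\<lambda>x. indicator {a<..b} x * g x)"
 by (simp add: loc_int_def)

lemma loc_int_integrable_lborel: "f \<in> borel_measurable borel ==> integrable lborel f ==> loc_int f"
 unfolding loc_int_def using integrable_mult_indicator[of _ lborel f] by simp

lemma loc_int_bounded:
 assumes "g \<in> borel_measurable borel" and "\<And>a b. \<exists>M. \<forall>x\<in>{a<..b}. \<bar>g x\<bar> <= M"
 shows "loc_int g"
 unfolding loc_int_def
proof (intro conjI allI)
 fix a b :: real
 obtain M where M: "\<And>x. x \<in> {a<..b} ==> \<bar>g x\<bar> <= M" using assms(2)[of a b] by blast
 have "emeasure lborel {a<..b} < \<infinity>" by (rule emeasure_bounded_finite) simp
 then have "integrable lborel (\<lambda>x. indicator {a<..b} x *\<^sub>R g x)"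
  using assms(1) M by (intro integrableI_bounded_set_indicator[where B = M]) auto
 then show "integrable lborel (\<lambda>x. indicator {a<..b} x * g x)" by simp
qed fact

lemma loc_int_add: "loc_int g ==> loc_int h ==> loc_int (\<lambda>x. g x + h x)"
 unfolding loc_int_def by (auto simp: distrib_left)

lemma loc_int_cmult: "loc_int g ==> loc_int (\<lambda>x. c * g x)"
 unfolding loc_int_def by (auto simp: mult.left_commute[of _ c])

lemma loc_int_diff: "loc_int g ==> loc_int h ==> loc_int (\<lambda>x. g x - h x)"
 using loc_int_add[of g "\<lambda>x. - 1 * h x"] loc_int_cmult[of h "-1"] by simp

lemma loc_int_abs: "loc_int g ==> loc_int (\<lambda>x. \<bar>g x\<bar>)"
proof -
 assume g: "loc_int g"
 have "integrable lborel (\<lambda>x. indicator {a<..b} x * \<bar>g x\<bar>)" for a b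
  using integrable_abs[OF loc_int_integrable[OF g, of a b]] by (simp add: abs_mult)
 then show ?thesis using g unfolding loc_int_def by auto
qed

lemma loc_int_sum: "finite A ==> (\<And>i. i \<in> A ==> loc_int (g i)) ==> loc_int (\<lambda>x. \<Sum>i\<in>A. g i x)"
proof (induction A rule: finite_induct)
 case empty show ?case by (simp add: loc_int_def)
qed (simp add: loc_int_add)

lemma loc_int_affine:
 assumes g: "loc_int g" and c: "0 < c"
 shows "loc_int (\<lambda>x. g (d + c * x))" "int_over (\<lambda>x. g (d + c * x)) a b = int_over g (d + c * a) (d + c * b) / c"
proof -
 have ind: "indicator {d + c * a<..d + c * b} (d + c * x) = (indicator {a<..b} x :: real)" for a b x
  using c by (auto simp: indicator_def)
 show "loc_int (\<lambda>x. g (d + c * x))" unfolding loc_int_def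
 proof (intro conjI allI)
  have [measurable]: "g \<in> borel_measurable borel" using g by (simp add: loc_int_def)
  show "(\<lambda>x. g (d + c * x)) \<in> borel_measurable borel" by measurable
  fix a b :: real
  have "integrable lborel (\<lambda>x. indicator {d + c * a<..d + c * b} (d + c * x) * g (d + c * x))"
   using lborel_integrable_real_affine[OF loc_int_integrable[OF g, of "d + c * a" "d + c * b"], of c d] c by auto
  then show "integrable lborel (\<lambda>x. indicator {a<..b} x * g (d + c * x))" unfolding ind .
 qed
 have "int_over g (d + c * a) (d + c * b) = c * (\<integral>x. indicator {d + c * a<..d + c * b} (d + c * x) * g (d + c * x) \<partial>lborel)"
  unfolding int_over_def using lborel_integral_real_affine[of c "\<lambda>x. indicator {d + c * a<..d + c * b} x * g x" d] c by simp
 then show "int_over (\<lambda>x. g (d + c * x)) a b = int_over g (d + c * a) (d + c * b) / c"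
  unfolding ind int_over_def using c by simp
qed

lemma loc_int_shift: "loc_int g ==> loc_int (\<lambda>x. g (x + s))"
 using loc_int_affine(1)[of g 1 s] by (simp add: add.commute)

lemma int_over_shift: "loc_int g ==> int_over (\<lambda>x. g (x + s)) a b = int_over g (a + s) (b + s)"
 using loc_int_affine(2)[of g 1 s] by (simp add: add.commute)

lemma int_over_split:
 assumes "loc_int g" "a <= b" "b <= c"
 shows "int_over g a c = int_over g a b + int_over g b c"
proof -
 have "int_over g a c = (\<integral>x. indicator {a<..b} x * g x + indicator {b<..c} x * g x \<partial>lborel)"
  unfolding int_over_def using assms(2,3) by (intro Bochner_Integration.integral_cong) (auto simp: indicator_def)
 also have "... = int_over g a b + int_over g b c"
  unfolding int_over_def by (intro Bochner_Integration.integral_add loc_int_integrable assms)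
 finally show ?thesis .
qed

lemma int_over_add: "loc_int g ==> loc_int h ==> int_over (\<lambda>x. g x + h x) a b = int_over g a b + int_over h a b"
 unfolding int_over_def distrib_left by (intro Bochner_Integration.integral_add loc_int_integrable)

lemma int_over_cmult: "int_over (\<lambda>x. c * g x) a b = c * int_over g a b"
 unfolding int_over_def mult.left_commute[of _ c] by simp

lemma int_over_diff: "loc_int g ==> loc_int h ==> int_over (\<lambda>x. g x - h x) a b = int_over g a b - int_over h a b"
 using int_over_add[of g "\<lambda>x. - 1 * h x" a b] loc_int_cmult[of h "-1"] int_over_cmult[of "-1" h a b] by simp

lemma int_over_sum: "finite A ==> (\<And>i. i \<in> A ==> loc_int (g i)) ==> int_over (\<lambda>x. \<Sum>i\<in>A. g i x) a b = (\<Sum>i\<in>A. int_over (g i) a b)"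
proof (induction A rule: finite_induct)
 case empty show ?case by (simp add: int_over_def)
qed (simp add: int_over_add loc_int_sum)

lemma int_over_cong: "(\<And>x. a < x ==> x <= b ==> g x = h x) ==> int_over g a b = int_over h a b"
 unfolding int_over_def by (intro Bochner_Integration.integral_cong) (auto simp: indicator_def)

lemma int_over_const: "a <= b ==> int_over (\<lambda>_. c) a b = (b - a) * c"
 unfolding int_over_def by simp

lemma loc_int_const: "loc_int (\<lambda>_. c)"
 by (intro loc_int_bounded) auto

lemma int_over_mono: "loc_int g ==> loc_int h ==> (\<And>x. a < x ==> x <= b ==> g x <= h x) ==> int_over g a b <= int_over h a b"
 unfolding int_over_def by (intro integral_mono loc_int_integrable) (auto simp: indicator_def)

lemma int_over_nonneg: "(\<And>x. a < x ==> x <= b ==> 0 <= g x) ==> 0 <= int_over g a b"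
 unfolding int_over_def by (intro Bochner_Integration.integral_nonneg) (auto simp: indicator_def)

lemma int_over_subset:
 assumes "loc_int g" "\<And>x. 0 <= g x" "c <= a" "b <= d"
 shows "int_over g a b <= int_over g c d"
 unfolding int_over_def using assms
 by (intro integral_mono loc_int_integrable) (auto simp: indicator_def)

lemma int_over_abs: "loc_int g ==> \<bar>int_over g a b\<bar> <= int_over (\<lambda>x. \<bar>g x\<bar>) a b"
 unfolding int_over_def
 using integral_abs_bound[of lborel "\<lambda>x. indicator {a<..b} x * g x"] by (simp add: abs_mult)

lemma int_over_abs_bound:
 assumes "loc_int g" "a <= b" "\<And>x. a < x ==> x <= b ==> \<bar>g x\<bar> <= M"
 shows "\<bar>int_over g a b\<bar> <= (b - a) * M"
proof -
 have "int_over (\<lambda>x. \<bar>g x\<bar>) a b <= int_over (\<lambda>_. M) a b"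
  by (intro int_over_mono loc_int_abs loc_int_const assms)
 then show ?thesis using int_over_abs[OF assms(1), of a b] assms(2) by (simp add: int_over_const)
qed

lemma nn_integral_int_over: "loc_int g ==> (\<And>x. 0 <= g x) ==> ennreal (int_over g a b) = (\<integral>x\<in>{a<..b}. ennreal (g x))"
proof -
 assume g: "loc_int g" and nn: "\<And>x. 0 <= g x"
 have "ennreal (int_over g a b) = (\<integral>x. ennreal (indicator {a<..b} x * g x))"
  unfolding int_over_def
  by (rule nn_integral_eq_integral[OF loc_int_integrable[OF g], symmetric]) (auto intro!: AE_I2 simp: nn)
 also have "... = (\<integral>x\<in>{a<..b}. ennreal (g x))"
  by (intro nn_integral_cong) (auto simp: indicator_def)
 finally show ?thesis .
qed

section \<open>Iterated primitives, Steklov means and differences, modulo polynomials\<close>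

definition prim :: "(real => real) => real => real" where
 "prim g x = int_over g 0 x"

definition mean :: "real => (real => real) => real => real" where
 "mean s g x = int_over g x (x + s) / s"

lemma int_over_measurable[measurable]:
 assumes [measurable]: "g \<in> borel_measurable borel" "a \<in> borel_measurable M" "b \<in> borel_measurable M"
 shows "(\<lambda>x. int_over g (a x) (b x)) \<in> borel_measurable M"
proof -
 have "(\<lambda>x. int_over g (a x) (b x)) = (\<lambda>x. \<integral>y. (if a x < y \<and> y <= b x then 1 else 0) * g y \<partial>lborel)"
  unfolding int_over_def by (intro ext Bochner_Integration.integral_cong) (auto simp: indicator_def)
 then show ?thesis by simp
qed

lemma loc_int_prim: "loc_int g ==> loc_int (prim g)"
proof (rule loc_int_bounded)
 assume g: "loc_int g"
 then have [measurable]: "g \<in> borel_measurable borel" by (simp add: loc_int_def)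
 show "prim g \<in> borel_measurable borel" unfolding prim_def by measurable
 fix a b :: real
 have "\<bar>prim g x\<bar> <= int_over (\<lambda>x. \<bar>g x\<bar>) 0 b" if "x <= b" for x
  unfolding prim_def using int_over_abs[OF g, of 0 x] int_over_subset[OF loc_int_abs[OF g], of 0 0 x b] that by simp
 then show "\<exists>M. \<forall>x\<in>{a<..b}. \<bar>prim g x\<bar> <= M" by (meson greaterThanAtMost_iff)
qed

lemma loc_int_mean: "loc_int g ==> 0 < s ==> loc_int (mean s g)"
proof (rule loc_int_bounded)
 assume g: "loc_int g" and s: "0 < s"
 then have [measurable]: "g \<in> borel_measurable borel" by (simp add: loc_int_def)
 show "mean s g \<in> borel_measurable borel" unfolding mean_def by measurable
 fix a b :: real
 have "\<bar>mean s g x\<bar> <= int_over (\<lambda>x. \<bar>g x\<bar>) a (b + s) / s" if "a < x" "x <= b" for x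
  unfolding mean_def abs_divide
  using int_over_abs[OF g, of x "x + s"] int_over_subset[OF loc_int_abs[OF g], of a x "x + s" "b + s"] that s
  by (simp add: divide_right_mono)
 then show "\<exists>M. \<forall>x\<in>{a<..b}. \<bar>mean s g x\<bar> <= M" by (meson greaterThanAtMost_iff)
qed

lemma loc_int_prim_pow: "loc_int g ==> loc_int ((prim ^^ k) g)"
 by (induction k) (auto intro: loc_int_prim)

lemma loc_int_mean_pow: "loc_int g ==> 0 < s ==> loc_int ((mean s ^^ k) g)"
 by (induction k) (auto intro: loc_int_mean)

lemma prim_cong: "(\<And>x. 0 <= x ==> g x = h x) ==> prim g = prim h"
 unfolding prim_def by (intro ext int_over_cong) auto

text \<open>A bound on the coefficients rather than \<open>degree p < k\<close>, so that
  \<open>k = 0\<close> is allowed and means the zero polynomial, the base of the inductions. The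
  restriction to \<open>x >= 0\<close> comes from \<open>prim\<close>, which vanishes on the
  negative axis.\<close>

definition poly_on :: "nat => (real => real) => bool" where
 "poly_on k h \<longleftrightarrow> (\<exists>p :: real poly. (\<forall>i\<ge>k. coeff p i = 0) \<and> (\<forall>x\<ge>0. h x = poly p x))"

lemma poly_onI: "(\<And>i. k <= i ==> coeff p i = 0) ==> (\<And>x. 0 <= x ==> h x = poly p x) ==> poly_on k h"
 unfolding poly_on_def by blast

lemma poly_onE:
 assumes "poly_on k h" obtains p where "\<And>i. k <= i ==> coeff p i = 0" "\<And>x. 0 <= x ==> h x = poly p x"
 using assms unfolding poly_on_def by blast

lemma poly_on_cong: "poly_on k h ==> (\<And>x. 0 <= x ==> g x = h x) ==> poly_on k g"
 unfolding poly_on_def by auto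

lemma poly_on_add: "poly_on k g ==> poly_on k h ==> poly_on k (\<lambda>x. g x + h x)"
 by (elim poly_onE, rule_tac p = "p + pa" in poly_onI) auto

lemma poly_on_cmult: "poly_on k g ==> poly_on k (\<lambda>x. c * g x)"
 by (elim poly_onE, rule_tac p = "smult c p" in poly_onI) auto

lemma poly_on_diff: "poly_on k g ==> poly_on k h ==> poly_on k (\<lambda>x. g x - h x)"
 by (elim poly_onE, rule_tac p = "p - pa" in poly_onI) auto

lemma poly_on_sum: "finite A ==> (\<And>i. i \<in> A ==> poly_on k (g i)) ==> poly_on k (\<lambda>x. \<Sum>i\<in>A. g i x)"
proof (induction A rule: finite_induct)
 case empty
 show ?case by (rule poly_onI[of _ 0]) auto
qed (simp add: poly_on_add)

lemma poly_on_zero: "poly_on k (\<lambda>_. 0)"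
 by (rule poly_onI[of _ 0]) auto

lemma poly_on_const: "poly_on (Suc k) (\<lambda>_. c)"
 by (rule poly_onI[of _ "[:c:]"]) (auto simp: coeff_pCons split: nat.split)

lemma poly_on_shift:
 assumes "poly_on k g" "0 <= s" shows "poly_on k (\<lambda>x. g (x + s))"
proof -
 from assms obtain p where p: "\<And>i. k <= i ==> coeff p i = 0" "\<And>x. 0 <= x ==> g x = poly p x" by (elim poly_onE) blast
 have d: "degree (p \<circ>\<^sub>p [:s, 1:]) = degree p" by (simp add: degree_pcompose)
 show ?thesis
 proof (rule poly_onI[of _ "p \<circ>\<^sub>p [:s, 1:]"])
  fix i assume i: "k <= i"
  show "coeff (p \<circ>\<^sub>p [:s, 1:]) i = 0"
  proof (cases "p = 0")
   case False
   have "degree p < i" using p(1) i False by (metis leading_coeff_0_iff le_trans not_le)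
   then show ?thesis using d by (intro coeff_eq_0) simp
  qed simp
 qed (use p assms in \<open>auto simp: poly_pcompose add.commute\<close>)
qed

lemma poly_antiderivative: "\<exists>q :: real poly. pderiv q = p \<and> coeff q 0 = 0 \<and> (\<forall>i. coeff q (Suc i) = coeff p i / real (Suc i))"
proof (induction p)
 case 0 show ?case by (intro exI[of _ 0]) auto
next
 case (pCons a p)
 define q where "q = (\<Sum>i\<le>degree (pCons a p). monom (coeff (pCons a p) i / real (Suc i)) (Suc i))"
 have c: "coeff q (Suc j) = coeff (pCons a p) j / real (Suc j)" for j
 proof -
  have "coeff q (Suc j) = (\<Sum>i\<le>degree (pCons a p). if i = j then coeff (pCons a p) i / real (Suc i) else 0)"
   unfolding q_def coeff_sum by (intro sum.cong) auto
  also have "... = coeff (pCons a p) j / real (Suc j)" using coeff_eq_0[of "pCons a p" j] by (auto simp: not_le)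
  finally show ?thesis .
 qed
 have "pderiv q = pCons a p" by (rule poly_eqI) (simp add: coeff_pderiv c)
 moreover have "coeff q 0 = 0" unfolding q_def coeff_sum by (intro sum.neutral) auto
 ultimately show ?case using c by blast
qed

lemma poly_on_prim:
 assumes "poly_on k h" shows "poly_on (Suc k) (prim h)"
proof -
 from assms obtain p where p: "\<And>i. k <= i ==> coeff p i = 0" "\<And>x. 0 <= x ==> h x = poly p x" by (elim poly_onE) blast
 obtain q where q: "pderiv q = p" "coeff q 0 = 0" "\<And>i. coeff q (Suc i) = coeff p i / real (Suc i)"
  using poly_antiderivative[of p] by auto
 show ?thesis
 proof (rule poly_onI[of _ q])
  fix i assume "Suc k <= i"
  then obtain j where "i = Suc j" "k <= j" by (cases i) auto
  then show "coeff q i = 0" using q p by simp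
 next
  fix x :: real assume x: "0 <= x"
  have "prim h x = prim (poly p) x" by (subst prim_cong[OF p(2)]) auto
  also have "... = (\<integral>u. indicator {0..x} u *\<^sub>R poly p u \<partial>lborel)"
  proof -
   have "AE u in lborel. u \<noteq> (0::real)" by (rule AE_lborel_singleton)
   then have "AE u in lborel. indicator {0<..x} u * poly p u = indicator {0..x} u *\<^sub>R poly p u"
    by eventually_elim (auto simp: indicator_def)
   moreover have [measurable]: "poly p \<in> borel_measurable borel"
    by (intro borel_measurable_continuous_onI continuous_intros)
   ultimately show ?thesis unfolding prim_def int_over_def
    by (intro integral_cong_AE) measurable
  qed
  also have "... = poly q x - poly q 0"
   by (rule integral_FTC_atLeastAtMost[OF x])
     (auto intro!: continuous_intros poly_DERIV[THEN DERIV_subset, unfolded has_real_derivative_iff_has_vector_derivative] simp: q(1)[symmetric] has_real_derivative_iff_has_vector_derivative[symmetric])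
  also have "... = poly q x" using q(2) by (simp add: poly_0_coeff_0)
  finally show "prim h x = poly q x" .
 qed
qed

definition fdiff1 :: "real => (real => real) => real => real" where
 "fdiff1 s g x = g (x + s) - g x"

lemma loc_int_fdiff1: "loc_int g ==> loc_int (fdiff1 s g)"
 unfolding fdiff1_def[abs_def] by (intro loc_int_diff loc_int_shift)

lemma loc_int_fdiff1_pow: "loc_int g ==> loc_int ((fdiff1 s ^^ k) g)"
 by (induction k) (auto intro: loc_int_fdiff1)

lemma fdiff1_prim:
 assumes "loc_int g" "0 <= s" "0 <= x"
 shows "fdiff1 s (prim g) x = int_over g x (x + s)"
  "fdiff1 s (prim g) x = prim (fdiff1 s g) x + prim g s"
proof -
 show 1: "fdiff1 s (prim g) x = int_over g x (x + s)"
  unfolding fdiff1_def prim_def using int_over_split[of g 0 x "x + s"] assms by simp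
 have "prim (fdiff1 s g) x = int_over g s (x + s) - int_over g 0 x"
  unfolding prim_def fdiff1_def[abs_def] using assms
  by (simp add: int_over_diff loc_int_shift int_over_shift)
 moreover have "int_over g 0 (x + s) = int_over g 0 s + int_over g s (x + s)"
  by (rule int_over_split) (use assms in auto)
 moreover have "int_over g 0 (x + s) = int_over g 0 x + int_over g x (x + s)"
  by (rule int_over_split) (use assms in auto)
 ultimately show "fdiff1 s (prim g) x = prim (fdiff1 s g) x + prim g s" unfolding 1 by (simp add: prim_def)
qed

lemma poly_on_loc_int_prim_diff:
 assumes "loc_int g" "loc_int h" "poly_on k (\<lambda>x. g x - h x)"
 shows "poly_on (Suc k) (\<lambda>x. prim g x - prim h x)"
proof -
 have "poly_on (Suc k) (prim (\<lambda>x. g x - h x))" by (rule poly_on_prim) fact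
 then show ?thesis by (rule poly_on_cong) (simp add: prim_def int_over_diff assms)
qed

text \<open>One primitive commutes with the difference up to a constant; every further primitive
  raises the degree of the discrepancy by one.\<close>

lemma fdiff1_prim_pow:
 assumes g: "loc_int g" and s: "0 < s"
 shows "poly_on k (\<lambda>x. fdiff1 s ((prim ^^ k) g) x - (prim ^^ k) (fdiff1 s g) x)"
proof (induction k)
 case 0 show ?case by (simp add: poly_on_zero)
next
 case (Suc k)
 let ?G = "(prim ^^ k) g"
 have "poly_on (Suc k) (\<lambda>x. (prim (fdiff1 s ?G) x - prim ((prim ^^ k) (fdiff1 s g)) x) + prim ?G s)"
  by (intro poly_on_add poly_on_const poly_on_loc_int_prim_diff Suc loc_int_fdiff1 loc_int_prim_pow g)
 then show ?case
  by (rule poly_on_cong) (use s in \<open>simp add: fdiff1_prim(2)[OF loc_int_prim_pow[OF g]]\<close>)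
qed

lemma mean_eq_fdiff1_prim: "loc_int g ==> 0 < s ==> 0 <= x ==> mean s g x = fdiff1 s (prim g) x / s"
 by (simp add: mean_def fdiff1_prim(1))

text \<open>A Steklov mean is a divided difference of a primitive. Moving all differences inside all
  primitives leaves a polynomial error, so an iterated mean of \<open>f\<close> is a polynomial plus
  iterated primitives of its differences.\<close>

lemma mean_pow_prim_pow:
 assumes f: "loc_int f" and s: "0 < s"
 shows "poly_on k (\<lambda>x. (mean s ^^ k) f x - (prim ^^ k) ((fdiff1 s ^^ k) f) x / s ^ k)"
proof (induction k)
 case 0 show ?case by (simp add: poly_on_zero)
next
 case (Suc k)
 let ?G = "(fdiff1 s ^^ k) f"
 let ?q = "\<lambda>x. (mean s ^^ k) f x - (prim ^^ k) ?G x / s ^ k"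
 have G: "loc_int ?G" by (rule loc_int_fdiff1_pow[OF f])
 note li = loc_int_mean_pow[OF f s, of k] loc_int_prim_pow[OF G, of k]
 have q: "poly_on (Suc k) (\<lambda>x. (prim ?q (x + s) - prim ?q x) * (1 / s))"
  using poly_on_prim[OF Suc] s by (subst mult.commute) (intro poly_on_cmult poly_on_diff poly_on_shift, auto)
 have h: "poly_on (Suc k) (\<lambda>x. 1 / s ^ Suc k * (fdiff1 s ((prim ^^ Suc k) ?G) x - (prim ^^ Suc k) (fdiff1 s ?G) x))"
  by (intro poly_on_cmult fdiff1_prim_pow G s)
 have "poly_on (Suc k) (\<lambda>x. (prim ?q (x + s) - prim ?q x) * (1 / s) + 1 / s ^ Suc k * (fdiff1 s ((prim ^^ Suc k) ?G) x - (prim ^^ Suc k) (fdiff1 s ?G) x))"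
  by (intro poly_on_add q h)
 then show ?case
 proof (rule poly_on_cong)
  fix x :: real assume x: "0 <= x"
  have pq: "prim ?q y = prim ((mean s ^^ k) f) y - prim ((prim ^^ k) ?G) y / s ^ k" for y
   using int_over_diff[OF li(1) loc_int_cmult[OF li(2), of "1 / s ^ k"], of 0 y]
    int_over_cmult[of "1 / s ^ k" "(prim ^^ k) ?G" 0 y] unfolding prim_def by simp
  have m: "(mean s ^^ Suc k) f x = (prim ((mean s ^^ k) f) (x + s) - prim ((mean s ^^ k) f) x) / s"
   using mean_eq_fdiff1_prim[OF li(1) s x] by (simp add: fdiff1_def)
  show "(mean s ^^ Suc k) f x - (prim ^^ Suc k) ((fdiff1 s ^^ Suc k) f) x / s ^ Suc k =
    (prim ?q (x + s) - prim ?q x) * (1 / s) + 1 / s ^ Suc k * (fdiff1 s ((prim ^^ Suc k) ?G) x - (prim ^^ Suc k) (fdiff1 s ?G) x)"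
   unfolding m pq using s by (simp add: fdiff1_def field_simps)
 qed
qed

lemma prim_pow_bound:
 assumes g: "loc_int g" and x: "0 <= x" "x <= l"
 shows "\<bar>(prim ^^ Suc k) g x\<bar> <= l ^ k * int_over (\<lambda>x. \<bar>g x\<bar>) 0 l"
 using x
proof (induction k arbitrary: x)
 case 0
 then show ?case
  using int_over_abs[OF g, of 0 x] int_over_subset[OF loc_int_abs[OF g], of 0 0 x l] by (simp add: prim_def)
next
 case (Suc k)
 let ?M = "int_over (\<lambda>x. \<bar>g x\<bar>) 0 l"
 have M: "0 <= ?M" by (rule int_over_nonneg) auto
 have "\<bar>(prim ^^ Suc (Suc k)) g x\<bar> = \<bar>int_over ((prim ^^ Suc k) g) 0 x\<bar>" by (simp add: prim_def)
 also have "... <= (x - 0) * (l ^ k * ?M)"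
  by (rule int_over_abs_bound[OF loc_int_prim_pow[OF g]]) (use Suc in auto)
 also have "... <= l * (l ^ k * ?M)" using Suc.prems M by (intro mult_mono) auto
 finally show ?case by simp
qed

lemma mean_pow_Suc: "(mean s ^^ Suc k) g v = int_over ((mean s ^^ k) g) v (v + s) / s"
 by (simp only: funpow.simps comp_apply) (subst mean_def, rule refl)

text \<open>Only the innermost mean turns an integral into a pointwise bound; the others average
  that bound. Each mean looks ahead by \<open>s\<close>, which explains the range of
  \<open>v\<close>.\<close>

lemma mean_pow_bound:
 assumes g: "loc_int g" and s: "0 < s" and k: "1 <= k" "k <= r" and v: "0 <= v" "v <= real (r - k) * s"
 shows "\<bar>(mean s ^^ k) g v\<bar> <= int_over (\<lambda>x. \<bar>g x\<bar>) 0 (real r * s) / s"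
 using k v
proof (induction k arbitrary: v rule: nat_induct_at_least)
 case base
 have "v + s <= real r * s" using base s by (simp add: of_nat_diff algebra_simps)
 then have "\<bar>int_over g v (v + s)\<bar> <= int_over (\<lambda>x. \<bar>g x\<bar>) 0 (real r * s)"
  using int_over_abs[OF g, of v "v + s"] int_over_subset[OF loc_int_abs[OF g], of 0 v "v + s" "real r * s"] base by simp
 then show ?case using s by (simp add: mean_def divide_right_mono)
next
 case (Suc k)
 let ?M = "int_over (\<lambda>x. \<bar>g x\<bar>) 0 (real r * s)"
 have "\<bar>int_over ((mean s ^^ k) g) v (v + s)\<bar> <= (v + s - v) * (?M / s)"
 proof (rule int_over_abs_bound[OF loc_int_mean_pow[OF g s]])
  fix u assume u: "v < u" "u <= v + s"
  have "v + s <= real (r - k) * s" using Suc.prems s by (simp add: of_nat_diff algebra_simps)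
  then show "\<bar>(mean s ^^ k) g u\<bar> <= ?M / s" using u Suc.prems by (intro Suc.IH) auto
 qed (use s in auto)
 then show ?case using s unfolding mean_pow_Suc by (simp add: divide_right_mono)
qed

text \<open>On the left the mean is taken over the step, on the right over the position: this is how
  averaging a difference over its step produces Steklov means of \<open>f\<close>.\<close>

lemma mean_pow_scale:
 assumes f: "loc_int f" and s: "0 < s" and c: "0 < c"
 shows "(mean s ^^ k) (\<lambda>v. f (x + c * v)) v = (mean (c * s) ^^ k) f (x + c * v)"
proof (induction k arbitrary: v)
 case (Suc k)
 have "(mean s ^^ k) (\<lambda>v. f (x + c * v)) = (\<lambda>v. (mean (c * s) ^^ k) f (x + c * v))" using Suc by auto
 then have "(mean s ^^ Suc k) (\<lambda>v. f (x + c * v)) v = int_over (\<lambda>v. (mean (c * s) ^^ k) f (x + c * v)) v (v + s) / s"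
  unfolding mean_pow_Suc by simp
 also have "... = int_over ((mean (c * s) ^^ k) f) (x + c * v) (x + c * v + c * s) / c / s"
  using s c by (subst loc_int_affine(2)) (auto intro!: loc_int_mean_pow f simp: algebra_simps)
 finally show ?case unfolding mean_pow_Suc using s c by (simp add: field_simps)
qed simp

lemma mean_pow_sum:
 assumes "finite A" "\<And>i. i \<in> A ==> loc_int (g i)" "0 < s"
 shows "(mean s ^^ k) (\<lambda>x. \<Sum>i\<in>A. c i * g i x) v = (\<Sum>i\<in>A. c i * (mean s ^^ k) (g i) v)"
proof (induction k arbitrary: v)
 case (Suc k)
 have eq: "(mean s ^^ k) (\<lambda>x. \<Sum>i\<in>A. c i * g i x) = (\<lambda>v. \<Sum>i\<in>A. c i * (mean s ^^ k) (g i) v)" using Suc by auto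
 show ?case
  by (simp add: mean_pow_Suc eq del: funpow.simps) (simp add: int_over_sum assms int_over_cmult loc_int_cmult loc_int_mean_pow sum_divide_distrib)
qed simp

lemma mean_pow_const: "0 < s ==> (mean s ^^ k) (\<lambda>_. c) = (\<lambda>_. c)"
 by (induction k) (auto simp: mean_def int_over_const)

definition fdiff :: "nat => real => (real => real) => real => real" where
 "fdiff r h f x = (\<Sum>i=0..r. real (r choose i) * (-1) ^ (r - i) * f (x + real i * h))"

lemma fdiff_Suc: "fdiff (Suc r) h f x = fdiff r h f (x + h) - fdiff r h f x"
proof -
 let ?a = "\<lambda>a. \<Sum>i=0..r. real (r choose Suc i) * (-1) ^ (r - i) * a (Suc i)"
 let ?b = "\<lambda>a. \<Sum>i=0..r. real (r choose i) * (-1) ^ (r - i) * a (Suc i)"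
 let ?c = "\<lambda>a. \<Sum>i=0..r. real (r choose i) * (-1) ^ (r - i) * a i"
 let ?d = "\<lambda>a. \<Sum>i=0..r. real (Suc r choose Suc i) * (-1) ^ (r - i) * a (Suc i)"
 let ?e = "\<lambda>a. \<Sum>i=0..Suc r. real (Suc r choose i) * (-1) ^ (Suc r - i) * a i"
 let ?f = "\<lambda>a. \<Sum>i=0..Suc r. real (r choose i) * (-1) ^ (Suc r - i) * a i"
 define a where "a = (\<lambda>i. f (x + real i * h))"
 have "fdiff r h f (x + h) = (?b a)"
  unfolding fdiff_def a_def by (intro sum.cong) (auto simp: algebra_simps)
 moreover have "(?e a) =
   (?b a) - (?c a)"
 proof -
  have "(?e a) =
    (-1) ^ Suc r * a 0 + (?d a)"
   by (subst sum.atLeast0_atMost_Suc_shift) (simp del: sum.cl_ivl_Suc)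
  also have "(?d a) =
    (?b a) + (?a a)"
   unfolding sum.distrib[symmetric] by (intro sum.cong) (auto simp: algebra_simps)
  also have "(?a a) =
    (-1) ^ r * a 0 - (?c a)"
  proof -
   have "(?f a) = (-1) ^ Suc r * a 0 + (?a a)"
    by (subst sum.atLeast0_atMost_Suc_shift) (simp del: sum.cl_ivl_Suc)
   moreover have "(?f a) = (\<Sum>i=0..r. real (r choose i) * (-1) ^ (Suc r - i) * a i)" by simp
   moreover have "... = - (?c a)"
    unfolding sum_negf[symmetric] by (intro sum.cong) (auto simp: Suc_diff_le)
   ultimately show ?thesis by simp
  qed
  finally show ?thesis by simp
 qed
 ultimately show ?thesis unfolding fdiff_def a_def by simp
qed

lemma fdiff_pow: "(fdiff1 h ^^ r) f = fdiff r h f"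
proof (induction r)
 case 0 show ?case by (simp add: fdiff_def)
next
 case (Suc r)
 then show ?case by (simp add: fun_eq_iff fdiff_Suc fdiff1_def)
qed

text \<open>The difference of \<open>f\<close> at \<open>x\<close>, as a function
  \<open>\<psi>\<close> of its step, is averaged \<open>r\<close> times. The term with
  \<open>i = 0\<close> gives \<open>f x\<close> up to sign, the others give Steklov means of
  \<open>f\<close> with steps \<open>i * s\<close>, and these are polynomials plus primitives of
  differences by \<open>mean_pow_prim_pow\<close>. Solving for \<open>f x\<close> shows
  \<open>T\<close>.\<close>

lemma whitney_left_aux:
 assumes f: "loc_int f" and r: "1 <= r" and s: "0 < s"
 shows "\<exists>T :: real poly. degree T < r \<and> (\<forall>x l. 0 <= x --> x <= l -->
  \<bar>f x - poly T x\<bar> <= int_over (\<lambda>v. \<bar>fdiff r v f x\<bar>) 0 (real r * s) / s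
   + (\<Sum>i=1..r. real (r choose i) * l ^ (r - 1) / (real i * s) ^ r * int_over (\<lambda>y. \<bar>fdiff r (real i * s) f y\<bar>) 0 l))"
proof -
 let ?a = "\<lambda>i. fdiff r (real i * s) f"
 let ?b = "\<lambda>i l. int_over (\<lambda>y. \<bar>fdiff r (real i * s) f y\<bar>) 0 l"
 let ?c = "\<lambda>i x. (prim ^^ r) (?a i) x / (real i * s) ^ r"
 let ?d = "\<lambda>x. int_over (\<lambda>v. \<bar>fdiff r v f x\<bar>) 0 (real r * s)"
 let ?e = "\<lambda>\<psi>. (mean s ^^ r) \<psi> 0"
 let ?f = "\<lambda>c x. \<Sum>i=1..r. c i * (mean (real i * s) ^^ r) f x"
 let ?g = "\<lambda>l. \<Sum>i=1..r. real (r choose i) * l ^ (r - 1) / (real i * s) ^ r * ?b i l"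
 let ?h = "\<lambda>x i. \<lambda>v. f (x + real i * v)"
 define c where "c i = real (r choose i) * (-1) ^ (r - i)" for i
 define q where "q i x = (mean (real i * s) ^^ r) f x - (prim ^^ r) (?a i) x / (real i * s) ^ r" for i x
 have q: "poly_on r (q i)" if "1 <= i" for i
  unfolding q_def fdiff_pow[symmetric] using that s by (intro mean_pow_prim_pow f) auto
 define Q where "Q x = (\<Sum>i=1..r. - ((-1) ^ r) * c i * q i x)" for x
 have "poly_on r Q" unfolding Q_def[abs_def]
  by (intro poly_on_sum poly_on_cmult q) auto
 then obtain T where T: "\<And>i. r <= i ==> coeff T i = 0" "\<And>x. 0 <= x ==> Q x = poly T x" by (elim poly_onE) blast
 show ?thesis
 proof (intro exI[of _ T] conjI allI impI)
  show "degree T < r"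
  proof (cases "T = 0")
   case False
   then show ?thesis using T(1)[of "degree T"] by (auto simp: not_le[symmetric])
  qed (use r in simp)
  fix x l :: real assume x: "0 <= x" "x <= l"
  define \<psi> where "\<psi> = (\<lambda>v. fdiff r v f x)"
  have lif: "loc_int (?h x i)" for i
   by (cases "i = 0") (use loc_int_affine(1)[OF f, of "real i" x] in \<open>auto intro: loc_int_const\<close>)
  have \<psi>: "\<psi> = (\<lambda>v. \<Sum>i=0..r. c i * f (x + real i * v))" unfolding \<psi>_def fdiff_def c_def ..
  have li\<psi>: "loc_int \<psi>" unfolding \<psi> by (intro loc_int_sum loc_int_cmult lif) auto
  have m: "?e \<psi> = (-1) ^ r * f x + (?f c x)"
  proof -
   have "?e \<psi> = (\<Sum>i=0..r. c i * ?e (?h x i))"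
    unfolding \<psi> by (rule mean_pow_sum) (use lif s in auto)
   also have "... = c 0 * ?e (?h x 0) + (\<Sum>i=1..r. c i * ?e (?h x i))"
    by (simp add: sum.atLeast_Suc_atMost)
   also have "... = (-1) ^ r * f x + (?f c x)"
    using s by (simp add: c_def mean_pow_const mean_pow_scale[OF f s])
   finally show ?thesis .
  qed
  have "f x - poly T x = (-1) ^ r * (?e \<psi> - (\<Sum>i=1..r. c i * (?c i x)))"
  proof -
   have "(?f c x) = (\<Sum>i=1..r. c i * q i x) + (\<Sum>i=1..r. c i * (?c i x))"
    unfolding sum.distrib[symmetric] q_def by (simp add: algebra_simps)
   moreover have "poly T x = - ((-1) ^ r) * (\<Sum>i=1..r. c i * q i x)"
    unfolding T(2)[OF x(1), symmetric] Q_def by (simp add: sum_distrib_left mult.assoc)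
   moreover have "(-1::real) ^ r * (-1) ^ r = 1" by (simp flip: power_mult_distrib)
   ultimately show ?thesis unfolding m by (simp add: ring_distribs flip: mult.assoc)
  qed
  then have "\<bar>f x - poly T x\<bar> = \<bar>?e \<psi> - (\<Sum>i=1..r. c i * (?c i x))\<bar>"
   by (simp add: abs_mult power_abs)
  also have "... <= \<bar>?e \<psi>\<bar> + (\<Sum>i=1..r. \<bar>c i * (?c i x)\<bar>)"
   by (rule order_trans[OF abs_triangle_ineq4]) (intro add_left_mono sum_abs)
  also have "... <= ?d x / s
   + (?g l)"
  proof (intro add_mono sum_mono)
   show "\<bar>?e \<psi>\<bar> <= ?d x / s"
    using mean_pow_bound[OF li\<psi> s, of r r 0] r unfolding \<psi>_def by simp
   fix i assume i: "i \<in> {1..r}"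
   have lif: "loc_int (?a i)" unfolding fdiff_pow[symmetric] by (rule loc_int_fdiff1_pow[OF f])
   have "\<bar>(prim ^^ r) (?a i) x\<bar> <= l ^ (r - 1) * ?b i l"
    using prim_pow_bound[OF lif x, of "r - 1"] r by simp
   then have "real (r choose i) / (real i * s) ^ r * \<bar>(prim ^^ r) (?a i) x\<bar> <= real (r choose i) / (real i * s) ^ r * (l ^ (r - 1) * ?b i l)"
    using s by (intro mult_left_mono) auto
   then show "\<bar>c i * (?c i x)\<bar> <= real (r choose i) * l ^ (r - 1) / (real i * s) ^ r * ?b i l"
    using s by (simp add: c_def abs_mult power_abs)
  qed
  finally show "\<bar>f x - poly T x\<bar> <= ?d x / s
   + (?g l)" .
 qed
qed

text \<open>Used to replace an arbitrary fixed step by one for which the integrated differences do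
  not exceed their average over all steps.\<close>

lemma nn_integral_below_mean:
 fixes F :: "real => ennreal"
 assumes [measurable]: "F \<in> borel_measurable borel" and ab: "a < b"
 shows "\<exists>s\<in>{a..b}. F s * ennreal (b - a) <= (\<integral>s\<in>{a..b}. F s)"
proof (rule ccontr)
 assume "\<not> ?thesis"
 then have less: "\<And>s. s \<in> {a..b} ==> (\<integral>s\<in>{a..b}. F s) < F s * ennreal (b - a)"
  by (auto simp: not_le)
 define I where "I = (\<integral>s\<in>{a..b}. F s)"
 define m where "m = I / ennreal (b - a)"
 have "I < F a * ennreal (b - a)" using less[of a] ab unfolding I_def by simp
 then have I: "I \<noteq> top" using less_top by fastforce
 have mI: "m * ennreal (b - a) = I" unfolding m_def using ab
  by (simp add: ennreal_divide_times ennreal_divide_self)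
 have mF: "m < F s" if "s \<in> {a..b}" for s
 proof (rule ccontr)
  assume "\<not> m < F s"
  then have "F s * ennreal (b - a) <= m * ennreal (b - a)" by (intro mult_right_mono) auto
  then show False using less[OF that] unfolding mI I_def by simp
 qed
 have int: "(\<integral>s\<in>{a..b}. m) = I" using ab by (simp add: nn_integral_cmult_indicator mI)
 have "(\<integral>s\<in>{a..b}. m) < (\<integral>s\<in>{a..b}. F s)"
 proof (rule nn_integral_less)
  show "(\<integral>s\<in>{a..b}. m) \<noteq> \<infinity>" using int I by simp
  show "AE s in lborel. m * indicator {a..b} s <= F s * indicator {a..b} s"
   using mF by (intro AE_I2) (auto simp: indicator_def intro: less_imp_le)
  show "\<not> (AE s in lborel. F s * indicator {a..b} s <= m * indicator {a..b} s)"
  proof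
   assume "AE s in lborel. F s * indicator {a..b} s <= m * indicator {a..b} s"
   then have "AE s in lborel. s \<notin> {a..b}"
    by eventually_elim (use mF in \<open>auto simp: indicator_def not_le[symmetric] split: if_splits\<close>)
   then have "emeasure lborel {a..b} = 0" by (subst (asm) AE_iff_measurable[of "{a..b}"]) auto
   then show False using ab by simp
  qed
 qed auto
 then show False using int unfolding I_def by simp
qed

lemma fdiff_shift: "fdiff r h (\<lambda>x. f (a + x)) x = fdiff r h f (a + x)"
 by (simp add: fdiff_def add.assoc)

lemma fdiff_reflect: "fdiff r h (\<lambda>x. f (- x)) x = (-1) ^ r * fdiff r h f (- x - real r * h)"
proof -
 have "fdiff r h (\<lambda>x. f (- x)) x = (\<Sum>i=0..r. real (r choose (r - i)) * (-1) ^ (r - (r - i)) * f (- (x + real (r - i) * h)))"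
  unfolding fdiff_def by (rule sum.reindex_bij_witness[of _ "\<lambda>i. r - i" "\<lambda>i. r - i"]) auto
 also have "... = (\<Sum>i=0..r. (-1) ^ r * (real (r choose i) * (-1) ^ (r - i) * f (- x - real r * h + real i * h)))"
 proof (rule sum.cong)
  fix i assume i: "i \<in> {0..r}"
  have "(-1::real) ^ r * (-1) ^ (r - i) = (-1) ^ i"
  proof -
   obtain j where "r = i + j" using i by (metis atLeastAtMost_iff le_add_diff_inverse)
   then show ?thesis by (simp add: power_add mult.assoc flip: power_mult_distrib)
  qed
  then have sg: "(-1::real) ^ r * (c * (-1) ^ (r - i) * y) = c * (-1) ^ i * y" for c y
   by (metis mult.assoc mult.commute)
  have nd: "- (x + real (r - i) * h) = - x - real r * h + real i * h"
   using i by (simp add: of_nat_diff algebra_simps)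
  have "r choose (r - i) = r choose i" "r - (r - i) = i" using i by (simp_all add: binomial_symmetric[symmetric])
  then show "real (r choose (r - i)) * (-1) ^ (r - (r - i)) * f (- (x + real (r - i) * h)) =
    (-1) ^ r * (real (r choose i) * (-1) ^ (r - i) * f (- x - real r * h + real i * h))"
   unfolding nd sg by simp
 qed simp
 finally show ?thesis by (simp add: fdiff_def sum_distrib_left)
qed

section \<open>Differences inside an interval as functions of a node and the step\<close>

lemma measurable_fdiff[measurable]:
 assumes [measurable]: "f \<in> borel_measurable borel" "g \<in> borel_measurable M" "h \<in> borel_measurable M"
 shows "(\<lambda>x. fdiff r (h x) f (g x)) \<in> borel_measurable M"
 unfolding fdiff_def by measurable

text \<open>Absolute differences with all nodes in \<open>[a, b]\<close>, as a function of the first node and the step.\<close>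

definition dpl :: "nat => (real => real) => real => real => real => real => ennreal" where
 "dpl r f a b y v = (if 0 < v \<and> a <= y \<and> y + real r * v <= b then ennreal \<bar>fdiff r v f y\<bar> else 0)"

lemma measurable_dpl[measurable]:
 assumes [measurable]: "f \<in> borel_measurable borel" "g \<in> borel_measurable M" "h \<in> borel_measurable M"
 shows "(\<lambda>x. dpl r f a b (g x) (h x)) \<in> borel_measurable M"
 unfolding dpl_def by measurable

definition fwd_diff :: "nat => (real => real) => real => real => real => ennreal" where
 "fwd_diff r f a b x = (\<integral>v. dpl r f a b x v)"

text \<open>Here \<open>x\<close> is the last node, so that this is the mirror image of
  \<open>fwd_diff\<close>. The two cover the points near the right and the left end of the
  interval.\<close>

definition bwd_diff :: "nat => (real => real) => real => real => real => ennreal" where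
 "bwd_diff r f a b x = (\<integral>v. dpl r f a b (x - real r * v) v)"

definition tot_diff :: "nat => (real => real) => real => real => ennreal" where
 "tot_diff r f a b = (\<integral>y. \<integral>v. dpl r f a b y v)"

lemma measurable_fwd_bwd[measurable]:
 assumes [measurable]: "f \<in> borel_measurable borel"
 shows "fwd_diff r f a b \<in> borel_measurable borel" "bwd_diff r f a b \<in> borel_measurable borel"
 unfolding fwd_diff_def[abs_def] bwd_diff_def[abs_def] by measurable

lemma nn_integral_fwd_diff: "(\<integral>x. fwd_diff r f a b x) = tot_diff r f a b"
 unfolding fwd_diff_def tot_diff_def ..

lemma lborel_swap:
 fixes h :: "real \<times> real => ennreal"
 assumes "h \<in> borel_measurable (borel \<Otimes>\<^sub>M borel)"
 shows "(\<integral>x. \<integral>y. h (x, y)) = (\<integral>y. \<integral>x. h (x, y))"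
 by (rule lborel_pair.Fubini') (use assms in \<open>simp add: case_prod_unfold lborel_prod borel_prod cong: measurable_cong_sets\<close>)

lemma nn_integral_lborel_shift:
 fixes h :: "real => ennreal"
 assumes "h \<in> borel_measurable borel"
 shows "(\<integral>x. h (x + c)) = (\<integral>x. h x)"
 using nn_integral_real_affine[of h 1 c] assms by (simp add: add.commute)

lemma nn_integral_lborel_reflect:
 fixes h :: "real => ennreal"
 assumes "h \<in> borel_measurable borel"
 shows "(\<integral>x. h (c - x)) = (\<integral>x. h x)"
 using nn_integral_real_affine[of h "-1" c] assms by simp

lemma nn_integral_bwd_diff:
 assumes [measurable]: "f \<in> borel_measurable borel"
 shows "(\<integral>x. bwd_diff r f a b x) = tot_diff r f a b"
proof -
 have "(\<integral>x. bwd_diff r f a b x) = (\<integral>v. \<integral>x. dpl r f a b (x - real r * v) v)"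
  unfolding bwd_diff_def using lborel_swap[of "\<lambda>(x, v). dpl r f a b (x - real r * v) v"] by simp
 also have "... = (\<integral>v. \<integral>x. dpl r f a b x v)"
  using nn_integral_lborel_shift[of "\<lambda>x. dpl r f a b x v" "- real r * v" for v] by simp
 also have "... = tot_diff r f a b"
  unfolding tot_diff_def using lborel_swap[of "\<lambda>(x, v). dpl r f a b x v"] by simp
 finally show ?thesis .
qed

lemma dpl_reflect: "dpl r (\<lambda>x. f (- x)) (- b) (- a) y v = dpl r f a b (- y - real r * v) v"
 unfolding dpl_def fdiff_reflect by (auto simp: abs_mult power_abs)

lemma fwd_diff_reflect: "fwd_diff r (\<lambda>x. f (- x)) (- b) (- a) x = bwd_diff r f a b (- x)"
 unfolding fwd_diff_def bwd_diff_def dpl_reflect ..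

lemma tot_diff_reflect:
 assumes [measurable]: "f \<in> borel_measurable borel"
 shows "tot_diff r (\<lambda>x. f (- x)) (- b) (- a) = tot_diff r f a b"
proof -
 have "tot_diff r (\<lambda>x. f (- x)) (- b) (- a) = (\<integral>x. bwd_diff r f a b (0 - x))"
  unfolding tot_diff_def fwd_diff_def[symmetric] fwd_diff_reflect by simp
 also have "... = tot_diff r f a b"
  by (subst nn_integral_lborel_reflect) (simp_all add: nn_integral_bwd_diff)
 finally show ?thesis .
qed

text \<open>\<open>whitney_left_aux\<close> with a step \<open>s\<close> selected by averaging. Only
  the left two thirds are reached, since forward differences from \<open>x\<close> need room to the
  right.\<close>

lemma whitney_left:
 assumes r: "1 <= r"
 shows "\<exists>C>0. \<forall>f a b. f \<in> borel_measurable borel --> integrable lborel f --> a < b -->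
  (\<exists>T :: real poly. degree T < r \<and> (\<forall>x. a <= x --> x <= a + 2/3 * (b - a) -->
   ennreal \<bar>f x - poly T x\<bar> <= ennreal (C / (b - a)) * fwd_diff r f a b x + ennreal (C / (b - a)^2) * tot_diff r f a b))"
proof -
 let ?a = "\<lambda>l' s g. \<Sum>i=1..r. real (r choose i) * l' ^ (r - 1) / (real i * s) ^ r * int_over (\<lambda>y. \<bar>fdiff r (real i * s) g y\<bar>) 0 l'"
 let ?b = "\<lambda>g x s. int_over (\<lambda>v. \<bar>fdiff r v g x\<bar>) 0 (real r * s)"
 let ?c = "\<lambda>l' i s g. \<integral>y\<in>{0<..l'}. ennreal \<bar>fdiff r (real i * s) g y\<bar>"
 let ?d = "\<lambda>i s g l'. int_over (\<lambda>y. \<bar>fdiff r (real i * s) g y\<bar>) 0 l'"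
 let ?e = "\<lambda>f a b. tot_diff r f a b"
 let ?f = "6 * (real r)^2"
 let ?g = "6 * real r ^ 3"
 define C where "C = 6 * (real r)^2 + 2 ^ r * ?f ^ r * ?g"
 have rr: "0 < real r" "1 <= real r" using r by auto
 have C: "0 < C" unfolding C_def using rr by (intro add_pos_nonneg) auto
 show ?thesis
 proof (intro exI[of _ C] conjI C allI impI)
  fix f :: "real => real" and a b :: real
  assume fm[measurable]: "f \<in> borel_measurable borel" and fi: "integrable lborel f" and ab: "a < b"
  define l where "l = b - a"
  have l: "0 < l" unfolding l_def using ab by simp
  \<comment> \<open>A step is at most \<open>r * s0\<close> and a difference spans \<open>r\<close>
    steps; with this choice the span is at most \<open>l / 3\<close>, the part of the interval
    beyond the range of \<open>x\<close>.\<close>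
  define s0 where "s0 = l / (3 * (real r)^2)"
  have s0: "0 < s0" unfolding s0_def using l rr by simp
  define l' where "l' = 2/3 * l"
  have l': "0 < l'" "l' <= l" unfolding l'_def using l by auto
  have rs0: "real r * (real r * s0) = l / 3" unfolding s0_def using rr by (simp add: power2_eq_square)
  define g where "g = (\<lambda>x. f (a + x))"
  have gli: "loc_int g" unfolding g_def using loc_int_affine(1)[OF loc_int_integrable_lborel[OF fm fi], of 1 a] by simp
  have gf: "fdiff r v g y = fdiff r v f (a + y)" for v y unfolding g_def by (rule fdiff_shift)
  have [measurable]: "g \<in> borel_measurable borel" unfolding g_def by measurable
  define \<Phi> where "\<Phi> s = (\<Sum>i=1..r. \<integral>y\<in>{0<..l'}. ennreal \<bar>fdiff r (real i * s) g y\<bar>)" for s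
  have \<Phi>m: "\<Phi> \<in> borel_measurable borel" unfolding \<Phi>_def[abs_def] by measurable
  have in_dpl: "ennreal \<bar>fdiff r v f y\<bar> <= dpl r f a b y v" if "0 < v" "v <= real r * s0" "a <= y" "y <= a + l'" for v y
  proof -
   have "real r * v <= real r * (real r * s0)" using that by (intro mult_left_mono) auto
   then have "real r * v <= l / 3" using rs0 by simp
   moreover have "l + a = b" unfolding l_def by simp
   ultimately have "y + real r * v <= b" using that unfolding l'_def by linarith
   then show ?thesis using that unfolding dpl_def by simp
  qed
  have \<Phi>int: "(\<integral>s\<in>{s0/2..s0}. \<Phi> s) <= ennreal (real r) * ?e f a b"
  proof -
   have "(\<integral>s\<in>{s0/2..s0}. \<Phi> s) = (\<integral>s. (\<Sum>i=1..r. (?c l' i s g) * indicator {s0/2..s0} s))"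
    unfolding \<Phi>_def sum_distrib_right ..
   also have "... = (\<Sum>i=1..r. \<integral>s. (?c l' i s g) * indicator {s0/2..s0} s)"
    by (rule nn_integral_sum) measurable
   also have "... <= (\<Sum>i=1..r. ?e f a b)"
   proof (rule sum_mono)
    fix i assume i: "i \<in> {1..r}"
    have "(\<integral>s. (?c l' i s g) * indicator {s0/2..s0} s)
      <= (\<integral>s. \<integral>y. dpl r f a b (y + a) (real i * s))"
    proof (rule nn_integral_mono)
     fix s :: real
     show "(?c l' i s g) * indicator {s0/2..s0} s <= (\<integral>y. dpl r f a b (y + a) (real i * s))"
     proof (cases "s \<in> {s0/2..s0}")
      case True
      have isr: "0 < real i * s" "real i * s <= real r * s0" using True i s0 by (auto intro!: mult_mono mult_pos_pos)
      have "ennreal \<bar>fdiff r (real i * s) g y\<bar> * indicator {0<..l'} y <= dpl r f a b (y + a) (real i * s)" for y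
       using in_dpl[OF isr, of "y + a"] by (auto simp: gf add.commute indicator_def)
      then show ?thesis using True by (auto intro!: nn_integral_mono)
     qed simp
    qed
    also have "... = (\<integral>s. \<integral>y. dpl r f a b y (real i * s))"
     by (intro nn_integral_cong nn_integral_lborel_shift) measurable
    also have "... <= ennreal (real i) * (\<integral>s. \<integral>y. dpl r f a b y (real i * s))"
    proof -
     have "1 <= ennreal (real i)" using i by (simp flip: ennreal_1)
     then show ?thesis by (metis mult_right_mono mult_1 zero_le)
    qed
    also have "... = (\<integral>v. \<integral>y. dpl r f a b y v)"
     using nn_integral_real_affine[of "\<lambda>v. \<integral>y. dpl r f a b y v" "real i" 0] i by simp
    also have "... = ?e f a b"
     unfolding tot_diff_def using lborel_swap[of "\<lambda>(y, v). dpl r f a b y v"] by simp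
    finally show "(\<integral>s. (?c l' i s g) * indicator {s0/2..s0} s) <= ?e f a b" .
   qed
   also have "... = ennreal (real r) * ?e f a b" by (simp add: ennreal_of_nat_eq_real_of_nat)
   finally show ?thesis .
  qed
  \<comment> \<open>The interval \<open>[s0 / 2, s0]\<close> keeps \<open>1 / s\<close> of the order
    \<open>1 / l\<close> while the choice of \<open>s\<close> is made.\<close>
  obtain s where s: "s \<in> {s0/2..s0}" "\<Phi> s * ennreal (s0 - s0/2) <= (\<integral>s\<in>{s0/2..s0}. \<Phi> s)"
   using nn_integral_below_mean[OF \<Phi>m, of "s0/2" s0] s0 by auto
  have sp: "0 < s" "s0 / 2 <= s" "s <= s0" using s s0 by auto
  have \<Phi>s: "\<Phi> s <= ennreal (6 * real r ^ 3 / l) * ?e f a b"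
  proof -
   have "\<Phi> s = \<Phi> s * ennreal (s0 - s0/2) * ennreal (2 / s0)"
    using s0 by (simp add: mult.assoc ennreal_mult[symmetric])
   also have "... <= ennreal (real r) * ?e f a b * ennreal (2 / s0)"
    using order_trans[OF s(2) \<Phi>int] by (intro mult_right_mono) auto
   also have "... = ennreal (real r * (2 / s0)) * ?e f a b"
    using s0 by (subst ennreal_mult) (auto simp: mult_ac)
   also have "real r * (2 / s0) = 6 * real r ^ 3 / l"
    unfolding s0_def using l rr by (simp add: power2_eq_square power3_eq_cube)
   finally show ?thesis .
  qed
  obtain T where T: "degree T < r" "\<And>x. 0 <= x ==> x <= l' ==>
    \<bar>g x - poly T x\<bar> <= ?b g x s / s
    + (?a l' s g)"
   using whitney_left_aux[OF gli r sp(1)] by blast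
  show "\<exists>T :: real poly. degree T < r \<and> (\<forall>x. a <= x --> x <= a + 2/3 * (b - a) -->
   ennreal \<bar>f x - poly T x\<bar> <= ennreal (C / (b - a)) * fwd_diff r f a b x + ennreal (C / (b - a)^2) * ?e f a b)"
  proof (intro exI[of _ "T \<circ>\<^sub>p [:- a, 1:]"] conjI allI impI)
   show "degree (T \<circ>\<^sub>p [:- a, 1:]) < r" using T(1) by (simp add: degree_pcompose)
   fix x assume x: "a <= x" "x <= a + 2/3 * (b - a)"
   define y where "y = x - a"
   have y: "0 <= y" "y <= l'" "a + y = x" using x unfolding y_def l'_def l_def by linarith+
   have lig: "loc_int (\<lambda>v. \<bar>fdiff r v g y\<bar>)"
   proof -
    have "loc_int (\<lambda>v. g (y + real i * v))" for i
     by (cases "i = 0") (use loc_int_affine(1)[OF gli, of "real i" y] in \<open>auto intro: loc_int_const\<close>)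
    then show ?thesis unfolding fdiff_def by (intro loc_int_abs loc_int_sum loc_int_cmult) auto
   qed
   have lig2: "loc_int (\<lambda>y. \<bar>fdiff r (real i * s) g y\<bar>)" for i
    unfolding fdiff_pow[symmetric] by (intro loc_int_abs loc_int_fdiff1_pow gli)
   have t1: "ennreal (?b g y s / s) <= ennreal (6 * (real r)^2 / l) * fwd_diff r f a b x"
   proof -
    have "ennreal (?b g y s) = (\<integral>v\<in>{0<..real r * s}. ennreal \<bar>fdiff r v g y\<bar>)"
     by (rule nn_integral_int_over[OF lig]) simp
    also have "... <= fwd_diff r f a b x" unfolding fwd_diff_def
    proof (rule nn_integral_mono)
     fix v
     have "real r * s <= real r * s0" using sp by (intro mult_left_mono) auto
     then show "ennreal \<bar>fdiff r v g y\<bar> * indicator {0<..real r * s} v <= dpl r f a b x v"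
      using in_dpl[of v x] y x by (auto simp: gf indicator_def)
    qed
    finally have 1: "ennreal (?b g y s) <= fwd_diff r f a b x" .
    have "1 / s <= 2 / s0" using sp s0 by (simp add: field_simps)
    also have "2 / s0 = 6 * (real r)^2 / l" unfolding s0_def by simp
    finally have 2: "1 / s <= 6 * (real r)^2 / l" .
    have nn: "0 <= ?b g y s" by (rule int_over_nonneg) simp
    have "ennreal (?b g y s / s) = ennreal (1 / s) * ennreal (?b g y s)"
     using nn sp by (simp add: ennreal_mult[symmetric])
    also have "... <= ennreal (6 * (real r)^2 / l) * fwd_diff r f a b x"
     using 1 2 by (intro mult_mono ennreal_leI) auto
    finally show ?thesis .
   qed
   have t2: "ennreal (?a l' s g)
     <= ennreal (2 ^ r * ?f ^ r * ?g / l^2) * ?e f a b"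
   proof -
    define c where "c = 2 ^ r * ?f ^ r / l"
    have c0: "0 <= c" unfolding c_def using l by simp
    have ci: "real (r choose i) * l' ^ (r - 1) / (real i * s) ^ r <= c" if i: "i \<in> {1..r}" for i
    proof -
     have "real (r choose i) <= 2 ^ r" using binomial_le_pow2[of r i] by (metis of_nat_le_iff of_nat_numeral of_nat_power)
     moreover have "l' ^ (r - 1) <= l ^ (r - 1)" using l' by (intro power_mono) auto
     moreover have "(s0 / 2) ^ r <= (real i * s) ^ r"
     proof (intro power_mono)
      have "1 * s <= real i * s" using i sp by (intro mult_right_mono) auto
      then show "s0 / 2 <= real i * s" using sp by linarith
     qed (use s0 in auto)
     ultimately have "real (r choose i) * l' ^ (r - 1) / (real i * s) ^ r <= 2 ^ r * l ^ (r - 1) / (s0 / 2) ^ r"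
      using s0 l l' by (intro frac_le mult_mono) auto
     also have "... = c"
     proof -
      have "s0 / 2 = l / ?f" unfolding s0_def by simp
      then have "(s0 / 2) ^ r = l * l ^ (r - 1) / ?f ^ r" using r
       by (simp add: power_divide power_eq_if[of l r])
      then show ?thesis unfolding c_def using l by simp
     qed
     finally show ?thesis .
    qed
    have "(?a l' s g)
      <= (\<Sum>i=1..r. c * ?d i s g l')"
     by (intro sum_mono mult_right_mono ci int_over_nonneg) auto
    then have "ennreal (?a l' s g)
      <= ennreal (\<Sum>i=1..r. c * ?d i s g l')" by (rule ennreal_leI)
    also have "... = (\<Sum>i=1..r. ennreal c * ennreal (?d i s g l'))"
     using c0 by (subst sum_ennreal[symmetric]) (auto intro!: sum.cong ennreal_mult int_over_nonneg mult_nonneg_nonneg)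
    also have "... = ennreal c * \<Phi> s"
     unfolding \<Phi>_def sum_distrib_left[symmetric] by (subst nn_integral_int_over[OF lig2]) auto
    also have "... <= ennreal c * (ennreal (6 * real r ^ 3 / l) * ?e f a b)"
     by (intro mult_left_mono \<Phi>s) auto
    also have "... = ennreal (c * (6 * real r ^ 3 / l)) * ?e f a b"
     using c0 l by (subst ennreal_mult) (auto simp: mult.assoc)
    also have "c * (6 * real r ^ 3 / l) = 2 ^ r * ?f ^ r * ?g / l^2"
     unfolding c_def by (simp add: power2_eq_square)
    finally show ?thesis .
   qed
   have "ennreal \<bar>f x - poly (T \<circ>\<^sub>p [:- a, 1:]) x\<bar> = ennreal \<bar>g y - poly T y\<bar>"
    unfolding g_def y(3) by (simp add: poly_pcompose y_def)
   also have "... <= ennreal (?b g y s / s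
    + (?a l' s g))"
    by (rule ennreal_leI, rule T(2)) (use y in auto)
   also have "... = ennreal (?b g y s / s)
    + ennreal (?a l' s g)"
    using sp l' by (intro ennreal_plus divide_nonneg_nonneg sum_nonneg mult_nonneg_nonneg int_over_nonneg) auto
   also have "... <= ennreal (6 * (real r)^2 / l) * fwd_diff r f a b x + ennreal (2 ^ r * ?f ^ r * ?g / l^2) * ?e f a b"
    by (rule add_mono[OF t1 t2])
   also have "... <= ennreal (C / l) * fwd_diff r f a b x + ennreal (C / l^2) * ?e f a b"
    using l by (intro add_mono mult_right_mono ennreal_leI divide_right_mono) (auto simp: C_def)
   finally show "ennreal \<bar>f x - poly (T \<circ>\<^sub>p [:- a, 1:]) x\<bar> <= ennreal (C / (b - a)) * fwd_diff r f a b x + ennreal (C / (b - a)^2) * ?e f a b"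
    unfolding l_def .
  qed
 qed
qed

text \<open>The left version and its reflection give polynomials \<open>T\<close> and
  \<open>S\<close>. Both are close to \<open>f\<close> in the mean on the middle third, so
  \<open>T - S\<close> is small there, and \<open>poly_growth\<close> makes it small on the whole
  interval; hence \<open>T\<close> serves on the right as well.\<close>

lemma whitney:
 assumes r: "1 <= r"
 shows "\<exists>C>0. \<forall>f a b. f \<in> borel_measurable borel --> integrable lborel f --> a < b -->
  (\<exists>T :: real poly. degree T < r \<and> (\<forall>x. a <= x --> x <= b -->
   ennreal \<bar>f x - poly T x\<bar> <= ennreal (C / (b - a)) * (fwd_diff r f a b x + bwd_diff r f a b x)
     + ennreal (C / (b - a)^2) * tot_diff r f a b))"
proof -
 let ?a = "\<lambda>C l. ennreal (C / l)"
 let ?b = "\<lambda>C l. ennreal (C / l^2)"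
 let ?c = "\<lambda>x u v. 2 * real r * (1 + cmod (of_real x - of_real u) / (v - u))"
 let ?d = "\<lambda>u v D. \<integral>x\<in>{u..v}. ennreal \<bar>poly D x\<bar>"
 let ?e = "\<lambda>C l. ennreal (2 * C / l^2)"
 let ?f = "\<lambda>G C l. ennreal (G * (4 * C) / l^2)"
 obtain C where C: "0 < C" and left: "\<And>f a b. f \<in> borel_measurable borel ==> integrable lborel f ==> a < b ==>
  (\<exists>T :: real poly. degree T < r \<and> (\<forall>x. a <= x --> x <= a + 2/3 * (b - a) -->
   ennreal \<bar>f x - poly T x\<bar> <= ?a C (b - a) * fwd_diff r f a b x + ?b C (b - a) * tot_diff r f a b))"
  using whitney_left[OF r] by metis
 define G where "G = real r * (8 * real r) ^ (r - 1) * (6 * real r)"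
 have G: "0 <= G" unfolding G_def by simp
 define C' where "C' = C + G * (4 * C)"
 have C': "C <= C'" "0 < C'" unfolding C'_def using C G by (auto intro: add_pos_nonneg)
 show ?thesis
 proof (intro exI[of _ C'] conjI C' allI impI)
  fix f :: "real => real" and a b :: real
  assume fm[measurable]: "f \<in> borel_measurable borel" and fi: "integrable lborel f" and ab: "a < b"
  define l where "l = b - a"
  have l: "0 < l" unfolding l_def using ab by simp
  let ?F = "fwd_diff r f a b" and ?B = "bwd_diff r f a b" and ?t = "tot_diff r f a b"
  obtain T where T: "degree T < r" "\<And>x. a <= x ==> x <= a + 2/3 * l ==>
    ennreal \<bar>f x - poly T x\<bar> <= ?a C l * ?F x + ?b C l * ?t"
   using left[OF fm fi ab] unfolding l_def by blast
  have "(\<lambda>x. f (- x)) \<in> borel_measurable borel" by measurable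
  moreover have "integrable lborel (\<lambda>x. f (- x))"
   using lborel_integrable_real_affine[OF fi, of "-1" 0] by simp
  ultimately obtain U where U: "degree U < r" "\<And>x. - b <= x ==> x <= - b + 2/3 * (- a - - b) ==>
    ennreal \<bar>f (- x) - poly U x\<bar> <= ?a C (- a - - b) * fwd_diff r (\<lambda>x. f (- x)) (- b) (- a) x + ?b C (- a - - b) * tot_diff r (\<lambda>x. f (- x)) (- b) (- a)"
   using left[of "\<lambda>x. f (- x)" "- b" "- a"] ab by auto
  define S where "S = U \<circ>\<^sub>p [:0, -1:]"
  have S: "degree S < r" unfolding S_def using U(1) by (simp add: degree_pcompose)
  have S2: "ennreal \<bar>f x - poly S x\<bar> <= ?a C l * ?B x + ?b C l * ?t" if "b - 2/3 * l <= x" "x <= b" for x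
   using U(2)[of "- x"] that unfolding fwd_diff_reflect tot_diff_reflect[OF fm] S_def l_def
   by (simp add: poly_pcompose)
  define D where "D = T - S"
  have D: "degree D < r" unfolding D_def using T(1) S by (metis degree_diff_less)
  \<comment> \<open>\<open>[u, v]\<close> is the middle third, the intersection of the ranges of the
    two one-sided estimates.\<close>
  define u where "u = a + l / 3"
  define v where "v = a + 2/3 * l"
  have uv: "u < v" "v - u = l / 3" "a <= u" "v <= b" "b - 2/3 * l = u" unfolding u_def v_def l_def using ab by (auto simp: field_simps)
  have Dint: "(?d u v D) <= ennreal (4 * C / l) * ?t"
  proof -
   have "(?d u v D)
     <= (\<integral>x. ?a C l * ?F x + ?a C l * ?B x + ?e C l * ?t * indicator {u..v} x)"
   proof (rule nn_integral_mono)
    fix x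
    show "ennreal \<bar>poly D x\<bar> * indicator {u..v} x <= ?a C l * ?F x + ?a C l * ?B x + ?e C l * ?t * indicator {u..v} x"
    proof (cases "x \<in> {u..v}")
     case True
     have "\<bar>poly D x\<bar> <= \<bar>f x - poly T x\<bar> + \<bar>f x - poly S x\<bar>" unfolding D_def by simp
     then have "ennreal \<bar>poly D x\<bar> <= ennreal \<bar>f x - poly T x\<bar> + ennreal \<bar>f x - poly S x\<bar>"
      by (simp flip: ennreal_plus)
     also have "... <= (?a C l * ?F x + ?b C l * ?t) + (?a C l * ?B x + ?b C l * ?t)"
      by (intro add_mono T(2) S2) (use True uv in \<open>auto simp: v_def\<close>)
     also have "... = ?a C l * ?F x + ?a C l * ?B x + (?b C l + ?b C l) * ?t"
      by (simp add: distrib_right add_ac)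
     also have "?b C l + ?b C l = ?e C l" using C by (simp flip: ennreal_plus)
     finally show ?thesis using True by simp
    qed simp
   qed
   also have "... = ?a C l * ?t + ?a C l * ?t + ?e C l * ?t * ?a l 3"
    unfolding uv(2)[symmetric] using uv(1) by (simp add: nn_integral_add nn_integral_cmult nn_integral_fwd_diff nn_integral_bwd_diff nn_integral_cmult_indicator)
   also have "... = (?a C l + ?a C l + ?e C l * ?a l 3) * ?t"
    by (simp only: distrib_right) (simp only: mult_ac)
   also have "?a C l + ?a C l + ?e C l * ?a l 3 = ennreal (C / l + C / l + 2 * C / l^2 * (l / 3))"
   proof -
    have p: "0 <= C / l" "0 <= 2 * C / l^2" "0 <= l / 3" "0 <= C / l + C / l" "0 <= 2 * C / l^2 * (l / 3)"
     using C l by auto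
    show ?thesis unfolding ennreal_plus[OF p(4,5)] ennreal_plus[OF p(1,1)] ennreal_mult[OF p(2,3)] ..
   qed
   also have "... * ?t <= ennreal (4 * C / l) * ?t"
    using C l by (intro mult_right_mono ennreal_leI) (auto simp: power2_eq_square field_simps)
   finally show ?thesis .
  qed
  have Dx: "ennreal \<bar>poly D x\<bar> <= ?f G C l * ?t" if x: "a <= x" "x <= b" for x
  proof -
   have cm: "cmod (of_real x - of_real u) <= l"
    using x uv unfolding of_real_diff[symmetric] norm_of_real l_def by auto
   have "ennreal \<bar>poly D x\<bar> = ennreal (cmod (poly (cpoly D) (of_real x)))" by (simp add: poly_cpoly_of_real)
   also have "... <= ennreal (real r * (?c x u v) ^ (r - 1) * (2 * real r / (v - u))) * (?d u v D)"
    by (rule poly_growth[OF D uv(1)])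
   also have "... <= ?a G l * (ennreal (4 * C / l) * ?t)"
   proof (intro mult_mono ennreal_leI Dint)
    have "cmod (of_real x - of_real u) / (v - u) <= 3"
     using cm l unfolding uv(2) by (simp add: field_simps)
    then have "real r * (?c x u v) ^ (r - 1) * (2 * real r / (v - u)) <= real r * (2 * real r * (1 + 3)) ^ (r - 1) * (2 * real r / (v - u))"
     using uv(1) by (intro mult_right_mono mult_left_mono power_mono) (simp_all add: add_nonneg_nonneg)
    then show "real r * (?c x u v) ^ (r - 1) * (2 * real r / (v - u)) <= G / l"
     unfolding uv(2) G_def by (simp add: mult_ac)
   qed auto
   also have "... = ?f G C l * ?t"
    using G C l by (simp add: mult.assoc[symmetric] ennreal_mult[symmetric] power2_eq_square)
   finally show ?thesis .
  qed
  show "\<exists>T :: real poly. degree T < r \<and> (\<forall>x. a <= x --> x <= b -->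
   ennreal \<bar>f x - poly T x\<bar> <= ?a C' (b - a) * (?F x + ?B x) + ?b C' (b - a) * ?t)"
   unfolding l_def[symmetric]
  proof (intro exI[of _ T] conjI T(1) allI impI)
   fix x assume x: "a <= x" "x <= b"
   have CC: "?a C l <= ?a C' l" "?b C l <= ?b C' l"
    using C' l by (auto intro!: ennreal_leI divide_right_mono)
   show "ennreal \<bar>f x - poly T x\<bar> <= ?a C' l * (?F x + ?B x) + ?b C' l * ?t"
   proof (cases "x <= v")
    case True
    have "ennreal \<bar>f x - poly T x\<bar> <= ?a C l * ?F x + ?b C l * ?t"
     using T(2)[of x] x True unfolding v_def by simp
    also have "... <= ?a C' l * (?F x + ?B x) + ?b C' l * ?t"
     using CC by (intro add_mono mult_mono) auto
    finally show ?thesis .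
   next
    case False
    have "\<bar>f x - poly T x\<bar> <= \<bar>f x - poly S x\<bar> + \<bar>poly D x\<bar>" unfolding D_def by simp
    then have "ennreal \<bar>f x - poly T x\<bar> <= ennreal \<bar>f x - poly S x\<bar> + ennreal \<bar>poly D x\<bar>"
     by (simp flip: ennreal_plus)
    also have "... <= (?a C l * ?B x + ?b C l * ?t) + ?f G C l * ?t"
     by (intro add_mono S2 Dx) (use x False uv in auto)
    also have "... = ?a C l * ?B x + (?b C l + ?f G C l) * ?t"
     by (simp add: distrib_right add_ac)
    also have "?b C l + ?f G C l = ?b C' l"
     unfolding C'_def using C G by (simp add: add_divide_distrib flip: ennreal_plus)
    also have "?a C l * ?B x + ?b C' l * ?t <= ?a C' l * (?F x + ?B x) + ?b C' l * ?t"
     using CC by (intro add_mono mult_mono) auto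
    finally show ?thesis .
   qed
  qed
 qed
qed

section \<open>Gluing local polynomials on the Chebyshev grid\<close>

definition grid :: "nat => nat => real" where
 "grid N j = real j * pi / real N"

text \<open>Index distance of two cells, raised by \<open>1\<close> so that negative powers are
  defined and at most \<open>1\<close>; all decay is expressed through it.\<close>

definition dd :: "nat => nat => real" where
 "dd i j = 1 + \<bar>real i - real j\<bar>"

lemma dd_ge_1: "1 <= dd i j" and dd_pos: "0 < dd i j"
 by (auto simp: dd_def)

lemma dd_Suc: "dd (Suc k) j <= 2 * dd k j"
proof -
 have "\<bar>1 + real k - real j\<bar> <= 1 + \<bar>real k - real j\<bar>"
  using abs_triangle_ineq[of 1 "real k - real j"] by (simp add: add_diff_eq)
 also have "... <= 1 + 2 * \<bar>real k - real j\<bar>" by simp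
 finally show ?thesis by (simp add: dd_def)
qed

lemma grid_mono: "i <= j ==> grid N i <= grid N j"
 by (simp add: grid_def divide_right_mono mult_right_mono)

lemma grid_0: "grid N 0 = 0" and grid_N: "0 < N ==> grid N N = pi"
 by (simp_all add: grid_def)

lemma grid_range: "j <= N ==> 0 <= grid N j \<and> grid N j <= pi"
 using grid_mono[of j N N] grid_N[of N] by (cases "N = 0") (auto simp: grid_def)

lemma cheb_node_grid: "cheb_node N j - grid N j = pi / (2 * real N)" "grid N (Suc j) - cheb_node N j = pi / (2 * real N)"
 by (simp_all add: cheb_node_def grid_def add_divide_distrib algebra_simps diff_divide_distrib[symmetric])

context
 fixes N :: nat assumes N: "0 < N"
begin

lemma pi_N: "3 / real N <= pi / real N" "pi / real N <= 4 / real N"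
 using pi_gt3 pi_less_4 N by (auto intro!: divide_right_mono)

lemma sin_node_lower: "j < N ==> 1 / (2 * real N) <= sin (cheb_node N j)"
proof -
 assume j: "j < N"
 define s where "s = cheb_node N j"
 have s1: "pi / (2 * real N) <= s" using cheb_node_grid(1)[of N j] grid_range[of j N] j unfolding s_def by simp
 have s2: "pi / (2 * real N) <= pi - s" using cheb_node_grid(2)[of N j] grid_range[of "Suc j" N] j unfolding s_def by simp
 have p: "1 / (2 * real N) <= pi / (2 * real N) / 2" using N pi_ge_two by (simp add: field_simps)
 have s0: "0 <= s" "0 <= pi - s" using cheb_node_range[OF j] unfolding s_def by auto
 show ?thesis
 proof (cases "s <= pi / 2")
  case True
  then show ?thesis using jordan[of s] s0 s1 p unfolding s_def by simp
 next
  case False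
  then have "(pi - s) / 2 <= sin (pi - s)" using s0 by (intro jordan) auto
  then show ?thesis using s2 p unfolding s_def by simp
 qed
qed

lemma sin_node_pos: "j < N ==> 0 < sin (cheb_node N j)"
proof -
 assume j: "j < N"
 have "0 < 1 / (2 * real N)" using N by simp
 then show ?thesis using sin_node_lower[OF j] by linarith
qed

lemma one_over_N_le: "j < N ==> 1 / real N <= 2 * sin (cheb_node N j)"
 using sin_node_lower[of j] by (simp add: field_simps)

lemma cell_length:
 assumes j: "j < N"
 shows "sin (cheb_node N j) / real N <= cos (grid N j) - cos (grid N (Suc j))"
  "cos (grid N j) - cos (grid N (Suc j)) <= 4 * sin (cheb_node N j) / real N"
proof -
 let ?a = "sin (cheb_node N j)"
 let ?b = "grid N (Suc j)"
 let ?c = "pi / (2 * real N)"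
 have "(grid N j + ?b) / 2 = cheb_node N j" "(?b - grid N j) / 2 = pi / (2 * real N)"
  using cheb_node_grid[of N j] by auto
 then have e: "cos (grid N j) - cos (?b) = 2 * ?a * sin ?c"
  by (simp only: cos_diff_cos)
 have l: "pi / (2 * real N) / 2 <= sin ?c" using N by (intro jordan) (auto simp: field_simps)
 have u: "sin ?c <= pi / (2 * real N)" by (intro sin_x_le_x) auto
 have s: "0 <= ?a" using sin_node_pos[OF j] by simp
 have "?a / real N <= 2 * ?a * (pi / (2 * real N) / 2)"
  using s N pi_ge_two mult_left_mono[of 2 pi "?a"] by (simp add: field_simps)
 also have "... <= 2 * ?a * sin ?c" using l s by (intro mult_left_mono) auto
 finally show "?a / real N <= cos (grid N j) - cos (?b)" unfolding e .
 have "2 * ?a * sin ?c <= 2 * ?a * ?c"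
  using u s by (intro mult_left_mono) auto
 also have "... <= 4 * ?a / real N"
  using s N pi_less_4 mult_left_mono[of pi 4 "?a"] by (simp add: field_simps)
 finally show "cos (grid N j) - cos (?b) <= 4 * ?a / real N" unfolding e .
qed

lemma node_distance:
 assumes "grid N j <= \<theta>" "\<theta> <= grid N (Suc j)"
 shows "\<bar>\<theta> - cheb_node N k\<bar> <= 4 * dd k j / real N" "\<bar>\<theta> - grid N (Suc k)\<bar> <= 4 * dd k j / real N"
  "pi / real N * (\<bar>real k - real j\<bar> - 1 / 2) <= \<bar>\<theta> - cheb_node N k\<bar>"
proof -
 define h where "h = pi / real N"
 have h: "0 <= h" "h <= 4 / real N" using pi_N(2) N unfolding h_def by auto
 have gj: "grid N j = real j * h" "grid N (Suc j) = real j * h + h" "grid N (Suc k) = real k * h + h"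
  "cheb_node N k = real k * h + h / 2" unfolding grid_def h_def cheb_node_def by (simp_all add: add_divide_distrib distrib_right)
 have kj: "\<bar>real j * h - real k * h\<bar> = \<bar>real k - real j\<bar> * h"
  using h by (simp add: left_diff_distrib[symmetric] abs_mult abs_minus_commute)
 have dh: "dd k j * h = h + \<bar>real k - real j\<bar> * h" unfolding dd_def by (simp add: distrib_right)
 have d4: "dd k j * h <= 4 * dd k j / real N" using mult_left_mono[OF h(2), of "dd k j"] dd_ge_1[of k j] by (simp add: mult.commute)
 show "\<bar>\<theta> - cheb_node N k\<bar> <= 4 * dd k j / real N" "\<bar>\<theta> - grid N (Suc k)\<bar> <= 4 * dd k j / real N"
  using assms kj dh d4 h unfolding gj by linarith+
 show "pi / real N * (\<bar>real k - real j\<bar> - 1 / 2) <= \<bar>\<theta> - cheb_node N k\<bar>"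
  unfolding h_def[symmetric] right_diff_distrib using assms kj h unfolding gj by (simp add: mult.commute)
qed

lemma sin_le_node:
 assumes j: "k < N" "grid N j <= \<theta>" "\<theta> <= grid N (Suc j)"
 shows "sin \<theta> <= 9 * dd k j * sin (cheb_node N k)"
proof -
 have "sin \<theta> <= sin (cheb_node N k) + 4 * dd k j / real N"
  using abs_sin_diff_le[of \<theta> "cheb_node N k"] node_distance(1)[OF j(2,3), of k] by linarith
 moreover have "4 * dd k j / real N <= 8 * dd k j * sin (cheb_node N k)"
  using mult_left_mono[OF one_over_N_le[OF j(1)], of "4 * dd k j"] dd_ge_1[of k j] by simp
 moreover have "sin (cheb_node N k) <= dd k j * sin (cheb_node N k)"
  using mult_right_mono[OF dd_ge_1, of "sin (cheb_node N k)" k j] sin_node_pos[OF j(1)] by simp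
 ultimately show ?thesis by (simp add: mult.assoc)
qed

text \<open>The distance from cell \<open>k\<close>, in units of the length of that cell, is at most
  quadratic in the index distance: lengths grow at most linearly away from the endpoints and there
  are \<open>dd k j\<close> of them. The square of \<open>M\<close> comes from \<open>rho n\<close>,
  a length on the coarser scale \<open>1 / n\<close>.\<close>

lemma scaled_distance:
 assumes k: "k < N" and j: "j < N" "grid N j <= \<theta>" "\<theta> <= grid N (Suc j)" and M: "N = M * n" "0 < M" "0 < n"
  and z: "cmod (z - of_real (cos \<theta>)) <= rho n (cos \<theta>) / 10"
 shows "cmod (z - of_real (cos (grid N (Suc k)))) / (cos (grid N k) - cos (grid N (Suc k))) <= 70 * (real M)^2 * (dd k j)^2"
proof -
 let ?a = "grid N (Suc k)"
 let ?b = "\<lambda>d. 9 * d * real M + 2 * (real M)^2"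
 let ?c = "of_real (cos (?a))"
 let ?d = "cos \<theta>"
 let ?e = "\<lambda>d. 70 * (real M)^2 * d^2"
 define \<sigma> where "\<sigma> = sin (cheb_node N k)"
 define d where "d = dd k j"
 have d1: "1 <= d" unfolding d_def by (rule dd_ge_1)
 have dd1: "d <= d^2" using d1 by (simp add: power2_eq_square)
 have \<sigma>: "0 < \<sigma>" "1 / real N <= 2 * \<sigma>" unfolding \<sigma>_def using sin_node_pos[OF k] one_over_N_le[OF k] by auto
 have M1: "1 <= real M" "real M <= (real M)^2" using M by (auto simp: power2_eq_square)
 have Nn: "1 / real n = real M * (1 / real N)" using M by simp
 have th: "0 <= \<theta>" "\<theta> <= pi" using j grid_range[of j N] grid_range[of "Suc j" N] by auto
 have gk: "0 <= ?a" "?a <= pi" using k grid_range[of "Suc k" N] by auto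
 have sg: "sin (?a) <= 9 * dd k k * \<sigma>" "0 <= sin (?a)"
  unfolding \<sigma>_def using k gk by (auto intro!: sin_le_node grid_mono sin_ge_zero)
 have "\<bar>cos \<theta> - cos (?a)\<bar> <= \<bar>\<theta> - ?a\<bar> * (\<bar>sin (?a)\<bar> + \<bar>\<theta> - ?a\<bar>)"
  by (rule abs_cos_diff_le)
 also have "... <= (4 * d / real N) * (9 * \<sigma> + 4 * d * (2 * \<sigma>))"
 proof (intro mult_mono add_mono)
  show "\<bar>\<theta> - ?a\<bar> <= 4 * d / real N" using node_distance(2)[OF j(2,3), of k] unfolding d_def .
  also have "... <= 4 * d * (2 * \<sigma>)" using mult_left_mono[OF \<sigma>(2), of "4 * d"] d1 by simp
  finally show "\<bar>\<theta> - ?a\<bar> <= 4 * d * (2 * \<sigma>)" .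
  show "\<bar>sin (?a)\<bar> <= 9 * \<sigma>" using sg by (simp add: dd_def)
 qed (use d1 in auto)
 also have "... = (36 * d + 32 * d^2) * (\<sigma> / real N)" by (simp add: power2_eq_square algebra_simps)
 finally have 1: "\<bar>cos \<theta> - cos (?a)\<bar> <= (36 * d + 32 * d^2) * (\<sigma> / real N)" .
 have "rho n ?d = (sin \<theta> + 1 / real n) * (1 / real n)"
  unfolding rho_cos[OF th] by (simp add: power2_eq_square distrib_right add_divide_distrib)
 also have "... <= (9 * d * \<sigma> + real M * (2 * \<sigma>)) * (real M * (1 / real N))"
  unfolding Nn d_def \<sigma>_def using sin_le_node[OF k j(2,3)] one_over_N_le[OF k]
  by (intro mult_right_mono add_mono mult_left_mono) auto
 also have "... = (?b d) * (\<sigma> / real N)" by (simp add: power2_eq_square algebra_simps)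
 finally have 2: "rho n ?d <= (?b d) * (\<sigma> / real N)" .
 have "cmod (z - ?c) <= cmod (z - of_real ?d) + cmod (of_real ?d - ?c)"
  by (metis diff_add_cancel add_diff_eq norm_triangle_ineq)
 also have "cmod (of_real ?d - ?c) = \<bar>cos \<theta> - cos (?a)\<bar>"
  by (metis norm_of_real of_real_diff)
 also have "cmod (z - of_real ?d) + \<bar>cos \<theta> - cos (?a)\<bar> <= (?b d) * (\<sigma> / real N) / 10 + (36 * d + 32 * d^2) * (\<sigma> / real N)"
  by (rule add_mono[OF order_trans[OF z divide_right_mono[OF 2]] 1]) simp
 also have "... = ((?b d) / 10 + (36 * d + 32 * d^2)) * (\<sigma> / real N)" by (simp add: algebra_simps)
 also have "... <= (?e d) * (\<sigma> / real N)"
 proof (rule mult_right_mono)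
  have a: "d * real M <= (real M)^2 * d^2" using M1 dd1 d1 by (subst mult.commute) (intro mult_mono, auto)
  have b: "(real M)^2 <= (real M)^2 * d^2" using d1 by (simp add: mult_le_cancel_left1)
  have c: "d^2 <= (real M)^2 * d^2" using M1 by (simp add: mult_le_cancel_right1)
  have "d <= (real M)^2 * d^2" using c dd1 by simp
  with a b c show "(?b d) / 10 + (36 * d + 32 * d^2) <= 70 * (real M)^2 * d^2"
  proof -
   have e: "9 * d * real M = 9 * (d * real M)" "70 * (real M)^2 * d^2 = 70 * ((real M)^2 * d^2)" by auto
   have "0 <= (real M)^2 * d^2" by simp
   have gen: "a1 <= X ==> a2 <= X ==> a3 <= X ==> a4 <= X ==> 0 <= X ==> (9 * a1 + 2 * a2) / 10 + (36 * a4 + 32 * a3) <= 70 * X"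
    for a1 a2 a3 a4 X :: real by argo
   show ?thesis unfolding e by (rule gen) (use a b c \<open>d <= (real M)^2 * d^2\<close> in auto)
  qed
 qed (use \<sigma> in auto)
 finally have 3: "cmod (z - ?c) <= (?e d) * (\<sigma> / real N)" .
 define I where "I = cos (grid N k) - cos (?a)"
 have I: "\<sigma> / real N <= I" unfolding I_def \<sigma>_def by (rule cell_length(1)[OF k])
 have "0 < \<sigma> / real N" using \<sigma> N by simp
 then have I0: "0 < I" using I by linarith
 have "(?e d) * (\<sigma> / real N) <= (?e d) * I" using I by (intro mult_left_mono) auto
 then have "cmod (z - ?c) <= (?e d) * I" using 3 by simp
 then show ?thesis unfolding I_def[symmetric] d_def[symmetric] using I0 by (simp add: divide_le_eq)
qed

text \<open>Turns decay in the angle into decay in the cell index; the factor \<open>M\<close>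
  relates the scale \<open>1 / n\<close> of the kernels to the scale \<open>1 / N\<close> of the
  cells.\<close>

lemma kernel_distance:
 assumes j: "grid N j <= \<theta>" "\<theta> <= grid N (Suc j)" and M: "N = M * n" "0 < M" "0 < n"
 shows "dd i j / (2 * real M) <= 1 + real n * \<bar>\<theta> - cheb_node N i\<bar>"
proof (cases "i = j")
 case True
 have "dd i j / (2 * real M) <= 1" using True M by (simp add: dd_def)
 then show ?thesis by (simp add: add_increasing2)
next
 case False
 define e where "e = \<bar>real i - real j\<bar>"
 have e1: "1 <= e" unfolding e_def using False by linarith
 have "real n * (pi / real N * (e - 1 / 2)) <= real n * \<bar>\<theta> - cheb_node N i\<bar>"
  unfolding e_def using node_distance(3)[OF j, of i] by (intro mult_left_mono) auto
 moreover have "real n * (pi / real N * (e - 1 / 2)) = pi * (e - 1 / 2) / real M"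
  using M by simp
 moreover have "(1 + e) / 2 <= pi * (e - 1 / 2)"
  using mult_right_mono[of 2 pi "e - 1/2"] pi_ge_two e1 by simp
 then have "(1 + e) / 2 / real M <= pi * (e - 1 / 2) / real M" by (intro divide_right_mono) auto
 ultimately show ?thesis unfolding dd_def e_def by simp
qed

end

lemma sum_inverse_squares: "(\<Sum>k<n. 1 / (1 + real k)^2) <= 2"
proof -
 have "(\<Sum>k<Suc n. 1 / (1 + real k)^2) <= 2 - 1 / (1 + real n)" for n
 proof (induction n)
  case (Suc n)
  have "1 / (1 + real (Suc n))^2 <= 1 / ((1 + real n) * (1 + real (Suc n)))"
   by (intro divide_left_mono) (auto simp: power2_eq_square intro!: mult_right_mono)
  also have "... = 1 / (1 + real n) - 1 / (1 + real (Suc n))" by (simp add: field_simps)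
  finally show ?case using Suc by simp
 qed simp
 moreover have "(\<Sum>k<n. 1 / (1 + real k)^2) <= (\<Sum>k<Suc n. 1 / (1 + real k)^2)" by simp
 moreover have "0 <= 1 / (1 + real n)" by simp
 ultimately show ?thesis by (meson diff_le_eq le_add_same_cancel1 order_trans)
qed

lemma sum_dd_squares: "(\<Sum>i<N. 1 / (dd i j)^2) <= 4"
proof -
 have "(\<Sum>i<N. 1 / (dd i j)^2) <= (\<Sum>i\<in>{..j} \<union> {j<..j+N}. 1 / (dd i j)^2)"
  by (intro sum_mono2) auto
 also have "... = (\<Sum>i\<in>{..j}. 1 / (dd i j)^2) + (\<Sum>i\<in>{j<..j+N}. 1 / (dd i j)^2)"
  by (intro sum.union_disjoint) auto
 also have "(\<Sum>i\<in>{..j}. 1 / (dd i j)^2) = (\<Sum>k<Suc j. 1 / (1 + real k)^2)"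
  by (rule sum.reindex_bij_witness[of _ "\<lambda>k. j - k" "\<lambda>i. j - i"]) (auto simp: dd_def of_nat_diff)
 also have "(\<Sum>i\<in>{j<..j+N}. 1 / (dd i j)^2) <= (\<Sum>k<Suc N. 1 / (1 + real k)^2)"
 proof -
  have "(\<Sum>i\<in>{j<..j+N}. 1 / (dd i j)^2) = (\<Sum>k\<in>{0<..N}. 1 / (1 + real k)^2)"
   by (rule sum.reindex_bij_witness[of _ "\<lambda>k. j + k" "\<lambda>i. i - j"]) (auto simp: dd_def of_nat_diff)
  also have "... <= (\<Sum>k<Suc N. 1 / (1 + real k)^2)" by (intro sum_mono2) auto
  finally show ?thesis .
 qed
 finally show ?thesis using sum_inverse_squares[of "Suc j"] sum_inverse_squares[of "Suc N"] by linarith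
qed

lemma sum_dd_le: "2 <= q ==> (\<Sum>i<N. 1 / dd i j ^ q) <= 4"
proof -
 assume q: "2 <= q"
 have "1 / dd i j ^ q <= 1 / (dd i j)^2" for i
  using q dd_ge_1[of i j] dd_pos[of i j] by (intro divide_left_mono power_increasing) auto
 then show ?thesis using sum_dd_squares[of j N] by (meson order_trans sum_mono)
qed

text \<open>Except for the last one, a cell consists of two adjacent grid pieces, so consecutive
  cells share a piece on which their local polynomials can be compared. The cosine decreases, so
  larger indices lie further left.\<close>

definition cell_lo :: "nat => nat => real" where "cell_lo N j = cos (grid N (min (j + 2) N))"
definition cell_hi :: "nat => nat => real" where "cell_hi N j = cos (grid N j)"
definition cell_len :: "nat => nat => real" where "cell_len N j = cell_hi N j - cell_lo N j"

lemma cell_bounds: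
 assumes N: "0 < N" and j: "j < N"
 shows "cell_lo N j <= cos (grid N (Suc j))" "cos (grid N (Suc j)) < cell_hi N j"
  "sin (cheb_node N j) / real N <= cell_len N j" "cell_len N j <= 40 * (sin (cheb_node N j) / real N)"
  "0 < cell_len N j"
  "Suc j < N ==> cell_lo N j = cos (grid N (j + 2))"
  "Suc j < N ==> cell_len N j <= 40 * (cos (grid N (Suc j)) - cos (grid N (j + 2)))"
proof -
 let ?a = "\<lambda>j. grid N (Suc j)"
 let ?b = "\<lambda>k. cos (grid N k)"
 let ?\<sigma> = "\<lambda>j. sin (cheb_node N j)"
 have mono: "?b k <= ?b i" if "i <= k" "k <= N" for i k
  using that grid_range[of i N] grid_range[of k N] grid_mono[of i k N] by (intro cos_monotone_0_pi_le) auto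
 show lo: "cell_lo N j <= cos (?a j)" unfolding cell_lo_def using j by (intro mono) auto
 have s: "0 < ?\<sigma> j / real N" using sin_node_pos[OF N j] N by simp
 have I: "?\<sigma> j / real N <= cell_hi N j - cos (?a j)" unfolding cell_hi_def by (rule cell_length(1)[OF N j])
 show "cos (?a j) < cell_hi N j" using I s by linarith
 show 1: "?\<sigma> j / real N <= cell_len N j" unfolding cell_len_def using I lo by linarith
 then show "0 < cell_len N j" using s by linarith
 have near: "?\<sigma> i <= 9 * ?\<sigma> k" if "i < N" "k < N" "i = Suc k \<or> k = Suc i" for i k
 proof -
  have "?\<sigma> i <= ?\<sigma> k + \<bar>cheb_node N i - cheb_node N k\<bar>" using abs_sin_diff_le[of "cheb_node N i" "cheb_node N k"] by linarith
  moreover have "\<bar>cheb_node N i - cheb_node N k\<bar> = pi / real N"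
   using that(3) N by (auto simp: cheb_node_def diff_divide_distrib[symmetric] algebra_simps add_divide_distrib)
  ultimately show ?thesis using pi_N(2)[OF N] one_over_N_le[OF N that(2)] by simp
 qed
 have len: "cell_len N j <= 4 * ?\<sigma> j / real N + (if Suc j < N then 4 * ?\<sigma> (Suc j) / real N else 0)"
 proof (cases "Suc j < N")
  case True
  then have "cell_len N j = (?b j - cos (?a j)) + (cos (?a j) - cos (?a (Suc j)))"
   by (simp add: cell_len_def cell_lo_def cell_hi_def min_def)
  then show ?thesis using True cell_length(2)[OF N j] cell_length(2)[OF N True] by simp
 next
  case False
  then have "Suc j = N" using j by simp
  then have "cell_len N j = ?b j - cos (?a j)"
   by (simp add: cell_len_def cell_lo_def cell_hi_def min_def)
  then show ?thesis using False cell_length(2)[OF N j] by simp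
 qed
 show "cell_len N j <= 40 * (?\<sigma> j / real N)"
 proof (cases "Suc j < N")
  case True
  have "?\<sigma> (Suc j) / real N <= 9 * ?\<sigma> j / real N" using near[OF True j] by (intro divide_right_mono) auto
  then show ?thesis using len True by simp
 qed (use len s in simp)
 assume S: "Suc j < N"
 then show "cell_lo N j = ?b (j + 2)" by (simp add: cell_lo_def min_def)
 have "?\<sigma> j / real N <= 9 * ?\<sigma> (Suc j) / real N" using near[OF j S] by (intro divide_right_mono) auto
 then have "cell_len N j <= 40 * (?\<sigma> (Suc j) / real N)" using len S by simp
 also have "... <= 40 * (cos (?a j) - ?b (j + 2))"
  using cell_length(1)[OF N S] by simp
 finally show "cell_len N j <= 40 * (cos (?a j) - ?b (j + 2))" .
qed

lemma pderiv_cpoly: "pderiv (cpoly p) = cpoly (pderiv p)"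
 by (rule poly_eqI) (simp add: coeff_pderiv coeff_map_poly)

lemma pderiv_pow_cpoly: "(pderiv ^^ k) (cpoly p) = cpoly ((pderiv ^^ k) p)"
 by (induction k) (simp_all add: pderiv_cpoly)

lemma deriv_pow_poly: "(deriv ^^ k) (poly p) = poly ((pderiv ^^ k) p)" for p :: "'a::real_normed_field poly"
proof (induction k)
 case (Suc k)
 have "deriv (poly q) = poly (pderiv q)" for q :: "'a poly"
  by (rule ext, rule DERIV_imp_deriv, rule poly_DERIV)
 then show ?case using Suc by simp
qed simp

lemma pderiv_pow_eq_0: "degree p < r ==> (pderiv ^^ r) p = 0" for p :: "real poly"
proof (induction r arbitrary: p)
 case (Suc r)
 show ?case
 proof (cases "r = 0")
  case True
  then show ?thesis using Suc.prems by (simp add: pderiv_eq_0_iff)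
 next
  case False
  then have "degree (pderiv p) < r" using Suc.prems by (simp add: degree_pderiv)
  then have "(pderiv ^^ r) (pderiv p) = 0" by (rule Suc.IH)
  then show ?thesis by (simp add: funpow_swap1)
 qed
qed simp

lemma pderiv_pow_diff: "(pderiv ^^ r) (p - q) = (pderiv ^^ r) p - (pderiv ^^ r) q" for p q :: "real poly"
 by (induction r) (simp_all add: pderiv_diff)

lemma poly_pderiv_pow_bound:
 assumes R: "0 < R" and B: "\<And>z. cmod (z - of_real x) <= R ==> cmod (poly (cpoly Q) z) <= B"
 shows "\<bar>poly ((pderiv ^^ k) Q) x\<bar> <= fact k * B / R ^ k"
proof -
 have "norm ((deriv ^^ k) (poly (cpoly Q)) (of_real x)) <= fact k * B / R ^ k"
 proof (rule Cauchy_inequality[OF _ _ R])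
  show "poly (cpoly Q) holomorphic_on ball (complex_of_real x) R" by (intro holomorphic_intros)
  show "continuous_on (cball (complex_of_real x) R) (poly (cpoly Q))" by (intro continuous_intros)
  show "norm (poly (cpoly Q) z) <= B" if "norm (complex_of_real x - z) = R" for z
   by (rule B) (use that in \<open>simp add: norm_minus_commute\<close>)
 qed
 then show ?thesis by (simp add: deriv_pow_poly pderiv_pow_cpoly poly_cpoly_of_real)
qed

text \<open>Integration turns both one-sided terms of the pointwise bound into
  \<open>tot_diff\<close>. The factor \<open>120\<close> is \<open>3 * 40\<close>: three terms, each
  with \<open>v - u <= b - a <= 40 * (v - u)\<close>.\<close>

lemma integral_whitney_error:
 assumes fm[measurable]: "f \<in> borel_measurable borel" and C: "0 < C" and l: "0 < b - a"
  and T: "\<And>x. a <= x ==> x <= b ==> ennreal \<bar>f x - poly T x\<bar> <= ennreal (C / (b - a)) * (fwd_diff r f a b x + bwd_diff r f a b x) + ennreal (C / (b - a)^2) * tot_diff r f a b"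
  and uv: "a <= u" "u < v" "v <= b" "b - a <= 40 * (v - u)"
 shows "(\<integral>x\<in>{u..v}. ennreal \<bar>f x - poly T x\<bar>) <= ennreal (120 * C * (v - u)) * (ennreal (1 / (b - a)^2) * tot_diff r f a b)"
proof -
 let ?a = "\<lambda>l. ennreal (C / l)"
 define l where "l = b - a"
 have l: "0 < l" "v - u <= l" "l <= 40 * (v - u)" using l uv unfolding l_def by auto
 let ?t = "tot_diff r f a b"
 have "(\<integral>x\<in>{u..v}. ennreal \<bar>f x - poly T x\<bar>)
   <= (\<integral>x. ?a l * (fwd_diff r f a b x + bwd_diff r f a b x) + ennreal (C / l^2) * ?t * indicator {u..v} x)"
  using T uv unfolding l_def by (intro nn_integral_mono) (auto simp: indicator_def)
 also have "... = ?a l * (?t + ?t) + ennreal (C / l^2) * ?t * ennreal (v - u)"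
  using uv by (simp add: nn_integral_add nn_integral_cmult nn_integral_fwd_diff nn_integral_bwd_diff nn_integral_cmult_indicator)
 also have "... = (?a l + ?a l + ennreal (C / l^2) * ennreal (v - u)) * ?t"
  by (simp only: distrib_right distrib_left) (simp only: mult_ac)
 also have "?a l + ?a l + ennreal (C / l^2) * ennreal (v - u) = ennreal (C / l + C / l + C / l^2 * (v - u))"
 proof -
  have p: "0 <= C / l" "0 <= C / l^2" "0 <= v - u" "0 <= C / l + C / l" "0 <= C / l^2 * (v - u)"
   using C l uv by auto
  show ?thesis unfolding ennreal_plus[OF p(4,5)] ennreal_plus[OF p(1,1)] ennreal_mult[OF p(2,3)] ..
 qed
 also have "ennreal (C / l + C / l + C / l^2 * (v - u)) <= ennreal (120 * C * (v - u) * (1 / l^2))"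
 proof (rule ennreal_leI)
  have "C / l + C / l + C / l^2 * (v - u) = C * (2 * l + (v - u)) * (1 / l^2)"
   using l by (simp add: power2_eq_square field_simps)
  also have "... <= C * (120 * (v - u)) * (1 / l^2)"
   using C l by (intro mult_right_mono mult_left_mono) auto
  finally show "C / l + C / l + C / l^2 * (v - u) <= 120 * C * (v - u) * (1 / l^2)" by (simp add: mult_ac)
 qed
 also have "ennreal (120 * C * (v - u) * (1 / l^2)) = ennreal (120 * C * (v - u)) * ennreal (1 / l^2)"
  by (rule ennreal_mult) (use C uv in auto)
 finally show ?thesis unfolding l_def by (simp add: mult.assoc mult_right_mono)
qed

text \<open>Admissible pairs of a node and a step fill an area of the order
  \<open>cell_len ^ 2\<close>, so up to a constant this is the mean size of the differences inside
  the cell.\<close>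

definition cell_eps :: "nat => (real => real) => nat => nat => ennreal" where
 "cell_eps r f N k = ennreal (1 / (cell_len N k)^2) * tot_diff r f (cell_lo N k) (cell_hi N k)"

lemma sum_telescope_abs:
 fixes g :: "nat => complex"
 shows "cmod (g i - g j) <= (\<Sum>k\<in>{min i j..<max i j}. cmod (g (Suc k) - g k))"
proof -
 have *: "cmod (g b - g a) <= (\<Sum>k\<in>{a..<b}. cmod (g (Suc k) - g k))" if "a <= b" for a b
  unfolding sum_Suc_diff'[OF that, symmetric] by (rule norm_sum)
 show ?thesis
 proof (cases "i <= j")
  case True
  then show ?thesis using *[of i j] by (simp add: norm_minus_commute)
 next
  case False
  then show ?thesis using *[of j i] by simp
 qed
qed

abbreviation eps_sum :: "nat => nat => (real => real) => nat => nat => ennreal" where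
 "eps_sum q r f N j \<equiv> \<Sum>k<N. ennreal (1 / dd k j ^ q) * cell_eps r f N k"

abbreviation end_diffs :: "nat => (real => real) => nat => nat => real => ennreal" where
 "end_diffs r f N j x \<equiv> ennreal (1 / cell_len N j) * (fwd_diff r f (cell_lo N j) (cell_hi N j) x + bwd_diff r f (cell_lo N j) (cell_hi N j) x)"

abbreviation apx_err_nn :: "nat => nat => (real => real) => real poly => real => ennreal" where
 "apx_err_nn r n f P x \<equiv> ennreal \<bar>f x - poly P x\<bar> + ennreal (rho n x ^ r * \<bar>poly ((pderiv ^^ r) P) x\<bar>)"

text \<open>The approximant is \<open>P = (\<Sum>i<N. p i * K i)\<close> with Whitney polynomials
  \<open>p i\<close> of the cells. As the kernels sum to \<open>1\<close>, \<open>P - p j\<close> is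
  a sum of \<open>K i * (p i - p j)\<close>, and \<open>p i - p j\<close> telescopes along the cells
  between \<open>i\<close> and \<open>j\<close>. The exponent \<open>q\<close> of the final decay is
  free, to be spent on the weight.\<close>

lemma pointwise_approximation:
 assumes r: "1 <= r" and M: "1 <= M"
 shows "\<exists>C>0. \<forall>n f. r <= n --> f \<in> borel_measurable borel --> integrable lborel f -->
  (\<exists>P :: real poly. degree P <= n - 1 \<and> (\<forall>j \<theta>. j < M * n --> grid (M * n) j <= \<theta> --> \<theta> <= grid (M * n) (Suc j) -->
   apx_err_nn r n f P (cos \<theta>)
   <= ennreal C * (end_diffs r f (M * n) j (cos \<theta>)
     + (eps_sum q r f (M * n) j))))"
proof -
 let ?a = "\<lambda>p i z j. cmod (poly (cpoly (p i)) z - poly (cpoly (p j)) z)"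
 let ?b = "\<lambda>k j. ennreal (1 / dd k j ^ q)"
 let ?c = "\<lambda>K j z. poly (cpoly (K j)) z"
 let ?d = "\<lambda>c2 i j. ennreal (c2 * (1 / (dd i j)^2))"
 let ?f = "\<lambda>P p j z. cmod (poly (cpoly (P - p j)) z)"
 let ?g = "\<lambda>c3. ennreal (fact r * 10 ^ r * c3)"
 let ?h = "\<lambda>P. (pderiv ^^ r) P"
 let ?i = "\<lambda>K j z. cmod (?c K j z)"
 let ?j = "\<lambda>c1 S. ennreal (c1 * (1 + 2 ^ q)) * S"
 let ?k = "\<lambda>c2 i j m. ennreal (c2 / dd i j ^ (2 * m))"
 let ?m = "\<lambda>u v Q. \<integral>x\<in>{u..v}. ennreal \<bar>poly Q x\<bar>"
 let ?n = "\<lambda>t. 2 * real r * (1 + t)"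
 let ?o = "\<lambda>c1 k j. ennreal (c1 * dd k j ^ (2 * r))"
 let ?p = "\<lambda>n \<theta> N j. 1 + real n * \<bar>\<theta> - cheb_node N j\<bar>"
 obtain Cw where Cw: "0 < Cw" and wh: "\<And>f a b. f \<in> borel_measurable borel ==> integrable lborel f ==> a < b ==>
  \<exists>T :: real poly. degree T < r \<and> (\<forall>x. a <= x --> x <= b -->
   ennreal \<bar>f x - poly T x\<bar> <= ennreal (Cw / (b - a)) * (fwd_diff r f a b x + bwd_diff r f a b x)
     + ennreal (Cw / (b - a)^2) * tot_diff r f a b)"
  using whitney[OF r] by metis
 \<comment> \<open>The kernel decay \<open>2 * m\<close> has to pay for the growth
   \<open>2 * r\<close> of the local polynomials, a summable factor with exponent \<open>2\<close>
   for the sum over \<open>i\<close>, and the decay \<open>q\<close> that is kept.\<close>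
 define m where "m = r + 1 + q"
 have m1: "1 <= m" unfolding m_def by simp
 obtain Ck where Ck: "0 < Ck" and ker: "\<And>n N. r <= n ==> n <= N ==> \<exists>K :: nat => real poly.
  (\<forall>j. degree (K j) <= n - r) \<and> (\<Sum>j<N. K j) = 1 \<and>
  (\<forall>\<theta> z j. 0 <= \<theta> --> \<theta> <= pi --> j < N --> cmod (z - of_real (cos \<theta>)) <= rho n (cos \<theta>) / 10 -->
    ?i K j z * (?p n \<theta> N j) ^ (2 * m) <= Ck)"
  using kernel_polynomials[OF r m1] by metis
 have MM: "1 <= real M" using M by simp
 define c1 where "c1 = real r * (2 * real r * (1 + 280 * (real M)^2)) ^ (r - 1) * (2 * real r) * (120 * Cw)"
 have c1: "0 < c1" unfolding c1_def using r Cw by (intro mult_pos_pos zero_less_power add_pos_nonneg) auto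
 define c2 where "c2 = Ck * (2 * real M) ^ (2 * m)"
 have c2: "0 < c2" unfolding c2_def using Ck MM by simp
 define c3 where "c3 = c2 * 4 * (c1 * (1 + 2 ^ q))"
 have c3: "0 < c3" unfolding c3_def using c1 c2 by (intro mult_pos_pos add_pos_pos) auto
 define C where "C = Cw + (1 + fact r * 10 ^ r) * c3"
 have C: "0 < C" "Cw <= C" unfolding C_def using c3 Cw by (auto intro!: add_pos_nonneg)
 show ?thesis
 proof (intro exI[of _ C] conjI C(1) allI impI)
  fix n :: nat and f :: "real => real"
  assume n: "r <= n" and fm[measurable]: "f \<in> borel_measurable borel" and fi: "integrable lborel f"
  define N where "N = M * n"
  have n0: "0 < n" using n r by simp
  have N: "0 < N" "n <= N" "N = M * n" unfolding N_def using n0 M by auto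
  have M0: "0 < M" using M by simp
  let ?lo = "cell_lo N" and ?hi = "cell_hi N" and ?l = "cell_len N" and ?e = "cell_eps r f N"
  have "\<exists>T :: real poly. degree T < r \<and> (\<forall>x. ?lo k <= x --> x <= ?hi k -->
   ennreal \<bar>f x - poly T x\<bar> <= ennreal (Cw / (?hi k - ?lo k)) * (fwd_diff r f (?lo k) (?hi k) x + bwd_diff r f (?lo k) (?hi k) x)
     + ennreal (Cw / (?hi k - ?lo k)^2) * tot_diff r f (?lo k) (?hi k))" if "k < N" for k
   using cell_bounds(5)[OF N(1) that] unfolding cell_len_def by (intro wh fm fi) auto
  then obtain p :: "nat => real poly" where p: "\<And>k. k < N ==> degree (p k) < r"
   "\<And>k x. k < N ==> ?lo k <= x ==> x <= ?hi k ==> ennreal \<bar>f x - poly (p k) x\<bar> <= ennreal (Cw / (?hi k - ?lo k)) * (fwd_diff r f (?lo k) (?hi k) x + bwd_diff r f (?lo k) (?hi k) x)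
     + ennreal (Cw / (?hi k - ?lo k)^2) * tot_diff r f (?lo k) (?hi k)"
   by metis
  obtain K :: "nat => real poly" where K: "\<And>j. degree (K j) <= n - r" "(\<Sum>j<N. K j) = 1"
   "\<And>\<theta> z j. 0 <= \<theta> ==> \<theta> <= pi ==> j < N ==> cmod (z - of_real (cos \<theta>)) <= rho n (cos \<theta>) / 10 ==>
    ?i K j z * (?p n \<theta> N j) ^ (2 * m) <= Ck"
   using ker[OF n N(2)] by blast
  define P where "P = (\<Sum>i<N. p i * K i)"
  have degP: "degree P <= n - 1" unfolding P_def
  proof (rule degree_sum_le)
   fix i assume "i \<in> {..<N}"
   then have "degree (p i * K i) <= (r - 1) + (n - r)"
    using p(1)[of i] K(1)[of i] by (intro order_trans[OF degree_mult_le] add_mono) auto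
   then show "degree (p i * K i) <= n - 1" using n r by simp
  qed simp
  show "\<exists>P :: real poly. degree P <= n - 1 \<and> (\<forall>j \<theta>. j < M * n --> grid (M * n) j <= \<theta> --> \<theta> <= grid (M * n) (Suc j) -->
   apx_err_nn r n f P (cos \<theta>)
   <= ennreal C * (end_diffs r f (M * n) j (cos \<theta>)
     + (eps_sum q r f (M * n) j)))"
   unfolding N_def[symmetric]
  proof (intro exI[of _ P] conjI degP allI impI)
   fix j \<theta> assume j: "j < N" "grid N j <= \<theta>" "\<theta> <= grid N (Suc j)"
   define x where "x = cos \<theta>"
   have \<theta>: "0 <= \<theta>" "\<theta> <= pi" using j grid_range[of j N] grid_range[of "Suc j" N] by auto
   have xin: "?lo j <= x" "x <= ?hi j" "x \<in> {-1..1}"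
   proof -
    have "cos (grid N (Suc j)) <= x" "x <= cos (grid N j)"
     unfolding x_def using j \<theta> grid_range[of j N] grid_range[of "Suc j" N] by (auto intro!: cos_monotone_0_pi_le)
    then show "?lo j <= x" "x <= ?hi j" using cell_bounds(1)[OF N(1) j(1)] by (auto simp: cell_hi_def)
   qed (simp add: x_def)
   define \<rho> where "\<rho> = rho n x"
   have \<rho>: "0 < \<rho>" unfolding \<rho>_def by (rule rho_pos[OF xin(3) n0])
   define S where "S = (\<Sum>k<N. ?b k j * ?e k)"
   \<comment> \<open>Both neighbours are close to \<open>f\<close> in the mean on the piece they
     share. \<open>poly_growth\<close> carries this to \<open>z\<close>, at a cost that is
     polynomial in \<open>dd k j\<close> by \<open>scaled_distance\<close>.\<close>
   have step: "ennreal (?a p (Suc k) z k) <= ?o c1 k j * (?e k + ?e (Suc k))"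
    if k: "Suc k < N" and z: "cmod (z - of_real x) <= \<rho> / 10" for k z
   proof -
    define u where "u = cos (grid N (Suc (Suc k)))"
    define v where "v = cos (grid N (Suc k))"
    define d where "d = dd k j"
    have kN: "k < N" using k by simp
    note cb = cell_bounds[OF N(1) kN] and cb' = cell_bounds[OF N(1) k]
    have uv: "u < v" unfolding u_def v_def using cb'(2) by (simp add: cell_hi_def)
    have lu: "?lo k = u" "v <= ?hi k" "?lo (Suc k) <= u" "?hi (Suc k) = v"
     using cb(2,6) cb'(1) k by (simp_all add: u_def v_def cell_hi_def)
    have l40: "?hi k - ?lo k <= 40 * (v - u)" "?hi (Suc k) - ?lo (Suc k) <= 40 * (v - u)"
     using cb(7)[OF k] cb'(4) cell_length(1)[OF N(1) k] by (simp_all add: cell_len_def u_def v_def)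
    have d1: "1 <= d" unfolding d_def by (rule dd_ge_1)
    define Q where "Q = p (Suc k) - p k"
    have Q: "degree Q < r" unfolding Q_def using p(1)[OF kN] p(1)[OF k] by (metis degree_diff_less)
    have Qint: "(?m u v Q) <= ennreal (120 * Cw * (v - u)) * (?e k + ?e (Suc k))"
    proof -
     have "(?m u v Q) <= (\<integral>x. ennreal \<bar>f x - poly (p k) x\<bar> * indicator {u..v} x + ennreal \<bar>f x - poly (p (Suc k)) x\<bar> * indicator {u..v} x)"
     proof (rule nn_integral_mono)
      fix y
      have "\<bar>poly Q y\<bar> <= \<bar>f y - poly (p k) y\<bar> + \<bar>f y - poly (p (Suc k)) y\<bar>" unfolding Q_def by simp
      then have "ennreal \<bar>poly Q y\<bar> <= ennreal \<bar>f y - poly (p k) y\<bar> + ennreal \<bar>f y - poly (p (Suc k)) y\<bar>"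
       by (simp flip: ennreal_plus)
      then show "ennreal \<bar>poly Q y\<bar> * indicator {u..v} y <= ennreal \<bar>f y - poly (p k) y\<bar> * indicator {u..v} y + ennreal \<bar>f y - poly (p (Suc k)) y\<bar> * indicator {u..v} y"
       by (auto simp: indicator_def)
     qed
     also have "... = (\<integral>x\<in>{u..v}. ennreal \<bar>f x - poly (p k) x\<bar>) + (\<integral>x\<in>{u..v}. ennreal \<bar>f x - poly (p (Suc k)) x\<bar>)"
     proof -
      have [measurable]: "poly (p i) \<in> borel_measurable borel" for i
       by (intro borel_measurable_continuous_onI continuous_intros)
      show ?thesis by (intro nn_integral_add) measurable
     qed
     also have "... <= ennreal (120 * Cw * (v - u)) * ?e k + ennreal (120 * Cw * (v - u)) * ?e (Suc k)"
      unfolding cell_eps_def cell_len_def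
      by (intro add_mono integral_whitney_error fm Cw p(2) l40) (use kN k uv lu cb(5) cb'(5) in \<open>auto simp: cell_len_def\<close>)
     finally show ?thesis by (simp add: distrib_left)
    qed
    define t where "t = cmod (z - of_real u) / (v - u)"
    have t0: "0 <= t" unfolding t_def using uv by simp
    have t: "1 + t <= (1 + 280 * (real M)^2) * d^2"
    proof -
     have "t <= 70 * (real M)^2 * (dd (Suc k) j)^2"
      unfolding t_def u_def v_def using z unfolding x_def \<rho>_def by (intro scaled_distance[OF N(1) k j N(3) M0 n0])
     also have "... <= 70 * (real M)^2 * (2 * d)^2"
      unfolding d_def using dd_Suc[of k j] dd_pos[of "Suc k" j] by (intro mult_left_mono power_mono) auto
     finally have "t <= 280 * (real M)^2 * d^2" by (simp add: power_mult_distrib)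
     moreover have "1 <= d^2" using d1 by simp
     ultimately show ?thesis by (simp add: distrib_right)
    qed
    have "ennreal (?a p (Suc k) z k) = ennreal (cmod (poly (cpoly Q) z))"
     unfolding Q_def cev_diff ..
    also have "... <= ennreal (real r * (?n t) ^ (r - 1) * (2 * real r / (v - u))) * (?m u v Q)"
     unfolding t_def by (rule poly_growth[OF Q uv])
    also have "... <= ennreal (real r * (?n t) ^ (r - 1) * (2 * real r / (v - u))) * (ennreal (120 * Cw * (v - u)) * (?e k + ?e (Suc k)))"
     by (intro mult_left_mono Qint) simp
    also have "... = ennreal (real r * (?n t) ^ (r - 1) * (2 * real r / (v - u)) * (120 * Cw * (v - u))) * (?e k + ?e (Suc k))"
     using uv Cw t0 by (subst ennreal_mult) (auto simp: mult.assoc)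
    also have "... <= ennreal (c1 * d ^ (2 * r)) * (?e k + ?e (Suc k))"
    proof (intro mult_right_mono ennreal_leI)
     have "real r * (?n t) ^ (r - 1) * (2 * real r / (v - u)) * (120 * Cw * (v - u)) = real r * (?n t) ^ (r - 1) * (2 * real r) * (120 * Cw)"
      using uv by simp
     also have "... <= real r * (2 * real r * ((1 + 280 * (real M)^2) * d^2)) ^ (r - 1) * (2 * real r) * (120 * Cw)"
      using t t0 Cw by (intro mult_right_mono mult_left_mono power_mono) auto
     also have "... = c1 * (d^2) ^ (r - 1)" unfolding c1_def by (simp add: power_mult_distrib mult_ac)
     also have "... <= c1 * (d^2) ^ r"
      using d1 c1 by (intro mult_left_mono power_increasing) auto
     also have "... = c1 * d ^ (2 * r)" by (simp add: power_mult)
     finally show "real r * (?n t) ^ (r - 1) * (2 * real r / (v - u)) * (120 * Cw * (v - u)) <= c1 * d ^ (2 * r)" .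
    qed simp
    finally show ?thesis unfolding d_def .
   qed
   \<comment> \<open>The shift from \<open>k\<close> to \<open>Suc k\<close> changes
     \<open>dd\<close> by a factor of at most \<open>2\<close>, which gives the
     \<open>2 ^ q\<close>.\<close>
   have shift: "(\<Sum>k\<in>{k. Suc k < N}. ?b k j * (?e k + ?e (Suc k))) <= ennreal (1 + 2 ^ q) * S"
   proof -
    have "(\<Sum>k\<in>{k. Suc k < N}. ?b k j * (?e k + ?e (Suc k))) = (\<Sum>k\<in>{k. Suc k < N}. ?b k j * ?e k) + (\<Sum>k\<in>{k. Suc k < N}. ?b k j * ?e (Suc k))"
     by (simp add: distrib_left sum.distrib)
    also have "... <= S + ennreal (2 ^ q) * S"
    proof (intro add_mono)
     show "(\<Sum>k\<in>{k. Suc k < N}. ?b k j * ?e k) <= S"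
      unfolding S_def by (intro sum_mono2) auto
     have "(\<Sum>k\<in>{k. Suc k < N}. ?b k j * ?e (Suc k)) <= (\<Sum>k\<in>{k. Suc k < N}. ennreal (2 ^ q * (1 / dd (Suc k) j ^ q)) * ?e (Suc k))"
     proof (intro sum_mono mult_right_mono ennreal_leI)
      fix k
      have "dd (Suc k) j ^ q <= (2 * dd k j) ^ q" using dd_Suc[of k j] dd_pos[of "Suc k" j] by (intro power_mono) auto
      then show "1 / dd k j ^ q <= 2 ^ q * (1 / dd (Suc k) j ^ q)"
       using dd_pos[of k j] dd_pos[of "Suc k" j] by (simp add: field_simps power_mult_distrib)
     qed simp
     also have "... = ennreal (2 ^ q) * (\<Sum>k\<in>{k. Suc k < N}. ?b (Suc k) j * ?e (Suc k))"
      unfolding sum_distrib_left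
     proof (intro sum.cong refl)
      fix k
      have "ennreal (2 ^ q * (1 / dd (Suc k) j ^ q)) = ennreal (2 ^ q) * ?b (Suc k) j"
       using dd_pos[of "Suc k" j] by (intro ennreal_mult) auto
      then show "ennreal (2 ^ q * (1 / dd (Suc k) j ^ q)) * ?e (Suc k) = ennreal (2 ^ q) * (?b (Suc k) j * ?e (Suc k))"
       by (simp only: mult.assoc)
     qed
     also have "(\<Sum>k\<in>{k. Suc k < N}. ?b (Suc k) j * ?e (Suc k)) = (\<Sum>k\<in>Suc ` {k. Suc k < N}. ?b k j * ?e k)"
      by (simp add: sum.reindex)
     also have "... <= S" unfolding S_def by (intro sum_mono2) auto
     finally show "(\<Sum>k\<in>{k. Suc k < N}. ?b k j * ?e (Suc k)) <= ennreal (2 ^ q) * S"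
      by (simp add: mult_left_mono)
    qed
    also have "... = ennreal (1 + 2 ^ q) * S" by (subst ennreal_plus) (auto simp: distrib_right)
    finally show ?thesis .
   qed
   \<comment> \<open>Proved on a complex disc, not only at \<open>x\<close>, so that it also
     controls derivatives.\<close>
   have main: "ennreal (?f P p j z) <= ennreal c3 * S" if z: "cmod (z - of_real x) <= \<rho> / 10" for z
   proof -
    have kb: "?i K i z <= c2 / dd i j ^ (2 * m)" if i: "i < N" for i
    proof -
     have "dd i j / (2 * real M) <= 1 + real n * \<bar>\<theta> - cheb_node N i\<bar>"
      by (rule kernel_distance[OF N(1) j(2,3) N(3) M0 n0])
     then have "(dd i j / (2 * real M)) ^ (2 * m) <= (?p n \<theta> N i) ^ (2 * m)"
      using dd_pos[of i j] by (intro power_mono) auto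
     then have "?i K i z * (dd i j / (2 * real M)) ^ (2 * m) <= ?i K i z * (?p n \<theta> N i) ^ (2 * m)"
      by (intro mult_left_mono) auto
     also have "... <= Ck" using z unfolding x_def \<rho>_def by (intro K(3) \<theta> i)
     finally show ?thesis unfolding c2_def using dd_pos[of i j] MM by (simp add: power_divide field_simps)
    qed
    have "poly (cpoly (P - p j)) z = (\<Sum>i<N. ?c K i z * (?c p i z - ?c p j z))"
    proof -
     have "poly (cpoly (\<Sum>i<N. K i)) z = 1" unfolding K(2) by simp
     then have "?c p j z = (\<Sum>i<N. ?c K i z * ?c p j z)"
      unfolding cev_sum sum_distrib_right[symmetric] by simp
     moreover have "poly (cpoly P) z = (\<Sum>i<N. ?c K i z * ?c p i z)"
      unfolding P_def cev_sum cev_mult by (simp add: mult.commute)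
     ultimately show ?thesis unfolding cev_diff by (simp add: right_diff_distrib sum_subtractf)
    qed
    then have "?f P p j z <= (\<Sum>i<N. ?i K i z * ?a p i z j)"
     by (metis (no_types, lifting) norm_mult norm_sum sum.cong)
    then have "ennreal (?f P p j z) <= ennreal (\<Sum>i<N. ?i K i z * ?a p i z j)"
     by (rule ennreal_leI)
    also have "... = (\<Sum>i<N. ennreal (?i K i z) * ennreal (?a p i z j))"
     by (subst sum_ennreal[symmetric]) (auto simp: ennreal_mult)
    also have "... <= (\<Sum>i<N. ?d c2 i j * (?j c1 S))"
    proof (rule sum_mono)
     fix i assume "i \<in> {..<N}" then have i: "i < N" by simp
     let ?A = "{min i j..<max i j}"
     have A: "?A \<subseteq> {k. Suc k < N}" using i j(1) by auto
     have "ennreal (?i K i z) * ennreal (?a p i z j)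
       <= ?k c2 i j m * (\<Sum>k\<in>?A. ennreal (?a p (Suc k) z k))"
     proof (rule mult_mono)
      show "ennreal (?i K i z) <= ?k c2 i j m" by (rule ennreal_leI[OF kb[OF i]])
      show "ennreal (?a p i z j) <= (\<Sum>k\<in>?A. ennreal (?a p (Suc k) z k))"
       using sum_telescope_abs[of "\<lambda>k. ?c p k z" i j] by (subst sum_ennreal) (auto intro: ennreal_leI)
     qed auto
     also have "... <= ?k c2 i j m * (\<Sum>k\<in>?A. ?o c1 k j * (?e k + ?e (Suc k)))"
      using A by (intro mult_left_mono sum_mono step z) auto
     also have "... = (\<Sum>k\<in>?A. ?k c2 i j m * ?o c1 k j * (?e k + ?e (Suc k)))"
      by (simp add: sum_distrib_left mult.assoc)
     also have "... <= (\<Sum>k\<in>?A. ?d c2 i j * ennreal c1 * (?b k j * (?e k + ?e (Suc k))))"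
     proof (rule sum_mono)
      fix k assume k: "k \<in> ?A"
      \<comment> \<open>Cells between \<open>i\<close> and \<open>j\<close> are no farther from
        \<open>j\<close> than \<open>i\<close> is, so kernel decay in \<open>dd i j\<close> can be
        converted into decay in \<open>dd k j\<close>.\<close>
      have dk: "dd k j <= dd i j" using k by (auto simp: dd_def min_def max_def split: if_splits)
      have pos: "0 < dd k j" "0 < dd i j" by (rule dd_pos)+
      have "c2 / dd i j ^ (2 * m) * (c1 * dd k j ^ (2 * r)) <= c2 * (1 / (dd i j)^2) * (c1 * (1 / dd k j ^ q))"
      proof -
       have "dd k j ^ (2 * r + q) * (dd i j)^2 <= dd i j ^ (2 * r + q) * (dd i j)^2"
        using dk pos by (intro mult_right_mono power_mono) auto
       also have "... = dd i j ^ (2 * r + q + 2)" by (simp add: power_add power2_eq_square)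
       also have "... <= dd i j ^ (2 * m)" unfolding m_def using dd_ge_1[of i j] by (intro power_increasing) auto
       finally have "dd k j ^ (2 * r) * (dd k j ^ q * (dd i j)^2) <= dd i j ^ (2 * m)" by (simp add: power_add mult_ac)
       then have "dd k j ^ (2 * r) / dd i j ^ (2 * m) <= 1 / (dd k j ^ q * (dd i j)^2)"
        using pos by (simp add: field_simps)
       then have "(c1 * c2) * (dd k j ^ (2 * r) / dd i j ^ (2 * m)) <= (c1 * c2) * (1 / (dd k j ^ q * (dd i j)^2))"
        using c1 c2 by (intro mult_left_mono) auto
       then show ?thesis by (simp add: mult_ac)
      qed
      then have "ennreal (c2 / dd i j ^ (2 * m) * (c1 * dd k j ^ (2 * r))) <= ennreal (c2 * (1 / (dd i j)^2) * (c1 * (1 / dd k j ^ q)))"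
       by (rule ennreal_leI)
      moreover have "ennreal (c2 / dd i j ^ (2 * m) * (c1 * dd k j ^ (2 * r))) = ?k c2 i j m * ?o c1 k j"
       using c1 c2 pos by (intro ennreal_mult) auto
      moreover have "ennreal (c2 * (1 / (dd i j)^2) * (c1 * (1 / dd k j ^ q))) = ?d c2 i j * (ennreal c1 * ?b k j)"
      proof -
       have "ennreal (c2 * (1 / (dd i j)^2) * (c1 * (1 / dd k j ^ q))) = ?d c2 i j * ennreal (c1 * (1 / dd k j ^ q))"
        using c1 c2 pos by (intro ennreal_mult) auto
       moreover have "ennreal (c1 * (1 / dd k j ^ q)) = ennreal c1 * ?b k j"
        using c1 pos by (intro ennreal_mult) auto
       ultimately show ?thesis by (simp only:)
      qed
      ultimately show "?k c2 i j m * ?o c1 k j * (?e k + ?e (Suc k)) <= ?d c2 i j * ennreal c1 * (?b k j * (?e k + ?e (Suc k)))"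
       by (simp add: mult.assoc[symmetric] mult_right_mono)
     qed
     also have "... = ?d c2 i j * ennreal c1 * (\<Sum>k\<in>?A. ?b k j * (?e k + ?e (Suc k)))"
      by (simp add: sum_distrib_left)
     also have "... <= ?d c2 i j * ennreal c1 * (ennreal (1 + 2 ^ q) * S)"
     proof (rule mult_left_mono)
      have "(\<Sum>k\<in>?A. ?b k j * (?e k + ?e (Suc k))) <= (\<Sum>k\<in>{k. Suc k < N}. ?b k j * (?e k + ?e (Suc k)))"
       by (intro sum_mono2 A finite_subset[of "{k. Suc k < N}" "{..<N}"]) auto
      then show "(\<Sum>k\<in>?A. ?b k j * (?e k + ?e (Suc k))) <= ennreal (1 + 2 ^ q) * S"
       using shift by (rule order_trans)
     qed simp
     also have "... = ?d c2 i j * (?j c1 S)"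
      using c1 by (subst ennreal_mult) (auto simp: mult.assoc)
     finally show "ennreal (?i K i z) * ennreal (?a p i z j) <= ?d c2 i j * (?j c1 S)" .
    qed
    also have "... = ennreal (\<Sum>i<N. c2 * (1 / (dd i j)^2)) * (?j c1 S)"
     unfolding sum_distrib_right[symmetric] using c2 by (subst sum_ennreal) auto
    also have "... <= ennreal (c2 * 4) * (?j c1 S)"
     unfolding sum_distrib_left[symmetric] using c2 sum_dd_squares by (intro mult_right_mono ennreal_leI mult_left_mono) auto
    also have "... = ennreal c3 * S"
     unfolding c3_def using c1 c2 by (subst (2) ennreal_mult) (auto simp: mult.assoc)
    finally show ?thesis .
   qed
   let ?FB = "fwd_diff r f (?lo j) (?hi j) x + bwd_diff r f (?lo j) (?hi j) x"
   have f1: "ennreal \<bar>f x - poly P x\<bar> <= ennreal (Cw / ?l j) * ?FB + ennreal Cw * S + ennreal c3 * S"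
   proof -
    have "\<bar>f x - poly P x\<bar> <= \<bar>f x - poly (p j) x\<bar> + \<bar>poly (P - p j) x\<bar>" by simp
    then have "ennreal \<bar>f x - poly P x\<bar> <= ennreal \<bar>f x - poly (p j) x\<bar> + ennreal \<bar>poly (P - p j) x\<bar>"
     by (simp flip: ennreal_plus)
    also have "... <= (ennreal (Cw / ?l j) * ?FB + ennreal Cw * ?e j) + ennreal c3 * S"
    proof (rule add_mono)
     have "ennreal (Cw / (?hi j - ?lo j)^2) = ennreal Cw * ennreal (1 / (?l j)^2)"
      unfolding cell_len_def using Cw by (subst ennreal_mult[symmetric]) auto
     then show "ennreal \<bar>f x - poly (p j) x\<bar> <= ennreal (Cw / ?l j) * ?FB + ennreal Cw * ?e j"
      using p(2)[OF j(1) xin(1,2)] unfolding cell_eps_def cell_len_def by (simp add: mult.assoc)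
     have "ennreal (?f P p j (of_real x)) <= ennreal c3 * S"
      by (rule main) (use \<rho> in simp)
     then show "ennreal \<bar>poly (P - p j) x\<bar> <= ennreal c3 * S" by (simp only: poly_cpoly_of_real norm_of_real)
    qed
    also have "... <= (ennreal (Cw / ?l j) * ?FB + ennreal Cw * S) + ennreal c3 * S"
    proof (intro add_mono order_refl mult_left_mono)
     have "?b j j * ?e j <= S" unfolding S_def using j(1) by (intro member_le_sum) auto
     then show "?e j <= S" by (simp add: dd_def)
    qed simp
    finally show ?thesis .
   qed
   \<comment> \<open>The \<open>r\<close>-th derivative of \<open>p j\<close> vanishes, so Cauchy's
     estimate for \<open>P - p j\<close> on the disc of \<open>main\<close> bounds that of
     \<open>P\<close>.\<close>
   have f2: "ennreal (\<rho> ^ r * \<bar>poly (?h P) x\<bar>) <= ?g c3 * S"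
   proof (cases "S = top")
    case True
    have "0 < fact r * 10 ^ r * c3" using c3 by simp
    then have "?g c3 * top = top" by (metis ennreal_mult_top ennreal_eq_0_iff not_le)
    then show ?thesis unfolding True by simp
   next
    case False
    then obtain s where s: "0 <= s" "S = ennreal s" by (cases S) auto
    have "?f P p j z <= c3 * s" if "cmod (z - of_real x) <= \<rho> / 10" for z
     using main[OF that] c3 s by (simp add: ennreal_mult[symmetric])
    then have "\<bar>poly (?h (P - p j)) x\<bar> <= fact r * (c3 * s) / (\<rho> / 10) ^ r"
     using \<rho> by (intro poly_pderiv_pow_bound) auto
    then have "\<rho> ^ r * \<bar>poly (?h P) x\<bar> <= fact r * 10 ^ r * c3 * s"
     using \<rho> unfolding pderiv_pow_diff pderiv_pow_eq_0[OF p(1)[OF j(1)]] by (simp add: power_divide field_simps)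
    then have "ennreal (\<rho> ^ r * \<bar>poly (?h P) x\<bar>) <= ennreal (fact r * 10 ^ r * c3 * s)" by (rule ennreal_leI)
    also have "... = ?g c3 * S" using s c3 by (simp add: ennreal_mult)
    finally show ?thesis .
   qed
   have "ennreal \<bar>f x - poly P x\<bar> + ennreal (\<rho> ^ r * \<bar>poly (?h P) x\<bar>)
     <= (ennreal (Cw / ?l j) * ?FB + ennreal Cw * S + ennreal c3 * S) + ?g c3 * S"
    by (rule add_mono[OF f1 f2])
   also have "... = ennreal (Cw / ?l j) * ?FB + (ennreal Cw + ennreal c3 + ?g c3) * S"
    by (simp add: distrib_right add.assoc)
   also have "ennreal Cw + ennreal c3 + ?g c3 = ennreal C"
    unfolding C_def using Cw c3 by (simp add: distrib_right add.assoc flip: ennreal_plus)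
   also have "ennreal (Cw / ?l j) <= ennreal C * ennreal (1 / ?l j)"
    using C cell_bounds(5)[OF N(1) j(1)] by (simp add: ennreal_mult[symmetric] divide_right_mono)
   finally show "apx_err_nn r n f P (cos \<theta>)
    <= ennreal C * (end_diffs r f N j (cos \<theta>)
     + (eps_sum q r f N j))"
    unfolding x_def[symmetric] \<rho>_def[symmetric] S_def[symmetric]
    by (simp add: distrib_left mult.assoc[symmetric] add_mono mult_right_mono)
  qed
 qed
qed

section \<open>Weighted norms\<close>

lemma ennreal_powr_ennreal: "0 <= x ==> ennreal_powr (ennreal x) q = ennreal (x powr q)"
 by (simp add: ennreal_powr_def)

lemma ennreal_powr_top: "ennreal_powr top q = top"
 by (simp add: ennreal_powr_def)

lemma ennreal_powr_0: "ennreal_powr 0 q = 0"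
 by (simp add: ennreal_powr_def)

lemma ennreal_powr_mono: "x <= y ==> 0 <= q ==> ennreal_powr x q <= ennreal_powr y q"
 by (cases x; cases y) (auto simp: ennreal_powr_ennreal ennreal_powr_top top_unique intro!: ennreal_leI powr_mono2)

lemma ennreal_powr_mult:
 assumes q: "0 < q" shows "ennreal_powr (x * y) q = ennreal_powr x q * ennreal_powr y q"
proof (cases x; cases y)
 fix a b assume "x = ennreal a" "0 <= a" "y = ennreal b" "0 <= b"
 then show ?thesis by (simp add: ennreal_powr_ennreal powr_mult flip: ennreal_mult)
next
 fix a assume a: "x = ennreal a" "0 <= a" and y: "y = top"
 then show ?thesis by (cases "a = 0") (auto simp: ennreal_powr_top ennreal_powr_ennreal ennreal_mult_top ennreal_powr_0)
next
 fix b assume b: "y = ennreal b" "0 <= b" and x: "x = top"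
 then show ?thesis by (cases "b = 0") (auto simp: ennreal_powr_top ennreal_powr_ennreal ennreal_top_mult ennreal_powr_0)
qed (auto simp: ennreal_powr_top)

lemma ennreal_powr_inverse:
 assumes "0 < q"
 shows "ennreal_powr (ennreal_powr x (1 / q)) q = x" "ennreal_powr (ennreal_powr x q) (1 / q) = x"
 using assms by (cases x; auto simp: ennreal_powr_ennreal ennreal_powr_top powr_powr)+

lemma ennreal_powr_root_le:
 assumes q: "0 < q" and le: "x <= ennreal (c powr q) * ennreal_powr y q" and c: "0 <= c"
 shows "ennreal_powr x (1 / q) <= ennreal c * y"
proof -
 have "ennreal_powr x (1 / q) <= ennreal_powr (ennreal_powr (ennreal c * y) q) (1 / q)"
  using q c le by (intro ennreal_powr_mono) (auto simp: ennreal_powr_mult ennreal_powr_ennreal)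
 then show ?thesis using q by (simp add: ennreal_powr_inverse)
qed

lemma ennreal_powr_add_le:
 assumes q: "0 < q"
 shows "ennreal_powr (x + y) q <= ennreal (2 powr q) * (ennreal_powr x q + ennreal_powr y q)"
proof -
 have "x + y <= ennreal 2 * max x y"
  using add_mono[of x "max x y" y "max x y"] by (simp add: mult_2)
 then have "ennreal_powr (x + y) q <= ennreal (2 powr q) * ennreal_powr (max x y) q"
  using q by (metis ennreal_powr_ennreal ennreal_powr_mono ennreal_powr_mult less_imp_le zero_le_numeral)
 also have "ennreal_powr (max x y) q <= ennreal_powr x q + ennreal_powr y q"
  by (auto simp: max_def add_increasing add_increasing2)
 finally show ?thesis by (simp add: mult_left_mono)
qed

text \<open>A crude Young inequality: either \<open>g <= l\<close>, or one power of \<open>g\<close>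
  is traded for powers of the quotient \<open>g / l >= 1\<close>. The parameter \<open>l\<close> is
  optimised in \<open>powr_jensen\<close>.\<close>

lemma young_powr:
 assumes "0 < (l::real)" "0 <= g" "1 <= q"
 shows "g <= l + g powr q * l powr (1 - q)"
proof (cases "g <= l")
 case False
 then have "l powr (q - 1) <= g powr (q - 1)" using assms by (intro powr_mono2) auto
 then have "l powr (q - 1) * g <= g powr (q - 1) * g" using assms by (intro mult_right_mono) auto
 also have "... = g powr q" using assms False by (simp add: powr_mult_base[symmetric] powr_diff)
 finally have "l powr (q - 1) * g * l powr (1 - q) <= g powr q * l powr (1 - q)" by (intro mult_right_mono) auto
 also have "l powr (q - 1) * g * l powr (1 - q) = g" using assms by (simp add: powr_diff)
 finally show ?thesis using assms by simp
qed (use assms in \<open>simp add: add_increasing2\<close>)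

text \<open>A form of Jensen's inequality for subprobability kernels, with a superfluous factor \<open>2\<^sup>q\<close>.\<close>

lemma powr_jensen:
 fixes k :: "'a => ennreal" and g :: "'a => real"
 assumes [measurable]: "k \<in> borel_measurable M" "g \<in> borel_measurable M"
  and g: "\<And>x. 0 <= g x" and q: "1 <= q" and k1: "(\<integral>\<^sup>+x. k x \<partial>M) <= 1"
 shows "ennreal_powr (\<integral>\<^sup>+x. k x * ennreal (g x) \<partial>M) q <= ennreal (2 powr q) * (\<integral>\<^sup>+x. k x * ennreal (g x powr q) \<partial>M)"
proof -
 let ?a = "\<lambda>l. l powr (1 - q)"
 let ?b = "\<lambda>l. ennreal (?a l)"
 let ?c = "\<lambda>x. ennreal (g x powr q)"
 define E where "E = (\<integral>\<^sup>+x. k x * ?c x \<partial>M)"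
 define I where "I = (\<integral>\<^sup>+x. k x * ennreal (g x) \<partial>M)"
 have bound: "I <= ennreal l + ?b l * E" if l: "0 < l" for l :: real
 proof -
  have "I <= (\<integral>\<^sup>+x. ennreal l * k x + ?b l * (k x * ?c x) \<partial>M)"
   unfolding I_def
  proof (rule nn_integral_mono)
   fix x
   have "ennreal (g x) <= ennreal (l + ?a l * g x powr q)"
    using young_powr[OF l g q, of x] by (intro ennreal_leI) (simp add: mult.commute)
   also have "... = ennreal l + ?b l * ?c x"
    using l by (simp add: ennreal_plus ennreal_mult)
   finally have "k x * ennreal (g x) <= k x * (ennreal l + ?b l * ?c x)"
    by (rule mult_left_mono) simp
   then show "k x * ennreal (g x) <= ennreal l * k x + ?b l * (k x * ?c x)"
    by (simp add: distrib_left mult_ac)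
  qed
  also have "... = ennreal l * (\<integral>\<^sup>+x. k x \<partial>M) + ?b l * E"
   unfolding E_def by (simp add: nn_integral_add nn_integral_cmult)
  also have "... <= ennreal l * 1 + ?b l * E"
   by (intro add_mono mult_left_mono k1) auto
  finally show ?thesis by simp
 qed
 have "ennreal_powr I q <= ennreal (2 powr q) * E"
 proof (cases E)
  case top
  have "ennreal (2 powr q) * top = top" by (simp add: ennreal_mult_top)
  then show ?thesis unfolding top by simp
 next
  case (real e)
  show ?thesis
  proof (cases "e = 0")
   case True
   then have "E = 0" using real by simp
   \<comment> \<open>If the right side vanishes, \<open>l\<close> tends to \<open>0\<close>.\<close>
   then have "I <= ennreal l" if "0 < l" for l using bound[OF that] by simp
   then have "I <= 0 + ennreal l" if "0 < l" for l using that by simp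
   from ennreal_le_epsilon[OF this] have "I <= 0" by blast
   then show ?thesis by (simp add: ennreal_powr_0)
  next
   case False
   \<comment> \<open>This value makes the two terms of \<open>bound\<close> equal; hence the factor
     \<open>2\<close>.\<close>
   define l where "l = e powr (1 / q)"
   have e: "0 < e" using False real by simp
   have l: "0 < l" unfolding l_def using e by simp
   have "?a l * e = l"
   proof -
    have "l powr q = e" unfolding l_def using e q by (simp add: powr_powr)
    then show ?thesis using l e by (simp add: powr_diff)
   qed
   then have "?b l * E = ennreal l"
    using real l by (simp add: ennreal_mult[symmetric])
   then have "I <= ennreal (2 * l)" using bound[OF l] l by (simp add: ennreal_plus[symmetric] del: ennreal_plus)
   then have "ennreal_powr I q <= ennreal_powr (ennreal (2 * l)) q" using q by (intro ennreal_powr_mono) auto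
   also have "... = ennreal ((2 * l) powr q)" using l by (intro ennreal_powr_ennreal) simp
   also have "(2 * l) powr q = 2 powr q * e" unfolding l_def using e q by (simp add: powr_mult powr_powr)
   also have "ennreal (2 powr q * e) = ennreal (2 powr q) * E" unfolding real(2) using real(1) by (simp add: ennreal_mult)
   finally show ?thesis .
  qed
 qed
 then show ?thesis unfolding E_def I_def .
qed

lemma enn2real_exponent: "1 <= p ==> p \<noteq> top ==> 1 <= enn2real p"
 by (cases p) auto

lemma wnorm_powr:
 assumes "1 <= p" "p \<noteq> top"
 shows "ennreal_powr (wnorm p v g) (enn2real p) = (\<integral>\<^sup>+x. ennreal (\<bar>g x\<bar> powr enn2real p * v x) \<partial>leb)"
 using enn2real_exponent[OF assms] assms by (simp add: wnorm_def ennreal_powr_inverse)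

lemma AE_lebesgue_on_iff: "(AE x in lebesgue_on {-1..1::real}. P x) \<longleftrightarrow> (AE x in lebesgue. x \<in> {-1..1} --> P x)"
 by (subst AE_restrict_space_iff) auto

lemma AE_lborel_imp_lebesgue_on: "AE x\<in>{-1..1::real} in lborel. P x ==> AE x in leb. P x"
 unfolding AE_lebesgue_on_iff by (rule AE_completion)

lemma nn_integral_lebesgue_on_borel:
 assumes "AE x\<in>{-1..1::real} in lborel. F x = F' x" and [measurable]: "F' \<in> borel_measurable borel"
 shows "(\<integral>\<^sup>+x. F x \<partial>leb) = (\<integral>x\<in>{-1..1}. F' x)"
proof -
 have "(\<integral>\<^sup>+x. F x \<partial>leb) = (\<integral>\<^sup>+x. F' x \<partial>leb)"
  by (intro nn_integral_cong_AE AE_lborel_imp_lebesgue_on assms)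
 also have "... = (\<integral>\<^sup>+x. F' x * indicator {-1..1} x \<partial>lebesgue)"
  by (rule nn_integral_restrict_space) auto
 also have "... = (\<integral>x\<in>{-1..1}. F' x)"
  by (rule nn_integral_completion)
 finally show ?thesis .
qed

text \<open>Fubini's theorem and the substitutions are applied to Borel functions, so each function
  is first replaced by a Borel one that agrees with it almost everywhere.\<close>

lemma borel_representative:
 fixes f :: "real => real"
 assumes f: "f \<in> borel_measurable leb"
 obtains f' where "f' \<in> borel_measurable borel" "\<And>x. x \<notin> {-1..1} ==> f' x = 0" "AE x\<in>{-1..1} in lborel. f x = f' x"
proof -
 have "(\<lambda>x. indicator {-1..1} x *\<^sub>R f x) \<in> borel_measurable lebesgue"
  using f by (subst (asm) borel_measurable_restrict_space_iff) simp_all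
 then obtain g where g: "g \<in> borel_measurable lborel" "AE x in lborel. indicator {-1..1} x *\<^sub>R f x = g x"
  using completion_ex_borel_measurable_real by blast
 define f' where "f' = (\<lambda>x. indicator {-1..1} x * g x)"
 show ?thesis
 proof
  show "f' \<in> borel_measurable borel" unfolding f'_def using g(1) by measurable
  show "f' x = 0" if "x \<notin> {-1..1}" for x using that unfolding f'_def by simp
  show "AE x\<in>{-1..1} in lborel. f x = f' x" using g(2) by eventually_elim (auto simp: f'_def)
 qed
qed

section \<open>The Jackson inequality\<close>

lemma sym_diff_fdiff:
 "sym_diff r h f x = (if x - real r * h / 2 \<in> {-1..1} \<and> x + real r * h / 2 \<in> {-1..1} then fdiff r h f (x - real r * h / 2) else 0)"
 by (simp add: sym_diff_def fdiff_def)

lemma measurable_phi[measurable]: "phi \<in> borel_measurable borel"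
 unfolding phi_def[abs_def] by measurable

lemma measurable_sym_diff[measurable]:
 assumes [measurable]: "f \<in> borel_measurable borel" "g \<in> borel_measurable M" "h \<in> borel_measurable M"
 shows "(\<lambda>x. sym_diff r (h x) f (g x)) \<in> borel_measurable M"
 unfolding sym_diff_fdiff by measurable

text \<open>Why steps inside a cell are of the form \<open>h * phi y\<close> with \<open>h\<close>
  small: \<open>v\<close> is at most the distance from \<open>y\<close> to the end of the cell on
  the side of the nearer endpoint of \<open>[-1, 1]\<close>. On that side the sine of the midpoint
  does not exceed \<open>sin \<theta> = phi y\<close>.\<close>

lemma center_step:
 assumes \<alpha>: "0 <= \<alpha>" "\<alpha> <= \<beta>" "\<beta> <= pi" and y: "cos \<beta> <= y - v" "y + v <= cos \<alpha>" and v: "0 <= v"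
 shows "v <= phi y * (\<beta> - \<alpha>)"
proof -
 define \<theta> where "\<theta> = arccos y"
 have y1: "-1 <= y" "y <= 1" using y v cos_ge_minus_one[of \<beta>] cos_le_one[of \<alpha>] by linarith+
 have c: "cos \<theta> = y" and th: "0 <= \<theta>" "\<theta> <= pi"
  unfolding \<theta>_def using y1 by (auto simp: arccos_lbound arccos_ubound)
 have a: "\<alpha> <= \<theta>" "\<theta> <= \<beta>"
 proof -
  have "cos \<theta> <= cos \<alpha>" "cos \<beta> <= cos \<theta>" using y v c by auto
  then show "\<alpha> <= \<theta>" "\<theta> <= \<beta>" using \<alpha> th by (simp_all add: cos_mono_le_eq)
 qed
 have ph: "phi y = sin \<theta>" using phi_cos[OF th] c by simp
 show ?thesis
 proof (cases "\<theta> <= pi / 2")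
  case True
  have "v <= cos \<alpha> - cos \<theta>" using y c by simp
  also have "... = 2 * sin ((\<alpha> + \<theta>) / 2) * sin ((\<theta> - \<alpha>) / 2)" by (simp add: cos_diff_cos)
  also have "... <= 2 * sin \<theta> * ((\<theta> - \<alpha>) / 2)"
  proof (intro mult_mono)
   show "sin ((\<alpha> + \<theta>) / 2) <= sin \<theta>" using a \<alpha> th True by (intro sin_monotone_2pi_le) auto
   show "sin ((\<theta> - \<alpha>) / 2) <= (\<theta> - \<alpha>) / 2" using a by (intro sin_x_le_x) auto
  qed (use a \<alpha> th in \<open>auto intro!: sin_ge_zero mult_nonneg_nonneg\<close>)
  also have "... <= sin \<theta> * (\<beta> - \<alpha>)" using a th by (auto intro!: mult_left_mono sin_ge_zero)
  finally show ?thesis unfolding ph .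
 next
  case False
  have "v <= cos \<theta> - cos \<beta>" using y c by simp
  also have "... = 2 * sin ((\<theta> + \<beta>) / 2) * sin ((\<beta> - \<theta>) / 2)" by (simp add: cos_diff_cos)
  also have "... <= 2 * sin \<theta> * ((\<beta> - \<theta>) / 2)"
  proof (intro mult_mono)
   have "- (pi / 2) <= pi - (\<theta> + \<beta>) / 2" "pi - (\<theta> + \<beta>) / 2 <= pi - \<theta>" "pi - \<theta> <= pi / 2"
    using a \<alpha> th False by argo+
   then have "sin (pi - (\<theta> + \<beta>) / 2) <= sin (pi - \<theta>)" by (rule sin_monotone_2pi_le)
   then show "sin ((\<theta> + \<beta>) / 2) <= sin \<theta>" by simp
   show "sin ((\<beta> - \<theta>) / 2) <= (\<beta> - \<theta>) / 2" using a by (intro sin_x_le_x) auto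
  qed (use a \<alpha> th in \<open>auto intro!: sin_ge_zero mult_nonneg_nonneg\<close>)
  also have "... <= sin \<theta> * (\<beta> - \<alpha>)" using a th by (auto intro!: mult_left_mono sin_ge_zero)
  finally show ?thesis unfolding ph .
 qed
qed

section \<open>Centred differences inside the cells\<close>

definition in_cell :: "nat => nat => nat => real => real => bool" where
 "in_cell r N k y s \<longleftrightarrow> 0 < s \<and> cell_lo N k <= y - real r * s / 2 \<and> y + real r * s / 2 <= cell_hi N k"

definition cdiff :: "nat => (real => real) => real => real => real" where
 "cdiff r f y s = \<bar>fdiff r s f (y - real r * s / 2)\<bar>"

lemma measurable_cdiff[measurable]:
 assumes [measurable]: "f \<in> borel_measurable borel" "g \<in> borel_measurable M" "h \<in> borel_measurable M"
 shows "(\<lambda>x. cdiff r f (g x) (h x)) \<in> borel_measurable M"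
 unfolding cdiff_def by measurable

lemma measurable_in_cell[measurable]:
 assumes [measurable]: "g \<in> borel_measurable M" "h \<in> borel_measurable M"
 shows "Measurable.pred M (\<lambda>x. in_cell r N k (g x) (h x))"
 unfolding in_cell_def by measurable

lemma cdiff_nonneg: "0 <= cdiff r f y s"
 by (simp add: cdiff_def)

lemma dpl_cell: "dpl r f (cell_lo N k) (cell_hi N k) (y - real r * s / 2) s = (if in_cell r N k y s then ennreal (cdiff r f y s) else 0)"
proof -
 have "y - real r * s / 2 + real r * s = y + real r * s / 2" by (simp add: field_simps)
 then show ?thesis unfolding dpl_def in_cell_def cdiff_def by (simp only:)
qed

lemma fwd_cell: "fwd_diff r f (cell_lo N k) (cell_hi N k) x = (\<integral>s. (if in_cell r N k (x + real r * s / 2) s then ennreal (cdiff r f (x + real r * s / 2) s) else 0))"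
 unfolding fwd_diff_def dpl_cell[symmetric] by simp

lemma bwd_cell: "bwd_diff r f (cell_lo N k) (cell_hi N k) x = (\<integral>s. (if in_cell r N k (x - real r * s / 2) s then ennreal (cdiff r f (x - real r * s / 2) s) else 0))"
 unfolding bwd_diff_def dpl_cell[symmetric] by (simp add: mult.commute)

text \<open>For a fixed step this is a translation. It makes the first node, the last node and the
  centre interchangeable as variables of integration.\<close>

lemma lborel_shear:
 fixes h :: "real => real => ennreal"
 assumes [measurable]: "case_prod h \<in> borel_measurable (borel \<Otimes>\<^sub>M borel)"
 shows "(\<integral>x. \<integral>s. h (x + c * s) s) = (\<integral>x. \<integral>s. h x s)"
proof -
 have [measurable]: "(\<lambda>p. h (fst p + c * snd p) (snd p)) \<in> borel_measurable (borel \<Otimes>\<^sub>M borel)"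
  using measurable_compose[OF _ assms, of "\<lambda>p. (fst p + c * snd p, snd p)"] by simp
 have hs[measurable]: "(\<lambda>x. h x s) \<in> borel_measurable borel" for s
  using measurable_compose[OF _ assms, of "\<lambda>x. (x, s)"] by simp
 have "(\<integral>x. \<integral>s. h (x + c * s) s) = (\<integral>s. \<integral>x. h (x + c * s) s)"
  using lborel_swap[of "\<lambda>p. h (fst p + c * snd p) (snd p)"] by simp
 also have "... = (\<integral>s. \<integral>x. h x s)"
  by (intro nn_integral_cong nn_integral_lborel_shift hs)
 also have "... = (\<integral>x. \<integral>s. h x s)"
  using lborel_swap[of "case_prod h"] assms by simp
 finally show ?thesis .
qed

lemma tot_cell:
 assumes [measurable]: "f \<in> borel_measurable borel"
 shows "tot_diff r f (cell_lo N k) (cell_hi N k) = (\<integral>y. \<integral>s. (if in_cell r N k y s then ennreal (cdiff r f y s) else 0))"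
 using lborel_shear[of "\<lambda>y s. dpl r f (cell_lo N k) (cell_hi N k) y s" "- real r / 2"]
 unfolding tot_diff_def dpl_cell[symmetric] by simp

context
 fixes N :: nat assumes N: "0 < N"
begin

lemma cell_arccos:
 assumes "k < N" "cell_lo N k <= y" "y <= cell_hi N k"
 shows "y \<in> {-1..1}" "grid N k <= arccos y" "arccos y <= grid N (min (k + 2) N)"
proof -
 show y: "y \<in> {-1..1}" using assms cos_ge_minus_one cos_le_one unfolding cell_lo_def cell_hi_def
  by (meson atLeastAtMost_iff order_trans)
 have g: "0 <= grid N k" "grid N k <= pi" "0 <= grid N (min (k + 2) N)" "grid N (min (k + 2) N) <= pi"
  using grid_range[of k N] grid_range[of "min (k + 2) N" N] assms(1) by auto
 have "arccos (cell_hi N k) <= arccos y" using y assms by (intro arccos_le_arccos) (auto simp: cell_hi_def)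
 then show "grid N k <= arccos y" using g by (simp add: cell_hi_def arccos_cos)
 have "arccos y <= arccos (cell_lo N k)" using y assms by (intro arccos_le_arccos) (auto simp: cell_lo_def)
 then show "arccos y <= grid N (min (k + 2) N)" using g by (simp add: cell_lo_def arccos_cos)
qed

lemma subcell_arccos:
 assumes "j < N" "cos (grid N (Suc j)) <= x" "x <= cos (grid N j)"
 shows "x \<in> {-1..1}" "grid N j <= arccos x" "arccos x <= grid N (Suc j)"
proof -
 show y: "x \<in> {-1..1}" using assms cos_ge_minus_one cos_le_one
  by (meson atLeastAtMost_iff order_trans)
 have g: "0 <= grid N j" "grid N j <= pi" "0 <= grid N (Suc j)" "grid N (Suc j) <= pi"
  using grid_range[of j N] grid_range[of "Suc j" N] assms(1) by auto
 have "arccos (cos (grid N j)) <= arccos x" using y assms by (intro arccos_le_arccos) auto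
 then show "grid N j <= arccos x" using g by (simp add: arccos_cos)
 have "arccos x <= arccos (cos (grid N (Suc j)))" using y assms by (intro arccos_le_arccos) auto
 then show "arccos x <= grid N (Suc j)" using g by (simp add: arccos_cos)
qed

lemma subcells_cover:
 assumes x: "x \<in> {-1..1}"
 shows "\<exists>j<N. cos (grid N (Suc j)) <= x \<and> x <= cos (grid N j)"
proof -
 define \<theta> where "\<theta> = arccos x"
 have c: "cos \<theta> = x" and th: "0 <= \<theta>" "\<theta> <= pi"
  unfolding \<theta>_def using x by (auto simp: arccos_lbound arccos_ubound)
 have "\<exists>j<N. grid N j <= \<theta> \<and> \<theta> <= grid N (Suc j)"
 proof -
  have "\<exists>j. \<theta> <= grid N (Suc j)" using th grid_N[OF N] N by (metis Suc_pred)
  define j where "j = (LEAST j. \<theta> <= grid N (Suc j))"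
  have j1: "\<theta> <= grid N (Suc j)" unfolding j_def by (rule LeastI_ex) fact
  have "\<theta> <= grid N (Suc (N - 1))" using th grid_N[OF N] N by simp
  then have "j <= N - 1" unfolding j_def by (rule Least_le)
  then have jN: "j < N" using N by simp
  have "grid N j <= \<theta>"
  proof (cases j)
   case 0 then show ?thesis using th by (simp add: grid_0)
  next
   case (Suc i)
   then have "\<not> \<theta> <= grid N (Suc i)" using not_less_Least[of i "\<lambda>j. \<theta> <= grid N (Suc j)"] unfolding j_def by simp
   then show ?thesis using Suc by simp
  qed
  then show ?thesis using j1 jN by blast
 qed
 then obtain j where j: "j < N" "grid N j <= \<theta>" "\<theta> <= grid N (Suc j)" by blast
 then show ?thesis using th c grid_range[of j N] grid_range[of "Suc j" N]
  by (intro exI[of _ j]) (auto simp flip: c intro!: cos_monotone_0_pi_le)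
qed

text \<open>The angular distance is at most \<open>8 * dd k j / N\<close> and \<open>n <= N\<close>,
  so \<open>weight_n_cos_compare\<close> gives a power of \<open>9 * dd k j\<close>.\<close>

lemma cell_weight:
 assumes dw: "doubling_weight w L" and L: "1 <= L" and s: "L <= (3/2) ^ s" and n: "0 < n" "n <= N"
  and j: "j < N" "cos (grid N (Suc j)) <= x" "x <= cos (grid N j)"
  and k: "k < N" "cell_lo N k <= y" "y <= cell_hi N k"
 shows "weight_n w n x <= 3 ^ s * 9 ^ (2 * s + 1) * dd k j ^ (2 * s + 1) * weight_n w n y"
proof -
 note a = subcell_arccos[OF j] and b = cell_arccos[OF k]
 have r: "0 <= arccos x" "arccos x <= pi" "0 <= arccos y" "arccos y <= pi"
  using a(1) b(1) by (auto simp: arccos_lbound arccos_ubound)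
 have "\<bar>arccos x - arccos y\<bar> <= 8 * dd k j / real N"
 proof -
  define h where "h = pi / real N"
  have h: "0 <= h" "h <= 4 / real N" using pi_N(2)[OF N] unfolding h_def by auto
  have "grid N (min (k + 2) N) <= grid N (k + 2)" by (rule grid_mono) simp
  then have "arccos y <= real k * h + 2 * h" "real k * h <= arccos y" "real j * h <= arccos x" "arccos x <= real j * h + h"
   using a(2,3) b(2,3) unfolding h_def grid_def by (auto simp: add_divide_distrib distrib_right)
  moreover have "\<bar>real k * h - real j * h\<bar> = \<bar>real k - real j\<bar> * h"
   using h by (simp add: left_diff_distrib[symmetric] abs_mult)
  ultimately have "\<bar>arccos x - arccos y\<bar> <= \<bar>real k - real j\<bar> * h + 2 * h" by linarith
  also have "... <= 2 * dd k j * h" unfolding dd_def using h by (simp add: distrib_right algebra_simps)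
  also have "... <= 2 * dd k j * (4 / real N)" using h dd_ge_1[of k j] by (intro mult_left_mono) auto
  finally show ?thesis by simp
 qed
 then have "real n * \<bar>arccos x - arccos y\<bar> <= real N * (8 * dd k j / real N)"
  using n by (intro mult_mono) auto
 then have nn: "1 + real n * \<bar>arccos x - arccos y\<bar> <= 9 * dd k j" using N dd_ge_1[of k j] by simp
 have "weight_n w n x = weight_n w n (cos (arccos x))" using a(1) by simp
 also have "... <= 3 ^ s * (1 + real n * \<bar>arccos x - arccos y\<bar>) ^ (2 * s + 1) * weight_n w n (cos (arccos y))"
  by (rule weight_n_cos_compare[OF dw L s n(1) r])
 also have "... <= 3 ^ s * (9 * dd k j) ^ (2 * s + 1) * weight_n w n y"
  using nn b(1) weight_n_nonneg[OF dw b(1) n(1)] less_imp_le[OF dd_pos, of k j]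
  by (intro mult_mono power_mono) auto
 finally show ?thesis by (simp only: power_mult_distrib mult.assoc)
qed

lemma cell_len_compare:
 assumes "j < N" "k < N" shows "cell_len N j <= 360 * dd k j * cell_len N k"
proof -
 have "cell_len N j <= 40 * (sin (cheb_node N j) / real N)" by (rule cell_bounds(4)[OF N assms(1)])
 also have "sin (cheb_node N j) <= 9 * dd k j * sin (cheb_node N k)"
 proof (rule sin_le_node[OF N assms(2)])
  have "0 <= pi / (2 * real N)" by simp
  then show "grid N j <= cheb_node N j" "cheb_node N j <= grid N (Suc j)" using cheb_node_grid[of N j] by linarith+
 qed
 then have "40 * (sin (cheb_node N j) / real N) <= 40 * (9 * dd k j * sin (cheb_node N k) / real N)"
  by (intro mult_left_mono divide_right_mono) auto
 also have "... = 360 * dd k j * (sin (cheb_node N k) / real N)" by simp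
 also have "... <= 360 * dd k j * cell_len N k"
  using cell_bounds(3)[OF N assms(2)] dd_ge_1[of k j] by (intro mult_left_mono) auto
 finally show ?thesis .
qed

text \<open>Controls the Jacobian of \<open>s = h * phi y\<close> relative to the length of the
  cell.\<close>

lemma phi_cell:
 assumes k: "k < N" "cell_lo N k <= y" "y <= cell_hi N k"
 shows "phi y <= 18 * real N * cell_len N k"
proof -
 note b = cell_arccos[OF k]
 have "phi y = sin (arccos y)" using phi_cos[of "arccos y"] b(1) by (simp add: arccos_lbound arccos_ubound)
 also have "... <= 18 * sin (cheb_node N k)"
 proof (cases "arccos y <= grid N (Suc k)")
  case True
  have "sin (arccos y) <= 9 * dd k k * sin (cheb_node N k)" by (rule sin_le_node[OF N k(1) b(2) True])
  then show ?thesis using sin_node_pos[OF N k(1)] by (simp add: dd_def)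
 next
  case False
  have "grid N (min (k + 2) N) <= grid N (Suc (Suc k))" by (rule grid_mono) simp
  then have "sin (arccos y) <= 9 * dd k (Suc k) * sin (cheb_node N k)"
   using False b(3) by (intro sin_le_node[OF N k(1)]) auto
  then show ?thesis by (simp add: dd_def)
 qed
 also have "... = 18 * real N * (sin (cheb_node N k) / real N)" using N by simp
 also have "... <= 18 * real N * cell_len N k" using cell_bounds(3)[OF N k(1)] by (intro mult_left_mono) auto
 finally show ?thesis .
qed

text \<open>A cell covers an angular range of two grid steps with both ends included, which leaves
  at most three possible indices.\<close>

lemma cell_overlap:
 "(\<Sum>k<N. if cell_lo N k <= y \<and> y <= cell_hi N k then 1 else 0 :: real) <= 3"
proof -
 let ?S = "{k. k < N \<and> cell_lo N k <= y \<and> y <= cell_hi N k}"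
 define z where "z = arccos y * real N / pi"
 define m where "m = nat \<lfloor>z\<rfloor>"
 have "?S \<subseteq> {m - 2..m}"
 proof
  fix k assume "k \<in> ?S"
  then have k: "k < N" "cell_lo N k <= y" "y <= cell_hi N k" by auto
  note b = cell_arccos[OF k]
  have "grid N (min (k + 2) N) <= grid N (k + 2)" by (rule grid_mono) simp
  then have "real k * pi / real N <= arccos y" "arccos y <= real (k + 2) * pi / real N" using b(2,3) by (auto simp: grid_def)
  then have "real k <= z" "z <= real (k + 2)" unfolding z_def using N by (auto simp: field_simps)
  then have "int k <= \<lfloor>z\<rfloor>" "\<lfloor>z\<rfloor> <= int (k + 2)" by (auto simp: le_floor_iff floor_le_iff)
  then show "k \<in> {m - 2..m}" unfolding m_def by auto
 qed
 then have "card ?S <= card {m - 2..m}" by (intro card_mono) auto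
 also have "... <= 3" by simp
 finally have "real (card ?S) <= 3" by simp
 moreover have "(\<Sum>k<N. if cell_lo N k <= y \<and> y <= cell_hi N k then 1 else 0 :: real) = real (card ?S)"
 proof -
  have "(\<Sum>k<N. if cell_lo N k <= y \<and> y <= cell_hi N k then 1 else 0 :: real) = (\<Sum>k\<in>{k \<in> {..<N}. cell_lo N k <= y \<and> y <= cell_hi N k}. 1)"
   by (rule sum.inter_filter[symmetric]) simp
  also have "{k \<in> {..<N}. cell_lo N k <= y \<and> y <= cell_hi N k} = ?S" by auto
  finally show ?thesis by simp
 qed
 ultimately show ?thesis by simp
qed

text \<open>A cell spans an angle of at most \<open>2 * pi / N <= 8 / N\<close>, so
  \<open>center_step\<close> bounds half the span of the difference by \<open>8 / N * phi y\<close>;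
  the step is at most the whole span, whence \<open>16 / N\<close>.\<close>

lemma in_cellD:
 assumes k: "k < N" and r: "1 <= r" and c: "in_cell r N k y s"
 shows "0 < s" "cell_lo N k <= y" "y <= cell_hi N k" "0 < phi y" "s <= 16 / real N * phi y"
  "\<bar>sym_diff r s f y\<bar> = cdiff r f y s" "s <= cell_len N k"
proof -
 let ?a = "grid N (min (k + 2) N)"
 show s: "0 < s" using c by (simp add: in_cell_def)
 define v where "v = real r * s / 2"
 have rr: "1 <= real r" using r by simp
 have v: "0 < v" unfolding v_def using s rr by (intro divide_pos_pos mult_pos_pos) auto
 have cc: "cell_lo N k <= y - v" "y + v <= cell_hi N k" using c by (auto simp: in_cell_def v_def)
 show y: "cell_lo N k <= y" "y <= cell_hi N k" using cc v by auto
 have sv: "s <= 2 * v" unfolding v_def using rr s by (simp add: mult_le_cancel_right1)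
 show "s <= cell_len N k" using cc sv by (simp add: cell_len_def)
 have "v <= phi y * (?a - grid N k)"
  using cc v k grid_range[of k N] grid_range[of "min (k + 2) N" N]
  by (intro center_step) (auto simp: cell_lo_def cell_hi_def intro!: grid_mono)
 also have "... <= phi y * (8 / real N)"
 proof (rule mult_left_mono)
  have "?a <= grid N (k + 2)" by (rule grid_mono) simp
  also have "grid N (k + 2) - grid N k = 2 * (pi / real N)" by (simp add: grid_def add_divide_distrib distrib_right)
  then have "grid N (k + 2) <= grid N k + 8 / real N" using pi_N(2)[OF N] by simp
  finally show "?a - grid N k <= 8 / real N" by simp
  have "y \<in> {-1..1}" by (rule cell_arccos(1)[OF k y])
  then show "0 <= phi y" by (auto simp: phi_def abs_square_le_1 abs_le_iff)
 qed
 finally have vp: "v <= phi y * (8 / real N)" .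
 then have "0 < phi y * (8 / real N)" using v by simp
 moreover have "0 <= 8 / real N" by simp
 ultimately show "0 < phi y" using N by (metis zero_less_mult_pos2 divide_pos_pos of_nat_0_less_iff zero_less_numeral)
 show "s <= 16 / real N * phi y" 
 proof -
  have "phi y * (8 / real N) * 2 = 16 / real N * phi y" by simp
  then show ?thesis using vp sv by linarith
 qed
 have "y - v \<in> {-1..1}" "y + v \<in> {-1..1}"
  using cell_arccos(1)[OF k, of "y - v"] cell_arccos(1)[OF k, of "y + v"] cc v by auto
 then show "\<bar>sym_diff r s f y\<bar> = cdiff r f y s" by (simp add: sym_diff_fdiff cdiff_def v_def)
qed

lemma in_cell_area:
 assumes k: "k < N" and r: "1 <= r"
 shows "(\<integral>y. \<integral>s. (if in_cell r N k y s then 1 else 0)) <= ennreal ((cell_len N k)^2)"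
proof -
 let ?l = "cell_len N k"
 have l: "0 < ?l" by (rule cell_bounds(5)[OF N k])
 have "(\<integral>y. \<integral>s. (if in_cell r N k y s then 1 else 0)) <= (\<integral>y. \<integral>s. indicator {cell_lo N k..cell_hi N k} y * indicator {0..?l} s)"
  using in_cellD(1,2,3,7)[OF k r] by (intro nn_integral_mono) (auto simp: indicator_def less_imp_le)
 also have "... = ennreal ?l * ennreal ?l"
  using l by (simp add: nn_integral_cmult nn_integral_multc cell_len_def)
 also have "... = ennreal (?l^2)" using l by (simp add: ennreal_mult[symmetric] power2_eq_square)
 finally show ?thesis .
qed

end

definition wcell :: "(real => real) => real => nat => (real => real) => nat => nat => real => real => ennreal" where
 "wcell v q r f N k y s = (if in_cell r N k y s then ennreal (cdiff r f y s powr q * v y) else 0)"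

lemma measurable_wcell[measurable]:
 assumes [measurable]: "f \<in> borel_measurable borel" "v \<in> borel_measurable borel" "g \<in> borel_measurable M" "h \<in> borel_measurable M"
 shows "(\<lambda>x. wcell v q r f N k (g x) (h x)) \<in> borel_measurable M"
 unfolding wcell_def by measurable

definition wcell_int :: "(real => real) => real => nat => (real => real) => nat => nat => ennreal" where
 "wcell_int v q r f N k = (\<integral>y. \<integral>s. wcell v q r f N k y s)"

lemma powr_jensen_cell:
 assumes N: "0 < N" and j: "j < N" and r: "1 <= r" and q: "1 <= q"
  and [measurable]: "f \<in> borel_measurable borel" "g \<in> borel_measurable borel"
 shows "ennreal_powr (ennreal (1 / cell_len N j) * (\<integral>s. (if in_cell r N j (g s) s then ennreal (cdiff r f (g s) s) else 0))) q
  <= ennreal (2 powr q) * (ennreal (1 / cell_len N j) * (\<integral>s. (if in_cell r N j (g s) s then ennreal (cdiff r f (g s) s powr q) else 0)))"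
proof -
 let ?l = "cell_len N j"
 have l: "0 < ?l" by (rule cell_bounds(5)[OF N j])
 define k where "k s = ennreal (1 / ?l) * (if in_cell r N j (g s) s then 1 else 0)" for s
 have [measurable]: "k \<in> borel_measurable borel" unfolding k_def[abs_def] by measurable
 have "(\<integral>s. k s) <= (\<integral>s. ennreal (1 / ?l) * indicator {0..?l} s)"
  unfolding k_def using in_cellD(1,7)[OF N j r] by (intro nn_integral_mono) (auto simp: indicator_def less_imp_le)
 also have "... = ennreal (1 / ?l) * ennreal ?l" using l by (simp add: nn_integral_cmult)
 also have "... = 1" using l by (simp add: ennreal_mult[symmetric])
 finally have k1: "(\<integral>s. k s) <= 1" .
 have e: "ennreal (1 / ?l) * (\<integral>s. (if in_cell r N j (g s) s then ennreal (c s) else 0)) = (\<integral>s. k s * ennreal (c s))"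
  if [measurable]: "c \<in> borel_measurable borel" for c
  unfolding k_def by (subst nn_integral_cmult[symmetric]) (auto intro!: nn_integral_cong)
 have "ennreal_powr (\<integral>s. k s * ennreal (cdiff r f (g s) s)) q <= ennreal (2 powr q) * (\<integral>s. k s * ennreal (cdiff r f (g s) s powr q))"
  by (rule powr_jensen) (use q k1 in \<open>simp_all add: cdiff_nonneg\<close>)
 then show ?thesis by (subst (1 2) e) simp_all
qed

lemma nn_integral_lborel_pair:
 fixes h :: "real \<times> real => ennreal"
 assumes "h \<in> borel_measurable (borel \<Otimes>\<^sub>M borel)"
 shows "(\<integral>\<^sup>+p. h p \<partial>(lborel \<Otimes>\<^sub>M lborel)) = (\<integral>y. \<integral>s. h (y, s))"
 by (rule lborel.nn_integral_fst[symmetric]) (use assms in \<open>simp cong: measurable_cong_sets\<close>)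

text \<open>Jensen's inequality for one kernel on the plane of centres and steps, a weighted sum of
  the indicators of all cells. The \<open>4\<close> in its weights bounds the sum of the negative
  powers of \<open>dd\<close> and makes the total mass at most \<open>1\<close>; with the factor
  \<open>2 powr q\<close> of \<open>powr_jensen\<close> this gives \<open>8 powr q\<close>.\<close>

lemma powr_jensen_cells:
 assumes N: "0 < N" and r: "1 <= r" and q: "1 <= q" and Q: "2 <= Q"
  and fm[measurable]: "f \<in> borel_measurable borel"
 shows "ennreal_powr (eps_sum Q r f N j) q
  <= ennreal (8 powr q) * (\<Sum>k<N. ennreal (1 / (4 * dd k j ^ Q * (cell_len N k)^2)) *
    (\<integral>y. \<integral>s. (if in_cell r N k y s then ennreal (cdiff r f y s powr q) else 0)))"
proof -
 let ?a = "\<lambda>p. cdiff r f (fst p) (snd p)"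
 let ?b = "\<lambda>k c. \<integral>y. \<integral>s. (if in_cell r N k y s then ennreal (c (y, s)) else 0)"
 let ?c = "\<lambda>p. cdiff r f (fst p) (snd p) powr q"
 let ?d = "\<lambda>k p c. if in_cell r N k (fst p) (snd p) then ennreal (c p) else 0"
 let ?e = "\<lambda>j. eps_sum Q r f N j"
 define a where "a k = 1 / (4 * dd k j ^ Q * (cell_len N k)^2)" for k
 have a0: "0 <= a k" for k unfolding a_def using dd_pos[of k j] by simp
 define K where "K p = (\<Sum>k<N. ennreal (a k) * (if in_cell r N k (fst p) (snd p) then 1 else 0))" for p :: "real \<times> real"
 let ?M = "lborel \<Otimes>\<^sub>M (lborel :: real measure)"
 have Km[measurable]: "K \<in> borel_measurable ?M"
  unfolding K_def[abs_def] by measurable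
 have Kint: "(\<integral>\<^sup>+p. K p * ennreal (c p) \<partial>?M) = (\<Sum>k<N. ennreal (a k) * (?b k c))"
  if [measurable]: "c \<in> borel_measurable (borel \<Otimes>\<^sub>M borel)" for c
 proof -
  have [measurable]: "c \<in> borel_measurable ?M" using that by (simp cong: measurable_cong_sets)
  have "(\<integral>\<^sup>+p. K p * ennreal (c p) \<partial>?M) = (\<integral>\<^sup>+p. (\<Sum>k<N. ennreal (a k) * (?d k p c)) \<partial>?M)"
   unfolding K_def sum_distrib_right by (intro nn_integral_cong sum.cong) auto
  also have "... = (\<Sum>k<N. \<integral>\<^sup>+p. ennreal (a k) * (?d k p c) \<partial>?M)"
   by (rule nn_integral_sum) measurable
  also have "... = (\<Sum>k<N. ennreal (a k) * (\<integral>\<^sup>+p. (?d k p c) \<partial>?M))"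
   by (intro sum.cong refl nn_integral_cmult) measurable
  also have "... = (\<Sum>k<N. ennreal (a k) * (?b k c))"
   by (intro sum.cong refl arg_cong2[where f = "(*)"], subst nn_integral_lborel_pair) simp_all
  finally show ?thesis .
 qed
 have K1: "(\<integral>\<^sup>+p. K p \<partial>?M) <= 1"
 proof -
  have "(\<integral>\<^sup>+p. K p \<partial>?M) = (\<Sum>k<N. ennreal (a k) * (\<integral>y. \<integral>s. (if in_cell r N k y s then 1 else 0)))"
   using Kint[of "\<lambda>_. 1"] by (simp cong: if_cong)
  also have "... <= (\<Sum>k<N. ennreal (a k) * ennreal ((cell_len N k)^2))"
   by (intro sum_mono mult_left_mono in_cell_area[OF N _ r]) auto
  also have "... = (\<Sum>k<N. ennreal (1 / 4 * (1 / dd k j ^ Q)))"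
  proof (intro sum.cong refl)
   fix k assume "k \<in> {..<N}"
   then have "0 < cell_len N k" using cell_bounds(5)[OF N] by simp
   then have "a k * (cell_len N k)^2 = 1 / 4 * (1 / dd k j ^ Q)" unfolding a_def by simp
   then show "ennreal (a k) * ennreal ((cell_len N k)^2) = ennreal (1 / 4 * (1 / dd k j ^ Q))"
    using a0[of k] by (simp only: ennreal_mult[symmetric] zero_le_power2)
  qed
  also have "... = ennreal (1 / 4 * (\<Sum>k<N. 1 / dd k j ^ Q))"
   unfolding sum_distrib_left using dd_pos by (intro sum_ennreal) (auto simp: less_imp_le)
  also have "... <= 1" using sum_dd_le[OF Q, of j N] by (simp add: ennreal_le_1)
  finally show ?thesis .
 qed
 have "(?e j) = ennreal 4 * (\<integral>\<^sup>+p. K p * ennreal (?a p) \<partial>?M)"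
 proof (subst Kint)
  show "(?e j) = ennreal 4 * (\<Sum>k<N. ennreal (a k) * (?b k ?a))"
   unfolding sum_distrib_left
  proof (intro sum.cong refl)
   fix k assume "k \<in> {..<N}"
   have "1 / dd k j ^ Q * (1 / (cell_len N k)^2) = 4 * a k" unfolding a_def by simp
   then have "ennreal (1 / dd k j ^ Q) * ennreal (1 / (cell_len N k)^2) = ennreal 4 * ennreal (a k)"
    using dd_pos[of k j] a0[of k] by (simp only: ennreal_mult[symmetric] zero_le_power2 less_imp_le zero_le_divide_1_iff zero_le_power zero_le_numeral)
   then show "ennreal (1 / dd k j ^ Q) * cell_eps r f N k = ennreal 4 * (ennreal (a k) * (?b k ?a))"
    unfolding cell_eps_def tot_cell[OF fm] mult.assoc[symmetric] fst_conv snd_conv by simp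
  qed
 qed measurable
 then have "ennreal_powr (?e j) q
   = ennreal (4 powr q) * ennreal_powr (\<integral>\<^sup>+p. K p * ennreal (?a p) \<partial>?M) q"
  using q by (simp only: ennreal_powr_mult ennreal_powr_ennreal zero_le_numeral)
 also have "... <= ennreal (4 powr q) * (ennreal (2 powr q) * (\<integral>\<^sup>+p. K p * ennreal (?c p) \<partial>?M))"
  by (intro mult_left_mono powr_jensen) (use q K1 in \<open>auto simp: cdiff_nonneg\<close>)
 also have "... = ennreal (8 powr q) * (\<integral>\<^sup>+p. K p * ennreal (?c p) \<partial>?M)"
  by (simp add: mult.assoc[symmetric] ennreal_mult[symmetric] powr_mult[symmetric])
 also have "(\<integral>\<^sup>+p. K p * ennreal (?c p) \<partial>?M) = (\<Sum>k<N. ennreal (a k) * (\<integral>y. \<integral>s. (if in_cell r N k y s then ennreal (cdiff r f y s powr q) else 0)))"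
  by (subst Kint) (simp_all only: fst_conv snd_conv, measurable)
 finally show ?thesis unfolding a_def .
qed

text \<open>Substitutes \<open>s = h * phi y\<close>; by \<open>in_cellD\<close> the new variable
  satisfies \<open>h <= 16 / N <= t\<close>. The Jacobian over the cell length is at most
  \<open>18 * N\<close> and every \<open>y\<close> lies in at most three cells, which gives
  \<open>54 * N\<close>.\<close>

lemma wcell_int_bound:
 assumes N: "0 < N" and r: "1 <= r" and t: "16 / real N <= t"
  and fm[measurable]: "f \<in> borel_measurable borel" and vm[measurable]: "v \<in> borel_measurable borel"
  and v: "\<And>x. x \<in> {-1..1} ==> 0 <= v x"
 shows "(\<Sum>k<N. ennreal (1 / cell_len N k) * wcell_int v q r f N k)
  <= ennreal (54 * real N) * (\<integral>h\<in>{0..t}. (\<integral>y\<in>{-1..1}. ennreal (\<bar>sym_diff r (h * phi y) f y\<bar> powr q * v y)))"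
proof -
 let ?a = "\<lambda>k y. \<integral>s. wcell v q r f N k y s"
 let ?b = "\<lambda>k. ennreal (1 / cell_len N k)"
 let ?c = "\<lambda>G y. \<integral>h. G y h"
 let ?d = "\<lambda>k y. ennreal (18 * real N * (if cell_lo N k <= y \<and> y <= cell_hi N k then 1 else 0))"
 let ?e = "ennreal (54 * real N)"
 define G where "G y h = ennreal (\<bar>sym_diff r (h * phi y) f y\<bar> powr q * v y) * indicator {-1..1} y * indicator {0..t} h" for y h
 have Gm[measurable]: "(\<lambda>p. G (fst p) (snd p)) \<in> borel_measurable (borel \<Otimes>\<^sub>M borel)"
  unfolding G_def by measurable
 have Gh[measurable]: "(\<lambda>h. G y h) \<in> borel_measurable borel" for y
  unfolding G_def by measurable
 have Gy[measurable]: "(\<lambda>y. \<integral>h. G y h) \<in> borel_measurable borel"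
  unfolding G_def by measurable
 have inner: "?b k * (?a k y) <= ?d k y * (?c G y)"
  if k: "k < N" for k y
 proof (cases "\<exists>s. in_cell r N k y s")
  case False
  then show ?thesis by (simp add: wcell_def)
 next
  case True
  then obtain s0 where "in_cell r N k y s0" by blast
  note D = in_cellD(2-4)[OF N k r this]
  have y: "y \<in> {-1..1}" by (rule cell_arccos(1)[OF N k D(1,2)])
  have l: "0 < cell_len N k" by (rule cell_bounds(5)[OF N k])
  have "(?a k y) = ennreal (phi y) * (\<integral>h. wcell v q r f N k y (h * phi y))"
   using nn_integral_real_affine[of "\<lambda>s. wcell v q r f N k y s" "phi y" 0] D(3) by (simp add: mult.commute)
  also have "(\<integral>h. wcell v q r f N k y (h * phi y)) <= (?c G y)"
  proof (rule nn_integral_mono)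
   fix h
   show "wcell v q r f N k y (h * phi y) <= G y h"
   proof (cases "in_cell r N k y (h * phi y)")
    case True
    note E = in_cellD[OF N k r True]
    have "0 < h" using E(1,4) by (simp add: zero_less_mult_iff)
    moreover have "h * phi y <= t * phi y" using E(5) t mult_right_mono[OF t less_imp_le[OF E(4)]] by simp
    then have "h <= t" using E(4) by simp
    ultimately show ?thesis using True y unfolding wcell_def G_def by (simp add: E(6)[symmetric])
   qed (simp add: wcell_def)
  qed
  finally have "?b k * (?a k y) <= ?b k * (ennreal (phi y) * (?c G y))"
   by (simp add: mult_left_mono)
  also have "... = ennreal (phi y / cell_len N k) * (?c G y)"
   using l D(3) by (simp add: mult.assoc[symmetric] ennreal_mult[symmetric])
  also have "... <= ennreal (18 * real N) * (?c G y)"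
   using phi_cell[OF N k D(1,2)] l by (intro mult_right_mono ennreal_leI) (auto simp: divide_le_eq)
  finally show ?thesis using D by simp
 qed
 have "(\<Sum>k<N. ?b k * wcell_int v q r f N k) = (\<Sum>k<N. \<integral>y. ?b k * (?a k y))"
  unfolding wcell_int_def by (intro sum.cong refl nn_integral_cmult[symmetric]) measurable
 also have "... = (\<integral>y. (\<Sum>k<N. ?b k * (?a k y)))"
  by (rule nn_integral_sum[symmetric]) measurable
 also have "... <= (\<integral>y. ?e * (?c G y))"
 proof (rule nn_integral_mono)
  fix y
  have "(\<Sum>k<N. ?b k * (?a k y)) <= (\<Sum>k<N. ?d k y * (?c G y))"
   by (intro sum_mono inner) auto
  also have "... = ennreal (18 * real N * (\<Sum>k<N. if cell_lo N k <= y \<and> y <= cell_hi N k then 1 else 0)) * (?c G y)"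
   unfolding sum_distrib_right[symmetric] sum_distrib_left by (subst sum_ennreal) auto
  also have "... <= ?e * (?c G y)"
   using mult_left_mono[OF cell_overlap[OF N, of y], of "18 * real N"] by (intro mult_right_mono ennreal_leI) auto
  finally show "(\<Sum>k<N. ?b k * (?a k y)) <= ?e * (?c G y)" .
 qed
 also have "... = ?e * (\<integral>y. \<integral>h. G y h)"
  by (rule nn_integral_cmult) measurable
 also have "(\<integral>y. \<integral>h. G y h) = (\<integral>h. \<integral>y. G y h)"
  using lborel_swap[of "\<lambda>p. G (fst p) (snd p)"] by simp
 also have "... = (\<integral>h\<in>{0..t}. (\<integral>y\<in>{-1..1}. ennreal (\<bar>sym_diff r (h * phi y) f y\<bar> powr q * v y)))"
  unfolding G_def by (intro nn_integral_cong nn_integral_multc) measurable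
 finally show ?thesis .
qed


text \<open>The pointwise bound is raised to the power \<open>q\<close> by Jensen, multiplied by the
  weight and summed over the cells. The factor \<open>n\<close> on the right becomes the
  \<open>1 / t\<close> of the averaged modulus later on.\<close>

lemma jackson_finite:
 assumes r: "1 <= r" and M: "1 <= M" and L: "1 <= L" and q: "1 <= q"
 shows "\<exists>C>0. \<forall>n f w t. r <= n --> f \<in> borel_measurable borel --> integrable lborel f --> doubling_weight w L --> 16 / (real M * real n) <= t -->
  (\<exists>P :: real poly. degree P <= n - 1 \<and>
   (\<integral>x\<in>{-1..1}. ennreal ((apx_err r n f P x) powr q * weight_n w n x))
   <= ennreal (C * real n) * (\<integral>h\<in>{0..t}. (\<integral>y\<in>{-1..1}. ennreal (\<bar>sym_diff r (h * phi y) f y\<bar> powr q * weight_n w n y))))"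
proof -
 let ?a = "\<lambda>C0. ennreal (C0 powr q * 2 powr q)"
 let ?b = "\<lambda>N j. ennreal (1 / cell_len N j)"
 let ?c = "\<lambda>f y s. cdiff r f y s powr q"
 let ?d = "\<lambda>S. ennreal_powr S q"
 let ?e = "\<lambda>N k f. \<integral>y. \<integral>s. (if in_cell r N k y s then ennreal (?c f y s) else 0)"
 let ?f = "\<lambda>F x v. ennreal (F x powr q * v x)"
 let ?g = "\<lambda>c1. ennreal (2 powr q * c1)"
 let ?h = "\<lambda>k j Q N. 4 * dd k j ^ Q * (cell_len N k)^2"
 let ?i = "ennreal (2 powr q)"
 let ?j = "\<lambda>c2 k j. ennreal (c2 / (dd k j)^2)"
 let ?k = "\<lambda>N j. grid N (Suc j)"
 let ?m = "\<lambda>t f v. \<integral>h\<in>{0..t}. (\<integral>y\<in>{-1..1}. ennreal (\<bar>sym_diff r (h * phi y) f y\<bar> powr q * v y))"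
 let ?n = "\<lambda>cv k j s. cv * dd k j ^ (2 * s + 1)"
 let ?o = "ennreal (8 powr q)"
 obtain s :: nat where s: "L <= (3/2) ^ s" using real_arch_pow[of "3/2" L] by (auto intro: less_imp_le)
 define cv where "cv = (3::real) ^ s * 9 ^ (2 * s + 1)"
 have cv: "0 < cv" unfolding cv_def by simp
 \<comment> \<open>The power \<open>2 * s + 1\<close> is spent on comparing the weights, one more on
   comparing the lengths of the cells, and \<open>2\<close> is left for summation over
   \<open>j\<close>.\<close>
 define Q where "Q = 2 * s + 4"
 obtain C0 where C0: "0 < C0" and pw: "\<And>n f. r <= n ==> f \<in> borel_measurable borel ==> integrable lborel f ==>
  (\<exists>P :: real poly. degree P <= n - 1 \<and> (\<forall>j \<theta>. j < M * n --> grid (M * n) j <= \<theta> --> \<theta> <= ?k (M * n) j -->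
   apx_err_nn r n f P (cos \<theta>)
   <= ennreal C0 * (end_diffs r f (M * n) j (cos \<theta>)
     + (eps_sum Q r f (M * n) j))))"
  using pointwise_approximation[OF r M, of Q] by blast
 define c1 where "c1 = 2 powr q * cv"
 define c2 where "c2 = 8 powr q * (90 * cv)"
 define c3 where "c3 = C0 powr q * 2 powr q * (2 powr q * (2 * c1) + 4 * c2)"
 have c12: "0 < c1" "0 < c2" unfolding c1_def c2_def using cv by auto
 have c3: "0 < c3" unfolding c3_def using c12 C0 by (intro mult_pos_pos add_pos_pos) auto
 define C where "C = c3 * (54 * real M)"
 have C: "0 < C" unfolding C_def using c3 M by simp
 show ?thesis
 proof (intro exI[of _ C] conjI C allI impI)
  fix n :: nat and f w :: "real => real" and t :: real
  assume n: "r <= n" and fm[measurable]: "f \<in> borel_measurable borel" and fi: "integrable lborel f"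
   and dw: "doubling_weight w L" and t: "16 / (real M * real n) <= t"
  define N where "N = M * n"
  have n0: "0 < n" using n r by simp
  have N: "0 < N" "n <= N" unfolding N_def using n0 M by auto
  define v where "v = weight_n w n"
  have vm[measurable]: "v \<in> borel_measurable borel" unfolding v_def by (rule weight_n_measurable[OF dw])
  have v0: "0 <= v x" if "x \<in> {-1..1}" for x unfolding v_def by (rule weight_n_nonneg[OF dw that n0])
  obtain P :: "real poly" where degP: "degree P <= n - 1" and P: "\<And>j \<theta>. j < N ==> grid N j <= \<theta> ==> \<theta> <= ?k N j ==>
   apx_err_nn r n f P (cos \<theta>)
   <= ennreal C0 * (end_diffs r f N j (cos \<theta>)
     + (eps_sum Q r f N j))"
   using pw[OF n fm fi] unfolding N_def by blast
  define F where "F x = apx_err r n f P x" for x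
  have F0: "0 <= F x" if "x \<in> {-1..1}" for x unfolding F_def using rho_pos[OF that n0] by simp
  define W where "W k = wcell_int v q r f N k" for k
  let ?wc = "wcell v q r f N"
  \<comment> \<open>The weight at \<open>x\<close> is moved inside every integral by
    \<open>wv\<close> and becomes the weight at the centre of the difference, at the price of a
    power of \<open>dd\<close>.\<close>
  have cell: "?f F x v <= ?a C0 * (?g c1 * (?b N j * (\<integral>s. ?wc j (x + real r / 2 * s) s)
     + ?b N j * (\<integral>s. ?wc j (x + (- real r / 2) * s) s))
     + (\<Sum>k<N. ennreal (8 powr q * cv * dd k j ^ (2 * s + 1) / (?h k j Q N)) * W k))"
   if j: "j < N" and x: "cos (?k N j) <= x" "x <= cos (grid N j)" for j x
  proof -
   note a = subcell_arccos[OF N(1) j x]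
   have cx: "cos (arccos x) = x" using a(1) by simp
   have x0: "0 <= F x" "0 <= v x" using F0 v0 a(1) by auto
   let ?l = "?b N j"
   define S where "S = (eps_sum Q r f N j)"
   define A where "A = ?l * fwd_diff r f (cell_lo N j) (cell_hi N j) x"
   define B where "B = ?l * bwd_diff r f (cell_lo N j) (cell_hi N j) x"
   have rx: "0 <= rho n x ^ r * \<bar>poly ((pderiv ^^ r) P) x\<bar>" using rho_pos[OF a(1) n0] by simp
   have wv: "v x <= cv * dd k j ^ (2 * s + 1) * v y" if "k < N" "in_cell r N k y s'" for k y s'
    unfolding v_def cv_def
    by (rule cell_weight[OF N(1) dw L s n0 N(2) j x that(1) in_cellD(2,3)[OF N(1) that(1) r that(2)]])
   have "ennreal (F x) <= ennreal C0 * (A + B + S)"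
    using P[OF j a(2,3)] rx unfolding F_def A_def B_def S_def cx by (simp add: ennreal_plus distrib_left)
   then have "?d (ennreal (F x)) <= ?d (ennreal C0 * (A + B + S))"
    using q by (intro ennreal_powr_mono) auto
   also have "... = ennreal (C0 powr q) * ?d (A + B + S)"
    using q C0 by (simp add: ennreal_powr_mult ennreal_powr_ennreal)
   also have "... <= ennreal (C0 powr q) * (?i * (?d (A + B) + ?d S))"
    using q by (intro mult_left_mono ennreal_powr_add_le) auto
   also have "... <= ennreal (C0 powr q) * (?i * (?i * (?d A + ?d B) + ?d S))"
    using q by (intro mult_left_mono add_right_mono ennreal_powr_add_le) auto
   finally have F1: "ennreal (F x powr q) <= ?a C0 * (?i * (?d A + ?d B) + ?d S)"
    using x0 by (simp add: ennreal_powr_ennreal ennreal_mult mult.assoc)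
   have shift: "ennreal (v x) * ennreal_powr (?l * (\<integral>s. (if in_cell r N j (x + c * s) s then ennreal (cdiff r f (x + c * s) s) else 0))) q
     <= ennreal c1 * (?l * (\<integral>s. ?wc j (x + c * s) s))" for c
   proof -
    have "ennreal (v x) * ennreal_powr (?l * (\<integral>s. (if in_cell r N j (x + c * s) s then ennreal (cdiff r f (x + c * s) s) else 0))) q
     <= ennreal (v x) * (?i * (?l * (\<integral>s. (if in_cell r N j (x + c * s) s then ennreal (?c f (x + c * s) s) else 0))))"
     by (intro mult_left_mono powr_jensen_cell[OF N(1) j r q fm]) auto
    also have "... = ?i * (?l * (\<integral>s. ennreal (v x) * (if in_cell r N j (x + c * s) s then ennreal (?c f (x + c * s) s) else 0)))"
     by (subst nn_integral_cmult) (auto simp: mult_ac)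
    also have "... <= ?i * (?l * (\<integral>s. ennreal cv * ?wc j (x + c * s) s))"
    proof (intro mult_left_mono nn_integral_mono)
     fix s'
     show "ennreal (v x) * (if in_cell r N j (x + c * s') s' then ennreal (?c f (x + c * s') s') else 0) <= ennreal cv * ?wc j (x + c * s') s'"
     proof (cases "in_cell r N j (x + c * s') s'")
      case True
      have "v x * ?c f (x + c * s') s' <= cv * v (x + c * s') * ?c f (x + c * s') s'"
       using wv[OF j True] by (intro mult_right_mono) (auto simp: dd_def)
      then have "ennreal (v x * ?c f (x + c * s') s') <= ennreal (cv * (?c f (x + c * s') s' * v (x + c * s')))"
       by (intro ennreal_leI) (simp add: mult_ac)
      then show ?thesis using True x0 cv unfolding wcell_def by (simp add: ennreal_mult' ennreal_mult'')
     qed simp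
    qed auto
    also have "... = ennreal c1 * (?l * (\<integral>s. ?wc j (x + c * s) s))"
     unfolding c1_def using cv by (subst nn_integral_cmult) (auto simp: ennreal_mult mult_ac)
    finally show ?thesis .
   qed
   have Av: "ennreal (v x) * ?d A <= ennreal c1 * (?l * (\<integral>s. ?wc j (x + real r / 2 * s) s))"
   proof -
    have e: "x + real r * s / 2 = x + real r / 2 * s" for s by simp
    show ?thesis unfolding A_def fwd_cell e by (rule shift)
   qed
   have Bv: "ennreal (v x) * ?d B <= ennreal c1 * (?l * (\<integral>s. ?wc j (x + (- real r / 2) * s) s))"
   proof -
    have e: "x - real r * s / 2 = x + (- real r / 2) * s" for s by simp
    show ?thesis unfolding B_def bwd_cell e by (rule shift)
   qed
   have Sv: "ennreal (v x) * ?d S <= (\<Sum>k<N. ennreal (8 powr q * cv * dd k j ^ (2 * s + 1) / (?h k j Q N)) * W k)"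
   proof -
    define a where "a k = 1 / (?h k j Q N)" for k
    have a0: "0 <= a k" for k unfolding a_def using dd_pos[of k j] by simp
    have "ennreal (v x) * ?d S <= ennreal (v x) * (?o * (\<Sum>k<N. ennreal (a k) *
     (?e N k f)))"
     unfolding S_def a_def by (intro mult_left_mono powr_jensen_cells[OF N(1) r q _ fm]) (auto simp: Q_def)
    also have "... = (\<Sum>k<N. ?o * (ennreal (a k) * (ennreal (v x) * (?e N k f))))"
     by (simp only: sum_distrib_left) (simp only: mult_ac)
    also have "... <= (\<Sum>k<N. ?o * (ennreal (a k) * (ennreal (?n cv k j s) * W k)))"
    proof (intro sum_mono mult_left_mono)
     fix k assume "k \<in> {..<N}"
     then have k: "k < N" by simp
     define d where "d = cv * dd k j ^ (2 * s + 1)"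
     have d0: "0 <= d" unfolding d_def using cv dd_pos[of k j] by simp
     have "ennreal (v x) * (?e N k f)
       = (\<integral>y. \<integral>s. ennreal (v x) * (if in_cell r N k y s then ennreal (?c f y s) else 0))"
      by (simp add: nn_integral_cmult)
     also have "... <= (\<integral>y. \<integral>s. ennreal d * ?wc k y s)"
     proof (intro nn_integral_mono)
      fix y s'
      show "ennreal (v x) * (if in_cell r N k y s' then ennreal (?c f y s') else 0) <= ennreal d * ?wc k y s'"
      proof (cases "in_cell r N k y s'")
       case True
       have "v x * ?c f y s' <= d * v y * ?c f y s'"
        using wv[OF k True] unfolding d_def by (intro mult_right_mono) auto
       then have "ennreal (v x * ?c f y s') <= ennreal (d * (?c f y s' * v y))"
        by (intro ennreal_leI) (simp add: mult_ac)
       then show ?thesis using True x0 d0 unfolding wcell_def by (simp add: ennreal_mult' ennreal_mult'')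
      qed simp
     qed
     also have "... = ennreal d * W k" unfolding W_def wcell_int_def by (simp add: nn_integral_cmult)
     finally show "ennreal (v x) * (?e N k f) <= ennreal (?n cv k j s) * W k"
      unfolding d_def .
    qed auto
    also have "... = (\<Sum>k<N. ennreal (8 powr q * cv * dd k j ^ (2 * s + 1) / (?h k j Q N)) * W k)"
    proof (intro sum.cong refl)
     fix k
     have "8 powr q * cv * dd k j ^ (2 * s + 1) / (?h k j Q N) = 8 powr q * (a k * (?n cv k j s))"
      unfolding a_def by simp
     moreover have "ennreal (8 powr q * (a k * (?n cv k j s))) = ?o * ennreal (a k * (?n cv k j s))"
      using a0[of k] cv dd_pos[of k j] by (intro ennreal_mult) auto
     moreover have "ennreal (a k * (?n cv k j s)) = ennreal (a k) * ennreal (?n cv k j s)"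
      using a0[of k] cv dd_pos[of k j] by (intro ennreal_mult) auto
     ultimately show "?o * (ennreal (a k) * (ennreal (?n cv k j s) * W k)) = ennreal (8 powr q * cv * dd k j ^ (2 * s + 1) / (?h k j Q N)) * W k"
      by (simp only: mult.assoc)
    qed
    finally show ?thesis .
   qed
   have "?f F x v = ennreal (v x) * ennreal (F x powr q)"
    using x0 by (simp add: ennreal_mult mult.commute)
   also have "... <= ennreal (v x) * (?a C0 * (?i * (?d A + ?d B) + ?d S))"
    by (rule mult_left_mono[OF F1]) simp
   also have "... = ?a C0 * (?i * (ennreal (v x) * ?d A + ennreal (v x) * ?d B) + ennreal (v x) * ?d S)"
    by (simp only: distrib_left) (simp only: mult_ac)
   also have "... <= ?a C0 * (?i * (ennreal c1 * (?l * (\<integral>s. ?wc j (x + real r / 2 * s) s)) + ennreal c1 * (?l * (\<integral>s. ?wc j (x + (- real r / 2) * s) s)))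
     + (\<Sum>k<N. ennreal (8 powr q * cv * dd k j ^ (2 * s + 1) / (?h k j Q N)) * W k))"
    by (intro mult_left_mono add_mono Av Bv Sv) auto
   also have "... = ?a C0 * (?g c1 * (?l * (\<integral>s. ?wc j (x + real r / 2 * s) s) + ?l * (\<integral>s. ?wc j (x + (- real r / 2) * s) s))
     + (\<Sum>k<N. ennreal (8 powr q * cv * dd k j ^ (2 * s + 1) / (?h k j Q N)) * W k))"
    using c12 by (subst ennreal_mult[of "2 powr q" c1]) (simp_all only: distrib_left mult.assoc powr_ge_zero less_imp_le)
   finally show ?thesis .
  qed
  let ?I = "\<lambda>j. {cos (?k N j)..cos (grid N j)}"
  have [measurable]: "F \<in> borel_measurable borel"
  proof -
   have [measurable]: "poly p \<in> borel_measurable borel" for p :: "real poly"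
    by (intro borel_measurable_continuous_onI continuous_intros)
   have [measurable]: "rho n \<in> borel_measurable borel" unfolding rho_def[abs_def] by measurable
   show ?thesis unfolding F_def[abs_def] by measurable
  qed
  define D where "D j = ?g c1 * (?b N j * W j + ?b N j * W j)
    + (\<Sum>k<N. ?j c2 k j * (?b N k * W k))" for j
  \<comment> \<open>The two one-sided terms are integrated over the whole line by
    \<open>lborel_shear\<close>; only the sum over all cells uses that \<open>x\<close> runs through
    a short interval.\<close>
  have cellint: "(\<integral>x. ?f F x v * indicator (?I j) x) <= ?a C0 * D j" if j: "j < N" for j
  proof -
   let ?l = "?b N j"
   define b where "b k = 8 powr q * cv * dd k j ^ (2 * s + 1) / (?h k j Q N)" for k
   have b0: "0 <= b k" for k unfolding b_def using cv dd_pos[of k j] by simp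
   define X where "X = (\<Sum>k<N. ennreal (b k) * W k)"
   have sh: "(\<integral>x. \<integral>s. ?wc j (x + c * s) s) = W j" for c
    unfolding W_def wcell_int_def by (rule lborel_shear) simp
   have sh': "(\<integral>x. \<integral>s. ?wc j (x - real r / 2 * s) s) = W j"
    using sh[of "- real r / 2"] by (simp del: times_divide_eq_left)
   have len: "cos (grid N j) - cos (?k N j) <= cell_len N j" "0 <= cos (grid N j) - cos (?k N j)"
    using cell_bounds(1,2)[OF N(1) j] by (auto simp: cell_len_def cell_hi_def)
   have [measurable]: "(\<lambda>x. \<integral>s. ?wc j (x + c * s) s) \<in> borel_measurable borel" for c
    by measurable
   have "(\<integral>x. ?f F x v * indicator (?I j) x)
     <= (\<integral>x. ?a C0 * (?g c1 * (?l * (\<integral>s. ?wc j (x + real r / 2 * s) s) + ?l * (\<integral>s. ?wc j (x + (- real r / 2) * s) s)) + X * indicator (?I j) x))"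
    using cell[OF j] unfolding X_def b_def by (intro nn_integral_mono) (auto simp: indicator_def)
   also have "... = ?a C0 * (?g c1 * (?l * W j + ?l * W j) + X * ennreal (cos (grid N j) - cos (?k N j)))"
    using len by (simp add: nn_integral_cmult nn_integral_add nn_integral_cmult_indicator sh sh' del: times_divide_eq_left minus_divide_left mult_minus_left)
   also have "... <= ?a C0 * D j"
    unfolding D_def
   proof (intro mult_left_mono add_left_mono)
    have "X * ennreal (cos (grid N j) - cos (?k N j)) <= X * ennreal (cell_len N j)"
     using len by (intro mult_left_mono ennreal_leI) auto
    also have "... = (\<Sum>k<N. ennreal (b k * cell_len N j) * W k)"
     unfolding X_def sum_distrib_right using b0 len by (intro sum.cong) (auto simp: ennreal_mult mult_ac)
    also have "... <= (\<Sum>k<N. ?j c2 k j * (?b N k * W k))"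
    proof (rule sum_mono)
     fix k assume "k \<in> {..<N}"
     then have k: "k < N" by simp
     have lk: "0 < cell_len N k" by (rule cell_bounds(5)[OF N(1) k])
     have d: "0 < dd k j" by (rule dd_pos)
     have "b k * cell_len N j <= b k * (360 * dd k j * cell_len N k)"
      by (intro mult_left_mono cell_len_compare[OF N(1) j k] b0)
     also have "... = c2 / (dd k j)^2 * (1 / cell_len N k)"
      unfolding b_def c2_def Q_def using lk d by (simp add: power_add power2_eq_square power4_eq_xxxx mult_ac)
     finally have "ennreal (b k * cell_len N j) <= ennreal (c2 / (dd k j)^2 * (1 / cell_len N k))" by (rule ennreal_leI)
     also have "... = ?j c2 k j * ?b N k"
      using lk c12 by (intro ennreal_mult) auto
     finally show "ennreal (b k * cell_len N j) * W k <= ?j c2 k j * (?b N k * W k)"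
      by (simp only: mult.assoc[symmetric] mult_right_mono zero_le)
    qed
    finally show "X * ennreal (cos (grid N j) - cos (?k N j)) <= (\<Sum>k<N. ?j c2 k j * (?b N k * W k))" .
   qed auto
   finally show ?thesis .
  qed
  define Z where "Z = (\<Sum>k<N. ?b N k * W k)"
  have D: "(\<Sum>j<N. D j) <= ennreal (2 powr q * (2 * c1) + 4 * c2) * Z"
  proof -
   have "(\<Sum>j<N. D j) = ?g c1 * (Z + Z) + (\<Sum>j<N. \<Sum>k<N. ?j c2 k j * (?b N k * W k))"
    unfolding D_def Z_def by (simp only: sum.distrib distrib_left sum_distrib_left)
   also have "(\<Sum>j<N. \<Sum>k<N. ?j c2 k j * (?b N k * W k)) = (\<Sum>k<N. (\<Sum>j<N. ?j c2 k j) * (?b N k * W k))"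
    by (subst sum.swap) (simp add: sum_distrib_right)
   also have "... <= (\<Sum>k<N. ennreal (4 * c2) * (?b N k * W k))"
   proof (intro sum_mono mult_right_mono)
    fix k
    have "(\<Sum>j<N. ?j c2 k j) = ennreal (\<Sum>j<N. c2 / (dd k j)^2)" using c12 by (intro sum_ennreal) auto
    also have "(\<Sum>j<N. c2 / (dd k j)^2) = c2 * (\<Sum>j<N. 1 / (dd j k)^2)"
     by (simp add: sum_distrib_left dd_def abs_minus_commute)
    also have "... <= c2 * 4" using c12 sum_dd_squares by (intro mult_left_mono) auto
    finally show "(\<Sum>j<N. ?j c2 k j) <= ennreal (4 * c2)" by (simp add: mult.commute ennreal_leI)
   qed auto
   also have "... = ennreal (4 * c2) * Z" unfolding Z_def sum_distrib_left ..
   also have "?g c1 * (Z + Z) + ennreal (4 * c2) * Z = (?g c1 + ?g c1 + ennreal (4 * c2)) * Z"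
    by (simp only: distrib_left distrib_right)
   also have "?g c1 + ?g c1 + ennreal (4 * c2) = ennreal (2 powr q * (2 * c1) + 4 * c2)"
    using c12 by (simp flip: ennreal_plus)
   finally show ?thesis by (simp add: add_left_mono)
  qed
  have "(\<integral>x\<in>{-1..1}. ?f F x v) <= (\<integral>x. (\<Sum>j<N. ?f F x v * indicator (?I j) x))"
  proof (rule nn_integral_mono)
   fix x :: real
   show "?f F x v * indicator {-1..1} x <= (\<Sum>j<N. ?f F x v * indicator (?I j) x)"
   proof (cases "x \<in> {-1..1}")
    case True
    then obtain j where j: "j < N" "x \<in> ?I j" using subcells_cover[OF N(1) True] by auto
    then have "?f F x v * indicator {-1..1} x = ?f F x v * indicator (?I j) x" using True by simp
    also have "... <= (\<Sum>j<N. ?f F x v * indicator (?I j) x)"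
     using j(1) by (intro member_le_sum) auto
    finally show ?thesis .
   qed simp
  qed
  also have "... = (\<Sum>j<N. \<integral>x. ?f F x v * indicator (?I j) x)"
   by (rule nn_integral_sum) measurable
  also have "... <= (\<Sum>j<N. ?a C0 * D j)" by (intro sum_mono cellint) auto
  also have "... = ?a C0 * (\<Sum>j<N. D j)" by (simp add: sum_distrib_left)
  also have "... <= ?a C0 * (ennreal (2 powr q * (2 * c1) + 4 * c2) * Z)" by (intro mult_left_mono D) simp
  also have "... = ennreal c3 * Z" unfolding c3_def using c12 by (subst ennreal_mult) (auto simp: mult.assoc)
  also have "... <= ennreal c3 * (ennreal (54 * real N) * (?m t f v))"
   unfolding Z_def W_def using t by (intro mult_left_mono wcell_int_bound[OF N(1) r _ fm vm v0]) (auto simp: N_def)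
  also have "... = ennreal (C * real n) * (?m t f v)"
  proof -
   have "C * real n = c3 * (54 * real N)" unfolding C_def N_def by simp
   then have "ennreal (C * real n) = ennreal c3 * ennreal (54 * real N)" using c3 by (simp add: ennreal_mult)
   then show ?thesis by (simp only: mult.assoc)
  qed
  finally show "\<exists>P :: real poly. degree P <= n - 1 \<and>
   (\<integral>x\<in>{-1..1}. ennreal ((apx_err r n f P x) powr q * weight_n w n x))
   <= ennreal (C * real n) * (\<integral>h\<in>{0..t}. (\<integral>y\<in>{-1..1}. ennreal (\<bar>sym_diff r (h * phi y) f y\<bar> powr q * weight_n w n y)))"
   using degP unfolding F_def v_def by blast
 qed
qed

text \<open>The hypothesis provides, for each \<open>h\<close>, a null set of \<open>y\<close>. By
  Fubini the bound holds for almost all pairs of a centre and a step, and this suffices, since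
  \<open>P\<close> is controlled by integrals of differences. \<open>P\<close> is fixed before
  \<open>\<Omega>\<close>.\<close>

lemma jackson_infinite:
 assumes r: "1 <= r" and M: "1 <= M" and L: "1 <= L"
 shows "\<exists>C>0. \<forall>n f w t. r <= n --> f \<in> borel_measurable borel --> integrable lborel f --> doubling_weight w L --> 16 / (real M * real n) <= t -->
  (\<exists>P :: real poly. degree P <= n - 1 \<and> (\<forall>\<Omega>\<ge>0.
   (\<forall>h. 0 < h --> h <= t --> (AE y\<in>{-1..1} in lborel. \<bar>sym_diff r (h * phi y) f y\<bar> * weight_n w n y <= \<Omega>)) -->
   (AE x\<in>{-1..1} in lborel. (apx_err r n f P x) * weight_n w n x <= C * \<Omega>)))"
proof -
 let ?a = "\<lambda>N k y s. in_cell r N k y s"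
 let ?b = "\<lambda>f x c s. cdiff r f (x + c * s) s"
 let ?c = "\<lambda>cv \<Omega>. ennreal (cv * \<Omega>)"
 let ?d = "\<lambda>f N k. tot_diff r f (cell_lo N k) (cell_hi N k)"
 let ?e = "\<lambda>f N j x. fwd_diff r f (cell_lo N j) (cell_hi N j) x"
 let ?f = "\<lambda>f N j x. bwd_diff r f (cell_lo N j) (cell_hi N j) x"
 let ?g = "\<lambda>Q f N j. eps_sum Q r f N j"
 let ?h = "\<lambda>N k. ennreal (1 / (cell_len N k)^2)"
 obtain s :: nat where s: "L <= (3/2) ^ s" using real_arch_pow[of "3/2" L] by (auto intro: less_imp_le)
 define cv where "cv = (3::real) ^ s * 9 ^ (2 * s + 1)"
 have cv: "0 < cv" unfolding cv_def by simp
 \<comment> \<open>As for finite exponents, but no comparison of cell lengths occurs, which saves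
   one power.\<close>
 define Q where "Q = 2 * s + 3"
 obtain C0 where C0: "0 < C0" and pw: "\<And>n f. r <= n ==> f \<in> borel_measurable borel ==> integrable lborel f ==>
  (\<exists>P :: real poly. degree P <= n - 1 \<and> (\<forall>j \<theta>. j < M * n --> grid (M * n) j <= \<theta> --> \<theta> <= grid (M * n) (Suc j) -->
   apx_err_nn r n f P (cos \<theta>)
   <= ennreal C0 * (end_diffs r f (M * n) j (cos \<theta>)
     + (?g Q f (M * n) j))))"
  using pointwise_approximation[OF r M, of Q] by blast
 \<comment> \<open>The two one-sided terms contribute \<open>1\<close> each, the sum over the cells
   contributes \<open>4\<close>.\<close>
 define C where "C = 6 * C0 * cv"
 have C: "0 < C" unfolding C_def using C0 cv by simp
 show ?thesis
 proof (intro exI[of _ C] conjI C allI impI)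
  fix n :: nat and f w :: "real => real" and t :: real
  assume n: "r <= n" and fm[measurable]: "f \<in> borel_measurable borel" and fi: "integrable lborel f"
   and dw: "doubling_weight w L" and t: "16 / (real M * real n) <= t"
  define N where "N = M * n"
  have n0: "0 < n" using n r by simp
  have N: "0 < N" "n <= N" unfolding N_def using n0 M by auto
  define v where "v = weight_n w n"
  have vm[measurable]: "v \<in> borel_measurable borel" unfolding v_def by (rule weight_n_measurable[OF dw])
  have v0: "0 <= v x" if "x \<in> {-1..1}" for x unfolding v_def by (rule weight_n_nonneg[OF dw that n0])
  obtain P :: "real poly" where degP: "degree P <= n - 1" and P: "\<And>j \<theta>. j < N ==> grid N j <= \<theta> ==> \<theta> <= grid N (Suc j) ==>
   apx_err_nn r n f P (cos \<theta>)
   <= ennreal C0 * (end_diffs r f N j (cos \<theta>)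
     + (?g Q f N j))"
   using pw[OF n fm fi] unfolding N_def by blast
  show "\<exists>P :: real poly. degree P <= n - 1 \<and> (\<forall>\<Omega>\<ge>0.
   (\<forall>h. 0 < h --> h <= t --> (AE y\<in>{-1..1} in lborel. \<bar>sym_diff r (h * phi y) f y\<bar> * weight_n w n y <= \<Omega>)) -->
   (AE x\<in>{-1..1} in lborel. (apx_err r n f P x) * weight_n w n x <= C * \<Omega>))"
   unfolding v_def[symmetric]
  proof (intro exI[of _ P] conjI degP allI impI)
   fix \<Omega> :: real
   assume \<Omega>: "0 <= \<Omega>" and hyp: "\<forall>h. 0 < h --> h <= t --> (AE y\<in>{-1..1} in lborel. \<bar>sym_diff r (h * phi y) f y\<bar> * v y <= \<Omega>)"
   \<comment> \<open>Indicators instead of sets: \<open>Bad\<close> lives on pairs of a centre and a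
     step, \<open>G\<close> on pairs of a centre and \<open>h\<close>. Measurability and Fubini then
     apply directly, and being null means having integral \<open>0\<close>.\<close>
   define Bad where "Bad y s = (if (\<exists>k\<in>{..<N}. ?a N k y s) \<and> \<Omega> < cdiff r f y s * v y then 1 else (0::ennreal))" for y s
   have Badm[measurable]: "(\<lambda>x. Bad (g x) (h x)) \<in> borel_measurable Mx"
    if [measurable]: "g \<in> borel_measurable Mx" "h \<in> borel_measurable Mx" for g h and Mx :: "'z measure"
    unfolding Bad_def by measurable
   define G where "G y h = (if y \<in> {-1..1} \<and> 0 < h \<and> h <= t \<and> \<Omega> < \<bar>sym_diff r (h * phi y) f y\<bar> * v y then 1 else (0::ennreal))" for y h
   have Gm[measurable]: "(\<lambda>p. G (fst p) (snd p)) \<in> borel_measurable (borel \<Otimes>\<^sub>M borel)"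
    unfolding G_def by measurable
   have G0: "(\<integral>y. \<integral>h. G y h) = 0"
   proof -
    have "(\<integral>y. G y h) = 0" for h
    proof (cases "0 < h \<and> h <= t")
     case True
     then have "AE y\<in>{-1..1} in lborel. \<bar>sym_diff r (h * phi y) f y\<bar> * v y <= \<Omega>" using hyp by blast
     then have "AE y in lborel. G y h = 0" by eventually_elim (auto simp: G_def)
     then have "(\<integral>y. G y h) = (\<integral>\<^sup>+y. 0 \<partial>(lborel :: real measure))" by (rule nn_integral_cong_AE)
     then show ?thesis by simp
    next
     case False
     then have "G y h = 0" for y unfolding G_def by auto
     then show ?thesis by simp
    qed
    then have "(\<integral>h. \<integral>y. G y h) = 0" by simp
    then show ?thesis using lborel_swap[of "\<lambda>p. G (fst p) (snd p)"] by simp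
   qed
   \<comment> \<open>The Jacobian \<open>phi y\<close> of \<open>s = h * phi y\<close> is at most
     \<open>1\<close>.\<close>
   have BadG: "(\<integral>s. Bad y s) <= (\<integral>h. G y h)" for y
   proof (cases "\<exists>s. \<exists>k\<in>{..<N}. ?a N k y s")
    case False
    then have "Bad y s = 0" for s unfolding Bad_def by auto
    then show ?thesis by simp
   next
    case True
    then obtain s0 k0 where k0: "k0 < N" "?a N k0 y s0" by blast
    note D = in_cellD(2-4)[OF N(1) k0(1) r k0(2)]
    have y: "y \<in> {-1..1}" by (rule cell_arccos(1)[OF N(1) k0(1) D(1,2)])
    have ph: "phi y <= 1" unfolding phi_def by simp
    have "(\<integral>s. Bad y s) = ennreal (phi y) * (\<integral>h. Bad y (h * phi y))"
     using nn_integral_real_affine[of "\<lambda>s. Bad y s" "phi y" 0] D(3) by (simp add: mult.commute)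
    also have "... <= 1 * (\<integral>h. Bad y (h * phi y))"
     using ph by (intro mult_right_mono) (auto simp: ennreal_le_1)
    also have "... <= (\<integral>h. G y h)"
     unfolding mult_1
    proof (rule nn_integral_mono)
     fix h
     show "Bad y (h * phi y) <= G y h"
     proof (cases "\<exists>k\<in>{..<N}. ?a N k y (h * phi y)")
      case True
      then obtain k where k: "k < N" "?a N k y (h * phi y)" by auto
      note E = in_cellD[OF N(1) k(1) r k(2)]
      have "0 < h" using E(1,4) by (simp add: zero_less_mult_iff)
      moreover have "16 / real N <= t" using t by (simp add: N_def)
      then have "h * phi y <= t * phi y" using E(5) mult_right_mono[OF _ less_imp_le[OF E(4)], of "16 / real N" t] by simp
      then have "h <= t" using E(4) by simp
      ultimately show ?thesis using y unfolding Bad_def G_def by (simp add: E(6)[of f])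
     qed (auto simp: Bad_def)
    qed
    finally show ?thesis .
   qed
   have Bad0: "(\<integral>y. \<integral>s. Bad y s) = 0"
    using nn_integral_mono[of lborel "\<lambda>y. \<integral>s. Bad y s" "\<lambda>y. \<integral>h. G y h"] BadG G0 by simp
   \<comment> \<open>A null set of the plane stays null under a shear, so almost every line of
     differences with \<open>x\<close> as first node (\<open>c = r / 2\<close>), last node
     (\<open>c = - r / 2\<close>) or centre (\<open>c = 0\<close>) meets it in a null set.\<close>
   have AEs: "AE x in lborel. AE s in lborel. Bad (x + c * s) s = 0" for c
   proof -
    have "(\<integral>x. \<integral>s. Bad (x + c * s) s) = 0"
     using lborel_shear[of Bad c] Bad0 by (simp add: case_prod_beta')
    then have "AE x in lborel. (\<integral>s. Bad (x + c * s) s) = 0"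
     by (subst (asm) nn_integral_0_iff_AE) measurable
    then show ?thesis
     by eventually_elim (subst (asm) nn_integral_0_iff_AE, auto)
   qed
   have good: "cdiff r f y s * v y <= \<Omega>" if "Bad y s = 0" "k < N" "?a N k y s" for k y s
    using that unfolding Bad_def by (auto split: if_splits)
   show "AE x\<in>{-1..1} in lborel. (apx_err r n f P x) * v x <= C * \<Omega>"
    using AEs[of "real r / 2"] AEs[of "- real r / 2"]
   proof eventually_elim
    case (elim x)
    show ?case
    proof
     assume "x \<in> {-1..1}"
     then obtain j where j: "j < N" and x: "cos (grid N (Suc j)) <= x" "x <= cos (grid N j)" using subcells_cover[OF N(1)] by auto
     note a = subcell_arccos[OF N(1) j x]
     have cx: "cos (arccos x) = x" using a(1) by simp
     have x0: "0 <= v x" using v0 a(1) by auto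
     define F where "F = apx_err r n f P x"
     have rx: "0 <= rho n x ^ r * \<bar>poly ((pderiv ^^ r) P) x\<bar>" using rho_pos[OF a(1) n0] by simp
     then have F0: "0 <= F" unfolding F_def by simp
     have wv: "v x <= cv * dd k j ^ (2 * s + 1) * v y" if "k < N" "?a N k y s'" for k y s'
      unfolding v_def cv_def
      by (rule cell_weight[OF N(1) dw L s n0 N(2) j x that(1) in_cellD(2,3)[OF N(1) that(1) r that(2)]])
     have pt: "v x * cdiff r f y s' <= cv * dd k j ^ (2 * s + 1) * \<Omega>" if "Bad y s' = 0" "k < N" "?a N k y s'" for k y s'
     proof -
      have "v x * cdiff r f y s' <= cv * dd k j ^ (2 * s + 1) * v y * cdiff r f y s'"
       by (intro mult_right_mono wv[OF that(2,3)] cdiff_nonneg)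
      also have "... = cv * dd k j ^ (2 * s + 1) * (cdiff r f y s' * v y)" by simp
      also have "... <= cv * dd k j ^ (2 * s + 1) * \<Omega>"
       using cv dd_pos[of k j] good[OF that] by (intro mult_left_mono) auto
      finally show ?thesis .
     qed
     let ?l = "cell_len N j"
     have l: "0 < ?l" by (rule cell_bounds(5)[OF N(1) j])
     have sh: "ennreal (v x) * (ennreal (1 / ?l) * (\<integral>s. (if ?a N j (x + c * s) s then ennreal (?b f x c s) else 0))) <= ?c cv \<Omega>"
      if "AE s in lborel. Bad (x + c * s) s = 0" for c
     proof -
      have "ennreal (v x) * (\<integral>s. (if ?a N j (x + c * s) s then ennreal (?b f x c s) else 0))
       = (\<integral>s. ennreal (v x) * (if ?a N j (x + c * s) s then ennreal (?b f x c s) else 0))"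
       by (rule nn_integral_cmult[symmetric]) measurable
      also have "... <= (\<integral>s. ?c cv \<Omega> * indicator {0..?l} s)"
      proof (rule nn_integral_mono_AE)
       show "AE s in lborel. ennreal (v x) * (if ?a N j (x + c * s) s then ennreal (?b f x c s) else 0) <= ?c cv \<Omega> * indicator {0..?l} s"
        using that
       proof eventually_elim
        case (elim s')
        show ?case
        proof (cases "?a N j (x + c * s') s'")
         case True
         have "v x * ?b f x c s' <= cv * \<Omega>" using pt[OF elim j True] by (simp add: dd_def)
         then have "ennreal (v x * ?b f x c s') <= ?c cv \<Omega>" by (rule ennreal_leI)
         then show ?thesis using True x0 in_cellD(1,7)[OF N(1) j r True] by (simp add: ennreal_mult cdiff_nonneg)
        qed simp
       qed
      qed
      also have "... = ?c cv \<Omega> * ennreal ?l" using l by (simp add: nn_integral_cmult)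
      finally have "ennreal (1 / ?l) * (ennreal (v x) * (\<integral>s. (if ?a N j (x + c * s) s then ennreal (?b f x c s) else 0))) <= ennreal (1 / ?l) * (?c cv \<Omega> * ennreal ?l)"
       by (rule mult_left_mono) simp
      also have "... = ?c cv \<Omega>" using l cv \<Omega> by (simp add: ennreal_mult[symmetric])
      finally show ?thesis by (simp only: mult_ac)
     qed
     have e: "x + real r * s / 2 = x + real r / 2 * s" "x - real r * s / 2 = x + (- real r / 2) * s" for s by simp_all
     have Av: "ennreal (v x) * (ennreal (1 / ?l) * ?e f N j x) <= ?c cv \<Omega>"
      unfolding fwd_cell e(1) by (rule sh[OF elim(1)])
     have Bv: "ennreal (v x) * (ennreal (1 / ?l) * ?f f N j x) <= ?c cv \<Omega>"
      unfolding bwd_cell e(2) by (rule sh[OF elim(2)])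
     have Sv: "ennreal (v x) * (?g Q f N j) <= ennreal (4 * cv * \<Omega>)"
     proof -
      have "ennreal (v x) * (?g Q f N j) = (\<Sum>k<N. ennreal (1 / dd k j ^ Q) * (?h N k * (ennreal (v x) * ?d f N k)))"
       unfolding sum_distrib_left cell_eps_def by (simp only: mult_ac)
      also have "... <= (\<Sum>k<N. ennreal (cv * \<Omega> * (1 / (dd k j)^2)))"
      proof (rule sum_mono)
       fix k assume "k \<in> {..<N}"
       then have k: "k < N" by simp
       define d where "d = cv * dd k j ^ (2 * s + 1) * \<Omega>"
       have d0: "0 <= d" unfolding d_def using cv dd_pos[of k j] \<Omega> by simp
       have lk: "0 < cell_len N k" by (rule cell_bounds(5)[OF N(1) k])
       have "ennreal (v x) * ?d f N k = (\<integral>y. \<integral>s. ennreal (v x) * (if ?a N k y s then ennreal (cdiff r f y s) else 0))"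
        unfolding tot_cell[OF fm] by (simp add: nn_integral_cmult)
       also have "... <= (\<integral>y. \<integral>s. ennreal d * (if ?a N k y s then 1 else 0))"
       proof (rule nn_integral_mono_AE)
        show "AE y in lborel. (\<integral>s. ennreal (v x) * (if ?a N k y s then ennreal (cdiff r f y s) else 0)) <= (\<integral>s. ennreal d * (if ?a N k y s then 1 else 0))"
         using AEs[of 0]
        proof eventually_elim
         case (elim y)
         show ?case
         proof (rule nn_integral_mono_AE)
          show "AE s in lborel. ennreal (v x) * (if ?a N k y s then ennreal (cdiff r f y s) else 0) <= ennreal d * (if ?a N k y s then 1 else 0)"
           using elim
          proof eventually_elim
           case (elim s')
           show ?case
           proof (cases "?a N k y s'")
            case True
            have "v x * cdiff r f y s' <= d" unfolding d_def using pt[OF _ k True] elim by simp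
            then have "ennreal (v x * cdiff r f y s') <= ennreal d" by (rule ennreal_leI)
            then show ?thesis using True x0 by (simp add: ennreal_mult cdiff_nonneg)
           qed simp
          qed
         qed
        qed
       qed
       also have "... = ennreal d * (\<integral>y. \<integral>s. (if ?a N k y s then 1 else 0))"
        by (simp add: nn_integral_cmult)
       also have "... <= ennreal d * ennreal ((cell_len N k)^2)" by (intro mult_left_mono in_cell_area[OF N(1) k r]) simp
       finally have "ennreal (1 / dd k j ^ Q) * (?h N k * (ennreal (v x) * ?d f N k))
         <= ennreal (1 / dd k j ^ Q) * (?h N k * (ennreal d * ennreal ((cell_len N k)^2)))"
        by (intro mult_left_mono) auto
       also have "... = ennreal (1 / dd k j ^ Q * (1 / (cell_len N k)^2 * (d * (cell_len N k)^2)))"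
        using d0 dd_pos[of k j] by (simp only: ennreal_mult[symmetric] zero_le_power2 less_imp_le zero_le_divide_1_iff zero_le_power mult_nonneg_nonneg)
       also have "1 / dd k j ^ Q * (1 / (cell_len N k)^2 * (d * (cell_len N k)^2)) = cv * \<Omega> * (1 / (dd k j)^2)"
        unfolding d_def Q_def using lk dd_pos[of k j] by (simp add: power_add power2_eq_square power3_eq_cube)
       finally show "ennreal (1 / dd k j ^ Q) * (?h N k * (ennreal (v x) * ?d f N k)) <= ennreal (cv * \<Omega> * (1 / (dd k j)^2))" .
      qed
      also have "... = ennreal (cv * \<Omega> * (\<Sum>k<N. 1 / (dd k j)^2))"
       unfolding sum_distrib_left using cv \<Omega> by (intro sum_ennreal) auto
      also have "... <= ennreal (4 * cv * \<Omega>)"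
       using mult_left_mono[OF sum_dd_squares[of j N], of "cv * \<Omega>"] cv \<Omega> by (intro ennreal_leI) (simp add: mult_ac)
      finally show ?thesis .
     qed
     have "ennreal F <= ennreal C0 * (ennreal (1 / ?l) * ?e f N j x + ennreal (1 / ?l) * ?f f N j x + (?g Q f N j))"
      using P[OF j a(2,3)] rx unfolding F_def cx by (simp add: ennreal_plus distrib_left)
     then have "ennreal (v x) * ennreal F <= ennreal (v x) * (ennreal C0 * (ennreal (1 / ?l) * ?e f N j x + ennreal (1 / ?l) * ?f f N j x + (?g Q f N j)))"
      by (rule mult_left_mono) simp
     also have "... = ennreal C0 * (ennreal (v x) * (ennreal (1 / ?l) * ?e f N j x) + ennreal (v x) * (ennreal (1 / ?l) * ?f f N j x) + ennreal (v x) * (?g Q f N j))"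
      by (simp only: distrib_left mult.left_commute[of "ennreal (v x)" "ennreal C0"])
     also have "... <= ennreal C0 * (?c cv \<Omega> + ?c cv \<Omega> + ennreal (4 * cv * \<Omega>))"
      by (intro mult_left_mono add_mono Av Bv Sv) simp
     also have "... = ?c C \<Omega>"
      unfolding C_def using C0 cv \<Omega> by (simp add: ennreal_mult[symmetric] flip: ennreal_plus)
     finally have "ennreal (F * v x) <= ?c C \<Omega>" using F0 x0 by (simp add: ennreal_mult mult.commute)
     then show "(apx_err r n f P x) * v x <= C * \<Omega>"
      unfolding F_def[symmetric] using C \<Omega> by (subst (asm) ennreal_le_iff) auto
    qed
   qed
  qed
 qed
qed

section \<open>Differences with step \<open>h * phi x\<close> and null sets\<close>

lemma phi_nonneg: "x \<in> {-1..1} ==> 0 <= phi x"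
 by (auto simp: phi_def abs_square_le_1 abs_le_iff)

lemma phi_squared: "x \<in> {-1..1} ==> (phi x)^2 = (1 - x) * (1 + x)"
proof -
 assume "x \<in> {-1..1}"
 then have "x^2 <= 1" by (auto simp: abs_square_le_1 abs_le_iff)
 then have "(phi x)^2 = 1 - x^2" by (simp add: phi_def)
 then show ?thesis by (simp add: power2_eq_square algebra_simps)
qed

definition diff_domain :: "real => real set" where
 "diff_domain c = {x \<in> {-1..1}. -1 <= x - c * phi x \<and> x + c * phi x <= 1}"

lemma diff_domain_measurable[measurable]: "diff_domain c \<in> sets borel"
proof -
 have "diff_domain c = {x \<in> space borel. x \<in> {-1..1} \<and> -1 <= x - c * phi x \<and> x + c * phi x <= 1}"
  unfolding diff_domain_def by auto
 then show ?thesis by simp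
qed

lemma diff_domainD:
 assumes "x \<in> diff_domain c" shows "x \<in> {-1..1}" "c * phi x <= 1 - \<bar>x\<bar>"
 using assms unfolding diff_domain_def by auto

text \<open>The two endpoints are excluded because \<open>phi\<close> vanishes there and the
  condition is void. Otherwise the factor \<open>1 - \<bar>x\<bar>\<close> of
  \<open>phi x ^ 2\<close> cancels and the condition becomes linear in
  \<open>\<bar>x\<bar>\<close>.\<close>

lemma diff_domain_subset:
 assumes c: "0 < c" and x: "x \<in> diff_domain c" "x \<noteq> -1" "x \<noteq> 1"
 shows "\<bar>x\<bar> <= (1 - c^2) / (1 + c^2)"
proof -
 note d = diff_domainD[OF x(1)]
 have a: "\<bar>x\<bar> < 1" using d(1) x by auto
 have "(c * phi x)^2 <= (1 - \<bar>x\<bar>)^2" using d c phi_nonneg[OF d(1)] by (intro power_mono) auto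
 moreover have "(phi x)^2 = (1 - \<bar>x\<bar>) * (1 + \<bar>x\<bar>)" unfolding phi_squared[OF d(1)] by (cases "0 <= x") auto
 ultimately have "(1 - \<bar>x\<bar>) * (c^2 * (1 + \<bar>x\<bar>)) <= (1 - \<bar>x\<bar>) * (1 - \<bar>x\<bar>)"
  by (simp add: power_mult_distrib power2_eq_square[of "1 - \<bar>x\<bar>"] mult_ac)
 then have "c^2 * (1 + \<bar>x\<bar>) <= 1 - \<bar>x\<bar>" using a by (simp add: mult_le_cancel_left)
 then have "\<bar>x\<bar> * (1 + c^2) <= 1 - c^2" by (simp add: algebra_simps)
 moreover have "0 < 1 + c^2" by (simp add: add_pos_nonneg)
 ultimately show ?thesis by (simp add: pos_le_divide_eq)
qed

lemma diff_domain_node: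
 assumes "x \<in> diff_domain c" "\<bar>\<kappa>\<bar> <= c" shows "x + \<kappa> * phi x \<in> {-1..1}"
proof -
 have p: "0 <= phi x" using phi_nonneg diff_domainD(1)[OF assms(1)] .
 have "\<kappa> * phi x <= c * phi x" "- c * phi x <= \<kappa> * phi x" using assms(2) p by (intro mult_right_mono; simp)+
 then show ?thesis using assms(1) unfolding diff_domain_def by auto
qed

text \<open>Substitution along the node map \<open>x + \<kappa> * phi x\<close>. Its derivative
  degenerates at the endpoints in general, but on \<open>diff_domain c\<close> it is at least
  \<open>1/2\<close>, whence the factor \<open>2\<close>.\<close>

lemma nn_integral_node_shift:
 assumes c: "0 < c" and \<kappa>: "\<bar>\<kappa>\<bar> <= c" and [measurable]: "F \<in> borel_measurable borel"
 shows "(\<integral>x\<in>diff_domain c. F (x + \<kappa> * phi x)) <= 2 * (\<integral>x\<in>{-1..1}. F x)"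
proof -
 let ?a = "\<lambda>x. 1 - \<bar>x\<bar>"
 let ?b = "\<integral>x\<in>diff_domain c. F (x + \<kappa> * phi x)"
 let ?c = "\<lambda>x. 1 + \<bar>x\<bar>"
 define b where "b = (1 - c^2) / (1 + c^2)"
 have cc: "0 < c^2" using c by simp
 have b1: "b < 1" unfolding b_def using cc by (simp add: divide_less_eq add_pos_pos)
 define g where "g x = x + \<kappa> * phi x" for x
 define g' where "g' x = 1 - \<kappa> * x / phi x" for x
 have AEb: "AE x\<in>diff_domain c in lborel. x \<in> {-b..b}"
 proof -
  have "AE x in lborel. x \<noteq> (-1::real)" "AE x in lborel. x \<noteq> (1::real)" by (rule AE_lborel_singleton)+
  then show ?thesis
  proof (eventually_elim, intro impI)
   fix x assume "x \<noteq> -1" "x \<noteq> 1" "x \<in> diff_domain c"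
   then have "\<bar>x\<bar> <= b" unfolding b_def by (intro diff_domain_subset[OF c])
   then show "x \<in> {-b..b}" by auto
  qed
 qed
 show ?thesis
 proof (cases "0 < b")
  case False
  \<comment> \<open>For \<open>c >= 1\<close> the domain is contained in a null set: at most the
    endpoints and the origin.\<close>
  have "AE x in lborel. x \<noteq> (0::real)" by (rule AE_lborel_singleton)
  with AEb have "AE x in lborel. F (x + \<kappa> * phi x) * indicator (diff_domain c) x = 0"
   by eventually_elim (use False in \<open>auto simp: indicator_def\<close>)
  then have "?b = (\<integral>\<^sup>+x. 0 \<partial>(lborel :: real measure))"
   by (rule nn_integral_cong_AE)
  then show ?thesis by simp
 next
  case True
  have ph: "0 < phi x" if "x \<in> {-b..b}" for x
  proof -
   have "\<bar>x\<bar> < 1" using that b1 by auto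
   then have "x^2 < 1" by (simp add: abs_square_less_1)
   then show ?thesis by (simp add: phi_def)
  qed
  have dom: "c * phi x <= 1 - \<bar>x\<bar>" if x: "x \<in> {-b..b}" for x
  proof -
   have a: "\<bar>x\<bar> <= b" "\<bar>x\<bar> < 1" "x \<in> {-1..1}" using x b1 by auto
   have "\<bar>x\<bar> * (1 + c^2) <= 1 - c^2" using a(1) cc unfolding b_def by (simp add: pos_le_divide_eq add_pos_pos)
   then have "c^2 * (?c x) <= 1 - \<bar>x\<bar>" by (simp add: algebra_simps)
   then have "(?a x) * (c^2 * (?c x)) <= (?a x) * (?a x)" using a by (intro mult_left_mono) auto
   moreover have "(phi x)^2 = (?a x) * (?c x)" unfolding phi_squared[OF a(3)] by (cases "0 <= x") auto
   ultimately have "(c * phi x)^2 <= (?a x)^2"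
    by (simp add: power_mult_distrib power2_eq_square[of "1 - \<bar>x\<bar>"] mult_ac)
   then show ?thesis by (rule power2_le_imp_le) (use a in auto)
  qed
  \<comment> \<open>After multiplying numerator and denominator by \<open>phi x\<close>, the domain
    condition \<open>c * phi x <= 1 - \<bar>x\<bar>\<close> cancels a factor of
    \<open>phi x ^ 2\<close> and leaves
    \<open>\<bar>x\<bar> / (1 + \<bar>x\<bar>) <= 1/2\<close>.\<close>
  have g'half: "1 / 2 <= g' x" if x: "x \<in> {-b..b}" for x
  proof -
   have a: "\<bar>x\<bar> < 1" "x \<in> {-1..1}" using x b1 by auto
   have "\<bar>\<kappa> * x / phi x\<bar> = \<bar>\<kappa>\<bar> * \<bar>x\<bar> / phi x" using ph[OF x] by (simp add: abs_mult)
   also have "... <= c * \<bar>x\<bar> / phi x" using \<kappa> ph[OF x] by (intro divide_right_mono mult_right_mono) auto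
   also have "... = (c * phi x) * \<bar>x\<bar> / (phi x)^2" using ph[OF x] by (simp add: power2_eq_square)
   also have "... <= (?a x) * \<bar>x\<bar> / (phi x)^2" using dom[OF x] by (intro divide_right_mono mult_right_mono) auto
   also have "(phi x)^2 = (?a x) * (?c x)" unfolding phi_squared[OF a(2)] by (cases "0 <= x") auto
   also have "(?a x) * \<bar>x\<bar> / ((?a x) * (?c x)) = \<bar>x\<bar> / (?c x)" using a by simp
   also have "... <= 1 / 2" using a by (simp add: divide_le_eq)
   finally have "\<bar>\<kappa> * x / phi x\<bar> <= 1 / 2" .
   then show ?thesis unfolding g'_def by (simp only: abs_le_iff) linarith
  qed
  have gin: "g x \<in> {-1..1}" if x: "x \<in> {-b..b}" for x
  proof -
   have "x \<in> diff_domain c" using dom[OF x] x b1 unfolding diff_domain_def by auto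
   then show ?thesis unfolding g_def by (rule diff_domain_node[OF _ \<kappa>])
  qed
  have sub: "(\<integral>x. F x * indicator {g (-b)..g b} x) = (\<integral>x. F (g x) * ennreal (g' x) * indicator {-b..b} x)"
  proof (rule nn_integral_substitution_aux)
   fix x assume x: "x \<in> {-b..b}"
   have "0 < 1 - x^2" using ph[OF x] by (simp add: phi_def)
   then show "(g has_real_derivative g' x) (at x)"
    unfolding g_def[abs_def] g'_def phi_def[abs_def] by (auto intro!: derivative_eq_intros simp: field_simps)
   show "0 <= g' x" using g'half[OF x] by simp
  next
   have nz: "\<forall>x\<in>{-b..b}. phi x \<noteq> 0"
   proof
    fix x assume "x \<in> {-b..b}"
    then show "phi x \<noteq> 0" using ph[of x] by simp
   qed
   have "continuous_on {-b..b} phi" unfolding phi_def[abs_def] by (intro continuous_intros)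
   then show "continuous_on {-b..b} g'" unfolding g'_def[abs_def]
    by (intro continuous_intros nz)
  qed (use True in auto)
  have "?b <= (\<integral>x. 2 * (F (g x) * ennreal (g' x) * indicator {-b..b} x))"
  proof (rule nn_integral_mono_AE)
   show "AE x in lborel. F (x + \<kappa> * phi x) * indicator (diff_domain c) x <= 2 * (F (g x) * ennreal (g' x) * indicator {-b..b} x)"
    using AEb
   proof eventually_elim
    case (elim x)
    show ?case
    proof (cases "x \<in> diff_domain c")
     case True
     then have x: "x \<in> {-b..b}" using elim by simp
     have "1 <= ennreal (2 * g' x)" using g'half[OF x] by (simp flip: ennreal_1)
     then have "F (g x) * 1 <= F (g x) * ennreal (2 * g' x)" by (rule mult_left_mono) simp
     also have "ennreal (2 * g' x) = 2 * ennreal (g' x)" using g'half[OF x] by (simp add: ennreal_mult)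
     finally show ?thesis using True x unfolding g_def by (simp add: mult_ac)
    qed simp
   qed
  qed
  also have "... = 2 * (\<integral>x. F (g x) * ennreal (g' x) * indicator {-b..b} x)"
   unfolding g_def g'_def by (rule nn_integral_cmult) measurable
  also have "... = 2 * (\<integral>x. F x * indicator {g (-b)..g b} x)" unfolding sub ..
  also have "... <= 2 * (\<integral>x\<in>{-1..1}. F x)"
   using gin[of "-b"] gin[of b] True by (intro mult_left_mono nn_integral_mono) (auto simp: indicator_def)
  finally show ?thesis .
 qed
qed

text \<open>The node map pulls null sets back to null sets: \<open>nn_integral_node_shift\<close>
  applied to the indicator of an exceptional set.\<close>

lemma AE_node_shift:
 assumes c: "0 < c" and \<kappa>: "\<bar>\<kappa>\<bar> <= c" and P: "AE x\<in>{-1..1} in lborel. P x"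
 shows "AE x\<in>diff_domain c in lborel. P (x + \<kappa> * phi x)"
proof -
 obtain Z where Z: "{x \<in> space lborel. \<not> (x \<in> {-1..1} --> P x)} \<subseteq> Z" "emeasure lborel Z = 0" "Z \<in> sets lborel"
  using P by (rule AE_E)
 have [measurable]: "Z \<in> sets borel" using Z(3) by simp
 have "(\<integral>x\<in>{-1..1}. indicator Z x) <= (\<integral>x. indicator Z x)"
  by (intro nn_integral_mono) (auto simp: indicator_def)
 also have "... = 0" using Z by simp
 finally have 0: "(\<integral>x\<in>{-1..1}. indicator Z x) = 0" by simp
 have "(\<integral>x\<in>diff_domain c. indicator Z (x + \<kappa> * phi x)) <= 2 * (\<integral>x\<in>{-1..1}. indicator Z x)"
  by (rule nn_integral_node_shift[OF c \<kappa>]) measurable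
 then have "(\<integral>x\<in>diff_domain c. indicator Z (x + \<kappa> * phi x)) = 0" using 0 by simp
 then have "AE x in lborel. indicator Z (x + \<kappa> * phi x) * indicator (diff_domain c) x = (0::ennreal)"
  by (subst (asm) nn_integral_0_iff_AE) measurable
 then show ?thesis
 proof eventually_elim
  case (elim x)
  show ?case
  proof
   assume x: "x \<in> diff_domain c"
   then have "x + \<kappa> * phi x \<notin> Z" using elim by (auto simp: indicator_def)
   then show "P (x + \<kappa> * phi x)" using Z(1) diff_domain_node[OF x \<kappa>] by auto
  qed
 qed
qed

lemma sym_diff_domain:
 assumes h: "0 < h" and x: "x \<in> {-1..1}"
 shows "sym_diff r (h * phi x) f x = (if x \<in> diff_domain (real r * h / 2)
  then \<Sum>i=0..r. real (r choose i) * (-1) ^ (r - i) * f (x + ((real i - real r / 2) * h) * phi x) else 0)"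
proof -
 have n: "0 <= real r * h / 2 * phi x" using h phi_nonneg[OF x] by simp
 have "(x - real r * (h * phi x) / 2 \<in> {-1..1} \<and> x + real r * (h * phi x) / 2 \<in> {-1..1}) = (x \<in> diff_domain (real r * h / 2))"
  using x n unfolding diff_domain_def by (auto simp: mult.assoc)
 moreover have "x - real r * (h * phi x) / 2 + real i * (h * phi x) = x + ((real i - real r / 2) * h) * phi x" for i
  by (simp add: algebra_simps)
 ultimately show ?thesis unfolding sym_diff_def by (simp only:)
qed

text \<open>Makes the moduli independent of the representative of \<open>f\<close>, although the
  difference evaluates \<open>f\<close> at points that vary with \<open>x\<close>.\<close>

lemma AE_sym_diff_cong:
 assumes h: "0 < h" and r: "1 <= r" and fg: "AE x\<in>{-1..1} in lborel. f x = g x"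
 shows "AE x\<in>{-1..1} in lborel. sym_diff r (h * phi x) f x = sym_diff r (h * phi x) g x"
proof -
 define c where "c = real r * h / 2"
 have c: "0 < c" unfolding c_def using h r by simp
 have "AE x\<in>diff_domain c in lborel. f (x + ((real i - real r / 2) * h) * phi x) = g (x + ((real i - real r / 2) * h) * phi x)"
  if "i \<in> {0..r}" for i
 proof (rule AE_node_shift[OF c _ fg])
  have "\<bar>real i - real r / 2\<bar> * h <= real r / 2 * h" using that h by (intro mult_right_mono) (auto simp: abs_le_iff field_simps)
  then show "\<bar>(real i - real r / 2) * h\<bar> <= c" unfolding c_def using h by (simp add: abs_mult)
 qed
 then have "AE x in lborel. \<forall>i\<in>{0..r}. x \<in> diff_domain c --> f (x + ((real i - real r / 2) * h) * phi x) = g (x + ((real i - real r / 2) * h) * phi x)"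
  by (intro AE_finite_allI) auto
 then show ?thesis
  by eventually_elim (auto simp: sym_diff_domain[OF h] c_def intro!: sum.cong)
qed

lemma phi_n_rho: "0 < n ==> phi_n n x = real n * rho n x"
 by (simp add: phi_n_def phi_def rho_def field_simps power2_eq_square)

lemma wnorm_sym_diff_powr:
 assumes p: "1 <= p" "p \<noteq> top" and h: "0 < h" and r: "1 <= r"
  and fg: "AE x\<in>{-1..1} in lborel. f x = f' x" and [measurable]: "f' \<in> borel_measurable borel" "v \<in> borel_measurable borel"
 shows "ennreal_powr (wnorm p v (\<lambda>x. sym_diff r (h * phi x) f x)) (enn2real p)
  = (\<integral>y\<in>{-1..1}. ennreal (\<bar>sym_diff r (h * phi y) f' y\<bar> powr enn2real p * v y))"
 unfolding wnorm_powr[OF p]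
proof (rule nn_integral_lebesgue_on_borel)
 show "AE x\<in>{-1..1} in lborel. ennreal (\<bar>sym_diff r (h * phi x) f x\<bar> powr enn2real p * v x) = ennreal (\<bar>sym_diff r (h * phi x) f' x\<bar> powr enn2real p * v x)"
  using AE_sym_diff_cong[OF h r fg] by eventually_elim auto
qed measurable

lemma omega_phi_avg_eq:
 assumes p: "1 <= p" "p \<noteq> top" and r: "1 <= r"
  and fg: "AE x\<in>{-1..1} in lborel. f x = f' x" and [measurable]: "f' \<in> borel_measurable borel" "v \<in> borel_measurable borel"
 shows "omega_phi_avg r f t p v = ennreal_powr (ennreal (1 / t) * (\<integral>h\<in>{0..t}. (\<integral>y\<in>{-1..1}. ennreal (\<bar>sym_diff r (h * phi y) f' y\<bar> powr enn2real p * v y)))) (1 / enn2real p)"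
proof -
 let ?G = "\<lambda>h. \<integral>y\<in>{-1..1}. ennreal (\<bar>sym_diff r (h * phi y) f' y\<bar> powr enn2real p * v y)"
 have "AE h in lborel. h \<noteq> (0::real)" by (rule AE_lborel_singleton)
 then have "AE h in lebesgue. h \<noteq> (0::real)" by (rule AE_completion)
 then have "AE h in lebesgue. ennreal_powr (wnorm p v (\<lambda>x. sym_diff r (h * phi x) f x)) (enn2real p) * indicator {0..t} h = ?G h * indicator {0..t} h"
 proof eventually_elim
  case (elim h)
  show ?case
  proof (cases "h \<in> {0..t}")
   case True
   then have "0 < h" using elim by simp
   then show ?thesis using wnorm_sym_diff_powr[OF p _ r fg, of h v] by simp
  qed simp
 qed
 then have "(\<integral>\<^sup>+h\<in>{0..t}. ennreal_powr (wnorm p v (\<lambda>x. sym_diff r (h * phi x) f x)) (enn2real p) \<partial>lebesgue) = (\<integral>\<^sup>+h\<in>{0..t}. ?G h \<partial>lebesgue)"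
  by (rule nn_integral_cong_AE)
 also have "... = (\<integral>h\<in>{0..t}. ?G h)" by (rule nn_integral_completion)
 finally show ?thesis using p by (simp add: omega_phi_avg_def)
qed

text \<open>Measurability has to be assumed, because \<open>esssup\<close> is \<open>top\<close> on
  functions that are not measurable.\<close>

lemma wnorm_top_le:
 assumes "(\<lambda>x. ennreal (\<bar>g x\<bar> * v x)) \<in> borel_measurable leb"
  and "AE x\<in>{-1..1} in lborel. ennreal (\<bar>g x\<bar> * v x) <= c"
 shows "wnorm top v g <= c"
 using assms AE_lborel_imp_lebesgue_on[OF assms(2)] by (simp add: wnorm_def esssup_I)

lemma wnorm_top_AE: "AE x\<in>{-1..1} in lborel. ennreal (\<bar>g x\<bar> * v x) <= wnorm top v g"
proof -
 have "AE x in leb. ennreal (\<bar>g x\<bar> * v x) <= wnorm top v g"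
  unfolding wnorm_def by (simp add: esssup_AE)
 then show ?thesis unfolding AE_lebesgue_on_iff by (simp add: AE_completion_iff)
qed

text \<open>On a bounded interval \<open>L_p\<close> lies in \<open>L_1\<close>, and the
  representative vanishes outside \<open>[-1, 1]\<close>; so it is integrable on the whole line, as
  Whitney's inequality requires.\<close>

lemma Lp_representative:
 assumes f: "f \<in> Lp p" and p: "1 <= p"
 obtains f' where "f' \<in> borel_measurable borel" "integrable lborel f'" "AE x\<in>{-1..1} in lborel. f x = f' x"
proof -
 let ?a = "wnorm p (\<lambda>_. 1) f"
 let ?b = "\<lambda>f' x q. ennreal (\<bar>f' x\<bar> powr q)"
 let ?c = "\<lambda>f'. \<integral>x. ennreal \<bar>f' x\<bar>"
 have fm: "f \<in> borel_measurable leb" and fn: "?a < top" using f by (auto simp: Lp_def)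
 obtain f' where f'[measurable]: "f' \<in> borel_measurable borel" and out: "\<And>x. x \<notin> {-1..1} ==> f' x = 0" and ff': "AE x\<in>{-1..1} in lborel. f x = f' x"
  using borel_representative[OF fm] by blast
 have "(?c f') < top"
 proof (cases "p = top")
  case True
  have "AE x in lborel. ennreal \<bar>f' x\<bar> <= ?a * indicator {-1..1} x"
   using ff' wnorm_top_AE[of f "\<lambda>_. 1"] by eventually_elim (use out True in \<open>auto split: split_indicator\<close>)
  then have "(?c f') <= (\<integral>\<^sup>+x. ?a * indicator {-1..1} x \<partial>(lborel :: real measure))"
   by (rule nn_integral_mono_AE)
  also have "... < top" using fn by (simp add: nn_integral_cmult_indicator ennreal_mult_less_top)
  finally show ?thesis .
 next
  case False
  define q where "q = enn2real p"
  have q: "1 <= q" unfolding q_def by (rule enn2real_exponent[OF p False])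
  have "(?c f') <= (\<integral>x. indicator {-1..1} x + ?b f' x q * indicator {-1..1} x)"
  proof (rule nn_integral_mono)
   fix x
   have "\<bar>f' x\<bar> <= 1 + \<bar>f' x\<bar> powr q" using young_powr[of 1 "\<bar>f' x\<bar>" q] q by simp
   then have "ennreal \<bar>f' x\<bar> <= 1 + ?b f' x q" by (simp flip: ennreal_plus ennreal_1)
   then show "ennreal \<bar>f' x\<bar> <= indicator {-1..1} x + ?b f' x q * indicator {-1..1} x"
    using out[of x] by (auto simp: indicator_def)
  qed
  also have "... = (\<integral>x. indicator {-1..1::real} x) + (\<integral>x\<in>{-1..1}. ?b f' x q)"
   by (rule nn_integral_add) auto
  also have "(\<integral>x\<in>{-1..1}. ?b f' x q) = ennreal_powr (?a) q"
   unfolding q_def wnorm_powr[OF p False] using ff' by (intro nn_integral_lebesgue_on_borel[symmetric]) (auto elim!: eventually_mono)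
  also have "(\<integral>x. indicator {-1..1::real} x) + ennreal_powr (?a) q < top"
   using fn by (cases "?a") (auto simp: ennreal_powr_ennreal)
  finally show ?thesis .
 qed
 then have "integrable lborel f'" by (intro integrableI_bounded) auto
 then show ?thesis using that f' ff' by blast
qed

section \<open>Absolutely continuous functions\<close>

definition osc :: "(real => real) => real set => ennreal" where
 "osc g I = (if I = {} then 0 else ennreal \<bar>g (Sup I) - g (Inf I)\<bar>)"

text \<open>\<open>S\<close> may be any set, and the divisions may leave gaps in it. This is what
  makes the variation superadditive over nonoverlapping sets and small on sets of small
  measure.\<close>

definition variation :: "(real => real) => real set => ennreal" where
 "variation g S = (SUP D\<in>{D. D division_of \<Union>D \<and> \<Union>D \<subseteq> S}. \<Sum>I\<in>D. osc g I)"

lemma osc_interval: "u <= v ==> osc g {u..v} = ennreal \<bar>g v - g u\<bar>"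
 by (simp add: osc_def)

lemma division_interval:
 fixes D :: "real set set"
 assumes "D division_of S" "I \<in> D" obtains u v where "u <= v" "I = {u..v}"
proof -
 have "I \<noteq> {}" "\<exists>a b. I = cbox a b" using division_ofD[OF assms(1)] assms(2) by blast+
 then show ?thesis using that by auto
qed

lemma division_osc_inter:
 fixes D :: "real set set"
 assumes D: "D division_of S" "I \<in> D" "J \<in> D" "I \<noteq> J" shows "osc g (I \<inter> J \<inter> {a..b}) = 0"
proof (cases "I \<inter> J \<inter> {a..b} = {}")
 case False
 obtain u v u' v' where uv: "I = {u..v}" "J = {u'..v'}" using division_interval[OF D(1)] D by metis
 have e: "I \<inter> J \<inter> {a..b} = {max (max u u') a..min (min v v') b}" unfolding uv by auto
 have "interior I \<inter> interior J = {}" using division_ofD(5)[OF D] .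
 then have "{max (max u u') a<..<min (min v v') b} = {}" unfolding uv by (auto simp: interior_atLeastAtMost_real set_eq_iff)
 then have "max (max u u') a = min (min v v') b" using False unfolding e by (simp only: atLeastatMost_empty_iff greaterThanLessThan_empty_iff) linarith
 then show ?thesis unfolding e by (simp add: osc_def)
qed (simp add: osc_def)

lemma variation_upper: "D division_of \<Union>D ==> \<Union>D \<subseteq> S ==> (\<Sum>I\<in>D. osc g I) <= variation g S"
 unfolding variation_def by (intro SUP_upper) auto

lemma osc_le_variation: "u <= v ==> ennreal \<bar>g v - g u\<bar> <= variation g {u..v}"
 using variation_upper[of "{{u..v}}" "{u..v}" g] by (simp add: osc_interval division_of_self[of u v, unfolded cbox_interval])

lemma variation_split:
 assumes c: "u <= c" "c <= v" shows "variation g {u..v} <= variation g {u..c} + variation g {c..v}"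
 unfolding variation_def[of g "{u..v}"]
proof (rule SUP_least)
 fix D :: "real set set" assume "D \<in> {D. D division_of \<Union>D \<and> \<Union>D \<subseteq> {u..v}}"
 then have D: "D division_of \<Union>D" and sub: "\<Union>D \<subseteq> {u..v}" by auto
 have fin: "finite D" using D by (rule division_of_finite)
 have cut: "(\<Sum>I\<in>D. osc g (I \<inter> {a..b})) <= variation g {a..b}" if ab: "a <= b" for a b
 proof -
  define E where "E = (\<lambda>I. I \<inter> {a..b}) ` D - {{}}"
  have "{{a..b}} division_of {a..b}" using ab division_of_self[of a b] by simp
  then have "{k1 \<inter> k2 |k1 k2. k1 \<in> D \<and> k2 \<in> {{a..b}} \<and> k1 \<inter> k2 \<noteq> {}} division_of \<Union>D \<inter> {a..b}"
   by (rule division_inter[OF D])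
  also have "{k1 \<inter> k2 |k1 k2. k1 \<in> D \<and> k2 \<in> {{a..b}} \<and> k1 \<inter> k2 \<noteq> {}} = E" unfolding E_def by auto
  also have "\<Union>D \<inter> {a..b} = \<Union>E" unfolding E_def by auto
  finally have E: "E division_of \<Union>E" .
  have "(\<Sum>I\<in>D. osc g (I \<inter> {a..b})) = (\<Sum>I\<in>(\<lambda>I. I \<inter> {a..b}) ` D. osc g I)"
  proof (subst sum.reindex_nontrivial[OF fin])
   fix I J assume "I \<in> D" "J \<in> D" "I \<noteq> J" "I \<inter> {a..b} = J \<inter> {a..b}"
   then show "osc g (I \<inter> {a..b}) = 0" using division_osc_inter[OF D, of I J g a b] by (metis Int_absorb Int_assoc Int_commute)
  qed simp
  also have "... = (\<Sum>I\<in>E. osc g I)" unfolding E_def using fin by (intro sum.mono_neutral_right) (auto simp: osc_def)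
  also have "... <= variation g {a..b}" by (rule variation_upper[OF E]) (auto simp: E_def)
  finally show ?thesis .
 qed
 have "(\<Sum>I\<in>D. osc g I) <= (\<Sum>I\<in>D. osc g (I \<inter> {u..c}) + osc g (I \<inter> {c..v}))"
 proof (rule sum_mono)
  fix I assume I: "I \<in> D"
  obtain x y where xy: "x <= y" "I = {x..y}" using division_interval[OF D I] .
  have "I \<subseteq> {u..v}" using sub I by blast
  then have uv: "u <= x" "y <= v" using xy by auto
  consider "y <= c" | "c <= x" | "x < c" "c < y" by linarith
  then show "osc g I <= osc g (I \<inter> {u..c}) + osc g (I \<inter> {c..v})"
  proof cases
   case 1
   then have "I \<inter> {u..c} = I" using xy uv by auto
   then show ?thesis by simp
  next
   case 2
   then have "I \<inter> {c..v} = I" using xy uv by auto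
   then show ?thesis by simp
  next
   case 3
   have "I \<inter> {u..c} = {x..c}" "I \<inter> {c..v} = {c..y}" using 3 uv xy by auto
   then show ?thesis using 3 by (simp add: osc_interval xy flip: ennreal_plus)
  qed
 qed
 also have "... <= variation g {u..c} + variation g {c..v}"
  unfolding sum.distrib by (intro add_mono cut c)
 finally show "(\<Sum>I\<in>D. osc g I) <= variation g {u..c} + variation g {c..v}" .
qed

lemma variation_Un:
 assumes int: "interior S \<inter> interior T = {}"
 shows "variation g S + variation g T <= variation g (S \<union> T)"
proof -
 let ?a = "\<lambda>E. \<Sum>I\<in>E. osc g I"
 let ?b = "\<lambda>S. variation g (S \<union> T)"
 let ?A = "\<lambda>S. {D. D division_of \<Union>D \<and> \<Union>D \<subseteq> S}"
 have ne: "?A S \<noteq> {}" for S :: "real set"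
  by (auto intro!: exI[of _ "{}"])
 have "variation g S + variation g T = (SUP E\<in>?A T. variation g S + (?a E))"
  unfolding variation_def[of g T] by (rule ennreal_SUP_add_right[OF ne])
 also have "... <= ?b S"
 proof (rule SUP_least)
  fix E assume E: "E \<in> ?A T"
  have "variation g S + (?a E) = (SUP D\<in>?A S. (?a D) + (?a E))"
   unfolding variation_def[of g S] by (rule ennreal_SUP_add_left[OF ne, symmetric])
  also have "... <= ?b S"
  proof (rule SUP_least)
   fix D assume D: "D \<in> ?A S"
   have fin: "finite D" "finite E" using D E division_of_finite by auto
   have DE: "D \<union> E division_of \<Union>D \<union> \<Union>E"
    using D E interior_mono[of "\<Union>D" S] interior_mono[of "\<Union>E" T] int by (intro division_disjoint_union) auto
   have 0: "(\<Sum>I\<in>D\<inter>E. osc g I) = 0"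
   proof (rule sum.neutral, rule ballI)
    fix I assume I: "I \<in> D \<inter> E"
    then obtain x y where xy: "x <= y" "I = {x..y}" using D division_interval by blast
    have "interior I \<subseteq> interior S" "interior I \<subseteq> interior T"
     using I D E by (intro interior_mono; auto)+
    then have "interior I = {}" using int by blast
    then have "x = y" using xy by (simp add: interior_atLeastAtMost_real)
    then show "osc g I = 0" using xy by (simp add: osc_def)
   qed
   have "(?a D) + (?a E) = (\<Sum>I\<in>D\<union>E. osc g I)"
    using sum.union_inter[OF fin, of "osc g"] 0 by simp
   also have "... <= ?b S" using DE D E by (intro variation_upper) auto
   finally show "(?a D) + (?a E) <= ?b S" .
  qed
  finally show "variation g S + (?a E) <= ?b S" .
 qed
 finally show ?thesis .
qed

text \<open>Bounds a sum of variations over a finite family of intervals covering a null set by the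
  variation over their union, a set of small measure.\<close>

lemma variation_Union:
 assumes "D division_of \<Union>D" shows "(\<Sum>I\<in>D. variation g I) <= variation g (\<Union>D)"
proof -
 have fin: "finite D" using assms by (rule division_of_finite)
 have "(\<Sum>I\<in>E. variation g I) <= variation g (\<Union>E)" if "E \<subseteq> D" for E
  using finite_subset[OF that fin] that
 proof (induction E rule: finite_induct)
  case (insert I E)
  have "interior I \<inter> interior (\<Union>E) = {}"
  proof (rule Int_interior_Union_intervals)
   show "finite E" by fact
   show "\<exists>a b. T = cbox a b" if "T \<in> E" for T using division_ofD(4)[OF assms] that insert by blast
   show "interior I \<inter> interior T = {}" if "T \<in> E" for T using division_ofD(5)[OF assms, of I T] that insert by blast
  qed simp
  from variation_Un[OF this, of g] insert show ?case by (auto intro: order_trans[OF add_left_mono])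
 qed simp
 then show ?thesis by simp
qed

lemma variation_additive:
 assumes c: "u <= c" "c <= v" shows "variation g {u..v} = variation g {u..c} + variation g {c..v}"
proof (rule antisym[OF variation_split[OF c]])
 have "variation g {u..c} + variation g {c..v} <= variation g ({u..c} \<union> {c..v})"
  by (rule variation_Un) (auto simp: interior_atLeastAtMost_real)
 also have "{u..c} \<union> {c..v} = {u..v}" using c by auto
 finally show "variation g {u..c} + variation g {c..v} <= variation g {u..v}" .
qed

text \<open>Passes from sums over divisions to measurable sets: a division inside \<open>S\<close>
  has total length at most the measure of \<open>S\<close>.\<close>

lemma variation_small:
 assumes ac: "absolutely_continuous_interval a b g" and e: "0 < e"
 obtains d where "0 < d" "\<And>S. S \<in> lmeasurable ==> S \<subseteq> {a..b} ==> measure lebesgue S < d ==> variation g S <= ennreal e"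
proof -
 let ?a = "\<lambda>D. \<Sum>I\<in>D. \<bar>g (Sup I) - g (Inf I)\<bar>"
 let ?b = "\<lambda>S. measure lebesgue S"
 obtain d where d: "0 < d" "\<And>D. D division_of \<Union>D ==> \<Union>D \<subseteq> {a..b} ==> (\<Sum>I\<in>D. Sup I - Inf I) < d ==> (?a D) < e"
  using ac e unfolding absolutely_continuous_interval_def by meson
 show ?thesis
 proof (rule that[OF d(1)])
  fix S assume S: "S \<in> lmeasurable" "S \<subseteq> {a..b}" "?b S < d"
  show "variation g S <= ennreal e"
   unfolding variation_def
  proof (rule SUP_least)
   fix D :: "real set set" assume "D \<in> {D. D division_of \<Union>D \<and> \<Union>D \<subseteq> S}"
   then have D: "D division_of \<Union>D" "\<Union>D \<subseteq> S" by auto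
   have i: "I \<noteq> {} \<and> Sup I - Inf I = ?b I" if "I \<in> D" for I
   proof -
    obtain u v where "u <= v" "I = {u..v}" using division_interval[OF D(1) \<open>I \<in> D\<close>] .
    then show ?thesis by simp
   qed
   have "(\<Sum>I\<in>D. Sup I - Inf I) = (\<Sum>I\<in>D. ?b I)" using i by (intro sum.cong) auto
   also have "... = ?b (\<Union>D)" by (rule content_division[OF D(1)])
   also have "... <= ?b S" using D S lmeasurable_division[OF D(1)] by (intro measure_mono_fmeasurable) auto
   finally have "(?a D) < e" using d(2)[OF D(1)] D S by fastforce
   moreover have "(\<Sum>I\<in>D. osc g I) = ennreal (?a D)"
    using i by (subst sum_ennreal[symmetric]) (auto simp: osc_def intro!: sum.cong)
   ultimately show "(\<Sum>I\<in>D. osc g I) <= ennreal e" by (simp add: ennreal_leI)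
  qed
 qed
qed

text \<open>The interval is cut into pieces so short that \<open>variation_small\<close> bounds the
  variation of each by \<open>1\<close>.\<close>

lemma variation_finite:
 assumes ac: "absolutely_continuous_interval a b g" and ab: "a <= b"
 shows "variation g {a..b} < top"
proof -
 let ?a = "\<lambda>k d. min b (a + real k * (d/2))"
 obtain d where d: "0 < d" "\<And>S. S \<in> lmeasurable ==> S \<subseteq> {a..b} ==> measure lebesgue S < d ==> variation g S <= ennreal 1"
  using variation_small[OF ac zero_less_one] by blast
 have step: "variation g {u..v} <= 1" if "a <= u" "u <= v" "v <= b" "v - u < d" for u v
  using d(2)[of "{u..v}"] that by auto
 have "variation g {a..?a k d} <= of_nat (Suc k)" for k
 proof (induction k)
  case 0
  then show ?case using step[of a a] ab d(1) by simp
 next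
  case (Suc k)
  define u v where "u = ?a k d" and "v = ?a (Suc k) d"
  have "0 <= real k * (d/2)" using d(1) by simp
  moreover have "real (Suc k) * (d/2) = real k * (d/2) + d/2" by (simp add: field_simps)
  ultimately have uv: "a <= u" "u <= v" "v <= b" "v - u < d" unfolding u_def v_def using ab d(1) by linarith+
  have "variation g {a..v} <= variation g {a..u} + variation g {u..v}" by (rule variation_split) (use uv in auto)
  also have "... <= of_nat (Suc k) + 1" using Suc step[OF uv] unfolding u_def by (intro add_mono) auto
  finally show ?case unfolding v_def by (simp add: add_ac)
 qed
 moreover obtain k :: nat where "(b - a) / (d/2) <= real k" using real_arch_simple by blast
 then have "?a k d = b" using d(1) by (simp add: pos_divide_le_eq min_def)
 ultimately have "variation g {a..b} <= of_nat (Suc k)" by metis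
 then show ?thesis using of_nat_less_top order.strict_trans1 by blast
qed


text \<open>The Stieltjes measure of \<open>W\<close> charges an interval by at most twice the
  variation of \<open>g\<close>, hence is absolutely continuous with respect to Lebesgue measure;
  its Radon-Nikodym density is the integrand sought. The factor \<open>2\<close> is made for
  \<open>W = V - g\<close>, with \<open>V\<close> the variation function of
  \<open>g\<close>.\<close>

lemma primitive_of_dominated:
 fixes g W :: "real => real"
 assumes ac: "absolutely_continuous_interval a b g" and ab: "a < b"
  and mono: "\<And>u v. a <= u ==> u <= v ==> v <= b ==> W u <= W v"
  and dom: "\<And>u v. a <= u ==> u <= v ==> v <= b ==> ennreal (W v - W u) <= 2 * variation g {u..v}"
 obtains f where "\<And>x. a <= x ==> x <= b ==> (f has_integral (W x - W a)) {a..x}"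
proof -
 let ?a = "\<lambda>S. measure lebesgue S"
 let ?b = "\<lambda>f0 x. \<integral>y. f0 y * indicator {a..x} y"
 let ?c = "\<lambda>f x. f has_integral (W x - W a)"
 \<comment> \<open>\<open>W\<close> is continued by constants, since \<open>interval_measure\<close>
   wants a monotone function on the whole line.\<close>
 define F where "F x = W (max a (min b x))" for x
 have Fm: "F x <= F y" if "x <= y" for x y unfolding F_def using that ab by (intro mono) auto
 have F_eq: "F x = W x" if "a <= x" "x <= b" for x unfolding F_def using that by simp
 have Fc: "continuous_on UNIV F"
  unfolding continuous_on_iff
 proof (intro ballI allI impI)
  fix x e :: real assume e: "0 < e"
  then have e4: "0 < e / 4" by simp
  obtain d where d: "0 < d" "\<And>S. S \<in> lmeasurable ==> S \<subseteq> {a..b} ==> ?a S < d ==> variation g S <= ennreal (e/4)"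
   using variation_small[OF ac e4] by blast
  have le: "F y - F x < e" if "x <= y" "y - x < d" for x y
  proof -
   define u v where "u = max a (min b x)" and "v = max a (min b y)"
   have uv: "a <= u" "u <= v" "v <= b" "v - u < d" unfolding u_def v_def using that ab d(1) by auto
   have "ennreal (W v - W u) <= 2 * variation g {u..v}" by (rule dom) fact+
   also have "... <= 2 * ennreal (e/4)" using uv by (intro mult_left_mono d(2)) auto
   also have "... = ennreal (e/2)" using e by (simp add: ennreal_mult[symmetric] flip: ennreal_numeral)
   finally have "W v - W u <= e / 2" using e by (simp add: ennreal_le_iff)
   then show ?thesis unfolding F_def u_def v_def using e by simp
  qed
  show "\<exists>d>0. \<forall>x'\<in>UNIV. dist x' x < d --> dist (F x') (F x) < e"
  proof (intro exI[of _ d] conjI d(1) ballI impI)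
   fix y assume "dist y x < d"
   then show "dist (F y) (F x) < e" using le[of x y] le[of y x] Fm[of x y] Fm[of y x] by (cases "x <= y") (auto simp: dist_real_def)
  qed
 qed
 define N where "N = interval_measure F"
 have sN[simp, measurable_cong]: "sets N = sets borel" unfolding N_def by simp
 have N_Icc: "emeasure N {u..v} = ennreal (F v - F u)" if "u <= v" for u v
  unfolding N_def by (rule emeasure_interval_measure_Icc[OF that Fm Fc])
 define N' where "N' = density N (indicator {a..b})"
 have N': "emeasure N' Z = emeasure N (Z \<inter> {a..b})" if "Z \<in> sets borel" for Z
 proof -
  have "emeasure N' Z = (\<integral>\<^sup>+x. indicator {a..b} x * indicator Z x \<partial>N)"
   unfolding N'_def using that by (subst emeasure_density) auto
  also have "... = (\<integral>\<^sup>+x. indicator (Z \<inter> {a..b}) x \<partial>N)"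
   by (intro nn_integral_cong) (auto simp: indicator_def)
  finally have "emeasure N' Z = (\<integral>\<^sup>+x. indicator (Z \<inter> {a..b}) x \<partial>N)" .
  then show ?thesis using that by simp
 qed
 have "absolutely_continuous lborel N'"
  unfolding absolutely_continuous_def
 proof
  fix Z :: "real set" assume Z: "Z \<in> null_sets lborel"
  then have Zb: "Z \<in> sets borel" by auto
  define S where "S = Z \<inter> {a..b}"
  have Sb: "S \<in> sets borel" unfolding S_def using Zb by auto
  have "emeasure lborel S <= emeasure lborel Z" unfolding S_def using Zb by (intro emeasure_mono) auto
  then have "emeasure lborel S = 0" using Z by (simp add: null_sets_def)
  then have "S \<in> null_sets lebesgue" using Sb by (intro null_sets_completionI) auto
  then have S: "S \<in> lmeasurable" "?a S = 0" "S \<subseteq> cbox a b"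
   unfolding S_def by (auto simp: fmeasurable_def measure_eq_0_null_sets null_sets_def)
  have "emeasure N S <= ennreal e" if e: "0 < e" for e
  proof -
   have e2: "0 < e / 2" using e by simp
   obtain d where d: "0 < d" "\<And>S. S \<in> lmeasurable ==> S \<subseteq> {a..b} ==> ?a S < d ==> variation g S <= ennreal (e/2)"
    using variation_small[OF ac e2] by blast
   \<comment> \<open>The null set is covered by nonoverlapping intervals of total measure below
     \<open>d\<close>. Finite subfamilies are divisions, to which \<open>variation_Union\<close>
     applies; continuity of the measure from below then gives the whole union.\<close>
   obtain D where D: "countable D" "\<And>K. K \<in> D ==> K \<subseteq> cbox a b \<and> K \<noteq> {} \<and> (\<exists>c d. K = cbox c d)"
    "pairwise (\<lambda>A B. interior A \<inter> interior B = {}) D" "S \<subseteq> \<Union>D" "\<Union>D \<in> lmeasurable" "?a (\<Union>D) <= ?a S + d / 2"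
    using measurable_outer_intervals_bounded[OF S(1,3), of "d/2"] d(1) by (metis half_gt_zero)
   have fin: "emeasure N (\<Union>E) <= ennreal e" if E: "finite E" "E \<subseteq> D" for E
   proof -
    have div: "E division_of \<Union>E"
    proof (rule division_ofI)
     show "interior I \<inter> interior J = {}" if "I \<in> E" "J \<in> E" "I \<noteq> J" for I J
      using D(3) E(2) that unfolding pairwise_def by blast
     show "\<exists>u v. I = cbox u v" "I \<noteq> {}" "I \<subseteq> \<Union>E" if "I \<in> E" for I
      using E(2) D(2) that by blast+
    qed (use E in auto)
    have "emeasure N (\<Union>E) = emeasure N (\<Union>I\<in>E. I)" by simp
    also have "... <= (\<Sum>I\<in>E. emeasure N I)"
    proof (rule emeasure_subadditive_finite[OF E(1)])
     have "I \<in> sets N" if "I \<in> E" for I using that by (rule division_interval[OF div]) simp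
     then show "(\<lambda>I. I) ` E \<subseteq> sets N" by auto
    qed
    also have "... <= (\<Sum>I\<in>E. 2 * variation g I)"
    proof (rule sum_mono)
     fix I assume I: "I \<in> E"
     obtain u v where uv: "u <= v" "I = {u..v}" using division_interval[OF div I] .
     have "I \<subseteq> {a..b}" using D(2) E(2) I by (metis cbox_interval subsetD)
     then have "a <= u" "v <= b" using uv by auto
     then show "emeasure N I <= 2 * variation g I" using dom[of u v] uv by (simp add: N_Icc F_eq)
    qed
    also have "... = 2 * (\<Sum>I\<in>E. variation g I)" by (simp add: sum_distrib_left)
    also have "... <= 2 * variation g (\<Union>E)" by (intro mult_left_mono variation_Union div) simp
    also have "... <= 2 * ennreal (e / 2)"
    proof (intro mult_left_mono d(2))
     show "\<Union>E \<in> lmeasurable" by (rule lmeasurable_division[OF div])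
     show "\<Union>E \<subseteq> {a..b}" using D(2) E(2) by (metis Sup_least cbox_interval subsetD)
     have "?a (\<Union>E) <= ?a (\<Union>D)"
      using D(5) E(2) lmeasurable_division[OF div] by (intro measure_mono_fmeasurable) auto
     then show "?a (\<Union>E) < d" using D(6) S(2) d(1) by linarith
    qed simp
    also have "... = ennreal e" using e by (simp add: ennreal_mult[symmetric] flip: ennreal_numeral)
    finally show ?thesis .
   qed
   show ?thesis
   proof (cases "D = {}")
    case True
    then show ?thesis using D(4) by simp
   next
    case False
    have Db: "I \<in> sets borel" if "I \<in> D" for I using D(2)[OF that] by (metis borel_closed closed_cbox)
    define U where "U n = \<Union> (from_nat_into D ` {..n})" for n
    have Ub: "range U \<subseteq> sets N" unfolding U_def using Db from_nat_into[OF False] by auto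
    have inc: "incseq U" unfolding U_def incseq_def by (auto intro: order_trans)
    have UD: "(\<Union>n. U n) = \<Union>D"
    proof -
     have "D = range (from_nat_into D)" using range_from_nat_into[OF False D(1)] ..
     then show ?thesis unfolding U_def by (auto; metis UNIV_I atMost_iff order_refl rangeE)
    qed
    have "emeasure N S <= emeasure N (\<Union>n. U n)"
     using D(4) Ub unfolding UD[symmetric] by (intro emeasure_mono) auto
    also have "... = (SUP n. emeasure N (U n))" using SUP_emeasure_incseq[OF Ub inc] by simp
    also have "... <= ennreal e" unfolding U_def by (intro SUP_least fin) (auto simp: from_nat_into[OF False])
    finally show ?thesis .
   qed
  qed
  then have "emeasure N S = 0" by (metis ennreal_0 ennreal_le_epsilon add_0 le_zero_eq zero_less_iff_neq_zero bot_ennreal)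
  then show "Z \<in> null_sets N'" using N'[OF Zb] Zb unfolding S_def N'_def by auto
 qed
 then obtain f0 where f0[measurable]: "f0 \<in> borel_measurable lborel" and dens: "density lborel f0 = N'"
  using sigma_finite_measure.Radon_Nikodym[OF sigma_finite_lborel, of N'] unfolding N'_def by auto
 have f0N: "(?b f0 x) = ennreal (W x - W a)" if x: "a <= x" "x <= b" for x
 proof -
  have "(?b f0 x) = emeasure N' {a..x}" unfolding dens[symmetric] by (subst emeasure_density) auto
  also have "{a..x} \<inter> {a..b} = {a..x}" using x by auto
  then have "emeasure N' {a..x} = ennreal (F x - F a)" using N'[of "{a..x}"] N_Icc[of a x] x by simp
  finally show ?thesis using x ab by (simp add: F_eq)
 qed
 have "AE y in lborel. f0 y * indicator {a..b} y \<noteq> \<infinity>"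
  using f0N[of b] ab by (intro nn_integral_PInf_AE) auto
 then have AEf: "AE y in lborel. y \<in> {a..b} --> f0 y \<noteq> \<infinity>" by eventually_elim auto
 define f where "f y = enn2real (f0 y)" for y
 have fm[measurable]: "f \<in> borel_measurable borel" unfolding f_def using f0 by measurable
 show ?thesis
 proof (rule that[of f])
  fix x assume x: "a <= x" "x <= b"
  have "(\<integral>y. ennreal (f y * indicator {a..x} y)) = (?b f0 x)"
   using AEf by (intro nn_integral_cong_AE) (auto elim!: eventually_mono simp: f_def indicator_def x less_top split: if_splits intro: order_trans[OF _ x(2)])
  also have "... = ennreal (W x - W a)" by (rule f0N[OF x])
  finally have "(?c (\<lambda>y. f y * indicator {a..x} y) x) UNIV"
   using mono[of a x] x by (intro nn_integral_has_integral) (auto simp: f_def)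
  moreover have "(\<lambda>y. f y * indicator {a..x} y) = (\<lambda>y. if y \<in> {a..x} then f y else 0)" by (auto simp: indicator_def)
  ultimately show "(?c f x) {a..x}" by (simp only: has_integral_restrict_UNIV)
 qed
qed

text \<open>Jordan decomposition: \<open>g\<close> is the difference of \<open>V\<close> and
  \<open>V - g\<close>, both nondecreasing with increments at most twice the variation of
  \<open>g\<close>.\<close>

lemma absolutely_continuous_primitive:
 assumes ac: "absolutely_continuous_interval a b g" and ab: "a < b"
 obtains f where "\<And>x. a <= x ==> x <= b ==> (f has_integral (g x - g a)) {a..x}"
proof -
 define V where "V x = enn2real (variation g {a..x})" for x
 have fin: "variation g {u..v} < top" if "a <= u" "u <= v" "v <= b" for u v
 proof -
  have "variation g {u..v} <= variation g {a..b}"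
   unfolding variation_def using that by (intro SUP_subset_mono) auto
  then show ?thesis using variation_finite[OF ac] ab by (simp add: order.strict_trans1)
 qed
 have V: "ennreal (V v - V u) = variation g {u..v}" "\<bar>g v - g u\<bar> <= V v - V u" if uv: "a <= u" "u <= v" "v <= b" for u v
 proof -
  obtain p where p: "0 <= p" "variation g {a..u} = ennreal p" using fin[of a u] uv by (cases "variation g {a..u}") auto
  obtain q where q: "0 <= q" "variation g {u..v} = ennreal q" using fin[of u v] uv by (cases "variation g {u..v}") auto
  have "variation g {a..v} = ennreal (p + q)"
   using variation_additive[of a u v g] uv p q by (simp add: ennreal_plus)
  then have e: "V v - V u = q" unfolding V_def using p q by (simp del: ennreal_plus)
  then show "ennreal (V v - V u) = variation g {u..v}" using q by simp
  have "ennreal \<bar>g v - g u\<bar> <= ennreal q" using osc_le_variation[OF uv(2), of g] q by simp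
  then show "\<bar>g v - g u\<bar> <= V v - V u" using e q by simp
 qed
 obtain f1 where f1: "\<And>x. a <= x ==> x <= b ==> (f1 has_integral (V x - V a)) {a..x}"
 proof (rule primitive_of_dominated[OF ac ab, of V])
  fix u v assume uv: "a <= u" "u <= v" "v <= b"
  show "V u <= V v" using V(2)[OF uv] by linarith
  show "ennreal (V v - V u) <= 2 * variation g {u..v}" using V(1)[OF uv] by (simp add: mult_2)
 qed blast
 obtain f2 where f2: "\<And>x. a <= x ==> x <= b ==> (f2 has_integral ((V x - g x) - (V a - g a))) {a..x}"
 proof (rule primitive_of_dominated[OF ac ab, of "\<lambda>x. V x - g x"])
  fix u v assume uv: "a <= u" "u <= v" "v <= b"
  show "V u - g u <= V v - g v" using V(2)[OF uv] by linarith
  have "ennreal (V v - g v - (V u - g u)) <= ennreal (2 * (V v - V u))" using abs_le_D2[OF V(2)[OF uv]] by (intro ennreal_leI) (simp add: algebra_simps)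
  also have "... = 2 * variation g {u..v}" unfolding V(1)[OF uv, symmetric] using V(2)[OF uv] by (subst ennreal_mult) auto
  finally show "ennreal (V v - g v - (V u - g u)) <= 2 * variation g {u..v}" .
 qed blast
 show ?thesis
 proof (rule that[of "\<lambda>x. f1 x - f2 x"])
  fix x assume x: "a <= x" "x <= b"
  from has_integral_diff[OF f1[OF x] f2[OF x]] show "((\<lambda>x. f1 x - f2 x) has_integral (g x - g a)) {a..x}"
   by (simp add: algebra_simps)
 qed
qed


text \<open>The differentiation theorem \<open>integrable_ccontinuous_explicit\<close> speaks of
  intervals to the right of a point only. The left difference quotients come from the reflected
  function, with the reflected exceptional set.\<close>

lemma AE_has_derivative_primitive:
 fixes f g :: "real => real"
 assumes prim: "\<And>x. a <= x ==> x <= b ==> (f has_integral (g x - g a)) {a..x}" and ab: "a < b"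
 shows "AE x in lebesgue. x \<in> {a<..<b} --> (g has_real_derivative f x) (at x)"
proof -
 let ?a = "\<lambda>x h. cbox x (x + h *\<^sub>R One)"
 define f0 where "f0 x = (if x \<in> {a..b} then f x else 0)" for x
 have int: "f0 integrable_on {u..v}" for u v
 proof -
  have "f integrable_on {a..b}" using prim[of b] ab by auto
  then have "f0 integrable_on UNIV" unfolding f0_def by (simp only: integrable_restrict_UNIV)
  then show ?thesis by (rule integrable_on_subinterval) simp
 qed
 have int': "(\<lambda>x. f0 (- x)) integrable_on {u..v}" for u v
  using int[of "-v" "-u"] Henstock_Kurzweil_Integration.integrable_reflect_real[where f = f0 and a = "-v" and b = "-u"] by simp
 obtain N1 where N1: "negligible N1" "\<And>x e. x \<notin> N1 ==> 0 < e ==>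
   \<exists>d>0. \<forall>h. 0 < h \<and> h < d --> norm (integral (?a x h) f0 /\<^sub>R h ^ DIM(real) - f0 x) < e"
  using integrable_ccontinuous_explicit[of f0] int by (metis cbox_interval)
 obtain N2 where N2: "negligible N2" "\<And>x e. x \<notin> N2 ==> 0 < e ==>
   \<exists>d>0. \<forall>h. 0 < h \<and> h < d --> norm (integral (?a x h) (\<lambda>x. f0 (- x)) /\<^sub>R h ^ DIM(real) - f0 (- x)) < e"
  using integrable_ccontinuous_explicit[of "\<lambda>x. f0 (- x)"] int' by (metis cbox_interval)
 have seg: "integral {x..y} f0 = g y - g x" if "a <= x" "x <= y" "y <= b" for x y
 proof -
  have "integral {a..x} f + integral {x..y} f = integral {a..y} f"
   using prim[of y] that by (intro Henstock_Kurzweil_Integration.integral_combine) auto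
  moreover have "integral {x..y} f0 = integral {x..y} f"
   using that by (intro integral_cong) (auto simp: f0_def)
  ultimately show ?thesis using prim[of x] prim[of y] that by (simp add: integral_unique)
 qed
 have "negligible (uminus ` N2)" using N2(1)
  by (intro negligible_differentiable_image_negligible) (auto intro!: derivative_intros simp: differentiable_on_def)
 then have "negligible (N1 \<union> uminus ` N2)" using N1(1) by simp
 then have "N1 \<union> uminus ` N2 \<in> null_sets lebesgue" by (simp add: negligible_iff_null_sets)
 then have "AE x in lebesgue. x \<notin> N1 \<union> uminus ` N2" by (rule AE_not_in)
 then show ?thesis
 proof (eventually_elim, intro impI)
  fix x assume xN: "x \<notin> N1 \<union> uminus ` N2" and x: "x \<in> {a<..<b}"
  have x1: "x \<notin> N1" using xN by simp
  have "x = - (- x)" by simp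
  then have x2: "- x \<notin> N2" using xN by blast
  have fx: "f0 x = f x" using x by (simp add: f0_def)
  show "(g has_real_derivative f x) (at x)"
   unfolding has_field_derivative_iff LIM_def
  proof (intro allI impI)
   fix e :: real assume e: "0 < e"
   obtain d1 where d1: "0 < d1" "\<And>h. 0 < h ==> h < d1 ==> \<bar>integral {x..x + h} f0 / h - f x\<bar> < e"
    using N1(2)[OF x1 e] fx by (auto simp: divide_inverse mult.commute)
   obtain d2 where d2: "0 < d2" "\<And>h. 0 < h ==> h < d2 ==> \<bar>integral {- x..- x + h} (\<lambda>x. f0 (- x)) / h - f x\<bar> < e"
    using N2(2)[OF x2 e] fx by (auto simp: divide_inverse mult.commute)
   define d where "d = min (min d1 d2) (min (x - a) (b - x))"
   have d: "0 < d" unfolding d_def using d1 d2 x by auto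
   show "\<exists>s>0. \<forall>y. y \<noteq> x \<and> dist y x < s --> dist ((g y - g x) / (y - x)) (f x) < e"
   proof (intro exI[of _ d] conjI d allI impI)
    fix y assume y: "y \<noteq> x \<and> dist y x < d"
    show "dist ((g y - g x) / (y - x)) (f x) < e"
    proof (cases "x < y")
     case True
     then have h: "0 < y - x" "y - x < d1" "y <= b" using y unfolding d_def by (auto simp: dist_real_def)
     have "integral {x..x + (y - x)} f0 = g y - g x" using seg[of x y] x h by simp
     then show ?thesis using d1(2)[OF h(1,2)] by (simp add: dist_real_def)
    next
     case False
     then have h: "0 < x - y" "x - y < d2" "a <= y" using y unfolding d_def by (auto simp: dist_real_def)
     have "integral {- x..- x + (x - y)} (\<lambda>x. f0 (- x)) = integral {y..x} f0"
      using integral_reflect_real[of x y f0] by simp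
     also have "... = g x - g y" using seg[of y x] x h by simp
     finally have "\<bar>(g x - g y) / (x - y) - f x\<bar> < e" using d2(2)[OF h(1,2)] by simp
     moreover have "(g x - g y) / (x - y) = (g y - g x) / (y - x)" using h by (simp add: field_simps)
     ultimately show ?thesis by (simp add: dist_real_def)
    qed
   qed
  qed
 qed
qed

lemma absolutely_continuous_interval_continuous_on:
 assumes ac: "absolutely_continuous_interval a b g" shows "continuous_on {a..b} g"
 unfolding continuous_on_iff
proof (intro ballI allI impI)
 fix x e :: real assume x: "x \<in> {a..b}" and e: "0 < e"
 obtain d where d: "0 < d" "\<And>S. S \<in> lmeasurable ==> S \<subseteq> {a..b} ==> measure lebesgue S < d ==> variation g S <= ennreal (e/2)"
  using variation_small[OF ac, of "e/2"] e by auto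
 have le: "\<bar>g v - g u\<bar> < e" if "a <= u" "u <= v" "v <= b" "v - u < d" for u v
 proof -
  have "ennreal \<bar>g v - g u\<bar> <= ennreal (e/2)"
   using order_trans[OF osc_le_variation d(2)[of "{u..v}"]] that by auto
  then show ?thesis using e by (simp add: ennreal_le_iff)
 qed
 show "\<exists>d>0. \<forall>x'\<in>{a..b}. dist x' x < d --> dist (g x') (g x) < e"
 proof (intro exI[of _ d] conjI d(1) ballI impI)
  fix y assume y: "y \<in> {a..b}" "dist y x < d"
  then show "dist (g y) (g x) < e" using le[of x y] le[of y x] x by (cases "x <= y") (auto simp: dist_real_def abs_minus_commute)
 qed
qed

text \<open>If the right side is finite, the gauge integral is an absolutely convergent Lebesgue
  integral; otherwise the claim is trivial. So users need not show integrability of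
  \<open>\<bar>f\<bar>\<close>.\<close>

lemma has_integral_abs_le_nn_integral:
 fixes f :: "real => real"
 assumes f: "(f has_integral I) {a..b}"
 shows "ennreal \<bar>I\<bar> <= (\<integral>\<^sup>+x\<in>{a..b}. ennreal \<bar>f x\<bar> \<partial>lebesgue)"
proof (cases "(\<integral>\<^sup>+x\<in>{a..b}. ennreal \<bar>f x\<bar> \<partial>lebesgue) = top")
 case False
 have "f integrable_on {a..b}" using f by auto
 then have "f \<in> borel_measurable (lebesgue_on {a..b})" by (rule integrable_imp_measurable)
 then have m[measurable]: "(\<lambda>x. indicator {a..b} x *\<^sub>R f x) \<in> borel_measurable lebesgue"
  by (subst (asm) borel_measurable_restrict_space_iff) simp_all
 have e: "ennreal (norm (indicator {a..b} x *\<^sub>R f x)) = ennreal \<bar>f x\<bar> * indicator {a..b} x" for x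
  by (auto simp: indicator_def)
 have int: "set_integrable lebesgue {a..b} f"
  unfolding set_integrable_def
  by (rule integrableI_bounded[OF m]) (use False in \<open>simp only: e less_top infinity_ennreal_def\<close>)
 then have "I = (LINT x:{a..b}|lebesgue. f x)"
  using has_integral_set_lebesgue[OF int] has_integral_unique f by blast
 then have "ennreal \<bar>I\<bar> <= (\<integral>\<^sup>+x. ennreal (norm (indicator {a..b} x *\<^sub>R f x)) \<partial>lebesgue)"
  using integral_norm_bound_ennreal[OF int[unfolded set_integrable_def]] unfolding set_lebesgue_integral_def by simp
 then show ?thesis unfolding e .
qed simp

text \<open>Provides one Borel function that equals the derivative almost everywhere and controls
  the increments on all compact subintervals, by exhausting the open interval with
  \<open>[a k, b k]\<close>.\<close>

lemma AC_loc_derivative: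
 assumes G: "G \<in> AC_loc"
 obtains F where "F \<in> borel_measurable borel" "AE x\<in>{-1<..<1} in lborel. deriv G x = F x"
  "\<And>a b. -1 < a ==> a <= b ==> b < 1 ==> ennreal \<bar>G b - G a\<bar> <= (\<integral>x\<in>{a..b}. ennreal \<bar>F x\<bar>)"
proof -
 let ?a = "\<lambda>x. nat \<lceil>1 / (1 - \<bar>x\<bar>)\<rceil>"
 define a b :: "nat => real" where "a k = -1 + 1 / (real k + 2)" and "b k = 1 - 1 / (real k + 2)" for k
 have k2: "0 < 1 / (real k + 2)" "1 / (real k + 2) <= 1 / 2" for k by (auto simp: field_simps)
 have ab: "-1 < a k" "a k < b k" "b k < 1" for k using k2[of k] unfolding a_def b_def by linarith+
 have "\<exists>f. \<forall>x. a k <= x --> x <= b k --> (f has_integral (G x - G (a k))) {a k..x}" for k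
 proof -
  have "absolutely_continuous_interval (a k) (b k) G" using G ab[of k] unfolding AC_loc_def by auto
  from absolutely_continuous_primitive[OF this ab(2)] show ?thesis by metis
 qed
 then obtain f where f: "\<And>k x. a k <= x ==> x <= b k ==> (f k has_integral (G x - G (a k))) {a k..x}" by metis
 have fd: "AE x in lebesgue. x \<in> {a k<..<b k} --> deriv G x = f k x" for k
  using AE_has_derivative_primitive[of "a k" "b k" "f k" G, OF f ab(2)]
  by (auto elim!: eventually_mono intro: DERIV_imp_deriv)
 have "\<exists>h. h \<in> borel_measurable lborel \<and> (AE x in lborel. indicator {a k..b k} x *\<^sub>R f k x = h x)" for k
 proof -
  have "f k integrable_on {a k..b k}" using f[of k "b k"] ab[of k] by auto
  then have "f k \<in> borel_measurable (lebesgue_on {a k..b k})" by (rule integrable_imp_measurable)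
  then have "(\<lambda>x. indicator {a k..b k} x *\<^sub>R f k x) \<in> borel_measurable lebesgue"
   by (subst (asm) borel_measurable_restrict_space_iff) simp_all
  then show ?thesis using completion_ex_borel_measurable_real by blast
 qed
 then obtain h where h: "\<And>k. h k \<in> borel_measurable lborel" "\<And>k. AE x in lborel. indicator {a k..b k} x *\<^sub>R f k x = h k x"
  by metis
 have hm[measurable]: "h k \<in> borel_measurable borel" for k using h(1)[of k] by simp
 \<comment> \<open>The densities on the compact intervals agree almost everywhere where they
   overlap, so \<open>F\<close> may take at \<open>x\<close> the one from an interval that contains
   \<open>x\<close> in its interior, with a measurable choice of the index.\<close>
 define F where "F x = h (?a x) x" for x
 have kx: "x \<in> {a (?a x)<..<b (?a x)}" if x: "x \<in> {-1<..<1}" for x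
 proof -
  define k where "k = nat \<lceil>1 / (1 - \<bar>x\<bar>)\<rceil>"
  have p: "0 < 1 - \<bar>x\<bar>" using x by auto
  have "1 / (1 - \<bar>x\<bar>) <= real k" unfolding k_def by (rule real_nat_ceiling_ge)
  then have "1 / (1 - \<bar>x\<bar>) < real k + 2" by simp
  then have "1 / (real k + 2) < 1 - \<bar>x\<bar>" using p by (simp add: field_simps)
  then show ?thesis unfolding k_def[symmetric] a_def b_def by auto
 qed
 have "AE x in lebesgue. \<forall>k. (x \<in> {a k<..<b k} --> deriv G x = f k x) \<and> indicator {a k..b k} x *\<^sub>R f k x = h k x"
  unfolding AE_all_countable using fd AE_completion[OF h(2)] by (auto intro: AE_conjI)
 then have AEF: "AE x in lebesgue. x \<in> {-1<..<1} --> deriv G x = F x \<and> (\<forall>k. x \<in> {a k<..<b k} --> f k x = F x)"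
 proof (eventually_elim, intro impI)
  fix x assume H: "\<forall>k. (x \<in> {a k<..<b k} --> deriv G x = f k x) \<and> indicator {a k..b k} x *\<^sub>R f k x = h k x" and x: "x \<in> {-1<..<1}"
  have 1: "deriv G x = h k x" "f k x = h k x" if "x \<in> {a k<..<b k}" for k using H[rule_format, of k] that by (auto simp: indicator_def)
  then show "deriv G x = F x \<and> (\<forall>k. x \<in> {a k<..<b k} --> f k x = F x)" using kx[OF x] unfolding F_def by metis
 qed
 show ?thesis
 proof (rule that[of F])
  show Fm[measurable]: "F \<in> borel_measurable borel"
   unfolding F_def by (rule measurable_compose_countable[where g = "\<lambda>x. nat \<lceil>1 / (1 - \<bar>x\<bar>)\<rceil>"]) measurable
  have "AE x in lebesgue. x \<in> {-1<..<1} --> deriv G x = F x" using AEF by eventually_elim auto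
  then show "AE x\<in>{-1<..<1} in lborel. deriv G x = F x" by (simp add: AE_completion_iff)
  fix u v :: real assume uv: "-1 < u" "u <= v" "v < 1"
  obtain k :: nat where k: "1 / min (1 + u) (1 - v) < real k" using reals_Archimedean2 by blast
  have "1 / (real k + 2) < min (1 + u) (1 - v)" using k uv by (simp add: field_simps min_def split: if_splits)
  then have kuv: "a k < u" "v < b k" unfolding a_def b_def by auto
  have "f k integrable_on {a k..v}" using f[of k v] kuv uv by auto
  then have "f k integrable_on {u..v}" by (rule integrable_on_subinterval) (use kuv in auto)
  moreover have "integral {a k..u} (f k) + integral {u..v} (f k) = integral {a k..v} (f k)"
   using f[of k v] kuv uv by (intro Henstock_Kurzweil_Integration.integral_combine) auto
  then have "integral {u..v} (f k) = G v - G u"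
   using f[of k u] f[of k v] kuv uv by (simp add: integral_unique)
  ultimately have "(f k has_integral (G v - G u)) {u..v}" by (metis integrable_integral)
  then have "ennreal \<bar>G v - G u\<bar> <= (\<integral>\<^sup>+x\<in>{u..v}. ennreal \<bar>f k x\<bar> \<partial>lebesgue)" by (rule has_integral_abs_le_nn_integral)
  also have "... = (\<integral>\<^sup>+x\<in>{u..v}. ennreal \<bar>F x\<bar> \<partial>lebesgue)"
   using AEF uv kuv by (intro nn_integral_cong_AE) (auto elim!: eventually_mono simp: indicator_def)
  also have "... = (\<integral>x\<in>{u..v}. ennreal \<bar>F x\<bar>)" by (rule nn_integral_completion)
  finally show "ennreal \<bar>G v - G u\<bar> <= (\<integral>x\<in>{u..v}. ennreal \<bar>F x\<bar>)" .
 qed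
qed

section \<open>Bounding the modulus of smoothness by the K-functional\<close>

text \<open>A forward difference lowers the degree: the leading coefficients cancel in
  \<open>Q\<close>.\<close>

lemma fdiff_poly:
 fixes P :: "real poly"
 shows "degree P < r ==> fdiff r h (poly P) x = 0"
proof (induction r arbitrary: P)
 case (Suc r)
 define Q where "Q = pcompose P [:h, 1:] - P"
 have Q: "poly Q y = poly P (y + h) - poly P y" for y unfolding Q_def by (simp add: poly_pcompose add.commute)
 have "fdiff (Suc r) h (poly P) x = fdiff r h (poly Q) x"
  unfolding fdiff_Suc unfolding fdiff_def sum_subtractf[symmetric] Q by (intro sum.cong) (auto simp: algebra_simps)
 also have "... = 0"
 proof (cases "degree P = 0")
  case True
  then obtain c where "P = [:c:]" by (rule degree_eq_zeroE)
  then show ?thesis by (simp add: fdiff_def Q_def)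
 next
  case False
  have d: "degree (pcompose P [:h, 1:]) = degree P" by (simp add: degree_pcompose)
  have "degree Q <= degree P" unfolding Q_def using degree_diff_le_max[of "pcompose P [:h, 1:]" P] d by simp
  moreover have "coeff Q (degree P) = 0"
   unfolding Q_def using lead_coeff_comp[of "[:h, 1:]" P] d by simp
  then have "degree Q \<noteq> degree P" using False by (metis degree_0 leading_coeff_0_iff)
  ultimately show ?thesis using Suc by simp
 qed
 finally show ?case .
qed simp

text \<open>An inequality in place of the integral formula: the last function \<open>g m\<close>
  need only have its increments bounded by integrals of \<open>F\<close>, and the right side may be
  infinite. In the induction \<open>(s - y) ^ m\<close> is enlarged to \<open>(z - y) ^ m\<close>
  before the integrals are exchanged, at the price of the factorial.\<close>

lemma taylor_remainder_nn_integral: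
 fixes F :: "real => ennreal" and g :: "nat => real => real"
 assumes [measurable]: "F \<in> borel_measurable borel"
  and "\<And>k u. k < m ==> u \<in> {0..l} ==> (g k has_real_derivative g (Suc k) u) (at u within {0..l})"
  and "\<And>u. u \<in> {0..l} ==> ennreal \<bar>g m u - g m 0\<bar> <= (\<integral>y\<in>{0..u}. F y)"
  and "z \<in> {0..l}"
 shows "ennreal \<bar>g 0 z - (\<Sum>k\<le>m. g k 0 * z ^ k / fact k)\<bar> <= (\<integral>y\<in>{0..z}. ennreal ((z - y) ^ m) * F y)"
 using assms(2-)
proof (induction m arbitrary: g z)
 case 0
 then show ?case by simp
next
 case (Suc m)
 define E where "E s = g 1 s - (\<Sum>k\<le>m. g (Suc k) 0 * s ^ k / fact k)" for s
 have E: "ennreal \<bar>E s\<bar> <= (\<integral>y\<in>{0..s}. ennreal ((s - y) ^ m) * F y)" if "s \<in> {0..l}" for s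
  using Suc.IH[of "\<lambda>k. g (Suc k)", OF Suc.prems(1,2) that] unfolding E_def by simp
 define D where "D s = g 0 s - (\<Sum>k\<le>Suc m. g k 0 * s ^ k / fact k)" for s
 have D_eq: "D s = g 0 s - (g 0 0 + (\<Sum>k\<le>m. g (Suc k) 0 * s ^ Suc k / fact (Suc k)))" for s
  unfolding D_def by (simp only: sum.atMost_Suc_shift) simp
 have "(E has_integral (D z - D 0)) {0..z}"
 proof (rule fundamental_theorem_of_calculus)
  fix s assume s: "s \<in> {0..z}"
  then have sl: "s \<in> {0..l}" using Suc.prems(3) by auto
  have "((\<lambda>s. g (Suc k) 0 * s ^ Suc k / fact (Suc k)) has_real_derivative g (Suc k) 0 * s ^ k / fact k) (at s within {0..z})" for k
  proof -
   have "((\<lambda>s. g (Suc k) 0 * s ^ Suc k / fact (Suc k)) has_real_derivative g (Suc k) 0 * (real (Suc k) * s ^ k) / fact (Suc k)) (at s within {0..z})"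
    by (intro derivative_eq_intros) auto
   also have "g (Suc k) 0 * (real (Suc k) * s ^ k) / fact (Suc k) = g (Suc k) 0 * s ^ k / fact k"
    by (simp add: field_simps del: of_nat_Suc)
   finally show ?thesis .
  qed
  moreover have "(g 0 has_real_derivative g 1 s) (at s within {0..z})"
   using Suc.prems(1)[of 0 s] sl Suc.prems(3) by (auto intro: DERIV_subset)
  ultimately have "(D has_real_derivative E s) (at s within {0..z})"
   unfolding D_eq[abs_def] E_def by (intro DERIV_diff DERIV_sum DERIV_add[where D = 0, simplified]) auto
  then show "(D has_vector_derivative E s) (at s within {0..z})" by (simp add: has_real_derivative_iff_has_vector_derivative)
 qed (use Suc.prems(3) in auto)
 moreover have "D 0 = 0" unfolding D_eq by simp
 ultimately have "ennreal \<bar>D z\<bar> <= (\<integral>\<^sup>+s\<in>{0..z}. ennreal \<bar>E s\<bar> \<partial>lebesgue)"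
  using has_integral_abs_le_nn_integral by fastforce
 also have "... = (\<integral>s\<in>{0..z}. ennreal \<bar>E s\<bar>)" by (rule nn_integral_completion)
 also have "... <= (\<integral>s. \<integral>y. (if 0 <= y \<and> y <= s \<and> s <= z then ennreal ((z - y) ^ m) * F y else 0))"
 proof (rule nn_integral_mono)
  fix s
  show "ennreal \<bar>E s\<bar> * indicator {0..z} s <= (\<integral>y. (if 0 <= y \<and> y <= s \<and> s <= z then ennreal ((z - y) ^ m) * F y else 0))"
  proof (cases "s \<in> {0..z}")
   case True
   then have "ennreal \<bar>E s\<bar> <= (\<integral>y\<in>{0..s}. ennreal ((s - y) ^ m) * F y)" using E Suc.prems(3) by simp
   also have "... <= (\<integral>y. (if 0 <= y \<and> y <= s \<and> s <= z then ennreal ((z - y) ^ m) * F y else 0))"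
    using True by (intro nn_integral_mono) (auto simp: indicator_def intro!: mult_right_mono ennreal_leI power_mono)
   finally show ?thesis using True by simp
  qed simp
 qed
 also have "... = (\<integral>y. \<integral>s. (if 0 <= y \<and> y <= s \<and> s <= z then ennreal ((z - y) ^ m) * F y else 0))"
  using lborel_swap[of "\<lambda>(s, y). if 0 <= y \<and> y <= s \<and> s <= z then ennreal ((z - y) ^ m) * F y else 0"] by simp
 also have "... = (\<integral>y\<in>{0..z}. ennreal ((z - y) ^ Suc m) * F y)"
 proof (rule nn_integral_cong)
  fix y
  have "(\<integral>s. (if 0 <= y \<and> y <= s \<and> s <= z then ennreal ((z - y) ^ m) * F y else 0))
   = (\<integral>s. ennreal ((z - y) ^ m) * F y * indicator {0..} y * indicator {y..z} s)"
   by (intro nn_integral_cong) (auto simp: indicator_def)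
  also have "... = ennreal ((z - y) ^ m) * F y * indicator {0..} y * emeasure lborel {y..z}"
   by (rule nn_integral_cmult_indicator) simp
  also have "... = ennreal ((z - y) ^ Suc m) * F y * indicator {0..z} y"
  proof (cases "y \<in> {0..z}")
   case True
   then have "ennreal ((z - y) ^ Suc m) = ennreal ((z - y) ^ m) * ennreal (z - y)" by (subst ennreal_mult[symmetric]) (auto simp: mult_ac)
   then show ?thesis using True by (simp add: mult_ac)
  qed (auto simp: indicator_def)
  finally show "(\<integral>s. (if 0 <= y \<and> y <= s \<and> s <= z then ennreal ((z - y) ^ m) * F y else 0))
   = ennreal ((z - y) ^ Suc m) * F y * indicator {0..z} y" .
 qed
 finally show ?case unfolding D_def .
qed

text \<open>The Taylor polynomial at the centre is annihilated by the difference, so only remainders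
  at the nodes count. For every node \<open>z\<close> and every \<open>y\<close> between
  \<open>x\<close> and \<open>z\<close>, \<open>\<bar>z - y\<bar> <= v - \<bar>y - x\<bar>\<close>,
  which yields one kernel for all nodes; the binomial coefficients add up to
  \<open>2 ^ r\<close>.\<close>

lemma sym_diff_taylor_bound:
 fixes g :: "real => real"
 assumes r: "1 <= r" and g: "g \<in> AC_loc_deriv r" and [measurable]: "F \<in> borel_measurable borel"
  and F: "\<And>a b. -1 < a ==> a <= b ==> b < 1 ==> ennreal \<bar>(deriv ^^ (r - 1)) g b - (deriv ^^ (r - 1)) g a\<bar> <= (\<integral>x\<in>{a..b}. ennreal \<bar>F x\<bar>)"
  and \<delta>: "0 <= \<delta>" and v: "v = real r * \<delta> / 2" "-1 < x - v" "x + v < 1"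
 shows "ennreal \<bar>sym_diff r \<delta> g x\<bar> <= ennreal (2 ^ r) * (\<integral>y\<in>{x - v..x + v}. ennreal ((v - \<bar>y - x\<bar>) ^ (r - 1)) * ennreal \<bar>F y\<bar>)"
proof -
 let ?a = "\<lambda>k u. (deriv ^^ k) g (x - u)"
 let ?b = "\<lambda>i. x - v + real i * \<delta>"
 let ?c = "\<lambda>k u. (deriv ^^ k) g (x + u)"
 let ?d = "\<lambda>i. real (r choose i)"
 let ?e = "\<lambda>k. smult ((deriv ^^ k) g x / fact k) ([:- x, 1:] ^ k)"
 let ?f = "\<lambda>k. deriv ^^ Suc k"
 let ?g = "sym_diff r \<delta> g x"
 define m where "m = r - 1"
 define H where "H y = ennreal ((v - \<bar>y - x\<bar>) ^ m) * ennreal \<bar>F y\<bar> * indicator {x - v..x + v} y" for y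
 have Hm[measurable]: "H \<in> borel_measurable borel" unfolding H_def by measurable
 define I where "I = (\<integral>y. H y)"
 have v0: "0 <= v" unfolding v(1) using \<delta> by simp
 define P where "P = (\<Sum>k\<le>m. ?e k)"
 have P: "poly P z = (\<Sum>k\<le>m. (deriv ^^ k) g x * (z - x) ^ k / fact k)" for z
  unfolding P_def by (simp add: poly_sum poly_power)
 have degP: "degree P < r"
 proof -
  have "degree P <= m" unfolding P_def
  proof (rule degree_sum_le)
   fix k assume "k \<in> {..m}"
   then show "degree (?e k) <= m"
    by (intro order_trans[OF degree_smult_le]) (simp add: degree_linear_power)
  qed simp
  then show ?thesis using r unfolding m_def by simp
 qed
 have der: "((deriv ^^ k) g has_real_derivative (?f k) g y) (at y)" if "k < m" "y \<in> {-1<..<1}" for k y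
  using g that unfolding AC_loc_deriv_def m_def by (auto simp: DERIV_deriv_iff_real_differentiable)
 have rem: "ennreal \<bar>g z - poly P z\<bar> <= I" if z: "z \<in> {x - v..x + v}" for z
 proof (cases "x <= z")
  case True
  have "ennreal \<bar>?c 0 (z - x) - (\<Sum>k\<le>m. ?c k 0 * (z - x) ^ k / fact k)\<bar>
   <= (\<integral>y\<in>{0..z - x}. ennreal (((z - x) - y) ^ m) * ennreal \<bar>F (y + x)\<bar>)"
  proof (rule taylor_remainder_nn_integral[where g = "\<lambda>k u. ?c k u" and l = v])
   fix k u assume "k < m" "u \<in> {0..v}"
   then have "((deriv ^^ k) g has_real_derivative (?f k) g (x + u)) (at (x + u))" using v v0 by (intro der) auto
   then have "((\<lambda>u. ?c k u) has_real_derivative (?f k) g (x + u) * (0 + 1)) (at u)"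
    by (rule DERIV_chain2) (auto intro!: derivative_eq_intros)
   then have "((\<lambda>u. ?c k u) has_real_derivative (?f k) g (x + u)) (at u)" by (simp only: add_0 mult_1_right)
   then show "((\<lambda>u. ?c k u) has_real_derivative (?f k) g (x + u)) (at u within {0..v})"
    by (rule has_field_derivative_at_within)
  next
   fix u assume u: "u \<in> {0..v}"
   have "ennreal \<bar>?c m u - ?c m 0\<bar> <= (\<integral>y. ennreal \<bar>F y\<bar> * indicator {x..x + u} y)"
    using F[of x "x + u"] u v v0 unfolding m_def by simp
   also have "... = (\<integral>y. ennreal \<bar>F (y + x)\<bar> * indicator {x..x + u} (y + x))"
    by (subst nn_integral_lborel_shift[of "\<lambda>y. ennreal \<bar>F y\<bar> * indicator {x..x + u} y"]) simp_all
   also have "... = (\<integral>y\<in>{0..u}. ennreal \<bar>F (y + x)\<bar>)"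
    by (intro nn_integral_cong) (auto simp: indicator_def)
   finally show "ennreal \<bar>?c m u - ?c m 0\<bar> <= (\<integral>y\<in>{0..u}. ennreal \<bar>F (y + x)\<bar>)" .
  qed (use z True in auto)
  also have "... <= (\<integral>y. H (y + x))"
   unfolding H_def using z True by (intro nn_integral_mono) (auto simp: indicator_def intro!: mult_right_mono ennreal_leI power_mono)
  also have "... = I" unfolding I_def by (rule nn_integral_lborel_shift) measurable
  finally show ?thesis unfolding P by simp
 next
  case False
  \<comment> \<open>Nodes to the left of the centre: Taylor's formula for the reflected function,
    whose derivatives carry alternating signs.\<close>
  have "ennreal \<bar>(-1) ^ 0 * ?a 0 (x - z) - (\<Sum>k\<le>m. (-1) ^ k * ?a k 0 * (x - z) ^ k / fact k)\<bar>
   <= (\<integral>y\<in>{0..x - z}. ennreal (((x - z) - y) ^ m) * ennreal \<bar>F (x - y)\<bar>)"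
  proof (rule taylor_remainder_nn_integral[where g = "\<lambda>k u. (-1) ^ k * ?a k u" and l = v])
   fix k u assume "k < m" "u \<in> {0..v}"
   then have "((deriv ^^ k) g has_real_derivative (?f k) g (x - u)) (at (x - u))" using v v0 by (intro der) auto
   then have "((\<lambda>u. ?a k u) has_real_derivative (?f k) g (x - u) * (0 - 1)) (at u)"
    by (rule DERIV_chain2) (auto intro!: derivative_eq_intros)
   from DERIV_cmult[OF this, of "(-1) ^ k"]
   have "((\<lambda>u. (-1) ^ k * ?a k u) has_real_derivative (-1) ^ Suc k * (?f k) g (x - u)) (at u)" by simp
   then show "((\<lambda>u. (-1) ^ k * ?a k u) has_real_derivative (-1) ^ Suc k * (?f k) g (x - u)) (at u within {0..v})"
    by (rule has_field_derivative_at_within)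
  next
   fix u assume u: "u \<in> {0..v}"
   have "\<bar>(-1) ^ m * ?a m u - (-1) ^ m * ?a m 0\<bar> = \<bar>(deriv ^^ m) g x - ?a m u\<bar>"
    by (simp add: abs_mult abs_minus_commute flip: right_diff_distrib)
   then have "ennreal \<bar>(-1) ^ m * ?a m u - (-1) ^ m * ?a m 0\<bar> <= (\<integral>y. ennreal \<bar>F y\<bar> * indicator {x - u..x} y)"
    using F[of "x - u" x] u v v0 unfolding m_def by simp
   also have "... = (\<integral>y. ennreal \<bar>F (x - y)\<bar> * indicator {x - u..x} (x - y))"
    by (subst nn_integral_lborel_reflect[of "\<lambda>y. ennreal \<bar>F y\<bar> * indicator {x - u..x} y"]) simp_all
   also have "... = (\<integral>y\<in>{0..u}. ennreal \<bar>F (x - y)\<bar>)"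
    by (intro nn_integral_cong) (auto simp: indicator_def)
   finally show "ennreal \<bar>(-1) ^ m * ?a m u - (-1) ^ m * ?a m 0\<bar> <= (\<integral>y\<in>{0..u}. ennreal \<bar>F (x - y)\<bar>)" .
  qed (use z False in auto)
  also have "... <= (\<integral>y. H (x - y))"
   unfolding H_def using z False by (intro nn_integral_mono) (auto simp: indicator_def intro!: mult_right_mono ennreal_leI power_mono)
  also have "... = I" unfolding I_def by (rule nn_integral_lborel_reflect) measurable
  also have "(\<Sum>k\<le>m. (-1) ^ k * ?a k 0 * (x - z) ^ k / fact k) = poly P z"
  proof -
   have "(-1) ^ k * (x - z) ^ k = (z - x) ^ k" for k by (simp flip: power_mult_distrib)
   then have "(-1) ^ k * ?a k 0 * (x - z) ^ k / fact k = (deriv ^^ k) g x * (z - x) ^ k / fact k" for k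
    by (metis diff_zero mult.commute mult.left_commute)
   then show ?thesis unfolding P by (simp only:)
  qed
  finally show ?thesis by simp
 qed
 have dom: "x - real r * \<delta> / 2 \<in> {-1..1} \<and> x + real r * \<delta> / 2 \<in> {-1..1}" using v v0 by auto
 have "?g = fdiff r \<delta> g (x - v) - fdiff r \<delta> (poly P) (x - v)"
  unfolding sym_diff_fdiff v(1) fdiff_poly[OF degP] using dom by simp
 also have "... = (\<Sum>i=0..r. ?d i * (-1) ^ (r - i) * (g (?b i) - poly P (?b i)))"
  unfolding fdiff_def sum_subtractf[symmetric] by (simp add: algebra_simps)
 finally have "\<bar>?g\<bar> <= (\<Sum>i=0..r. ?d i * \<bar>g (?b i) - poly P (?b i)\<bar>)"
  by (auto intro!: order_trans[OF sum_abs] sum_mono simp: abs_mult)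
 then have "ennreal \<bar>?g\<bar> <= ennreal (\<Sum>i=0..r. ?d i * \<bar>g (?b i) - poly P (?b i)\<bar>)"
  by (rule ennreal_leI)
 also have "... = (\<Sum>i=0..r. ennreal (?d i) * ennreal \<bar>g (?b i) - poly P (?b i)\<bar>)"
  by (subst sum_ennreal[symmetric]) (auto simp: ennreal_mult)
 also have "... <= (\<Sum>i=0..r. ennreal (?d i) * I)"
 proof (intro sum_mono mult_left_mono rem)
  fix i assume i: "i \<in> {0..r}"
  have "real i * \<delta> <= real r * \<delta>" using i \<delta> by (intro mult_right_mono) auto
  then show "x - v + real i * \<delta> \<in> {x - v..x + v}" using \<delta> v(1) by auto
 qed simp
 also have "... = ennreal (\<Sum>i=0..r. ?d i) * I"
  by (simp add: sum_distrib_right[symmetric] sum_ennreal)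
 also have "(\<Sum>i=0..r. ?d i) = 2 ^ r"
  by (simp only: of_nat_sum[symmetric] atMost_atLeast0[symmetric] choose_row_sum) simp
 finally show ?thesis unfolding I_def H_def m_def by (simp add: mult.assoc)
qed

text \<open>Completeness of Lebesgue measure: agreement almost everywhere with a Borel function
  suffices.\<close>

lemma measurable_lebesgue_on_AE:
 fixes f g :: "real => 'a :: topological_space"
 assumes g: "g \<in> borel_measurable borel" and fg: "AE x\<in>{-1..1} in lborel. f x = g x"
 shows "f \<in> borel_measurable leb"
proof (rule measurableI)
 fix A :: "'a set" assume A: "A \<in> sets borel"
 have "g \<in> borel_measurable lborel" using g by simp
 then have "g \<in> borel_measurable lebesgue" by (rule measurable_completion)
 then have "g -` A \<inter> {-1..1} \<in> sets lebesgue" using A measurable_sets[of g lebesgue borel A] by auto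
 then have "{x \<in> {-1..1}. f x \<in> A} \<in> sets lebesgue"
 proof (rule completion.in_sets_AE[rotated])
  show "AE x in lebesgue. (x \<in> g -` A \<inter> {-1..1}) = (x \<in> {x \<in> {-1..1}. f x \<in> A})"
   using AE_completion[OF fg] by eventually_elim auto
 qed simp
 moreover have "f -` A \<inter> space leb = {x \<in> {-1..1}. f x \<in> A}" by auto
 ultimately show "f -` A \<inter> space leb \<in> sets leb"
  by (subst sets_restrict_space_iff) auto
qed simp

lemma wnorm_le_of_powr:
 assumes p: "1 <= p" "p \<noteq> top" and c: "0 <= c"
  and le: "(\<integral>\<^sup>+x. ennreal (\<bar>a x\<bar> powr enn2real p * v x) \<partial>leb) <=
   ennreal (c powr enn2real p) * (\<integral>\<^sup>+x. ennreal (\<bar>b x\<bar> powr enn2real p * v x) \<partial>leb)"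
 shows "wnorm p v a <= ennreal c * wnorm p v b"
proof -
 have q: "0 < enn2real p" using enn2real_exponent[OF p] by simp
 show ?thesis using ennreal_powr_root_le[OF q _ c, of _ "wnorm p v b"] le p
  unfolding wnorm_powr[OF p] by (simp add: wnorm_def[of p v a])
qed

text \<open>A quasi-triangle inequality is enough up to constants. One factor \<open>2\<close> comes
  from \<open>\<bar>a + b\<bar> <= 2 * max \<bar>a\<bar> \<bar>b\<bar>\<close>, the other from
  collecting two \<open>q\<close>-th powers into that of the sum.\<close>

lemma wnorm_add_le:
 assumes p: "1 <= p" and v: "\<And>x. x \<in> {-1..1} ==> 0 <= v x"
  and [measurable]: "a \<in> borel_measurable leb" "b \<in> borel_measurable leb" "v \<in> borel_measurable leb"
 shows "wnorm p v (\<lambda>x. a x + b x) <= 4 * (wnorm p v a + wnorm p v b)"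
proof (cases "p = top")
 case True
 have "wnorm top v (\<lambda>x. a x + b x) <= wnorm top v a + wnorm top v b"
 proof (rule wnorm_top_le)
  show "AE x\<in>{-1..1} in lborel. ennreal (\<bar>a x + b x\<bar> * v x) <= wnorm top v a + wnorm top v b"
   using wnorm_top_AE[of a v] wnorm_top_AE[of b v]
  proof (eventually_elim, intro impI)
   fix x :: real assume 1: "x \<in> {-1..1} --> ennreal (\<bar>a x\<bar> * v x) <= wnorm top v a"
    "x \<in> {-1..1} --> ennreal (\<bar>b x\<bar> * v x) <= wnorm top v b" and x: "x \<in> {-1..1}"
   have "\<bar>a x + b x\<bar> * v x <= \<bar>a x\<bar> * v x + \<bar>b x\<bar> * v x"
    using v[OF x] unfolding distrib_right[symmetric] by (intro mult_right_mono) auto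
   then have "ennreal (\<bar>a x + b x\<bar> * v x) <= ennreal (\<bar>a x\<bar> * v x) + ennreal (\<bar>b x\<bar> * v x)"
    using v[OF x] by (simp add: ennreal_leI flip: ennreal_plus)
   also have "... <= wnorm top v a + wnorm top v b" using 1 x by (intro add_mono) auto
   finally show "ennreal (\<bar>a x + b x\<bar> * v x) <= wnorm top v a + wnorm top v b" .
  qed
 qed measurable
 also have "... <= 4 * (wnorm top v a + wnorm top v b)"
  using mult_right_mono[of 1 4 "wnorm top v a + wnorm top v b"] by simp
 finally show ?thesis using True by simp
next
 case False
 define q where "q = enn2real p"
 have q: "1 <= q" unfolding q_def by (rule enn2real_exponent[OF p False])
 define X Y where "X = wnorm p v a" and "Y = wnorm p v b"
 have "(\<integral>\<^sup>+x. ennreal (\<bar>a x + b x\<bar> powr q * v x) \<partial>leb)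
  <= (\<integral>\<^sup>+x. ennreal (2 powr q) * (ennreal (\<bar>a x\<bar> powr q * v x) + ennreal (\<bar>b x\<bar> powr q * v x)) \<partial>leb)"
 proof (rule nn_integral_mono)
  fix x :: real assume "x \<in> space leb"
  then have x: "x \<in> {-1..1}" by simp
  have "\<bar>a x + b x\<bar> powr q <= (2 * max \<bar>a x\<bar> \<bar>b x\<bar>) powr q" using q by (intro powr_mono2) auto
  also have "... = 2 powr q * max \<bar>a x\<bar> \<bar>b x\<bar> powr q" by (rule powr_mult)
  also have "... <= 2 powr q * (\<bar>a x\<bar> powr q + \<bar>b x\<bar> powr q)" by (intro mult_left_mono) (auto simp: max_def)
  finally have "\<bar>a x + b x\<bar> powr q * v x <= 2 powr q * (\<bar>a x\<bar> powr q + \<bar>b x\<bar> powr q) * v x" using v[OF x] by (rule mult_right_mono)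
  then have "ennreal (\<bar>a x + b x\<bar> powr q * v x) <= ennreal (2 powr q * (\<bar>a x\<bar> powr q * v x + \<bar>b x\<bar> powr q * v x))"
   by (intro ennreal_leI) (simp add: algebra_simps)
  also have "... = ennreal (2 powr q) * (ennreal (\<bar>a x\<bar> powr q * v x) + ennreal (\<bar>b x\<bar> powr q * v x))"
   using v[OF x] by (subst ennreal_plus[symmetric]) (auto simp: ennreal_mult')
  finally show "ennreal (\<bar>a x + b x\<bar> powr q * v x) <= ennreal (2 powr q) * (ennreal (\<bar>a x\<bar> powr q * v x) + ennreal (\<bar>b x\<bar> powr q * v x))" .
 qed
 also have "... = ennreal (2 powr q) * (ennreal_powr X q + ennreal_powr Y q)"
  unfolding X_def Y_def q_def wnorm_powr[OF p False] by (simp add: nn_integral_cmult nn_integral_add)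
 also have "... <= ennreal (2 powr q) * (ennreal (2 powr q) * ennreal_powr (X + Y) q)"
 proof (rule mult_left_mono)
  have "ennreal_powr X q + ennreal_powr Y q <= 2 * ennreal_powr (X + Y) q"
   unfolding mult_2 using q by (intro add_mono ennreal_powr_mono) auto
  also have "(2::ennreal) <= ennreal (2 powr q)" using q powr_mono[of 1 q "2::real"] by (simp flip: ennreal_numeral)
  finally show "ennreal_powr X q + ennreal_powr Y q <= ennreal (2 powr q) * ennreal_powr (X + Y) q" by (simp add: mult_right_mono)
 qed simp
 also have "... = ennreal (4 powr q) * ennreal_powr (X + Y) q"
  by (simp add: mult.assoc[symmetric] powr_mult[symmetric] flip: ennreal_mult)
 finally have "ennreal_powr (\<integral>\<^sup>+x. ennreal (\<bar>a x + b x\<bar> powr q * v x) \<partial>leb) (1 / q) <= ennreal 4 * (X + Y)"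
  by (rule ennreal_powr_root_le[rotated]) (use q in auto)
 then show ?thesis using False unfolding X_def Y_def q_def by (simp add: wnorm_def[of p v "\<lambda>x. a x + b x"])
qed

text \<open>The sine of the mean angle is at least half of \<open>sin \<alpha> = phi x\<close>, so
  this factor cancels from the product formula for \<open>x - y\<close>.\<close>

lemma abs_arccos_diff_le:
 assumes x: "x \<in> {-1..1}" and y: "y \<in> {-1..1}" and c: "0 <= c" and xy: "\<bar>x - y\<bar> <= c * phi x"
 shows "\<bar>arccos x - arccos y\<bar> <= 4 * c"
proof -
 define \<alpha> \<theta> where "\<alpha> = arccos x" and "\<theta> = arccos y"
 have a: "0 <= \<alpha>" "\<alpha> <= pi" "x = cos \<alpha>" unfolding \<alpha>_def using x by (auto simp: arccos_lbound arccos_ubound cos_arccos)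
 have t: "0 <= \<theta>" "\<theta> <= pi" "y = cos \<theta>" unfolding \<theta>_def using y by (auto simp: arccos_lbound arccos_ubound cos_arccos)
 have s: "phi x = sin \<alpha>" unfolding a(3) by (rule phi_cos[OF a(1,2)])
 show ?thesis
 proof (cases "sin \<alpha> = 0")
  case True
  then have "x = y" using xy s by simp
  then show ?thesis using c by simp
 next
  case False
  then have sp: "0 < sin \<alpha>" using sin_ge_zero[OF a(1,2)] by simp
  have "sin \<alpha> + sin \<theta> = 2 * sin ((\<alpha> + \<theta>) / 2) * cos ((\<alpha> - \<theta>) / 2)" by (simp add: sin_plus_sin)
  also have "... <= 2 * sin ((\<alpha> + \<theta>) / 2) * 1" using a t by (intro mult_left_mono) (auto intro!: sin_ge_zero)
  finally have "sin \<alpha> <= 2 * sin ((\<alpha> + \<theta>) / 2)" using sin_ge_zero[OF t(1,2)] by simp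
  moreover have "\<bar>x - y\<bar> = 2 * \<bar>sin ((\<alpha> + \<theta>) / 2)\<bar> * \<bar>sin ((\<theta> - \<alpha>) / 2)\<bar>"
   unfolding a(3) t(3) by (simp add: cos_diff_cos abs_mult)
  ultimately have "sin \<alpha> * \<bar>sin ((\<theta> - \<alpha>) / 2)\<bar> <= \<bar>x - y\<bar>" by (auto intro!: mult_right_mono)
  then have "sin \<alpha> * \<bar>sin ((\<theta> - \<alpha>) / 2)\<bar> <= sin \<alpha> * c" using xy s by (simp add: mult.commute)
  then have "\<bar>sin ((\<theta> - \<alpha>) / 2)\<bar> <= c" using sp by simp
  then have "\<bar>\<theta> - \<alpha>\<bar> <= 4 * c" using sin_half_lower(1)[OF t(1,2) a(1,2)] by argo
  then show ?thesis unfolding \<alpha>_def \<theta>_def by (simp add: abs_minus_commute)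
 qed
qed

text \<open>All nodes of a difference with \<open>h <= B / n\<close> lie within an angle of order
  \<open>1 / n\<close> of the centre, where the weight changes by a bounded factor.\<close>

lemma weight_n_local_compare:
 fixes B L :: real and r :: nat
 assumes L: "1 <= L" and B: "0 < B"
 shows "\<exists>C\<ge>1. \<forall>w n h x y. doubling_weight w L --> 0 < n --> 0 < h --> h <= B / real n --> x \<in> {-1..1} --> y \<in> {-1..1} -->
  \<bar>x - y\<bar> <= real r * h / 2 * phi x --> weight_n w n x <= C * weight_n w n y"
proof -
 obtain s :: nat where s: "L <= (3/2) ^ s" using real_arch_pow[of "3/2" L] by (auto intro: less_imp_le)
 define K where "K = 2 * real r * B"
 define C :: real where "C = 3 ^ s * (1 + K) ^ (2 * s + 1)"
 have "1 * 1 <= C" unfolding C_def K_def using B by (intro mult_mono one_le_power) auto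
 moreover have "weight_n w n x <= C * weight_n w n y"
  if dw: "doubling_weight w L" and n: "0 < n" and h: "0 < h" "h <= B / real n" and x: "x \<in> {-1..1}" and y: "y \<in> {-1..1}"
   and xy: "\<bar>x - y\<bar> <= real r * h / 2 * phi x" for w n h x y
 proof -
  have "real n * h <= B" using h(2) n by (simp add: pos_le_divide_eq mult.commute)
  then have "real r * (real n * h) <= real r * B" by (intro mult_left_mono) auto
  moreover have "real n * \<bar>arccos x - arccos y\<bar> <= real n * (4 * (real r * h / 2))"
   using abs_arccos_diff_le[OF x y _ xy] h by (intro mult_left_mono) auto
  ultimately have d: "real n * \<bar>arccos x - arccos y\<bar> <= K" unfolding K_def by (simp add: mult_ac)
  have "weight_n w n (cos (arccos x)) <= 3 ^ s * (1 + real n * \<bar>arccos x - arccos y\<bar>) ^ (2 * s + 1) * weight_n w n (cos (arccos y))"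
   using x y by (intro weight_n_cos_compare[OF dw L s n]) (auto simp: arccos_lbound arccos_ubound)
  also have "... <= C * weight_n w n (cos (arccos y))"
   unfolding C_def using d y weight_n_nonneg[OF dw y n] by (intro mult_right_mono mult_left_mono power_mono add_left_mono) (auto simp: cos_arccos)
  finally show ?thesis using x y by (simp add: cos_arccos)
 qed
 ultimately show ?thesis by (intro exI[of _ C]) auto
qed

lemma borel_measurable_sym_diff:
 assumes h: "0 < h" and r: "1 <= r" and f: "f \<in> borel_measurable leb"
 shows "(\<lambda>x. sym_diff r (h * phi x) f x) \<in> borel_measurable leb"
proof -
 obtain f' where [measurable]: "f' \<in> borel_measurable borel" and ff': "AE x\<in>{-1..1} in lborel. f x = f' x"
  using borel_representative[OF f] by blast
 show ?thesis by (rule measurable_lebesgue_on_AE[OF _ AE_sym_diff_cong[OF h r ff']]) measurable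
qed

text \<open>A single node with the largest value is selected, which passes to \<open>q\<close>-th
  powers and to the supremum norm alike.\<close>

lemma abs_sym_diff_le:
 assumes "x \<in> {-1..1}" "0 < h"
 shows "\<exists>j\<le>r. \<bar>sym_diff r (h * phi x) f x\<bar> <= (if x \<in> diff_domain (real r * h / 2) then 2 ^ r * \<bar>f (x + ((real j - real r / 2) * h) * phi x)\<bar> else 0)"
proof -
 define a where "a i = \<bar>f (x + ((real i - real r / 2) * h) * phi x)\<bar>" for i
 have "Max (a ` {..r}) \<in> a ` {..r}" by (intro Max_in) auto
 then obtain j where j: "j <= r" "a j = Max (a ` {..r})" by (metis atMost_iff imageE)
 have aj: "a i <= a j" if "i <= r" for i unfolding j(2) using that by (intro Max_ge) auto
 have "\<bar>\<Sum>i=0..r. real (r choose i) * (-1) ^ (r - i) * f (x + ((real i - real r / 2) * h) * phi x)\<bar> <= (\<Sum>i=0..r. real (r choose i) * a i)"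
  unfolding a_def by (intro order_trans[OF sum_abs] sum_mono) (auto simp: abs_mult)
 also have "... <= (\<Sum>i=0..r. real (r choose i) * a j)" using aj by (intro sum_mono mult_left_mono) auto
 also have "... = real (\<Sum>i\<le>r. r choose i) * a j" by (simp add: sum_distrib_right atMost_atLeast0)
 also have "... = 2 ^ r * a j" by (simp add: choose_row_sum)
 finally show ?thesis using j(1) unfolding a_def by (intro exI[of _ j]) (auto simp: sym_diff_domain[OF assms(2,1)])
qed

text \<open>The part of the K-functional estimate that concerns \<open>f - g\<close>: the weight is
  moved from \<open>x\<close> to the node, and \<open>nn_integral_node_shift\<close> changes
  variables to the node.\<close>

lemma wnorm_sym_diff_le:
 fixes p :: ennreal and B L :: real
 assumes r: "1 <= r" and p: "1 <= p" and B: "0 < B" and L: "1 <= L"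
 shows "\<exists>C>0. \<forall>w f n h. doubling_weight w L --> f \<in> borel_measurable leb --> 0 < n --> 0 < h --> h <= B / real n -->
  wnorm p (weight_n w n) (\<lambda>x. sym_diff r (h * phi x) f x) <= ennreal C * wnorm p (weight_n w n) f"
proof -
 let ?a = "\<lambda>h x f'. sym_diff r (h * phi x) f' x"
 let ?b = "\<lambda>v x \<kappa> i. v (x + \<kappa> i * phi x)"
 let ?c = "\<lambda>q D. ennreal ((2 ^ r) powr q * D)"
 let ?d = "\<lambda>E. ennreal (2 ^ r * E)"
 let ?e = "\<lambda>h x f v. ennreal (\<bar>?a h x f\<bar> * v x)"
 obtain D where D: "1 <= D" "\<And>w n h x y. doubling_weight w L ==> 0 < n ==> 0 < h ==> h <= B / real n ==> x \<in> {-1..1} ==> y \<in> {-1..1} ==>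
  \<bar>x - y\<bar> <= real r * h / 2 * phi x ==> weight_n w n x <= D * weight_n w n y"
  using weight_n_local_compare[OF L B, of r] by blast
 \<comment> \<open>Collects the weight factor \<open>D\<close>, the Jacobian factor \<open>2\<close>
   and the number of nodes. As \<open>E >= 1\<close>, also \<open>E <= E powr q\<close>, so it can
   be pulled out of the \<open>q\<close>-th root.\<close>
 define E where "E = 2 * D * real (Suc r)"
 have E: "1 <= E" unfolding E_def using D(1) mult_mono[of 1 "2 * D" 1 "real (Suc r)"] by simp
 have DE: "D <= E" unfolding E_def using D(1) mult_mono[of D "2 * D" 1 "real (Suc r)"] by simp
 show ?thesis
 proof (intro exI[of _ "2 ^ r * E"] conjI allI impI)
  show "0 < 2 ^ r * E" using E by simp
  fix w f :: "real => real" and n :: nat and h :: real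
  assume dw: "doubling_weight w L" and fm: "f \<in> borel_measurable leb" and n: "0 < n" and h: "0 < h" "h <= B / real n"
  define v where "v = weight_n w n"
  have vm[measurable]: "v \<in> borel_measurable borel" unfolding v_def by (rule weight_n_measurable[OF dw])
  have v0: "0 <= v x" if "x \<in> {-1..1}" for x unfolding v_def by (rule weight_n_nonneg[OF dw that n])
  obtain f' where f'm[measurable]: "f' \<in> borel_measurable borel" and ff': "AE x\<in>{-1..1} in lborel. f x = f' x"
   using borel_representative[OF fm] by blast
  define c where "c = real r * h / 2"
  have c: "0 < c" unfolding c_def using h r by simp
  define \<kappa> where "\<kappa> i = (real i - real r / 2) * h" for i
  have \<kappa>: "\<bar>\<kappa> i\<bar> <= c" if "i <= r" for i
  proof -
   have "\<bar>real i - real r / 2\<bar> * h <= real r / 2 * h" using that h(1) by (intro mult_right_mono) (auto simp: abs_le_iff field_simps)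
   then show ?thesis unfolding c_def \<kappa>_def using h(1) by (simp add: abs_mult)
  qed
  have vle: "v x <= D * ?b v x \<kappa> i" "x + \<kappa> i * phi x \<in> {-1..1}" if x: "x \<in> diff_domain c" and i: "i <= r" for x i
  proof -
   note xx = diff_domainD(1)[OF x]
   show nd: "x + \<kappa> i * phi x \<in> {-1..1}" by (rule diff_domain_node[OF x \<kappa>[OF i]])
   have "\<bar>x - (x + \<kappa> i * phi x)\<bar> <= c * phi x"
    using \<kappa>[OF i] phi_nonneg[OF xx] by (simp add: abs_mult mult_right_mono)
   then show "v x <= D * ?b v x \<kappa> i" unfolding v_def using nd xx by (intro D(2)[OF dw n h]) (auto simp: c_def)
  qed
  have pt: "\<exists>j\<le>r. \<bar>?a h x f'\<bar> <= (if x \<in> diff_domain c then 2 ^ r * \<bar>?b f' x \<kappa> j\<bar> else 0)" if "x \<in> {-1..1}" for x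
   unfolding c_def \<kappa>_def by (rule abs_sym_diff_le[OF that h(1)])
  note cong = AE_sym_diff_cong[OF h(1) r ff']
  show "wnorm p (weight_n w n) (\<lambda>x. ?a h x f) <= ?d E * wnorm p (weight_n w n) f"
   unfolding v_def[symmetric]
  proof (cases "p = top")
   case False
   define q where "q = enn2real p"
   have q: "1 <= q" unfolding q_def by (rule enn2real_exponent[OF p False])
   define G where "G y = ennreal (\<bar>f' y\<bar> powr q * v y)" for y
   have Gm[measurable]: "G \<in> borel_measurable borel" unfolding G_def by measurable
   have "(\<integral>\<^sup>+x. ennreal (\<bar>?a h x f\<bar> powr q * v x) \<partial>leb)
    = (\<integral>x\<in>{-1..1}. ennreal (\<bar>?a h x f'\<bar> powr q * v x))"
    using cong by (intro nn_integral_lebesgue_on_borel) (auto elim!: eventually_mono)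
   also have "... <= (\<integral>x. (\<Sum>i\<le>r. ?c q D * (?b G x \<kappa> i * indicator (diff_domain c) x)))"
   proof (rule nn_integral_mono)
    fix x :: real
    show "ennreal (\<bar>?a h x f'\<bar> powr q * v x) * indicator {-1..1} x <= (\<Sum>i\<le>r. ?c q D * (?b G x \<kappa> i * indicator (diff_domain c) x))"
    proof (cases "x \<in> diff_domain c")
     case True
     note x = diff_domainD(1)[OF True]
     obtain j where j: "j <= r" "\<bar>?a h x f'\<bar> <= 2 ^ r * \<bar>?b f' x \<kappa> j\<bar>" using pt[OF x] True by auto
     have "\<bar>?a h x f'\<bar> powr q <= (2 ^ r * \<bar>?b f' x \<kappa> j\<bar>) powr q" using j q by (intro powr_mono2) auto
     also have "... = (2 ^ r) powr q * \<bar>?b f' x \<kappa> j\<bar> powr q" by (rule powr_mult)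
     finally have "\<bar>?a h x f'\<bar> powr q * v x <= ((2 ^ r) powr q * \<bar>?b f' x \<kappa> j\<bar> powr q) * (D * ?b v x \<kappa> j)"
      using vle(1)[OF True j(1)] v0[OF x] by (intro mult_mono) auto
     then have "ennreal (\<bar>?a h x f'\<bar> powr q * v x) <= ennreal (((2 ^ r) powr q * D) * (\<bar>?b f' x \<kappa> j\<bar> powr q * ?b v x \<kappa> j))"
      by (intro ennreal_leI) (simp add: mult_ac)
     also have "... = ?c q D * ?b G x \<kappa> j"
      unfolding G_def using D(1) v0[OF vle(2)[OF True j(1)]] by (subst ennreal_mult) auto
     also have "... <= (\<Sum>i\<le>r. ?c q D * ?b G x \<kappa> i)"
      using j by (intro member_le_sum) auto
     finally show ?thesis using True x by simp
    next
     case False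
     have "?a h x f' = 0" if "x \<in> {-1..1}" using pt[OF that] False by auto
     then show ?thesis by (cases "x \<in> {-1..1}") (auto simp: indicator_def)
    qed
   qed
   also have "... = (\<Sum>i\<le>r. ?c q D * (\<integral>x\<in>diff_domain c. ?b G x \<kappa> i))"
    by (simp add: nn_integral_sum nn_integral_cmult)
   also have "... <= (\<Sum>i\<le>r. ?c q D * (2 * (\<integral>x\<in>{-1..1}. G x)))"
    by (intro sum_mono mult_left_mono nn_integral_node_shift[OF c \<kappa> Gm]) auto
   also have "... = ?c q E * (\<integral>x\<in>{-1..1}. G x)"
   proof -
    have "?c q E = of_nat (Suc r) * (?c q D * 2)"
     unfolding E_def using D(1) by (simp add: ennreal_mult[symmetric] ennreal_of_nat_eq_real_of_nat mult_ac del: of_nat_Suc flip: ennreal_numeral)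
    then show ?thesis by (simp add: mult_ac del: of_nat_Suc)
   qed
   also have "(\<integral>x\<in>{-1..1}. G x) = (\<integral>\<^sup>+x. ennreal (\<bar>f x\<bar> powr q * v x) \<partial>leb)"
    unfolding G_def using ff' by (intro nn_integral_lebesgue_on_borel[symmetric]) (auto elim!: eventually_mono)
   also have "?c q E * ... <= ennreal ((2 ^ r * E) powr q) * ..."
   proof (intro mult_right_mono ennreal_leI)
    have "E powr 1 <= E powr q" using E q by (intro powr_mono) auto
    then show "(2 ^ r) powr q * E <= (2 ^ r * E) powr q" using E by (simp add: powr_mult mult_left_mono)
   qed simp
   finally show "wnorm p v (\<lambda>x. ?a h x f) <= ?d E * wnorm p v f"
    unfolding q_def by (rule wnorm_le_of_powr[OF p False, rotated]) (use E in simp)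
  next
   case True
   have nodes: "AE x in lborel. \<forall>i\<in>{..r}. x \<in> diff_domain c --> ennreal (\<bar>?b f' x \<kappa> i\<bar> * ?b v x \<kappa> i) <= wnorm top v f"
   proof (rule AE_finite_allI)
    fix i assume "i \<in> {..r}"
    then have i: "i <= r" by simp
    have "AE x\<in>{-1..1} in lborel. ennreal (\<bar>f' x\<bar> * v x) <= wnorm top v f"
     using ff' wnorm_top_AE[of f v] by eventually_elim auto
    then show "AE x\<in>diff_domain c in lborel. ennreal (\<bar>?b f' x \<kappa> i\<bar> * ?b v x \<kappa> i) <= wnorm top v f"
     by (rule AE_node_shift[OF c \<kappa>[OF i]])
   qed simp
   have "wnorm top v (\<lambda>x. ?a h x f) <= ?d E * wnorm top v f"
   proof (rule wnorm_top_le)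
    note [measurable] = borel_measurable_sym_diff[OF h(1) r fm]
    have [measurable]: "v \<in> borel_measurable leb"
     by (rule measurable_lebesgue_on_AE[OF vm]) simp
    show "(\<lambda>x. ?e h x f v) \<in> borel_measurable leb" by measurable
    show "AE x\<in>{-1..1} in lborel. ?e h x f v <= ?d E * wnorm top v f"
     using cong nodes
    proof (eventually_elim, intro impI)
     fix x :: real
     assume e: "x \<in> {-1..1} --> ?a h x f = ?a h x f'"
      and nd: "\<forall>i\<in>{..r}. x \<in> diff_domain c --> ennreal (\<bar>?b f' x \<kappa> i\<bar> * ?b v x \<kappa> i) <= wnorm top v f"
      and x: "x \<in> {-1..1}"
     obtain j where j: "j <= r" "\<bar>?a h x f'\<bar> <= (if x \<in> diff_domain c then 2 ^ r * \<bar>?b f' x \<kappa> j\<bar> else 0)" using pt[OF x] by auto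
     show "?e h x f v <= ?d E * wnorm top v f"
     proof (cases "x \<in> diff_domain c")
      case True
      have "\<bar>?a h x f\<bar> * v x <= (2 ^ r * \<bar>?b f' x \<kappa> j\<bar>) * (D * ?b v x \<kappa> j)"
       using e x True j vle(1)[OF True j(1)] v0[OF x] by (intro mult_mono) auto
      also have "... = 2 ^ r * (D * (\<bar>?b f' x \<kappa> j\<bar> * ?b v x \<kappa> j))" by simp
      also have "... <= 2 ^ r * (E * (\<bar>?b f' x \<kappa> j\<bar> * ?b v x \<kappa> j))"
       using DE v0[OF vle(2)[OF True j(1)]] by (intro mult_left_mono mult_right_mono) auto
      finally have "?e h x f v <= ennreal (2 ^ r * E * (\<bar>?b f' x \<kappa> j\<bar> * ?b v x \<kappa> j))"
       by (intro ennreal_leI) (simp add: mult_ac)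
      also have "... = ?d E * ennreal (\<bar>?b f' x \<kappa> j\<bar> * ?b v x \<kappa> j)"
       using E v0[OF vle(2)[OF True j(1)]] by (subst ennreal_mult) auto
      also have "... <= ?d E * wnorm top v f" using nd True j(1) by (intro mult_left_mono) auto
      finally show ?thesis .
     next
      case False
      then show ?thesis using j e x by simp
     qed
    qed
   qed
   then show "wnorm p v (\<lambda>x. ?a h x f) <= ?d E * wnorm p v f" using True by simp
  qed
 qed
qed

text \<open>The strict version of \<open>diff_domain\<close>: all nodes lie in the open interval,
  where \<open>g\<close> is differentiable and the increments of its derivatives are controlled. It
  differs from \<open>diff_domain\<close> by a null set.\<close>

definition inner_domain :: "real => real set" where
 "inner_domain c = {x \<in> {-1<..<1}. -1 < x - c * phi x \<and> x + c * phi x < 1}"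

lemma inner_domain_measurable[measurable]: "inner_domain c \<in> sets borel"
proof -
 have "inner_domain c = {x \<in> space borel. x \<in> {-1<..<1} \<and> -1 < x - c * phi x \<and> x + c * phi x < 1}"
  unfolding inner_domain_def by auto
 then show ?thesis by simp
qed

lemma inner_diff_domain: "x \<in> inner_domain c ==> x \<in> diff_domain c"
 unfolding inner_domain_def diff_domain_def by auto

lemma AE_inner_domain:
 assumes c: "0 < c" shows "AE x\<in>diff_domain c in lborel. x \<in> inner_domain c"
proof -
 define b where "b = (1 - c^2) / (1 + c^2)"
 have "AE x in lborel. x \<noteq> (-1::real)" "AE x in lborel. x \<noteq> (1::real)" "AE x in lborel. x \<noteq> b" "AE x in lborel. x \<noteq> -b"
  by (rule AE_lborel_singleton)+
 then show ?thesis
 proof (eventually_elim, intro impI)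
  fix x assume ne: "x \<noteq> -1" "x \<noteq> 1" "x \<noteq> b" "x \<noteq> -b" and x: "x \<in> diff_domain c"
  note d = diff_domainD[OF x]
  have a: "\<bar>x\<bar> < 1" using d(1) ne by auto
  have "\<bar>x\<bar> <= b" unfolding b_def by (rule diff_domain_subset[OF c x ne(1,2)])
  then have "\<bar>x\<bar> < b" using ne by (auto simp: abs_if split: if_splits)
  then have "\<bar>x\<bar> * (1 + c^2) < 1 - c^2" unfolding b_def by (simp add: pos_less_divide_eq add_pos_nonneg)
  then have "c^2 * (1 + \<bar>x\<bar>) < 1 - \<bar>x\<bar>" by (simp add: algebra_simps)
  then have "(1 - \<bar>x\<bar>) * (c^2 * (1 + \<bar>x\<bar>)) < (1 - \<bar>x\<bar>) * (1 - \<bar>x\<bar>)" using a by (intro mult_strict_left_mono) auto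
  moreover have "(phi x)^2 = (1 - \<bar>x\<bar>) * (1 + \<bar>x\<bar>)" unfolding phi_squared[OF d(1)] by (cases "0 <= x") auto
  ultimately have "(c * phi x)^2 < (1 - \<bar>x\<bar>)^2"
   by (simp add: power_mult_distrib power2_eq_square[of "1 - \<bar>x\<bar>"] mult_ac)
  then have "c * phi x < 1 - \<bar>x\<bar>" by (rule power2_less_imp_less) (use a in simp)
  then show "x \<in> inner_domain c" unfolding inner_domain_def using a by auto
 qed
qed

lemma phi_pos: "x \<in> {-1<..<1} ==> 0 < phi x"
 by (auto simp: phi_def abs_square_less_1 abs_less_iff)

text \<open>The second claim converts the Taylor kernel into powers of \<open>phi y\<close>. If
  \<open>phi x\<close> is much larger than \<open>phi y\<close>, then \<open>phi y <= 2 * c\<close>,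
  that is, \<open>y\<close> is near an endpoint, and the left side is at most
  \<open>1 - \<bar>y\<bar> <= phi y ^ 2\<close>. The third claim says that away from the endpoints
  \<open>phi\<close> does not change by more than a factor.\<close>

lemma inner_domain_near:
 assumes c: "0 < c" and x: "x \<in> inner_domain c" and y: "\<bar>y - x\<bar> <= c * phi x"
 shows "y \<in> {-1<..<1}" "c * phi x - \<bar>y - x\<bar> <= 2 * c * phi y" "c <= phi y ==> phi x <= 5 / 2 * phi y"
proof -
 have x1: "x \<in> {-1<..<1}" and xc: "\<bar>x\<bar> + c * phi x < 1" using x unfolding inner_domain_def by auto
 show y1: "y \<in> {-1<..<1}" using xc y by auto
 have px: "0 < phi x" and py: "0 < phi y" using phi_pos x1 y1 by auto
 have sq: "(phi x)^2 = 1 - x^2" "(phi y)^2 = 1 - y^2"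
  using phi_squared[of x] phi_squared[of y] x1 y1 by (auto simp: power2_eq_square algebra_simps)
 have "(phi x)^2 - (phi y)^2 = (y - x) * (y + x)" unfolding sq by (simp add: power2_eq_square algebra_simps)
 also have "... <= \<bar>y - x\<bar> * \<bar>y + x\<bar>" by (metis abs_ge_self abs_mult)
 also have "... <= (c * phi x) * 2" using y x1 y1 by (intro mult_mono) auto
 finally have diff: "(phi x)^2 - (phi y)^2 <= 2 * c * phi x" by simp
 have d1: "c * phi x - \<bar>y - x\<bar> <= 1 - \<bar>y\<bar>" using xc by linarith
 have "1 - \<bar>y\<bar> <= (1 - \<bar>y\<bar>) * (1 + \<bar>y\<bar>)" using y1 mult_left_mono[of 1 "1 + \<bar>y\<bar>" "1 - \<bar>y\<bar>"] by auto
 also have "... = (phi y)^2" unfolding sq by (simp add: power2_eq_square algebra_simps)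
 finally have d2: "c * phi x - \<bar>y - x\<bar> <= (phi y)^2" using d1 by linarith
 show "c * phi x - \<bar>y - x\<bar> <= 2 * c * phi y"
 proof (cases "phi x <= 2 * phi y")
  case True
  then have "c * phi x <= c * (2 * phi y)" using c by (intro mult_left_mono) auto
  then show ?thesis by simp
 next
  case False
  then have "phi y * phi y <= (phi x / 2) * (phi x / 2)" using py by (intro mult_mono) auto
  then have "(3/4) * phi x * phi x <= 2 * c * phi x" using diff by (simp add: power2_eq_square)
  then have "(3/4) * phi x <= 2 * c" using px by (simp only: mult_le_cancel_right_pos)
  then have "phi y <= 2 * c" using False c by linarith
  then have "phi y * phi y <= 2 * c * phi y" using py by (intro mult_right_mono) auto
  then show ?thesis using d2 by (simp add: power2_eq_square)
 qed
 assume cy: "c <= phi y"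
 show "phi x <= 5 / 2 * phi y"
 proof (rule ccontr)
  assume "\<not> ?thesis"
  then have g: "5 / 2 * phi y < phi x" by simp
  have "phi x * phi x <= phi y * phi y + 2 * c * phi x" using diff by (simp add: power2_eq_square)
  also have "... <= phi y * phi y + 2 * phi y * phi x" using cy px by (intro add_left_mono mult_right_mono) auto
  finally have 1: "phi x * (phi x - 2 * phi y) <= phi y * phi y" by (simp add: algebra_simps)
  have "(5 / 2 * phi y) * (1 / 2 * phi y) <= phi x * (phi x - 2 * phi y)" using g py by (intro mult_mono) auto
  then have "5 / 4 * (phi y * phi y) <= phi y * phi y" using 1 by simp
  then show False using mult_pos_pos[OF py py] by linarith
 qed
qed

definition near_set :: "real => real => real set" where
 "near_set c y = {x \<in> inner_domain c. \<bar>y - x\<bar> <= c * phi x}"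

text \<open>Bounds the measure of the centres whose differences reach \<open>y\<close>. For
  \<open>phi y >= c\<close> they fill a short interval about \<open>y\<close>; close to an endpoint
  \<open>phi x\<close> is not comparable with \<open>phi y\<close> and another argument is
  used.\<close>

lemma nn_integral_near_set:
 assumes c: "0 < c" and y: "y \<in> {-1<..<1}"
 shows "(\<integral>x. indicator (near_set c y) x) <= ennreal (5 * c * phi y)"
proof (cases "c <= phi y")
 case True
 have "(\<integral>x. indicator (near_set c y) x) <= (\<integral>x. indicator {y - c * (5/2 * phi y)..y + c * (5/2 * phi y)} x)"
 proof (rule nn_integral_mono)
  fix x
  have near: "\<bar>y - x\<bar> <= c * (5/2 * phi y)" if x: "x \<in> near_set c y"
  proof -
   have "c * phi x <= c * (5/2 * phi y)" using inner_domain_near(3)[OF c, of x y] True x c unfolding near_set_def by (intro mult_left_mono) auto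
   then show ?thesis using x unfolding near_set_def by auto
  qed
  then have "x \<in> {y - c * (5/2 * phi y)..y + c * (5/2 * phi y)}" if "x \<in> near_set c y"
   using near[OF that] by (simp only: atLeastAtMost_iff abs_le_iff) linarith
  then show "(indicator (near_set c y) x :: ennreal) <= indicator {y - c * (5/2 * phi y)..y + c * (5/2 * phi y)} x"
   by (simp only: indicator_def) simp
 qed
 also have "... = ennreal (5 * c * phi y)" using c phi_pos[OF y] by simp
 finally show ?thesis .
next
 case False
 have py: "0 < phi y" using phi_pos[OF y] .
 \<comment> \<open>Near an endpoint the outermost node \<open>x + \<kappa> * phi x\<close>, with
   \<open>\<kappa>\<close> equal to \<open>c\<close> or \<open>- c\<close>, is caught between
   \<open>y\<close> and that endpoint, an interval of length
   \<open>1 - \<bar>y\<bar> <= phi y ^ 2 <= c * phi y\<close>.\<close>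
 obtain a b \<kappa> where ab: "\<bar>\<kappa>\<bar> <= c" "a <= b" "b - a <= 1 - \<bar>y\<bar>" "{a..b} \<subseteq> {-1..1}" "\<And>x. x \<in> near_set c y ==> x + \<kappa> * phi x \<in> {a..b}"
 proof (cases "0 <= y")
  case True
  show ?thesis by (rule that[of c y 1]) (use True y c in \<open>auto simp: near_set_def inner_domain_def\<close>)
 next
  case False
  show ?thesis by (rule that[of "-c" "-1" y]) (use False y c in \<open>auto simp: near_set_def inner_domain_def\<close>)
 qed
 have "(\<integral>x. indicator (near_set c y) x) <= (\<integral>x\<in>diff_domain c. indicator {a..b} (x + \<kappa> * phi x))"
  using ab(5) by (intro nn_integral_mono) (auto simp: indicator_def near_set_def dest: inner_diff_domain)
 also have "... <= 2 * (\<integral>x\<in>{-1..1}. indicator {a..b} x)"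
  by (rule nn_integral_node_shift[OF c ab(1)]) measurable
 also have "(\<integral>x\<in>{-1..1}. indicator {a..b} x) <= (\<integral>x. indicator {a..b} x)"
  by (intro nn_integral_mono) (auto simp: indicator_def)
 also have "... = ennreal (b - a)" using ab(2) by simp
 also have "2 * ... = ennreal (2 * (b - a))" using ab(2) by (subst ennreal_mult) auto
 also have "... <= ennreal (5 * c * phi y)"
 proof (rule ennreal_leI)
  have "1 - \<bar>y\<bar> <= (1 - \<bar>y\<bar>) * (1 + \<bar>y\<bar>)" using y mult_left_mono[of 1 "1 + \<bar>y\<bar>" "1 - \<bar>y\<bar>"] by auto
  also have "... = phi y * phi y" using phi_squared[of y] y by (cases "0 <= y") (auto simp: power2_eq_square)
  also have "... <= c * phi y" using False py by (intro mult_right_mono) auto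
  finally have "b - a <= c * phi y" using ab(3) by simp
  moreover have "0 <= c * phi y" using c py by simp
  ultimately show "2 * (b - a) <= 5 * c * phi y" by simp
 qed
 finally show ?thesis by (simp add: mult_left_mono)
qed

lemma nn_integral_inverse_phi:
 assumes c: "0 < c" and x: "x \<in> inner_domain c"
 shows "(\<integral>y\<in>{x - c * phi x..x + c * phi x}. ennreal (1 / phi y)) <= ennreal (8 * c)"
proof -
 define u v where "u = x - c * phi x" and "v = x + c * phi x"
 have x1: "x \<in> {-1<..<1}" using x unfolding inner_domain_def by auto
 have uv: "-1 < u" "v < 1" using x unfolding inner_domain_def u_def v_def by auto
 have px: "0 < c * phi x" using c phi_pos[OF x1] by simp
 have "(\<integral>y\<in>{u..v}. ennreal (1 / phi y)) = ennreal ((- arccos v) - (- arccos u))"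
 proof (rule nn_integral_FTC_Icc)
  fix y assume "y \<in> {u..v}"
  then have y: "u <= y" "y <= v" by auto
  have "((\<lambda>y. - arccos y) has_real_derivative - inverse (- sqrt (1 - y^2))) (at y)"
   using y uv by (intro DERIV_minus DERIV_arccos) auto
  then show "((\<lambda>y. - arccos y) has_real_derivative 1 / phi y) (at y)"
   by (simp add: phi_def divide_inverse)
  show "0 <= 1 / phi y" using phi_pos[of y] y uv by (auto intro!: less_imp_le)
 qed (use px in \<open>auto simp: u_def v_def\<close>)
 also have "... <= ennreal (8 * c)"
 proof (rule ennreal_leI)
  have "\<bar>arccos x - arccos u\<bar> <= 4 * c" using x1 uv px by (intro abs_arccos_diff_le) (use c in \<open>auto simp: u_def v_def\<close>)
  moreover have "\<bar>arccos x - arccos v\<bar> <= 4 * c" using x1 uv px by (intro abs_arccos_diff_le) (use c in \<open>auto simp: u_def v_def\<close>)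
  ultimately show "(- arccos v) - (- arccos u) <= 8 * c" by (simp only: abs_le_iff) linarith
 qed
 finally show ?thesis unfolding u_def v_def .
qed

text \<open>Averaging over \<open>y\<close> with density \<open>1 / phi y\<close>, that is, with
  respect to the angle. The constant \<open>8\<close> makes the integral over \<open>y\<close> at
  most \<open>1\<close>; the integral over \<open>x\<close> is then at most
  \<open>5/8\<close>.\<close>

definition smooth_kernel :: "real => real => real => ennreal" where
 "smooth_kernel c x y = ennreal (1 / (8 * c * phi y)) * indicator (near_set c y) x"

lemma near_set_iff: "x \<in> near_set c y \<longleftrightarrow> x \<in> inner_domain c \<and> \<bar>y - x\<bar> <= c * phi x"
 by (simp add: near_set_def)

lemma measurable_smooth_kernel[measurable]:
 assumes [measurable]: "f \<in> borel_measurable M" "g \<in> borel_measurable M"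
 shows "(\<lambda>z. smooth_kernel c (f z) (g z)) \<in> borel_measurable M"
proof -
 have "smooth_kernel c x y = (if x \<in> inner_domain c \<and> \<bar>y - x\<bar> <= c * phi x then ennreal (1 / (8 * c * phi y)) else 0)" for x y
  by (simp add: smooth_kernel_def indicator_def near_set_iff)
 then show ?thesis by simp
qed

lemma smooth_kernel_integrals:
 assumes c: "0 < c"
 shows "(\<integral>y. smooth_kernel c x y) <= 1"
  and "y \<in> {-1<..<1} ==> (\<integral>x. smooth_kernel c x y) <= 1"
proof -
 let ?a = "ennreal (1 / (8 * c))"
 show "(\<integral>y. smooth_kernel c x y) <= 1"
 proof (cases "x \<in> inner_domain c")
  case True
  have "(\<integral>y. smooth_kernel c x y) = (\<integral>y. ?a * (ennreal (1 / phi y) * indicator {x - c * phi x..x + c * phi x} y))"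
  proof (rule nn_integral_cong)
   fix y
   show "smooth_kernel c x y = ?a * (ennreal (1 / phi y) * indicator {x - c * phi x..x + c * phi x} y)"
   proof (cases "\<bar>y - x\<bar> <= c * phi x")
    case near: True
    have "0 < phi y" using inner_domain_near(1)[OF c True near] phi_pos by blast
    then have "ennreal (1 / (8 * c * phi y)) = ?a * ennreal (1 / phi y)" using c by (subst ennreal_mult[symmetric]) auto
    then show ?thesis using near True by (auto simp: smooth_kernel_def near_set_iff indicator_def abs_le_iff)
   qed (auto simp: smooth_kernel_def near_set_iff indicator_def abs_le_iff)
  qed
  also have "... = ?a * (\<integral>y\<in>{x - c * phi x..x + c * phi x}. ennreal (1 / phi y))"
   by (rule nn_integral_cmult) measurable
  also have "... <= ?a * ennreal (8 * c)" by (intro mult_left_mono nn_integral_inverse_phi c True) simp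
  also have "... = 1" using c by (simp add: ennreal_mult[symmetric])
  finally show ?thesis .
 qed (simp add: smooth_kernel_def near_set_iff)
next
 assume y: "y \<in> {-1<..<1}"
 have [measurable]: "near_set c y \<in> sets borel"
 proof -
  have "near_set c y = {x \<in> space borel. x \<in> inner_domain c \<and> \<bar>y - x\<bar> <= c * phi x}" by (auto simp: near_set_def)
  then show ?thesis by simp
 qed
 have "(\<integral>x. smooth_kernel c x y) = ennreal (1 / (8 * c * phi y)) * (\<integral>x. indicator (near_set c y) x)"
  unfolding smooth_kernel_def by (rule nn_integral_cmult) measurable
 also have "... <= ennreal (1 / (8 * c * phi y)) * ennreal (5 * c * phi y)" by (intro mult_left_mono nn_integral_near_set c y) simp
 also have "... = ennreal (5 / 8)" using c phi_pos[OF y] by (subst ennreal_mult[symmetric]) auto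
 also have "... <= 1" by (simp flip: ennreal_1)
 finally show "(\<integral>x. smooth_kernel c x y) <= 1" .
qed

text \<open>Continuity on the open interval comes from absolute continuity if \<open>r = 1\<close>
  and from differentiability otherwise; the arbitrary values at the endpoints form a null
  set.\<close>

lemma AC_loc_deriv_measurable:
 assumes g: "g \<in> AC_loc_deriv r" and r: "1 <= r"
 shows "g \<in> borel_measurable leb"
proof -
 have "isCont g x" if x: "x \<in> {-1<..<1}" for x
 proof (cases "r = 1")
  case True
  define a b where "a = (x - 1) / 2" and "b = (x + 1) / 2"
  have ab: "-1 < a" "a < x" "x < b" "b < 1" using x unfolding a_def b_def by auto
  then have "absolutely_continuous_interval a b g" using g True unfolding AC_loc_deriv_def AC_loc_def by auto
  then have "continuous_on {a..b} g" by (rule absolutely_continuous_interval_continuous_on)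
  then show ?thesis by (rule continuous_on_interior) (use ab in \<open>auto simp: interior_atLeastAtMost_real\<close>)
 next
  case False
  then have "(deriv ^^ 0) g differentiable (at x)" using g r x unfolding AC_loc_deriv_def by (auto dest!: spec[of _ 0])
  then show ?thesis by (simp add: differentiable_imp_continuous_within)
 qed
 then have "continuous_on {-1<..<1} g" by (intro continuous_at_imp_continuous_on) auto
 then have m: "(\<lambda>x. indicator {-1<..<1} x *\<^sub>R g x) \<in> borel_measurable borel"
  by (rule borel_measurable_continuous_on_indicator[rotated]) simp
 have "AE x in lborel. x \<noteq> (-1::real)" "AE x in lborel. x \<noteq> (1::real)" by (rule AE_lborel_singleton)+
 then have "AE x\<in>{-1..1} in lborel. g x = indicator {-1<..<1} x *\<^sub>R g x"
  by eventually_elim (auto simp: indicator_def)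
 then show ?thesis by (rule measurable_lebesgue_on_AE[OF m])
qed

text \<open>Each of the \<open>r - 1\<close> powers of \<open>c * phi x - \<bar>y - x\<bar>\<close>
  is replaced by \<open>2 * c * phi y\<close>; the last power of \<open>phi y\<close> comes from the
  density of the kernel. The constants combine as
  \<open>2 ^ r * ((2 * c) ^ (r - 1) * (8 * c))\<close>, where \<open>c = r * h / 2\<close>.\<close>

lemma sym_diff_kernel_bound:
 fixes g :: "real => real"
 assumes r: "1 <= r" and g: "g \<in> AC_loc_deriv r" and F: "F \<in> borel_measurable borel"
  and FG: "\<And>a b. -1 < a ==> a <= b ==> b < 1 ==> ennreal \<bar>(deriv ^^ (r - 1)) g b - (deriv ^^ (r - 1)) g a\<bar> <= (\<integral>x\<in>{a..b}. ennreal \<bar>F x\<bar>)"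
  and h: "0 < h" and c: "c = real r * h / 2" and x: "x \<in> inner_domain c"
 shows "ennreal \<bar>sym_diff r (h * phi x) g x\<bar> <= ennreal (4 * (2 * real r) ^ r * h ^ r) * (\<integral>y. smooth_kernel c x y * ennreal (\<bar>phi y\<bar> ^ r * \<bar>F y\<bar>))"
proof -
 let ?a = "\<lambda>y. \<bar>phi y\<bar> ^ r * \<bar>F y\<bar>"
 let ?b = "\<lambda>y. c * phi x - \<bar>y - x\<bar>"
 let ?c = "\<integral>y\<in>{x - c * phi x..x + c * phi x}. ennreal ((?b y) ^ (r - 1)) * ennreal \<bar>F y\<bar>"
 let ?d = "\<integral>y. smooth_kernel c x y * ennreal (?a y)"
 let ?e = "(2 * c) ^ (r - 1) * (8 * c)"
 note F[measurable]
 have c0: "0 < c" unfolding c using h r by simp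
 have x1: "x \<in> {-1<..<1}" "-1 < x - c * phi x" "x + c * phi x < 1" using x unfolding inner_domain_def by auto
 define A where "A = ennreal ?e"
 have "ennreal \<bar>sym_diff r (h * phi x) g x\<bar> <= ennreal (2 ^ r) * ?c"
  by (rule sym_diff_taylor_bound[OF r g F FG]) (use h x1 phi_pos[OF x1(1)] in \<open>auto simp: c\<close>)
 also have "?c
  <= (\<integral>y. A * (smooth_kernel c x y * ennreal (?a y)))"
 proof (rule nn_integral_mono)
  fix y
  show "ennreal ((?b y) ^ (r - 1)) * ennreal \<bar>F y\<bar> * indicator {x - c * phi x..x + c * phi x} y
   <= A * (smooth_kernel c x y * ennreal (?a y))"
  proof (cases "\<bar>y - x\<bar> <= c * phi x")
   case True
   note y = inner_domain_near[OF c0 x True]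
   have py: "0 < phi y" using phi_pos[OF y(1)] .
   have "(?b y) ^ (r - 1) * \<bar>F y\<bar> <= (2 * c * phi y) ^ (r - 1) * \<bar>F y\<bar>"
    using y(2) True by (intro mult_right_mono power_mono) auto
   also have "... = (2 * c) ^ (r - 1) * (8 * c) * (1 / (8 * c * phi y) * (?a y))"
   proof -
    have "\<bar>phi y\<bar> ^ r = phi y ^ (r - 1) * phi y" using r py by (cases r) (auto simp: mult.commute)
    then show ?thesis using py c0 by (simp add: power_mult_distrib)
   qed
   finally have "ennreal ((?b y) ^ (r - 1) * \<bar>F y\<bar>) <= ennreal ((2 * c) ^ (r - 1) * (8 * c) * (1 / (8 * c * phi y) * (?a y)))"
    by (rule ennreal_leI)
   also have "... = A * (ennreal (1 / (8 * c * phi y)) * ennreal (?a y))"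
    unfolding A_def using py c0 by (subst ennreal_mult; (subst ennreal_mult)?) auto
   also have "ennreal ((?b y) ^ (r - 1) * \<bar>F y\<bar>) = ennreal ((?b y) ^ (r - 1)) * ennreal \<bar>F y\<bar>"
    using True by (subst ennreal_mult) auto
   finally show ?thesis using True x by (simp add: smooth_kernel_def near_set_iff mult_left_le[of "indicator _ _"] split: split_indicator)
  qed (auto simp: indicator_def abs_le_iff)
 qed
 also have "... = A * ?d"
  by (rule nn_integral_cmult) measurable
 also have "ennreal (2 ^ r) * (A * ?d)
  = ennreal (4 * (2 * real r) ^ r * h ^ r) * ?d"
 proof -
  have "ennreal (2 ^ r) * A = ennreal (2 ^ r * ?e)"
   unfolding A_def by (rule ennreal_mult[symmetric]) (use c0 in auto)
  also have "2 ^ r * ?e = 4 * (2 ^ r * (2 * c) ^ r)" using r by (cases r) auto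
  also have "... = 4 * (2 * real r) ^ r * h ^ r" unfolding c by (simp add: power_mult_distrib)
  finally have "ennreal (2 ^ r) * A = ennreal (4 * (2 * real r) ^ r * h ^ r)" .
  then show ?thesis by (simp only: mult.assoc[symmetric])
 qed
 finally show ?thesis by (simp add: mult_left_mono)
qed

text \<open>For finite exponents Jensen's inequality uses the bound on the integral of the kernel
  over \<open>y\<close> and Fubini the one over \<open>x\<close>; for the supremum norm the first
  suffices. The kernel is local, so the weights at \<open>x\<close> and \<open>y\<close> are
  comparable wherever it does not vanish.\<close>

lemma wnorm_sym_diff_smooth_le:
 fixes p :: ennreal and B L :: real
 assumes r: "1 <= r" and p: "1 <= p" and B: "0 < B" and L: "1 <= L"
 shows "\<exists>C>0. \<forall>w g n h. doubling_weight w L --> g \<in> AC_loc_deriv r --> 0 < n --> 0 < h --> h <= B / real n -->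
  wnorm p (weight_n w n) (\<lambda>x. sym_diff r (h * phi x) g x) <= ennreal (C * h ^ r) * wnorm p (weight_n w n) (\<lambda>x. phi x ^ r * (deriv ^^ r) g x)"
proof -
 let ?a = "\<lambda>c x y. smooth_kernel c x y"
 let ?b = "\<lambda>h x g. sym_diff r (h * phi x) g x"
 let ?c = "\<lambda>c x H. \<integral>y. ?a c x y * ennreal (H y)"
 let ?d = "\<lambda>c x G. \<integral>y. ?a c x y * G y"
 let ?e = "\<lambda>g. \<lambda>x. phi x ^ r * (deriv ^^ r) g x"
 let ?f = "\<lambda>E D h. ennreal (2 * E * D * h ^ r)"
 let ?g = "\<lambda>E h q. (E * h ^ r) powr q"
 let ?h = "deriv ^^ (r - 1)"
 let ?i = "\<lambda>h x g v. ennreal (\<bar>?b h x g\<bar> * v x)"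
 let ?j = "\<lambda>H y q. ennreal (H y powr q)"
 obtain D where D: "1 <= D" "\<And>w n h x y. doubling_weight w L ==> 0 < n ==> 0 < h ==> h <= B / real n ==> x \<in> {-1..1} ==> y \<in> {-1..1} ==>
  \<bar>x - y\<bar> <= real r * h / 2 * phi x ==> weight_n w n x <= D * weight_n w n y"
  using weight_n_local_compare[OF L B, of r] by blast
 define E where "E = 4 * (2 * real r) ^ r"
 have E: "0 < E" unfolding E_def using r by simp
 show ?thesis
 proof (intro exI[of _ "2 * E * D"] conjI allI impI)
  show "0 < 2 * E * D" using E D by simp
  fix w g :: "real => real" and n :: nat and h :: real
  assume dw: "doubling_weight w L" and g: "g \<in> AC_loc_deriv r" and n: "0 < n" and h: "0 < h" "h <= B / real n"
  define v where "v = weight_n w n"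
  have vm[measurable]: "v \<in> borel_measurable borel" unfolding v_def by (rule weight_n_measurable[OF dw])
  have v0: "0 <= v x" if "x \<in> {-1..1}" for x unfolding v_def by (rule weight_n_nonneg[OF dw that n])
  note gm = AC_loc_deriv_measurable[OF g r]
  obtain g' where [measurable]: "g' \<in> borel_measurable borel" and gg': "AE x\<in>{-1..1} in lborel. g x = g' x"
   using borel_representative[OF gm] by blast
  have "?h g \<in> AC_loc" using g unfolding AC_loc_deriv_def by simp
  then obtain F where F[measurable]: "F \<in> borel_measurable borel" and dF: "AE x\<in>{-1<..<1} in lborel. deriv (?h g) x = F x"
   and FG: "\<And>a b. -1 < a ==> a <= b ==> b < 1 ==> ennreal \<bar>?h g b - ?h g a\<bar> <= (\<integral>x\<in>{a..b}. ennreal \<bar>F x\<bar>)"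
   using AC_loc_derivative by blast
  have dr: "(deriv ^^ r) g = deriv (?h g)" using r by (cases r) auto
  define H where "H y = \<bar>phi y\<bar> ^ r * \<bar>F y\<bar>" for y
  have H0: "0 <= H y" for y unfolding H_def by simp
  have Hm[measurable]: "H \<in> borel_measurable borel" unfolding H_def by measurable
  have HF: "AE x\<in>{-1..1} in lborel. \<bar>phi x ^ r * (deriv ^^ r) g x\<bar> = H x"
  proof -
   have "AE x in lborel. x \<noteq> (-1::real)" "AE x in lborel. x \<noteq> (1::real)" by (rule AE_lborel_singleton)+
   then show ?thesis using dF by eventually_elim (auto simp: dr H_def abs_mult power_abs)
  qed
  define c where "c = real r * h / 2"
  have c: "0 < c" unfolding c_def using h r by simp
  have Kv: "y \<in> {-1<..<1} \<and> v x <= D * v y" if "?a c x y \<noteq> 0" for x y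
  proof -
   have xy: "x \<in> inner_domain c" "\<bar>y - x\<bar> <= c * phi x" using that by (auto simp: smooth_kernel_def near_set_iff split: split_indicator_asm)
   have "y \<in> {-1<..<1}" by (rule inner_domain_near(1)[OF c xy])
   moreover have "v x <= D * v y" unfolding v_def
    using xy calculation by (intro D(2)[OF dw n h]) (auto simp: inner_domain_def abs_minus_commute c_def)
   ultimately show ?thesis by simp
  qed
  have pt: "ennreal \<bar>?b h x g\<bar> <= ennreal (E * h ^ r) * (?c c x H)" if "x \<in> inner_domain c" for x
   unfolding E_def H_def by (rule sym_diff_kernel_bound[OF r g F FG h(1) c_def that])
  have zero: "?b h x g = 0" if "x \<in> {-1..1}" "x \<notin> diff_domain c" for x
   using that by (simp add: sym_diff_domain[OF h(1)] c_def)
  have Eh: "0 < E * h ^ r" using E h by simp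
  show "wnorm p (weight_n w n) (\<lambda>x. ?b h x g) <= ?f E D h * wnorm p (weight_n w n) (?e g)"
   unfolding v_def[symmetric]
  proof (cases "p = top")
   case False
   define q where "q = enn2real p"
   have q: "1 <= q" unfolding q_def by (rule enn2real_exponent[OF p False])
   define G where "G y = ennreal (H y powr q * v y) * indicator {-1<..<1} y" for y
   have Gm[measurable]: "G \<in> borel_measurable borel" unfolding G_def by measurable
   define M where "M = ennreal (?g E h q * 2 powr q * D)"
   have "(\<integral>\<^sup>+x. ennreal (\<bar>?b h x g\<bar> powr q * v x) \<partial>leb)
    <= (\<integral>\<^sup>+x. M * (?d c x G) \<partial>leb)"
   proof (rule nn_integral_mono_AE, rule AE_lborel_imp_lebesgue_on)
    show "AE x\<in>{-1..1} in lborel. ennreal (\<bar>?b h x g\<bar> powr q * v x) <= M * (?d c x G)"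
     using AE_inner_domain[OF c]
    proof (eventually_elim, intro impI)
     fix x assume i: "x \<in> diff_domain c --> x \<in> inner_domain c" and x: "x \<in> {-1..1}"
     show "ennreal (\<bar>?b h x g\<bar> powr q * v x) <= M * (?d c x G)"
     proof (cases "x \<in> diff_domain c")
      case True
      then have xi: "x \<in> inner_domain c" using i by simp
      have "ennreal (\<bar>?b h x g\<bar> powr q * v x) = ennreal_powr (ennreal \<bar>?b h x g\<bar>) q * ennreal (v x)"
       using v0[OF x] by (simp add: ennreal_powr_ennreal ennreal_mult)
      also have "... <= ennreal_powr (ennreal (E * h ^ r) * (?c c x H)) q * ennreal (v x)"
       using q by (intro mult_right_mono ennreal_powr_mono pt[OF xi]) auto
      also have "... = ennreal (?g E h q) * ennreal_powr (?c c x H) q * ennreal (v x)"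
       using q Eh by (simp add: ennreal_powr_mult ennreal_powr_ennreal)
      also have "... <= ennreal (?g E h q) * (ennreal (2 powr q) * (\<integral>y. ?a c x y * ?j H y q)) * ennreal (v x)"
       by (intro mult_right_mono mult_left_mono powr_jensen H0 q smooth_kernel_integrals(1) c) auto
      also have "... = ennreal (?g E h q * 2 powr q) * (ennreal (v x) * (\<integral>y. ?a c x y * ?j H y q))"
       by (simp add: ennreal_mult mult_ac)
      also have "ennreal (v x) * (\<integral>y. ?a c x y * ?j H y q)
       = (\<integral>y. ennreal (v x) * (?a c x y * ?j H y q))"
       by (rule nn_integral_cmult[symmetric]) measurable
      also have "... <= (\<integral>y. ennreal D * (?a c x y * G y))"
      proof (rule nn_integral_mono)
       fix y
       show "ennreal (v x) * (?a c x y * ?j H y q) <= ennreal D * (?a c x y * G y)"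
       proof (cases "?a c x y = 0")
        case False
        note y = Kv[OF False]
        have "ennreal (v x) * ?j H y q <= ennreal (D * v y) * ?j H y q"
         using y by (intro mult_right_mono ennreal_leI) auto
        also have "... = ennreal D * G y"
         unfolding G_def using y D(1) v0[of y] by (simp add: ennreal_mult mult_ac)
        finally show ?thesis by (metis mult.left_commute mult_left_mono zero_le)
       qed simp
      qed
      also have "... = ennreal D * (?d c x G)"
       by (rule nn_integral_cmult) measurable
      also have "ennreal (?g E h q * 2 powr q) * ... = M * (?d c x G)"
       unfolding M_def using D(1) by (simp add: ennreal_mult mult.assoc)
      finally show ?thesis by (simp add: mult_left_mono)
     qed (use zero x in simp)
    qed
   qed
   also have "... = (\<integral>x\<in>{-1..1}. M * (?d c x G))"
    by (rule nn_integral_lebesgue_on_borel) auto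
   also have "... <= (\<integral>x. M * (?d c x G))"
    by (intro nn_integral_mono) (auto simp: indicator_def)
   also have "... = M * (\<integral>x. \<integral>y. ?a c x y * G y)"
    by (rule nn_integral_cmult) measurable
   also have "(\<integral>x. \<integral>y. ?a c x y * G y) = (\<integral>y. \<integral>x. ?a c x y * G y)"
    using lborel_swap[of "\<lambda>(x, y). ?a c x y * G y"] by simp
   also have "... = (\<integral>y. (\<integral>x. ?a c x y) * G y)"
    by (intro nn_integral_cong nn_integral_multc) measurable
   also have "... <= (\<integral>y\<in>{-1..1}. ennreal (H y powr q * v y))"
   proof (rule nn_integral_mono)
    fix y
    show "(\<integral>x. ?a c x y) * G y <= ennreal (H y powr q * v y) * indicator {-1..1} y"
    proof (cases "y \<in> {-1<..<1}")
     case True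
     have "(\<integral>x. ?a c x y) * G y <= 1 * G y" by (intro mult_right_mono smooth_kernel_integrals(2) c True) simp
     then show ?thesis using True by (simp add: G_def)
    qed (simp add: G_def)
   qed
   also have "... = (\<integral>\<^sup>+x. ennreal (\<bar>phi x ^ r * (deriv ^^ r) g x\<bar> powr q * v x) \<partial>leb)"
    using HF by (intro nn_integral_lebesgue_on_borel[symmetric]) (auto elim!: eventually_mono)
   also have "M * ... <= ennreal ((2 * E * D * h ^ r) powr q) * ..."
    unfolding M_def
   proof (intro mult_right_mono ennreal_leI)
    have "D powr 1 <= D powr q" using D(1) q by (intro powr_mono) auto
    then have "?g E h q * 2 powr q * D <= ?g E h q * 2 powr q * D powr q" using D(1) by (intro mult_left_mono) auto
    also have "... = (2 * E * D * h ^ r) powr q" by (simp add: powr_mult[symmetric] mult_ac)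
    finally show "?g E h q * 2 powr q * D <= (2 * E * D * h ^ r) powr q" .
   qed simp
   finally show "wnorm p v (\<lambda>x. ?b h x g) <= ?f E D h * wnorm p v (?e g)"
    unfolding q_def by (rule wnorm_le_of_powr[OF p False, rotated]) (use E D(1) h in \<open>auto simp: mult_left_mono\<close>)
  next
   case True
   define N where "N = wnorm top v (?e g)"
   have HN: "AE y\<in>{-1..1} in lborel. ennreal (H y * v y) <= N"
    using HF wnorm_top_AE[of "\<lambda>x. phi x ^ r * (deriv ^^ r) g x" v] unfolding N_def by eventually_elim auto
   have "wnorm top v (\<lambda>x. ?b h x g) <= ?f E D h * N"
   proof (rule wnorm_top_le)
    note [measurable] = borel_measurable_sym_diff[OF h(1) r gm]
    have [measurable]: "v \<in> borel_measurable leb"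
     by (rule measurable_lebesgue_on_AE[OF vm]) simp
    show "(\<lambda>x. ?i h x g v) \<in> borel_measurable leb" by measurable
    show "AE x\<in>{-1..1} in lborel. ?i h x g v <= ?f E D h * N"
     using AE_inner_domain[OF c]
    proof (eventually_elim, intro impI)
     fix x assume i: "x \<in> diff_domain c --> x \<in> inner_domain c" and x: "x \<in> {-1..1}"
     show "?i h x g v <= ?f E D h * N"
     proof (cases "x \<in> diff_domain c")
      case True
      then have xi: "x \<in> inner_domain c" using i by simp
      have "?i h x g v = ennreal \<bar>?b h x g\<bar> * ennreal (v x)"
       using v0[OF x] by (simp add: ennreal_mult)
      also have "... <= ennreal (E * h ^ r) * (?c c x H) * ennreal (v x)"
       by (intro mult_right_mono pt[OF xi]) auto
      also have "... = ennreal (E * h ^ r) * (ennreal (v x) * (?c c x H))"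
       by (simp add: mult_ac)
      also have "ennreal (v x) * (?c c x H)
       = (\<integral>y. ennreal (v x) * (?a c x y * ennreal (H y)))"
       by (rule nn_integral_cmult[symmetric]) measurable
      also have "... <= (\<integral>y. ennreal D * N * ?a c x y)"
      proof (rule nn_integral_mono_AE)
       show "AE y in lborel. ennreal (v x) * (?a c x y * ennreal (H y)) <= ennreal D * N * ?a c x y"
        using HN
       proof eventually_elim
        case (elim y)
        show ?case
        proof (cases "?a c x y = 0")
         case False
         note y = Kv[OF False]
         have "ennreal (v x) * ennreal (H y) <= ennreal (D * v y) * ennreal (H y)"
          using y by (intro mult_right_mono ennreal_leI) auto
         also have "... = ennreal D * ennreal (H y * v y)"
          using y D(1) v0[of y] H0[of y] by (simp add: ennreal_mult mult_ac)
         also have "... <= ennreal D * N" using elim y by (intro mult_left_mono) auto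
         finally show ?thesis by (metis mult.commute mult.left_commute mult_left_mono zero_le)
        qed simp
       qed
      qed
      also have "... = ennreal D * N * (\<integral>y. ?a c x y)"
       by (rule nn_integral_cmult) measurable
      also have "... <= ennreal D * N * 1" by (intro mult_left_mono smooth_kernel_integrals(1) c) simp
      also have "ennreal (E * h ^ r) * (ennreal D * N * 1) = ennreal (E * h ^ r * D) * N"
       using D(1) E h by (simp add: ennreal_mult mult.assoc)
      also have "... <= ?f E D h * N"
       using D(1) E h by (intro mult_right_mono ennreal_leI) (auto simp: mult_ac)
      finally show ?thesis by (simp add: mult_left_mono)
     qed (use zero x in simp)
    qed
   qed
   then show "wnorm p v (\<lambda>x. ?b h x g) <= ?f E D h * wnorm p v (?e g)"
    unfolding N_def using True by simp
  qed
 qed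
qed

lemma sym_diff_add: "sym_diff r h (\<lambda>x. f x + g x) x = sym_diff r h f x + sym_diff r h g x"
 by (simp add: sym_diff_def distrib_left sum.distrib)

text \<open>Splits \<open>f\<close> into \<open>f - g\<close> and \<open>g\<close>: the difference
  of the first is bounded by its norm, that of the second by \<open>h ^ r\<close> times the weighted
  derivative.\<close>

theorem omega_phi_le_K_functional:
 fixes p :: ennreal and B L :: real
 assumes r: "1 <= r" and p: "1 <= p" and B: "0 < B" and L: "1 <= L"
 shows "\<exists>C>0. \<forall>w f n t. doubling_weight w L --> f \<in> Lp p --> 0 < n --> t <= B / real n -->
  omega_phi r f t p (weight_n w n) <= ennreal C * K_functional r phi f t p (weight_n w n)"
proof -
 let ?a = "\<lambda>v h f. wnorm p v (\<lambda>x. sym_diff r (h * phi x) f x)"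
 let ?b = "\<lambda>v g. wnorm p v (\<lambda>x. phi x ^ r * (deriv ^^ r) g x)"
 let ?c = "\<lambda>v f g. wnorm p v (\<lambda>x. f x - g x)"
 let ?d = "\<lambda>C. ennreal (inverse C)"
 obtain C1 where C1: "0 < C1" "\<And>w f n h. doubling_weight w L ==> f \<in> borel_measurable leb ==> 0 < n ==> 0 < h ==> h <= B / real n ==>
  ?a (weight_n w n) h f <= ennreal C1 * wnorm p (weight_n w n) f"
  using wnorm_sym_diff_le[OF r p B L] by blast
 obtain C2 where C2: "0 < C2" "\<And>w g n h. doubling_weight w L ==> g \<in> AC_loc_deriv r ==> 0 < n ==> 0 < h ==> h <= B / real n ==>
  ?a (weight_n w n) h g <= ennreal (C2 * h ^ r) * ?b (weight_n w n) g"
  using wnorm_sym_diff_smooth_le[OF r p B L] by blast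
 define C where "C = 4 * max C1 C2"
 show ?thesis
 proof (intro exI[of _ C] conjI allI impI)
  show C0: "0 < C" unfolding C_def using C1(1) by simp
  fix w f :: "real => real" and n :: nat and t :: real
  assume dw: "doubling_weight w L" and f: "f \<in> Lp p" and n: "0 < n" and t: "t <= B / real n"
  define v where "v = weight_n w n"
  have vm: "v \<in> borel_measurable borel" unfolding v_def by (rule weight_n_measurable[OF dw])
  have [measurable]: "v \<in> borel_measurable leb"
   by (rule measurable_lebesgue_on_AE[OF vm]) simp
  have v0: "0 <= v x" if "x \<in> {-1..1}" for x unfolding v_def by (rule weight_n_nonneg[OF dw that n])
  have fm[measurable]: "f \<in> borel_measurable leb" using f by (simp add: Lp_def)
  have main: "?a v h f <= ennreal C * (?c v f g + ennreal (t ^ r) * ?b v g)"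
   if h: "0 < h" "h <= t" and g: "g \<in> AC_loc_deriv r" for h g
  proof -
   note gm[measurable] = AC_loc_deriv_measurable[OF g r]
   have hB: "h <= B / real n" using h t by simp
   have fg: "(\<lambda>x. f x - g x) \<in> borel_measurable leb" by measurable
   note [measurable] = borel_measurable_sym_diff[OF h(1) r fg] borel_measurable_sym_diff[OF h(1) r gm]
   have "?a v h f = wnorm p v (\<lambda>x. sym_diff r (h * phi x) (\<lambda>x. f x - g x) x + sym_diff r (h * phi x) g x)"
    using sym_diff_add[of r _ "\<lambda>x. f x - g x" g] by simp
   also have "... <= 4 * (?a v h (\<lambda>x. f x - g x) + ?a v h g)"
    by (rule wnorm_add_le[OF p v0]) measurable
   also have "... <= 4 * (ennreal C1 * ?c v f g + ennreal (C2 * h ^ r) * ?b v g)"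
    unfolding v_def using h hB n by (intro mult_left_mono add_mono C1(2)[OF dw fg] C2(2)[OF dw g]) auto
   also have "... <= 4 * (ennreal (max C1 C2) * ?c v f g + ennreal (max C1 C2 * t ^ r) * ?b v g)"
    using C1(1) C2(1) h by (intro mult_left_mono add_mono mult_right_mono ennreal_leI mult_mono power_mono) auto
   also have "... = ennreal C * (?c v f g + ennreal (t ^ r) * ?b v g)"
    unfolding C_def using C1(1) h by (simp add: ennreal_mult distrib_left mult.assoc)
   finally show ?thesis .
  qed
  \<comment> \<open>Moves the constant to the other side, so that the estimate for all
    \<open>g\<close> matches the rule for a lower bound of an infimum.\<close>
  have Cinv: "ennreal C * (?d C * X) = X" "?d C * (ennreal C * X) = X" for X
   using C0 by (simp_all add: mult.assoc[symmetric] flip: ennreal_mult)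
  have "omega_phi r f t p v <= ennreal C * K_functional r phi f t p v"
   unfolding omega_phi_def
  proof (rule SUP_least)
   fix h assume h: "h \<in> {0<..t}"
   have "?d C * ?a v h f <= K_functional r phi f t p v"
    unfolding K_functional_def
   proof (rule INF_greatest)
    fix g assume "g \<in> AC_loc_deriv r"
    then have "?a v h f <= ennreal C * (?c v f g + ennreal (t ^ r) * ?b v g)"
     using h by (intro main) auto
    from mult_left_mono[OF this zero_le, of "?d C"]
    show "?d C * ?a v h f <= ?c v f g + ennreal (t ^ r) * ?b v g"
     unfolding Cinv(2) .
   qed
   from mult_left_mono[OF this zero_le, of "ennreal C"]
   show "?a v h f <= ennreal C * K_functional r phi f t p v"
    unfolding Cinv(1) .
  qed
  then show "omega_phi r f t p (weight_n w n) <= ennreal C * K_functional r phi f t p (weight_n w n)" unfolding v_def .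
 qed
qed

section \<open>The equivalences\<close>

lemma poly_AC_loc: "poly P \<in> AC_loc" for P :: "real poly"
 unfolding AC_loc_def absolutely_continuous_interval_def
proof (intro CollectI allI impI)
 fix a b e :: real assume e: "0 < e"
 have "bounded (poly (pderiv P) ` {a..b})"
  by (intro compact_imp_bounded compact_continuous_image continuous_intros) auto
 then obtain M where M: "0 < M" "\<And>x. x \<in> {a..b} ==> \<bar>poly (pderiv P) x\<bar> <= M"
  by (auto simp: bounded_pos)
 have lip: "\<bar>poly P x - poly P y\<bar> <= M * \<bar>x - y\<bar>" if "x \<in> {a..b}" "y \<in> {a..b}" for x y
  using field_differentiable_bound[of "{a..b}" "poly P" "poly (pderiv P)" M x y] M that
  by (auto intro: has_field_derivative_at_within poly_DERIV)
 show "\<exists>\<delta>>0. \<forall>\<D>. \<D> division_of \<Union>\<D> \<and> \<Union>\<D> \<subseteq> {a..b} \<and> (\<Sum>I\<in>\<D>. Sup I - Inf I) < \<delta>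
    --> (\<Sum>I\<in>\<D>. \<bar>poly P (Sup I) - poly P (Inf I)\<bar>) < e"
 proof (intro exI[of _ "e / M"] conjI allI impI)
  show "0 < e / M" using e M by simp
  fix D :: "real set set" assume D: "D division_of \<Union>D \<and> \<Union>D \<subseteq> {a..b} \<and> (\<Sum>I\<in>D. Sup I - Inf I) < e / M"
  have "(\<Sum>I\<in>D. \<bar>poly P (Sup I) - poly P (Inf I)\<bar>) <= (\<Sum>I\<in>D. M * (Sup I - Inf I))"
  proof (rule sum_mono)
   fix I assume I: "I \<in> D"
   obtain u v where uv: "u <= v" "I = {u..v}" using division_interval[of D "\<Union>D" I] D I by blast
   have "I \<subseteq> {a..b}" using D I by blast
   then show "\<bar>poly P (Sup I) - poly P (Inf I)\<bar> <= M * (Sup I - Inf I)" using lip[of v u] uv by auto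
  qed
  also have "... = M * (\<Sum>I\<in>D. Sup I - Inf I)" by (simp add: sum_distrib_left)
  also have "... < e" using D M by (simp add: pos_less_divide_eq mult.commute)
  finally show "(\<Sum>I\<in>D. \<bar>poly P (Sup I) - poly P (Inf I)\<bar>) < e" .
 qed
qed

lemma poly_AC_loc_deriv: "poly P \<in> AC_loc_deriv r" for P :: "real poly"
 by (auto simp: AC_loc_deriv_def deriv_pow_poly poly_AC_loc real_differentiable_def intro: poly_DERIV)

lemma AC_loc_deriv_deriv_measurable:
 assumes g: "g \<in> AC_loc_deriv r" and r: "1 <= r"
 shows "(deriv ^^ r) g \<in> borel_measurable leb"
proof -
 have "(deriv ^^ (r - 1)) g \<in> AC_loc" using g unfolding AC_loc_deriv_def by simp
 then obtain F where F: "F \<in> borel_measurable borel" and dF: "AE x\<in>{-1<..<1} in lborel. deriv ((deriv ^^ (r - 1)) g) x = F x"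
  using AC_loc_derivative by blast
 have dr: "(deriv ^^ r) g = deriv ((deriv ^^ (r - 1)) g)" using r by (cases r) auto
 have "AE x in lborel. x \<noteq> (-1::real)" "AE x in lborel. x \<noteq> (1::real)" by (rule AE_lborel_singleton)+
 then have "AE x\<in>{-1..1} in lborel. (deriv ^^ r) g x = F x" using dF by eventually_elim (auto simp: dr)
 then show ?thesis by (rule measurable_lebesgue_on_AE[OF F])
qed

lemma wnorm_mono:
 assumes v: "\<And>x. x \<in> {-1..1} ==> 0 <= v x" and ab: "\<And>x. x \<in> {-1..1} ==> \<bar>a x\<bar> <= \<bar>b x\<bar>"
  and [measurable]: "a \<in> borel_measurable leb" "v \<in> borel_measurable leb"
 shows "wnorm p v a <= wnorm p v b"
proof (cases "p = top")
 case True
 have "wnorm top v a <= wnorm top v b"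
 proof (rule wnorm_top_le)
  show "AE x\<in>{-1..1} in lborel. ennreal (\<bar>a x\<bar> * v x) <= wnorm top v b"
   using wnorm_top_AE[of b v]
  proof (eventually_elim, intro impI)
   fix x :: real assume "x \<in> {-1..1} --> ennreal (\<bar>b x\<bar> * v x) <= wnorm top v b" and x: "x \<in> {-1..1}"
   then show "ennreal (\<bar>a x\<bar> * v x) <= wnorm top v b"
    using ennreal_leI[OF mult_right_mono[OF ab[OF x] v[OF x]]] by (metis order_trans)
  qed
 qed measurable
 then show ?thesis using True by simp
next
 case False
 then show ?thesis unfolding wnorm_def
  by (auto intro!: ennreal_powr_mono nn_integral_mono ennreal_leI mult_right_mono powr_mono2 v ab)
qed

lemma wnorm_cmult_le:
 assumes p: "1 <= p" and c: "0 <= c" and [measurable]: "a \<in> borel_measurable leb" "v \<in> borel_measurable leb"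
 shows "wnorm p v (\<lambda>x. c * a x) <= ennreal c * wnorm p v a"
proof (cases "p = top")
 case True
 have e: "ennreal (\<bar>c * a x\<bar> * v x) = ennreal c * ennreal (\<bar>a x\<bar> * v x)" for x
  using c by (simp add: abs_mult mult.assoc ennreal_mult')
 have "wnorm top v (\<lambda>x. c * a x) <= ennreal c * wnorm top v a"
  by (rule wnorm_top_le) (measurable, use wnorm_top_AE[of a v] in eventually_elim, auto simp: e intro!: mult_left_mono)
 then show ?thesis using True by simp
next
 case False
 have "ennreal (\<bar>c * a x\<bar> powr enn2real p * v x) = ennreal (c powr enn2real p) * ennreal (\<bar>a x\<bar> powr enn2real p * v x)" for x
  using c by (simp add: abs_mult powr_mult mult.assoc ennreal_mult')
 then show ?thesis by (intro wnorm_le_of_powr[OF p False c]) (simp add: nn_integral_cmult)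
qed

lemma poly_borel_measurable: "poly P \<in> borel_measurable borel" for P :: "real poly"
 by (intro borel_measurable_continuous_onI continuous_intros)

text \<open>Both terms of the realization functional are kept in one function, since the same
  polynomial has to serve for both.\<close>

lemma jackson_wnorm:
 fixes p :: ennreal and A B L :: real
 assumes r: "1 <= r" and p: "1 <= p" and A: "0 < A" and B: "0 < B" and L: "1 <= L"
 shows "\<exists>C>0. \<forall>w f n t. doubling_weight w L --> f \<in> Lp p --> r <= n --> A / real n <= t --> t <= B / real n -->
  (\<exists>P :: real poly. degree P <= n - 1 \<and>
   wnorm p (weight_n w n) (apx_err r n f P) <= ennreal C * omega_phi_avg r f t p (weight_n w n))"
  (is "\<exists>C>0. ?Q C")
proof -
 let ?a = "\<lambda>n f P x. apx_err r n f P x"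
 let ?b = "\<lambda>h y f. sym_diff r (h * phi y) f y"
 let ?c = "\<lambda>C q. (C * B) powr (1 / q)"
 \<comment> \<open>This fineness of the grid ensures \<open>16 / (M * n) <= A / n <= t\<close>, so
   the steps of all differences inside cells are covered by the modulus at \<open>t\<close>.\<close>
 obtain M :: nat where M: "16 / A <= real M" using real_arch_simple by blast
 have "0 < 16 / A" using A by simp
 then have M1: "1 <= M" using M by (cases M) auto
 have tM: "16 / (real M * real n) <= t" if "A / real n <= t" "0 < n" for n t
 proof -
  have "16 <= A * real M" using M A by (simp add: divide_le_eq mult.commute)
  then have "16 / (real M * real n) <= A / real n" using that M1 by (simp add: field_simps)
  then show ?thesis using that by simp
 qed
 note [measurable] = poly_borel_measurable
 have [measurable]: "rho n \<in> borel_measurable borel" for n unfolding rho_def[abs_def] by measurable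
 have rr: "\<bar>\<bar>a\<bar> + rho n x ^ r * \<bar>b\<bar>\<bar> = \<bar>a\<bar> + rho n x ^ r * \<bar>b\<bar>" if "-1 <= x" "x <= 1" "0 < n" for a b x n
  using rho_pos[of x n] that by simp
 show ?thesis
 proof (cases "p = top")
  case False
  define q where "q = enn2real p"
  have q: "1 <= q" unfolding q_def by (rule enn2real_exponent[OF p False])
  from jackson_finite[OF r M1 L q] obtain C where C: "0 < C" and J: "\<And>n f w t. r <= n ==> f \<in> borel_measurable borel ==> integrable lborel f ==> doubling_weight w L ==> 16 / (real M * real n) <= t ==>
   (\<exists>P :: real poly. degree P <= n - 1 \<and>
    (\<integral>x\<in>{-1..1}. ennreal ((?a n f P x) powr q * weight_n w n x))
    <= ennreal (C * real n) * (\<integral>h\<in>{0..t}. (\<integral>y\<in>{-1..1}. ennreal (\<bar>?b h y f\<bar> powr q * weight_n w n y))))"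
   by blast
  have "?Q (?c C q)"
  proof (intro allI impI)
   fix w f :: "real => real" and n :: nat and t :: real
   assume dw: "doubling_weight w L" and f: "f \<in> Lp p" and n: "r <= n" and t: "A / real n <= t" "t <= B / real n"
   have n0: "0 < n" using n r by simp
   then have "0 < A / real n" using A by simp
   then have t0: "0 < t" using t by linarith
   define v where "v = weight_n w n"
   have vm[measurable]: "v \<in> borel_measurable borel" unfolding v_def by (rule weight_n_measurable[OF dw])
   obtain f' where f'm[measurable]: "f' \<in> borel_measurable borel" and f'i: "integrable lborel f'" and ff': "AE x\<in>{-1..1} in lborel. f x = f' x"
    using Lp_representative[OF f p] by blast
   define I where "I = (\<integral>h\<in>{0..t}. (\<integral>y\<in>{-1..1}. ennreal (\<bar>?b h y f'\<bar> powr q * v y)))"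
   have om: "omega_phi_avg r f t p v = ennreal_powr (ennreal (1 / t) * I) (1 / q)"
    unfolding I_def q_def by (rule omega_phi_avg_eq[OF p False r ff' f'm vm])
   obtain P :: "real poly" where degP: "degree P <= n - 1" and P:
    "(\<integral>x\<in>{-1..1}. ennreal ((?a n f' P x) powr q * v x)) <= ennreal (C * real n) * I"
    using J[OF n f'm f'i dw tM[OF t(1) n0]] unfolding I_def v_def by blast
   define F where "F x = ?a n f P x" for x
   have "(\<integral>\<^sup>+x. ennreal (\<bar>F x\<bar> powr q * v x) \<partial>leb) = (\<integral>x\<in>{-1..1}. ennreal ((?a n f' P x) powr q * v x))"
   proof (rule nn_integral_lebesgue_on_borel)
    show "AE x\<in>{-1..1} in lborel. ennreal (\<bar>F x\<bar> powr q * v x) = ennreal ((?a n f' P x) powr q * v x)"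
     using ff' by eventually_elim (auto simp: F_def rr n0)
   qed measurable
   also note P
   \<comment> \<open>Turns the factor \<open>n\<close> of \<open>jackson_finite\<close> into the
     \<open>1 / t\<close> of the averaged modulus.\<close>
   also have "real n * t <= B" using t n0 by (simp add: pos_le_divide_eq mult.commute)
   then have "C * real n <= C * B * (1 / t)" using C t0 by (simp add: field_simps mult_left_mono)
   then have "ennreal (C * real n) * I <= ennreal (C * B * (1 / t)) * I" by (intro mult_right_mono ennreal_leI) auto
   also have "... = ennreal (C * B) * (ennreal (1 / t) * I)" using C B t0 by (subst ennreal_mult) (auto simp: mult.assoc)
   finally have "wnorm p v F <= ennreal_powr (ennreal (C * B) * (ennreal (1 / t) * I)) (1 / q)"
    using False q unfolding wnorm_def q_def by (auto intro!: ennreal_powr_mono)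
   also have "... = ennreal (?c C q) * omega_phi_avg r f t p v"
    unfolding om using q C B by (simp add: ennreal_powr_mult ennreal_powr_ennreal)
   finally show "\<exists>P :: real poly. degree P <= n - 1 \<and>
    wnorm p (weight_n w n) (apx_err r n f P) <= ennreal (?c C q) * omega_phi_avg r f t p (weight_n w n)"
    unfolding v_def F_def using degP by blast
  qed
  then show ?thesis using B C by (intro exI[of _ "?c C q"]) auto
 next
  case True
  from jackson_infinite[OF r M1 L] obtain C where C: "0 < C" and J: "\<And>n f w t. r <= n ==> f \<in> borel_measurable borel ==> integrable lborel f ==> doubling_weight w L ==> 16 / (real M * real n) <= t ==>
   (\<exists>P :: real poly. degree P <= n - 1 \<and> (\<forall>\<Omega>\<ge>0.
   (\<forall>h. 0 < h --> h <= t --> (AE y\<in>{-1..1} in lborel. \<bar>?b h y f\<bar> * weight_n w n y <= \<Omega>)) -->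
   (AE x\<in>{-1..1} in lborel. (?a n f P x) * weight_n w n x <= C * \<Omega>)))"
   by blast
  have "?Q C"
  proof (intro allI impI)
   fix w f :: "real => real" and n :: nat and t :: real
   assume dw: "doubling_weight w L" and f: "f \<in> Lp p" and n: "r <= n" and t: "A / real n <= t" "t <= B / real n"
   have n0: "0 < n" using n r by simp
   define v where "v = weight_n w n"
   have [measurable]: "v \<in> borel_measurable borel" unfolding v_def by (rule weight_n_measurable[OF dw])
   obtain f' where f'm[measurable]: "f' \<in> borel_measurable borel" and f'i: "integrable lborel f'" and ff': "AE x\<in>{-1..1} in lborel. f x = f' x"
    using Lp_representative[OF f p] by blast
   obtain P :: "real poly" where degP: "degree P <= n - 1" and P: "\<And>\<Omega>. 0 <= \<Omega> ==>
    (\<forall>h. 0 < h --> h <= t --> (AE y\<in>{-1..1} in lborel. \<bar>?b h y f'\<bar> * v y <= \<Omega>)) ==>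
    (AE x\<in>{-1..1} in lborel. (?a n f' P x) * v x <= C * \<Omega>)"
    using J[OF n f'm f'i dw tM[OF t(1) n0]] unfolding v_def by blast
   define F where "F x = ?a n f P x" for x
   have "wnorm top v F <= ennreal C * omega_phi r f t top v"
   proof (cases "omega_phi r f t top v")
    case top
    have "ennreal C * top = top" using C by (metis ennreal_mult_top ennreal_eq_0_iff not_le)
    then show ?thesis unfolding top by simp
   next
    case (real \<Omega>)
    have sd: "AE y\<in>{-1..1} in lborel. \<bar>?b h y f'\<bar> * v y <= \<Omega>" if h: "0 < h" "h <= t" for h
    proof -
     have le: "wnorm top v (\<lambda>x. ?b h x f) <= ennreal \<Omega>"
      unfolding real(2)[symmetric] omega_phi_def using h by (intro SUP_upper) auto
     show ?thesis
      using AE_sym_diff_cong[OF h(1) r ff'] wnorm_top_AE[of "\<lambda>x. ?b h x f" v]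
      by eventually_elim (use real(1) in \<open>auto dest!: order_trans[OF _ le]\<close>)
    qed
    have fF: "AE x\<in>{-1..1} in lborel. ennreal (\<bar>F x\<bar> * v x) = ennreal ((?a n f' P x) * v x)"
     using ff' by eventually_elim (auto simp: F_def rr n0)
    have "(\<lambda>x. ennreal (\<bar>F x\<bar> * v x)) \<in> borel_measurable leb"
     by (rule measurable_lebesgue_on_AE[OF _ fF]) measurable
    then have "wnorm top v F <= ennreal (C * \<Omega>)"
    proof (rule wnorm_top_le)
     have "AE x\<in>{-1..1} in lborel. (?a n f' P x) * v x <= C * \<Omega>"
      using P[OF real(1)] sd by blast
     with fF show "AE x\<in>{-1..1} in lborel. ennreal (\<bar>F x\<bar> * v x) <= ennreal (C * \<Omega>)"
      by eventually_elim (auto intro: ennreal_leI)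
    qed
    then show ?thesis using C real by (simp add: ennreal_mult)
   qed
   then show "\<exists>P :: real poly. degree P <= n - 1 \<and>
    wnorm p (weight_n w n) (apx_err r n f P) <= ennreal C * omega_phi_avg r f t p (weight_n w n)"
    unfolding v_def F_def using degP True by (auto simp: omega_phi_avg_def)
  qed
  then show ?thesis using C by blast
 qed
qed

text \<open>Since \<open>phi_n = n * rho\<close>, the derivative term of the functional is
  \<open>(t * n) ^ r\<close> times that of \<open>apx_err\<close>, and
  \<open>t * n <= B\<close>.\<close>

lemma R_functional_le_omega_phi_avg:
 fixes p :: ennreal and A B L :: real
 assumes r: "1 <= r" and p: "1 <= p" and A: "0 < A" and B: "0 < B" and L: "1 <= L"
 shows "\<exists>C>0. \<forall>w f n t. doubling_weight w L --> f \<in> Lp p --> r <= n --> A / real n <= t --> t <= B / real n -->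
  R_functional n r (phi_n n) f t p (weight_n w n) <= ennreal C * omega_phi_avg r f t p (weight_n w n)"
proof -
 let ?a = "\<lambda>P. (pderiv ^^ r) P"
 let ?b = "\<lambda>v n P. wnorm p v (\<lambda>x. phi_n n x ^ r * poly (?a P) x)"
 from jackson_wnorm[OF assms] obtain C where C: "0 < C" and J: "\<And>w f n t. doubling_weight w L ==> f \<in> Lp p ==> r <= n ==> A / real n <= t ==> t <= B / real n ==>
  (\<exists>P :: real poly. degree P <= n - 1 \<and>
   wnorm p (weight_n w n) (apx_err r n f P) <= ennreal C * omega_phi_avg r f t p (weight_n w n))"
  by blast
 show ?thesis
 proof (intro exI[of _ "(1 + B ^ r) * C"] conjI allI impI)
  show "0 < (1 + B ^ r) * C" using B C by (intro mult_pos_pos add_pos_pos) auto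
  fix w f :: "real => real" and n :: nat and t :: real
  assume dw: "doubling_weight w L" and f: "f \<in> Lp p" and n: "r <= n" and t: "A / real n <= t" "t <= B / real n"
  have n0: "0 < n" using n r by simp
  then have "0 < A / real n" using A by simp
  then have t0: "0 < t" using t by linarith
  have "t * real n <= B" using t n0 by (simp add: pos_le_divide_eq)
  then have "(t * real n) ^ r <= B ^ r" using t0 by (intro power_mono) auto
  then have tn: "t ^ r * real n ^ r <= B ^ r" by (simp add: power_mult_distrib)
  define v where "v = weight_n w n"
  have vm: "v \<in> borel_measurable borel" unfolding v_def by (rule weight_n_measurable[OF dw])
  have v0: "0 <= v x" if "x \<in> {-1..1}" for x unfolding v_def by (rule weight_n_nonneg[OF dw that n0])
  obtain P :: "real poly" where degP: "degree P <= n - 1"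
   and P: "wnorm p v (apx_err r n f P) <= ennreal C * omega_phi_avg r f t p v"
   using J[OF dw f n t] unfolding v_def by blast
  define F where "F x = apx_err r n f P x" for x
  have meas: "u \<in> borel_measurable leb" if "u \<in> borel_measurable borel" for u :: "real => real"
   by (rule measurable_lebesgue_on_AE[OF that]) simp
  have "rho n \<in> borel_measurable borel" "phi_n n \<in> borel_measurable borel"
   unfolding rho_def[abs_def] phi_n_def[abs_def] by measurable
  note [measurable] = this[THEN meas] meas[OF poly_borel_measurable] meas[OF vm]
  have [measurable]: "f \<in> borel_measurable leb" using f by (simp add: Lp_def)
  have Fm[measurable]: "F \<in> borel_measurable leb" unfolding F_def[abs_def] by measurable
  have rr: "0 <= rho n x ^ r * \<bar>poly (?a P) x\<bar>" if "x \<in> {-1..1}" for x using rho_pos[OF that n0] by simp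
  have w1: "wnorm p v (\<lambda>x. f x - poly P x) <= wnorm p v F"
   by (rule wnorm_mono[OF v0]) (use rr in \<open>auto simp: F_def\<close>)
  have "?b v n P <= wnorm p v (\<lambda>x. real n ^ r * F x)"
  proof (rule wnorm_mono[OF v0])
   fix x :: real assume x: "x \<in> {-1..1}"
   have "\<bar>phi_n n x ^ r * poly (?a P) x\<bar> = real n ^ r * (rho n x ^ r * \<bar>poly (?a P) x\<bar>)"
    using rho_pos[OF x n0] by (simp add: phi_n_rho[OF n0] abs_mult power_abs power_mult_distrib)
   also have "... <= real n ^ r * \<bar>F x\<bar>" unfolding F_def using rr[OF x] by (intro mult_left_mono) auto
   finally show "\<bar>phi_n n x ^ r * poly (?a P) x\<bar> <= \<bar>real n ^ r * F x\<bar>" by (simp add: abs_mult)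
  qed measurable
  also have "... <= ennreal (real n ^ r) * wnorm p v F" by (rule wnorm_cmult_le[OF p]) auto
  finally have w2: "?b v n P <= ennreal (real n ^ r) * wnorm p v F" .
  have "R_functional n r (phi_n n) f t p v <= wnorm p v (\<lambda>x. f x - poly P x) + ennreal (t ^ r) * ?b v n P"
   unfolding R_functional_def by (rule INF_lower) (use degP in simp)
  also have "... <= wnorm p v F + ennreal (t ^ r) * (ennreal (real n ^ r) * wnorm p v F)"
   by (intro add_mono mult_left_mono w1 w2) auto
  also have "... = ennreal (1 + t ^ r * real n ^ r) * wnorm p v F"
   using t0 by (simp add: ennreal_plus ennreal_mult distrib_right mult.assoc)
  also have "... <= ennreal (1 + B ^ r) * (ennreal C * omega_phi_avg r f t p v)"
   using tn P unfolding F_def by (intro mult_mono ennreal_leI) auto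
  also have "... = ennreal ((1 + B ^ r) * C) * omega_phi_avg r f t p v"
   using B C by (subst ennreal_mult) (auto simp: mult.assoc)
  finally show "R_functional n r (phi_n n) f t p (weight_n w n) <= ennreal ((1 + B ^ r) * C) * omega_phi_avg r f t p (weight_n w n)"
   unfolding v_def .
 qed
qed

lemma omega_phi_avg_le_omega_phi:
 assumes p: "1 <= p" and t: "0 < t"
 shows "omega_phi_avg r f t p v <= omega_phi r f t p v"
proof (cases "p = top")
 case False
 define q where "q = enn2real p"
 have q: "1 <= q" unfolding q_def by (rule enn2real_exponent[OF p False])
 let ?W = "omega_phi r f t p v"
 have "(\<integral>\<^sup>+h\<in>{0..t}. ennreal_powr (wnorm p v (\<lambda>x. sym_diff r (h * phi x) f x)) q \<partial>lebesgue)
  <= (\<integral>\<^sup>+h\<in>{0..t}. ennreal_powr ?W q \<partial>lebesgue)"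
 proof (rule nn_integral_mono_AE)
  have "AE h in lborel. h \<noteq> (0::real)" by (rule AE_lborel_singleton)
  then have "AE h in lebesgue. h \<noteq> (0::real)" by (rule AE_completion)
  then show "AE h in lebesgue. ennreal_powr (wnorm p v (\<lambda>x. sym_diff r (h * phi x) f x)) q * indicator {0..t} h <= ennreal_powr ?W q * indicator {0..t} h"
  proof eventually_elim
   case (elim h)
   show ?case
   proof (cases "h \<in> {0..t}")
    case True
    then have "wnorm p v (\<lambda>x. sym_diff r (h * phi x) f x) <= ?W"
     unfolding omega_phi_def using elim by (intro SUP_upper) auto
    then show ?thesis using True q by (auto intro!: ennreal_powr_mono)
   qed simp
  qed
 qed
 also have "... = ennreal_powr ?W q * ennreal t" using t by (simp add: nn_integral_cmult_indicator)
 finally have "ennreal (1 / t) * (\<integral>\<^sup>+h\<in>{0..t}. ennreal_powr (wnorm p v (\<lambda>x. sym_diff r (h * phi x) f x)) q \<partial>lebesgue)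
  <= ennreal (1 / t) * (ennreal_powr ?W q * ennreal t)" by (rule mult_left_mono) simp
 also have "... = (ennreal (1 / t) * ennreal t) * ennreal_powr ?W q" by (simp add: mult_ac)
 also have "... = ennreal_powr ?W q" using t by (simp add: ennreal_mult[symmetric])
 finally have "omega_phi_avg r f t p v <= ennreal_powr (ennreal_powr ?W q) (1 / q)"
  using False q unfolding omega_phi_avg_def q_def by (auto intro!: ennreal_powr_mono)
 then show ?thesis using q by (simp add: ennreal_powr_inverse)
qed (simp add: omega_phi_avg_def)

lemma K_functional_le_R_functional: "K_functional r \<psi> f t p v <= R_functional n r \<psi> f t p v"
 unfolding R_functional_def
proof (rule INF_greatest)
 fix P :: "real poly"
 show "K_functional r \<psi> f t p v <= wnorm p v (\<lambda>x. f x - poly P x) + ennreal (t ^ r) * wnorm p v (\<lambda>x. \<psi> x ^ r * poly ((pderiv ^^ r) P) x)"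
  unfolding K_functional_def by (rule INF_lower2[OF poly_AC_loc_deriv[of P r]]) (simp add: deriv_pow_poly)
qed

lemma phi_power_le: "x \<in> {-1..1} ==> \<bar>phi x ^ r * y\<bar> <= \<bar>phi_n n x ^ r * y\<bar>"
 using phi_nonneg[of x] by (auto simp: abs_mult power_abs phi_n_def intro!: mult_right_mono power_mono)

lemma functional_phi_le_phi_n:
 assumes r: "1 <= r" and v: "\<And>x. x \<in> {-1..1} ==> 0 <= v x" and vm: "v \<in> borel_measurable borel"
 shows "K_functional r phi f t p v <= K_functional r (phi_n n) f t p v"
  and "R_functional n r phi f t p v <= R_functional n r (phi_n n) f t p v"
proof -
 have [measurable]: "v \<in> borel_measurable leb" "phi \<in> borel_measurable leb"
  by (rule measurable_lebesgue_on_AE[OF vm]; simp) (rule measurable_lebesgue_on_AE[OF measurable_phi]; simp)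
 have le: "wnorm p v (\<lambda>x. phi x ^ r * u x) <= wnorm p v (\<lambda>x. phi_n n x ^ r * u x)" if [measurable]: "u \<in> borel_measurable leb" for u
  by (rule wnorm_mono[OF v phi_power_le]) measurable
 show "K_functional r phi f t p v <= K_functional r (phi_n n) f t p v"
  unfolding K_functional_def
 proof (rule INF_mono)
  fix g assume g: "g \<in> AC_loc_deriv r"
  show "\<exists>g'\<in>AC_loc_deriv r. wnorm p v (\<lambda>x. f x - g' x) + ennreal (t ^ r) * wnorm p v (\<lambda>x. phi x ^ r * (deriv ^^ r) g' x)
   <= wnorm p v (\<lambda>x. f x - g x) + ennreal (t ^ r) * wnorm p v (\<lambda>x. phi_n n x ^ r * (deriv ^^ r) g x)"
   by (intro bexI[OF _ g] add_left_mono mult_left_mono le AC_loc_deriv_deriv_measurable[OF g r]) simp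
 qed
 have pm: "poly P \<in> borel_measurable leb" for P :: "real poly"
  by (rule measurable_lebesgue_on_AE[of "poly P"]) (intro borel_measurable_continuous_onI continuous_on_poly continuous_on_id, simp)
 show "R_functional n r phi f t p v <= R_functional n r (phi_n n) f t p v"
  unfolding R_functional_def
 proof (rule INF_mono)
  fix P :: "real poly" assume P: "P \<in> {P. degree P <= n - 1}"
  show "\<exists>Q\<in>{P. degree P <= n - 1}. wnorm p v (\<lambda>x. f x - poly Q x) + ennreal (t ^ r) * wnorm p v (\<lambda>x. phi x ^ r * poly ((pderiv ^^ r) Q) x)
   <= wnorm p v (\<lambda>x. f x - poly P x) + ennreal (t ^ r) * wnorm p v (\<lambda>x. phi_n n x ^ r * poly ((pderiv ^^ r) P) x)"
   by (intro bexI[OF _ P] add_left_mono mult_left_mono le pm) simp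
 qed
qed

text \<open>All six quantities are compared with one reference \<open>Z\<close>, and any two of them
  through it; this squares the constant.\<close>

lemma equiv_with_through:
 assumes c: "0 < c" and X: "Z <= ennreal c * X" "X <= ennreal c * Z" and Y: "Z <= ennreal c * Y" "Y <= ennreal c * Z"
 shows "equiv_with (c * c) X Y"
proof -
 have cc: "ennreal c * (ennreal c * U) = ennreal (c * c) * U" for U
  using c by (simp add: ennreal_mult mult.assoc)
 have XY: "X <= ennreal (c * c) * Y" "Y <= ennreal (c * c) * X"
  using order_trans[OF X(2) mult_left_mono[OF Y(1) zero_le]] order_trans[OF Y(2) mult_left_mono[OF X(1) zero_le]] by (simp_all only: cc)
 have "ennreal (inverse (c * c)) * ennreal (c * c) = ennreal (inverse (c * c) * (c * c))"
  by (rule ennreal_mult[symmetric]) (use c in auto)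
 also have "inverse (c * c) * (c * c) = 1" using c by (intro left_inverse) simp
 finally have "ennreal (inverse (c * c)) * (ennreal (c * c) * Y) = Y"
  by (simp only: mult.assoc[symmetric]) simp
 then show ?thesis unfolding equiv_with_def using mult_left_mono[OF XY(1) zero_le, of "ennreal (inverse (c * c))"] XY(2) by simp
qed

theorem corollary8p1:
  fixes r :: nat and p :: ennreal and A B L :: real
  assumes "1 \<le> r" and "1 \<le> p" and "0 < A" and "0 < B"
  shows "\<exists>c>0. \<forall>(w :: real \<Rightarrow> real) (f :: real \<Rightarrow> real) (n :: nat) (t :: real).
    doubling_weight w L \<and> f \<in> Lp p \<and> r \<le> n \<and> A / real n \<le> t \<and> t \<le> B / real n \<longrightarrow>
      equiv_with c (omega_phi r f t p (weight_n w n)) (omega_phi_avg r f t p (weight_n w n)) \<and>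
      equiv_with c (omega_phi_avg r f t p (weight_n w n)) (K_functional r phi f t p (weight_n w n)) \<and>
      equiv_with c (K_functional r phi f t p (weight_n w n)) (K_functional r (phi_n n) f t p (weight_n w n)) \<and>
      equiv_with c (K_functional r (phi_n n) f t p (weight_n w n)) (R_functional n r phi f t p (weight_n w n)) \<and>
      equiv_with c (R_functional n r phi f t p (weight_n w n)) (R_functional n r (phi_n n) f t p (weight_n w n))"
proof -
 let ?a = "\<lambda>f t w n. K_functional r phi f t p (weight_n w n)"
 let ?b = "\<lambda>n f t w. K_functional r (phi_n n) f t p (weight_n w n)"
 let ?c = "\<lambda>f t w n. omega_phi_avg r f t p (weight_n w n)"
 let ?d = "\<lambda>n f t w. R_functional n r phi f t p (weight_n w n)"
 let ?e = "\<lambda>n f t w. R_functional n r (phi_n n) f t p (weight_n w n)"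
 \<comment> \<open>The estimates need a doubling constant of at least \<open>1\<close>; a weight
   with constant \<open>L\<close> also has the constant \<open>L'\<close>.\<close>
 define L' where "L' = max 1 L"
 have L': "1 <= L'" "L <= L'" unfolding L'_def by auto
 obtain C1 where C1: "0 < C1" "\<And>w f n t. doubling_weight w L' ==> f \<in> Lp p ==> r <= n ==> A / real n <= t ==> t <= B / real n ==>
   ?e n f t w <= ennreal C1 * ?c f t w n"
  using R_functional_le_omega_phi_avg[OF assms L'(1)] by blast
 obtain C2 where C2: "0 < C2" "\<And>w f n t. doubling_weight w L' ==> f \<in> Lp p ==> 0 < n ==> t <= B / real n ==>
   omega_phi r f t p (weight_n w n) <= ennreal C2 * ?a f t w n"
  using omega_phi_le_K_functional[OF assms(1,2,4) L'(1)] by blast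
 define c where "c = max 1 C1 * max 1 C2"
 have c: "1 <= c" "C1 <= c" "C2 <= c" "C1 * C2 <= c"
  unfolding c_def using C1(1) C2(1) mult_mono[of 1 "max 1 C1" 1 "max 1 C2"] mult_mono[of C1 "max 1 C1" 1 "max 1 C2"]
   mult_mono[of 1 "max 1 C1" C2 "max 1 C2"] mult_mono[of C1 "max 1 C1" C2 "max 1 C2"] by auto
 show ?thesis
 proof (intro exI[of _ "c * c"] conjI[of "0 < c * c"] allI impI)
  show "0 < c * c" using c(1) by simp
  fix w f :: "real => real" and n :: nat and t :: real
  assume H: "doubling_weight w L \<and> f \<in> Lp p \<and> r <= n \<and> A / real n <= t \<and> t <= B / real n"
  then have dw: "doubling_weight w L'" using doubling_weight_mono[OF _ L'(2)] by blast
  have n: "0 < n" using H assms(1) by auto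
  then have "0 < A / real n" using assms(3) by simp
  then have t: "0 < t" using H by linarith
  define v where "v = weight_n w n"
  have vm: "v \<in> borel_measurable borel" unfolding v_def by (rule weight_n_measurable[OF dw])
  have v0: "0 <= v x" if "x \<in> {-1..1}" for x unfolding v_def by (rule weight_n_nonneg[OF dw that n])
  \<comment> \<open>The reference \<open>Z\<close> is the realization functional for
    \<open>phi_n\<close>. It dominates \<open>X3\<close>, \<open>X4\<close> and \<open>X5\<close>
    directly and is bounded by \<open>X2\<close>, then \<open>X1\<close>, then \<open>X3\<close>,
    which closes the circle.\<close>
  define X1 X2 X3 X4 X5 Z where "X1 = omega_phi r f t p v" and "X2 = omega_phi_avg r f t p v"
   and "X3 = K_functional r phi f t p v" and "X4 = K_functional r (phi_n n) f t p v"
   and "X5 = R_functional n r phi f t p v" and "Z = R_functional n r (phi_n n) f t p v"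
  have 21: "X2 <= X1" unfolding X1_def X2_def by (rule omega_phi_avg_le_omega_phi[OF assms(2) t])
  have 13: "X1 <= ennreal C2 * X3" unfolding X1_def X3_def v_def using H n by (intro C2(2)[OF dw]) auto
  have Z2: "Z <= ennreal C1 * X2" unfolding Z_def X2_def v_def using H by (intro C1(2)[OF dw]) auto
  have 34: "X3 <= X4" unfolding X3_def X4_def by (rule functional_phi_le_phi_n(1)[OF assms(1) v0 vm])
  have 5: "X5 <= Z" unfolding X5_def Z_def by (rule functional_phi_le_phi_n(2)[OF assms(1) v0 vm])
  have 35: "X3 <= X5" and 4: "X4 <= Z" unfolding X3_def X4_def X5_def Z_def by (rule K_functional_le_R_functional)+
  have up: "U <= ennreal c * U'" if "U <= ennreal d * U'" "d <= c" for U U' d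
   using that(1) mult_right_mono[OF ennreal_leI[OF that(2)] zero_le, of U'] by (rule order_trans)
  have one: "U <= ennreal c * U'" if "U <= U'" for U U' by (rule up[of _ 1]) (use that c in auto)
  have 3: "X3 <= Z" using 34 4 by (rule order_trans)
  have 1: "X1 <= ennreal C2 * Z" using order_trans[OF 13 mult_left_mono[OF 3 zero_le]] .
  have 2: "X2 <= ennreal C2 * Z" using 21 1 by (rule order_trans)
  have Z1: "Z <= ennreal C1 * X1" using order_trans[OF Z2 mult_left_mono[OF 21 zero_le]] .
  have Z3: "Z <= ennreal (C1 * C2) * X3"
   using order_trans[OF Z1 mult_left_mono[OF 13 zero_le]] C1(1) C2(1) by (simp add: ennreal_mult mult.assoc)
  have Z4: "Z <= ennreal (C1 * C2) * X4" using order_trans[OF Z3 mult_left_mono[OF 34 zero_le]] .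
  have Z5: "Z <= ennreal (C1 * C2) * X5" using order_trans[OF Z3 mult_left_mono[OF 35 zero_le]] .
  have c0: "0 < c" using c(1) by simp
  show "equiv_with (c * c) (omega_phi r f t p (weight_n w n)) (?c f t w n) \<and>
   equiv_with (c * c) (?c f t w n) (?a f t w n) \<and>
   equiv_with (c * c) (?a f t w n) (?b n f t w) \<and>
   equiv_with (c * c) (?b n f t w) (?d n f t w) \<and>
   equiv_with (c * c) (?d n f t w) (?e n f t w)"
   unfolding v_def[symmetric] X1_def[symmetric] X2_def[symmetric] X3_def[symmetric] X4_def[symmetric] X5_def[symmetric] Z_def[symmetric]
   by (intro conjI equiv_with_through[OF c0, of Z] up[OF Z1 c(2)] up[OF Z2 c(2)] up[OF Z3 c(4)] up[OF Z4 c(4)] up[OF Z5 c(4)]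
     up[OF 1 c(3)] up[OF 2 c(3)] one[OF 3] one[OF 4] one[OF 5] one[OF order_refl])
 qed
qed

end
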